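(* Consider the BROS algorithm described in the context, and suppose that (A1), (A2), (A3) of the context hold and that $\Phi^*:=\inf_{x}\Phi(x)>-\infty$. Let $\omega_P:=\max_{1\le\ell\le L} m_\ell/r_\ell$. Then there exist positive coupling constants $c_1,c_2,c_3$ and finite constants $C_0,C_1,\bar\alpha>0$ (independent of $K$ and $\alpha$) such that the following holds. If $\alpha_k\equiv\alpha$, $\beta_k\equiv c_1\alpha$, $\gamma_k\equiv c_2\alpha$, $\theta_k\equiv c_3\alpha$ with $0<\alpha\le \bar\alpha/(1+\omega_P^3)$, then for every $K\ge1$ $$\frac1K\sum_{k=0}^{K-1}\mathbb E\|\nabla\Phi(x^k)\|^2\le 2\left(\frac{C_0(1+\omega_P^2)}{K\alpha}+C_1(1+\omega_P^4)\alpha\right).$$ Choosing $\alpha=\Theta(K^{-1/2})$ subject to $0<\alpha\le \bar\alpha/(1+\omega_P^3)$ yields, as $K\to\infty$, $$\frac1K\sum_{k=0}^{K-1}\mathbb E\|\nabla\Phi(x^k)\|^2=\mathcal O\bigl((1+\omega_P^4)K^{-1/2}\bigr)\quad\text{and}\quad \mathbb E\|\nabla\Phi(x^R)\|^2=\mathcal O\bigl((1+\omega_P^4)K^{-1/2}\bigr),$$ where $R\sim\mathrm{Unif}\{0,\dots,K-1\}$ is independent of the algorithmic randomness. Hence, to guarantee $\mathbb E\|\nabla\Phi(x^R)\|^2\le\varepsilon$ it suffices to take $K=\mathcal O((1+\omega_P^4)^2\varepsilon^{-2})$ iterations (as $\varepsilon\downarrow0$); in particular, for fixed $\omega_P$,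 $K=\mathcal O(\varepsilon^{-2})$ iterations suffice.
   Context: **Problem.** Fix integers $d_x,L\ge1$ and, for $\ell\in[L]:=\{1,\dots,L\}$, integers $n_\ell\ge1$, $2\le r_\ell\le m_\ell$. Let $\mathcal Y=\prod_{\ell=1}^L\mathbb R^{m_\ell\times n_\ell}$ and $\mathcal B=\prod_{\ell=1}^L\mathbb R^{r_\ell\times n_\ell}$ with the product Frobenius inner product and norm; $\mathbb R^{d_x}\times\mathcal Y$ carries $\|(x,\boldsymbol Y)\|^2=\|x\|^2+\|\boldsymbol Y\|^2$. Let $f,g:\mathbb R^{d_x}\times\mathcal Y\to\mathbb R$. Write $\mathcal H(x,\boldsymbol Y)=\nabla^2_{\boldsymbol Y\boldsymbol Y}g(x,\boldsymbol Y):\mathcal Y\to\mathcal Y$, and $\mathcal J(x,\boldsymbol Y)=\nabla^2_{x\boldsymbol Y}g(x,\boldsymbol Y):\mathcal Y\to\mathbb R^{d_x}$, the adjoint of $u\mapsto\nabla^2_{\boldsymbol Yx}g(x,\boldsymbol Y)[u]$. Let $\boldsymbol Y^*(x)=\arg\min_{\boldsymbol Y}g(x,\boldsymbol Y)$ and $\Phi(x)=f(x,\boldsymbol Y^*(x))$. **(A1)** There are positive constants $\mu_g,L_{f,0},L_{f,1},L_{g,1},L_{g,2}$ such that: $\nabla f$ and $\nabla g$ are $L_{f,1}$- and $L_{g,1}$-Lipschitz in $(x,\boldsymbol Y)$; $\nabla^2g$ is $L_{g,2}$-Lipschitz (operator norm) on $\mathbb R^{d_x}\times\mathcal Y$; $\|\nabla_{\boldsymbol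 Y}f(x,\boldsymbol Y^*(x))\|\le L_{f,0}$ for all $x$; for every $x$, $g(x,\cdot)$ is $\mu_g$-strongly convex. **Projectors and projected functions.** At iteration $k$ a tuple $\boldsymbol P^k=(P_1^k,\dots,P_L^k)$, $P_\ell^k\in\mathbb R^{m_\ell\times r_\ell}$, is drawn; $(\boldsymbol P^k\boldsymbol B)_\ell=P_\ell^kB_\ell$, $(\boldsymbol P^{k\top}\boldsymbol U)_\ell=(P_\ell^k)^\top U_\ell$. Put $\tilde f_k(x,\boldsymbol B)=f(x,\boldsymbol Y^k+\boldsymbol P^k\boldsymbol B)$, $\tilde g_k(x,\boldsymbol B)=g(x,\boldsymbol Y^k+\boldsymbol P^k\boldsymbol B)$ for $\boldsymbol B\in\mathcal B$. **Filtrations.** $\mathcal F_k=\sigma(x^0,\dots,x^k,\boldsymbol Y^0,\dots,\boldsymbol Y^k,\boldsymbol Z^0,\dots,\boldsymbol Z^k,h^0,\dots,h^k,\boldsymbol P^0,\dots,\boldsymbol P^{k-1})$, $\mathcal F_k^+=\sigma(\mathcal F_k\cup\{\boldsymbol P^k\})$, $\mathcal F_k^{++}=\sigma(\mathcal F_k^+,\{u_\ell^{k+1},\xi_\ell^{k+1}\}_{\ell=1}^L)$, where $u_\ell^{k+1}\in\{-1,1\}^{n_\ell}$, $\xi_\ell^{k+1}\in\{-1,1\}^{r_\ell}$ are Rademacher probes (independent uniform signs). **(A2)** At each iteration there are random $\tilde U_x^{k+1}\in\mathbb R^{d_x}$, $\tilde{\boldsymbol U}_Y^{k+1},\tilde{\boldsymbol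 V}^{k+1}\in\mathcal B$ and random linear operators $\tilde{\mathcal H}^{k+1}:\mathcal B\to\mathcal B$, $\tilde{\mathcal J}^{k+1}:\mathcal B\to\mathbb R^{d_x}$ whose conditional means given $\mathcal F_k^+$ are $\nabla_x\tilde f_k(x^k,0)$, $\nabla_{\boldsymbol B}\tilde f_k(x^k,0)$, $\nabla_{\boldsymbol B}\tilde g_k(x^k,0)$, and, for every $W\in\mathcal B$, $\nabla^2_{\boldsymbol B\boldsymbol B}\tilde g_k(x^k,0)[W]$ (for $\tilde{\mathcal H}^{k+1}[W]$) and $\nabla^2_{x\boldsymbol B}\tilde g_k(x^k,0)[W]$ (for $\tilde{\mathcal J}^{k+1}[W]$). Their conditional mean-square deviations from these means given $\mathcal F_k^+$ are at most $\tilde\sigma_{f,1}^2,\tilde\sigma_{f,2}^2,\tilde\sigma_{g,1}^2,\tilde\sigma_{g,2}^2\|W\|^2,\tilde\sigma_{g,2}^2\|W\|^2$ respectively, for constants $\tilde\sigma_{\cdot,\cdot}\ge0$. The probes are independent of $\mathcal F_k^+$ and of these five oracle objects; given $\mathcal F_k^+$, the five oracle objects are mutually independent. $\tilde{\mathcal H}^{k+1},\tilde{\mathcal J}^{k+1}$ are sampled once per iteration and may be queried several times; the first- and second-moment relations for them extend to every $\mathcal F_k^{++}$-measurable random direction $W$ with finite conditional second moment (conditioning on $\mathcal F_k^{++}$). **(A3)** Conditionally on $\mathcal F_k$, $P_1^k,\dots,P_L^k$ are independent and $P_\ell^k=\sqrt{m_\ell/r_\ell}\,O^k_{\ell,r_\ell}$,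 where $O^k_{\ell,r_\ell}$ is the first $r_\ell$ columns of a Haar-uniform matrix in $O(m_\ell)$; $r_\ell\ge2$ for all $\ell$. The probes are independent across layers and $u_\ell^{k+1},\xi_\ell^{k+1}$ are independent. **Corrected Hessian action.** Let $E_t(W)\in\mathcal B$ have $W$ in block $t$ and zeros elsewhere, $\tilde Z_t^k=(P_t^k)^\top Z_t^k$, $A_\ell^{(t),k+1}=P_\ell^k(\tilde{\mathcal H}^{k+1}[E_t(\tilde Z_t^k)])_\ell$, $\boldsymbol M^{k+1}=\tilde{\mathcal H}^{k+1}[(\xi_1^{k+1}(u_1^{k+1})^\top,\dots,\xi_L^{k+1}(u_L^{k+1})^\top)]$ with blocks $M_t^{k+1}$, $\widehat C_t^{k+1}=Z_t^k\bigl((M_t^{k+1})^\top\xi_t^{k+1}(u_t^{k+1})^\top\bigr)$, $\widehat B_{\sharp,t}^{k+1}=P_t^k\bigl(\xi_t^{k+1}((M_t^{k+1})^\top\tilde Z_t^ku_t^{k+1})^\top\bigr)$. With $m=m_t,r=r_t$, $$\widehat{\mathcal H_{tt}[Z_t]}^{k+1}=\tfrac{r(m-1)(m+2)}{m(mr+m-2)}A_t^{(t),k+1}-\tfrac{m-r}{mr+m-2}\widehat C_t^{k+1}+\tfrac{r(m-1)(m-r)}{m(r-1)(mr+m-2)}\bigl(A_t^{(t),k+1}-\widehat B_{\sharp,t}^{k+1}\bigr),$$ and $(\widehat{\mathcal H[\boldsymbol Z]}^{k+1})_\ell=\widehat{\mathcal H_{\ell\ell}[Z_\ell]}^{k+1}+\sum_{t\ne\ell}A_\ell^{(t),k+1}$.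 **BROS algorithm.** From deterministic $x^0\in\mathbb R^{d_x}$, $\boldsymbol Y^0,\boldsymbol Z^0\in\mathcal Y$, $h^0=0$, with stepsizes $\alpha_k,\beta_k,\gamma_k,\theta_k$, for $k=0,1,\dots$: $x^{k+1}=x^k-\alpha_kh^k$; $\boldsymbol Y^{k+1}=\boldsymbol Y^k-\beta_k\widehat{\boldsymbol V}^{k+1}$; $\boldsymbol Z^{k+1}=\boldsymbol Z^k-\gamma_k\widehat{\boldsymbol S}^{k+1}$; $h^{k+1}=(1-\theta_k)h^k+\theta_k\widehat W^{k+1}$, where $\widehat{\boldsymbol V}^{k+1}=\boldsymbol P^k\tilde{\boldsymbol V}^{k+1}$, $\widehat{\boldsymbol S}^{k+1}=\widehat{\mathcal H[\boldsymbol Z]}^{k+1}-\boldsymbol P^k\tilde{\boldsymbol U}_Y^{k+1}$, $\widehat W^{k+1}=\tilde U_x^{k+1}-\tilde{\mathcal J}^{k+1}[\boldsymbol P^{k\top}\boldsymbol Z^k]$. The constants in the theorem may depend on the problem constants, the dimensions and the initialization ("fixed dimension- and model-dependent quantities"). *)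

theory Defs
  imports "HOL-Probability.Probability"
begin

text \<open>A \<open>p \<times> q\<close> matrix is a function on index pairs of which only the entries in
  \<open>{..<p} \<times> {..<q}\<close> matter; the products below carry the length of the contracted index.\<close>

type_synonym rmat = "nat \<times> nat \<Rightarrow> real"
type_synonym rvec = "nat \<Rightarrow> real"

definition mm :: "nat \<Rightarrow> rmat \<Rightarrow> rmat \<Rightarrow> rmat" where
  "mm q A B = (\<lambda>(i, j). \<Sum>a<q. A (i, a) * B (a, j))"

definition mv :: "nat \<Rightarrow> rmat \<Rightarrow> rvec \<Rightarrow> rvec" where
  "mv q A v = (\<lambda>i. \<Sum>a<q. A (i, a) * v a)"

definition tr :: "rmat \<Rightarrow> rmat" where
  "tr A = (\<lambda>(i, j). A (j, i))"

definition outer :: "rvec \<Rightarrow> rvec \<Rightarrow> rmat" where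
  "outer v w = (\<lambda>(i, j). v i * w j)"

text \<open>The layer shapes vary with the layer, so the products of matrix spaces
  \<open>\<Prod>\<^sub>l \<real>\<^bsup>m l \<times> n l\<^esup>\<close> and \<open>\<Prod>\<^sub>l \<real>\<^bsup>r l \<times> n l\<^esup>\<close> are rendered as \<open>real ^ 'y\<close> and \<open>real ^ 'b\<close>, where the
  finite types \<open>'y\<close> and \<open>'b\<close> enumerate all triples (layer, row, column) through the bijections
  \<open>posY\<close> and \<open>posB\<close>. The Euclidean inner product and norm of \<open>real ^ 'y\<close>, \<open>real ^ 'b\<close> are then exactly
  the product Frobenius ones. The fields \<open>nrow\<close>, \<open>ncol\<close>, \<open>nred\<close> are \<open>m\<close>, \<open>n\<close>, \<open>r\<close>; the layers are the
  elements of the finite type \<open>'l\<close>.\<close>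

record ('l, 'y, 'b) layout =
  nrow :: "'l \<Rightarrow> nat"
  ncol :: "'l \<Rightarrow> nat"
  nred :: "'l \<Rightarrow> nat"
  posY :: "'y \<Rightarrow> 'l \<times> nat \<times> nat"
  posB :: "'b \<Rightarrow> 'l \<times> nat \<times> nat"

definition entries :: "('l \<Rightarrow> nat) \<Rightarrow> ('l \<Rightarrow> nat) \<Rightarrow> ('l \<times> nat \<times> nat) set" where
  "entries p q = {(l, i, j). i < p l \<and> j < q l}"

definition valid_layout :: "('l::finite, 'y::finite, 'b::finite) layout \<Rightarrow> bool" where
  "valid_layout D \<longleftrightarrow>
     (\<forall>l. 1 \<le> ncol D l \<and> 2 \<le> nred D l \<and> nred D l \<le> nrow D l) \<and>
     bij_betw (posY D) UNIV (entries (nrow D) (ncol D)) \<and>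
     bij_betw (posB D) UNIV (entries (nred D) (ncol D))"

definition block :: "('i::finite \<Rightarrow> 'l \<times> nat \<times> nat) \<Rightarrow> real ^ 'i \<Rightarrow> 'l \<Rightarrow> rmat" where
  "block e V l = (\<lambda>(i, j). V $ inv e (l, i, j))"

definition unblock :: "('i::finite \<Rightarrow> 'l \<times> nat \<times> nat) \<Rightarrow> ('l \<Rightarrow> rmat) \<Rightarrow> real ^ 'i" where
  "unblock e A = (\<chi> c. case e c of (l, i, j) \<Rightarrow> A l (i, j))"

text \<open>The maps \<open>B \<mapsto> P B\<close> and \<open>U \<mapsto> P\<^sup>T U\<close>, layer by layer.\<close>

definition lift :: "('l, 'y::finite, 'b::finite) layout \<Rightarrow> ('l \<Rightarrow> rmat) \<Rightarrow> real ^ 'b \<Rightarrow> real ^ 'y" where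
  "lift D P B = unblock (posY D) (\<lambda>l. mm (nred D l) (P l) (block (posB D) B l))"

definition compress :: "('l, 'y::finite, 'b::finite) layout \<Rightarrow> ('l \<Rightarrow> rmat) \<Rightarrow> real ^ 'y \<Rightarrow> real ^ 'b" where
  "compress D P U = unblock (posB D) (\<lambda>l. mm (nrow D l) (tr (P l)) (block (posY D) U l))"

definition omegaP :: "('l::finite, 'y, 'b) layout \<Rightarrow> real" where
  "omegaP D = (MAX l. real (nrow D l) / real (nred D l))"

definition grad :: "('a::real_inner \<Rightarrow> real) \<Rightarrow> 'a \<Rightarrow> 'a" where
  "grad F z = (THE d. GDERIV F z :> d)"

definition hess :: "('a::real_inner \<Rightarrow> real) \<Rightarrow> 'a \<Rightarrow> 'a \<Rightarrow>\<^sub>L 'a" where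
  "hess F z = Blinfun (frechet_derivative (grad F) (at z))"

text \<open>\<open>hess_xY G x y\<close> is \<open>\<nabla>\<^sup>2\<^sub>x\<^sub>y G (x, y)\<close>, the adjoint of
  \<open>u \<mapsto> \<nabla>\<^sup>2\<^sub>y\<^sub>x G (x, y) [u]\<close>, the derivative of \<open>\<nabla>\<^sub>y G\<close> with respect to \<open>x\<close>.\<close>

definition hess_xY ::
  "('a::euclidean_space \<times> 'c::euclidean_space \<Rightarrow> real) \<Rightarrow> 'a \<Rightarrow> 'c \<Rightarrow> 'c \<Rightarrow> 'a" where
  "hess_xY G x y = adjoint (frechet_derivative (\<lambda>x'. grad (\<lambda>y'. G (x', y')) y) (at x))"

definition strongly_convex :: "real \<Rightarrow> ('a::real_inner \<Rightarrow> real) \<Rightarrow> bool" where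
  "strongly_convex \<mu> F \<longleftrightarrow>
     (\<forall>y z. \<forall>t\<in>{0..1}. F ((1 - t) *\<^sub>R y + t *\<^sub>R z)
        \<le> (1 - t) * F y + t * F z - \<mu> / 2 * t * (1 - t) * (norm (y - z))\<^sup>2)"

definition Ystar :: "('a \<times> 'c \<Rightarrow> real) \<Rightarrow> 'a \<Rightarrow> 'c" where
  "Ystar g x = arg_min (\<lambda>y. g (x, y)) (\<lambda>_. True)"

definition Phi :: "('a \<times> 'c \<Rightarrow> real) \<Rightarrow> ('a \<times> 'c \<Rightarrow> real) \<Rightarrow> 'a \<Rightarrow> real" where
  "Phi f g x = f (x, Ystar g x)"

definition smooth_bilevel ::
  "('a::euclidean_space \<times> 'c::euclidean_space \<Rightarrow> real) \<Rightarrow> ('a \<times> 'c \<Rightarrow> real) \<Rightarrow>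
   real \<Rightarrow> real \<Rightarrow> real \<Rightarrow> real \<Rightarrow> real \<Rightarrow> bool" where
  "smooth_bilevel f g \<mu>g Lf0 Lf1 Lg1 Lg2 \<longleftrightarrow>
     0 < \<mu>g \<and> 0 < Lf0 \<and> 0 < Lf1 \<and> 0 < Lg1 \<and> 0 < Lg2 \<and>
     (\<forall>z. f differentiable (at z)) \<and> Lf1-lipschitz_on UNIV (grad f) \<and>
     (\<forall>z. g differentiable (at z)) \<and> Lg1-lipschitz_on UNIV (grad g) \<and>
     (\<forall>z. grad g differentiable (at z)) \<and> Lg2-lipschitz_on UNIV (hess g) \<and>
     (\<forall>x. norm (grad (\<lambda>y. f (x, y)) (Ystar g x)) \<le> Lf0) \<and>
     (\<forall>x. strongly_convex \<mu>g (\<lambda>y. g (x, y)))"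

definition mat_space :: "nat \<Rightarrow> nat \<Rightarrow> rmat measure" where
  "mat_space p q = (\<Pi>\<^sub>M ij\<in>{..<p} \<times> {..<q}. borel)"

definition orthogonal_mats :: "nat \<Rightarrow> rmat set" where
  "orthogonal_mats p =
     {Q \<in> space (mat_space p p). \<forall>i<p. \<forall>j<p. mm p (tr Q) Q (i, j) = (if i = j then 1 else 0)}"

text \<open>The Haar probability measure of the compact group \<open>O(p)\<close> is the unique left-invariant one.\<close>

definition haar_orthogonal :: "nat \<Rightarrow> rmat measure \<Rightarrow> bool" where
  "haar_orthogonal p \<mu> \<longleftrightarrow>
     prob_space \<mu> \<and> sets \<mu> = sets (mat_space p p) \<and>
     (AE Q in \<mu>. Q \<in> orthogonal_mats p) \<and>
     (\<forall>Q\<in>orthogonal_mats p.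
        distr \<mu> (mat_space p p) (\<lambda>A. restrict (mm p Q A) ({..<p} \<times> {..<p})) = \<mu>)"

text \<open>The law of \<open>sqrt (p / q)\<close> times the first \<open>q\<close> columns of a Haar-uniform matrix in \<open>O(p)\<close>.\<close>

definition frame_law :: "nat \<Rightarrow> nat \<Rightarrow> rmat measure \<Rightarrow> bool" where
  "frame_law p q \<nu> \<longleftrightarrow>
     (\<exists>\<mu>. haar_orthogonal p \<mu> \<and>
        \<nu> = distr \<mu> (mat_space p q)
              (\<lambda>Q. \<lambda>ij\<in>{..<p} \<times> {..<q}. sqrt (real p / real q) * Q ij))"

definition gen :: "'w measure \<Rightarrow> ('w \<Rightarrow> 'a) \<Rightarrow> 'a measure \<Rightarrow> 'w set set" where
  "gen M X N = sets (vimage_algebra (space M) X N)"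

text \<open>\<open>real_cond_exp\<close> is only available for real random variables, so the conditional mean of a
  vector is taken coordinatewise. The conditional first absolute moment is required to be finite,
  without which \<open>real_cond_exp\<close> has no meaning.\<close>

definition has_cond_mean ::
  "'w measure \<Rightarrow> 'w measure \<Rightarrow> ('w \<Rightarrow> 'a::euclidean_space) \<Rightarrow> ('w \<Rightarrow> 'a) \<Rightarrow> bool" where
  "has_cond_mean M F X Y \<longleftrightarrow>
     (AE \<omega> in M. nn_cond_exp M F (\<lambda>\<omega>. ennreal (norm (X \<omega>))) \<omega> < \<infinity>) \<and>
     (\<forall>b\<in>Basis. AE \<omega> in M. real_cond_exp M F (\<lambda>\<omega>. X \<omega> \<bullet> b) \<omega> = Y \<omega> \<bullet> b)"

definition cond_msd_le ::
  "'w measure \<Rightarrow> 'w measure \<Rightarrow> ('w \<Rightarrow> 'a::euclidean_space) \<Rightarrow> ('w \<Rightarrow> 'a) \<Rightarrow> ('w \<Rightarrow> real) \<Rightarrow> bool" where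
  "cond_msd_le M F X Y v \<longleftrightarrow>
     (AE \<omega> in M. nn_cond_exp M F (\<lambda>\<omega>. ennreal ((norm (X \<omega> - Y \<omega>))\<^sup>2)) \<omega> \<le> ennreal (v \<omega>))"

definition cond_indep :: "'w measure \<Rightarrow> 'w measure \<Rightarrow> 'w set set list \<Rightarrow> bool" where
  "cond_indep M F Gs \<longleftrightarrow>
     (\<forall>As. list_all2 (\<in>) As Gs \<longrightarrow>
        (AE \<omega> in M. real_cond_exp M F (indicator (\<Inter> (set As))) \<omega>
                   = prod_list (map (\<lambda>A. real_cond_exp M F (indicator A) \<omega>) As)))"

definition rademacher :: "'w measure \<Rightarrow> ('w \<Rightarrow> real) \<Rightarrow> bool" where
  "rademacher M X \<longleftrightarrow> X \<in> borel_measurable M \<and>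
     measure M {\<omega> \<in> space M. X \<omega> = 1} = 1 / 2 \<and> measure M {\<omega> \<in> space M. X \<omega> = - 1} = 1 / 2"

text \<open>A run, together with its probability space. \<open>pUx\<close>, \<open>pUY\<close>, \<open>pV\<close>, \<open>pH\<close>, \<open>pJ\<close> are the stochastic
  estimators and \<open>pu\<close>, \<open>pxi\<close> the probes; those used in iteration \<open>k\<close> have index \<open>Suc k\<close>.\<close>

record ('w, 'd, 'l, 'y, 'b) process =
  pM :: "'w measure"
  px :: "nat \<Rightarrow> 'w \<Rightarrow> real ^ 'd"
  pY :: "nat \<Rightarrow> 'w \<Rightarrow> real ^ 'y"
  pZ :: "nat \<Rightarrow> 'w \<Rightarrow> real ^ 'y"
  ph :: "nat \<Rightarrow> 'w \<Rightarrow> real ^ 'd"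
  pP :: "nat \<Rightarrow> 'w \<Rightarrow> 'l \<Rightarrow> rmat"
  pUx :: "nat \<Rightarrow> 'w \<Rightarrow> real ^ 'd"
  pUY :: "nat \<Rightarrow> 'w \<Rightarrow> real ^ 'b"
  pV :: "nat \<Rightarrow> 'w \<Rightarrow> real ^ 'b"
  pH :: "nat \<Rightarrow> 'w \<Rightarrow> (real ^ 'b) \<Rightarrow>\<^sub>L (real ^ 'b)"
  pJ :: "nat \<Rightarrow> 'w \<Rightarrow> (real ^ 'b) \<Rightarrow>\<^sub>L (real ^ 'd)"
  pu :: "nat \<Rightarrow> 'w \<Rightarrow> 'l \<Rightarrow> rvec"
  pxi :: "nat \<Rightarrow> 'w \<Rightarrow> 'l \<Rightarrow> rvec"

definition gen_P ::
  "('l, 'y, 'b) layout \<Rightarrow> ('w, 'd::finite, 'l, 'y::finite, 'b::finite) process \<Rightarrow> nat \<Rightarrow> 'w set set" where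
  "gen_P D S k = (\<Union>l. gen (pM S) (\<lambda>\<omega>. pP S k \<omega> l) (mat_space (nrow D l) (nred D l)))"

definition gen_probes ::
  "('l, 'y, 'b) layout \<Rightarrow> ('w, 'd::finite, 'l, 'y::finite, 'b::finite) process \<Rightarrow> nat \<Rightarrow> 'w set set" where
  "gen_probes D S k =
     (\<Union>l. (\<Union>j<ncol D l. gen (pM S) (\<lambda>\<omega>. pu S k \<omega> l j) borel) \<union>
           (\<Union>a<nred D l. gen (pM S) (\<lambda>\<omega>. pxi S k \<omega> l a) borel))"

definition est_algebras ::
  "('w, 'd::finite, 'l, 'y::finite, 'b::finite) process \<Rightarrow> nat \<Rightarrow> 'w set set list" where
  "est_algebras S k =
     [gen (pM S) (pUx S k) borel, gen (pM S) (pUY S k) borel, gen (pM S) (pV S k) borel,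
      gen (pM S) (pH S k) borel, gen (pM S) (pJ S k) borel]"

definition gen_states :: "('w, 'd::finite, 'l, 'y::finite, 'b::finite) process \<Rightarrow> nat \<Rightarrow> 'w set set" where
  "gen_states S k = gen (pM S) (px S k) borel \<union> gen (pM S) (pY S k) borel \<union>
     gen (pM S) (pZ S k) borel \<union> gen (pM S) (ph S k) borel"

definition Fil ::
  "('l, 'y, 'b) layout \<Rightarrow> ('w, 'd::finite, 'l, 'y::finite, 'b::finite) process \<Rightarrow> nat \<Rightarrow> 'w measure" where
  "Fil D S k = sigma (space (pM S)) ((\<Union>i\<le>k. gen_states S i) \<union> (\<Union>i<k. gen_P D S i))"

definition FilP ::
  "('l, 'y, 'b) layout \<Rightarrow> ('w, 'd::finite, 'l, 'y::finite, 'b::finite) process \<Rightarrow> nat \<Rightarrow> 'w measure" where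
  "FilP D S k = sigma (space (pM S)) (sets (Fil D S k) \<union> gen_P D S k)"

definition FilPP ::
  "('l, 'y, 'b) layout \<Rightarrow> ('w, 'd::finite, 'l, 'y::finite, 'b::finite) process \<Rightarrow> nat \<Rightarrow> 'w measure" where
  "FilPP D S k = sigma (space (pM S)) (sets (FilP D S k) \<union> gen_probes D S (Suc k))"

definition FilAll ::
  "('l, 'y, 'b) layout \<Rightarrow> ('w, 'd::finite, 'l, 'y::finite, 'b::finite) process \<Rightarrow> 'w measure" where
  "FilAll D S = sigma (space (pM S))
     (\<Union>k. gen_states S k \<union> gen_P D S k \<union> gen_probes D S (Suc k) \<union> \<Union> (set (est_algebras S (Suc k))))"

text \<open>\<open>(x, B) \<mapsto> F (x, Y\<^sup>k + P\<^sup>k B)\<close>\<close>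

definition projected ::
  "('l, 'y, 'b) layout \<Rightarrow> ('w, 'd::finite, 'l, 'y::finite, 'b::finite) process \<Rightarrow>
   ((real ^ 'd) \<times> (real ^ 'y) \<Rightarrow> real) \<Rightarrow> nat \<Rightarrow> 'w \<Rightarrow> (real ^ 'd) \<times> (real ^ 'b) \<Rightarrow> real" where
  "projected D S F k \<omega> = (\<lambda>(x, B). F (x, pY S k \<omega> + lift D (pP S k \<omega>) B))"

definition estimator_moments ::
  "('l, 'y, 'b) layout \<Rightarrow> ((real ^ 'd) \<times> (real ^ 'y) \<Rightarrow> real) \<Rightarrow> ((real ^ 'd) \<times> (real ^ 'y) \<Rightarrow> real) \<Rightarrow>
   real \<Rightarrow> real \<Rightarrow> real \<Rightarrow> real \<Rightarrow>
   ('w, 'd::finite, 'l::finite, 'y::finite, 'b::finite) process \<Rightarrow> bool" where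
  "estimator_moments D f g \<sigma>f1 \<sigma>f2 \<sigma>g1 \<sigma>g2 S \<longleftrightarrow>
     (\<forall>k. let M = pM S; F = FilP D S k; F' = FilPP D S k;
            gx = (\<lambda>\<omega>. grad (\<lambda>x. projected D S f k \<omega> (x, 0)) (px S k \<omega>));
            gB = (\<lambda>\<omega>. grad (\<lambda>B. projected D S f k \<omega> (px S k \<omega>, B)) 0);
            gV = (\<lambda>\<omega>. grad (\<lambda>B. projected D S g k \<omega> (px S k \<omega>, B)) 0);
            hB = (\<lambda>\<omega> W. hess (\<lambda>B. projected D S g k \<omega> (px S k \<omega>, B)) 0 W);
            hx = (\<lambda>\<omega> W. hess_xY (projected D S g k \<omega>) (px S k \<omega>) 0 W)
        in
          pUx S (Suc k) \<in> borel_measurable M \<and> pUY S (Suc k) \<in> borel_measurable M \<and>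
          pV S (Suc k) \<in> borel_measurable M \<and> pH S (Suc k) \<in> borel_measurable M \<and>
          pJ S (Suc k) \<in> borel_measurable M \<and>
          has_cond_mean M F (pUx S (Suc k)) gx \<and> cond_msd_le M F (pUx S (Suc k)) gx (\<lambda>_. \<sigma>f1\<^sup>2) \<and>
          has_cond_mean M F (pUY S (Suc k)) gB \<and> cond_msd_le M F (pUY S (Suc k)) gB (\<lambda>_. \<sigma>f2\<^sup>2) \<and>
          has_cond_mean M F (pV S (Suc k)) gV \<and> cond_msd_le M F (pV S (Suc k)) gV (\<lambda>_. \<sigma>g1\<^sup>2) \<and>
          (\<forall>W. has_cond_mean M F (\<lambda>\<omega>. pH S (Suc k) \<omega> W) (\<lambda>\<omega>. hB \<omega> W) \<and>
               cond_msd_le M F (\<lambda>\<omega>. pH S (Suc k) \<omega> W) (\<lambda>\<omega>. hB \<omega> W) (\<lambda>_. \<sigma>g2\<^sup>2 * (norm W)\<^sup>2) \<and>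
               has_cond_mean M F (\<lambda>\<omega>. pJ S (Suc k) \<omega> W) (\<lambda>\<omega>. hx \<omega> W) \<and>
               cond_msd_le M F (\<lambda>\<omega>. pJ S (Suc k) \<omega> W) (\<lambda>\<omega>. hx \<omega> W) (\<lambda>_. \<sigma>g2\<^sup>2 * (norm W)\<^sup>2)) \<and>
          cond_indep M F (est_algebras S (Suc k)) \<and>
          (\<forall>W\<in>borel_measurable F'.
             (AE \<omega> in M. nn_cond_exp M F' (\<lambda>\<omega>. ennreal ((norm (W \<omega>))\<^sup>2)) \<omega> < \<infinity>) \<longrightarrow>
               has_cond_mean M F' (\<lambda>\<omega>. pH S (Suc k) \<omega> (W \<omega>)) (\<lambda>\<omega>. hB \<omega> (W \<omega>)) \<and>
               cond_msd_le M F' (\<lambda>\<omega>. pH S (Suc k) \<omega> (W \<omega>)) (\<lambda>\<omega>. hB \<omega> (W \<omega>))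
                 (\<lambda>\<omega>. \<sigma>g2\<^sup>2 * (norm (W \<omega>))\<^sup>2) \<and>
               has_cond_mean M F' (\<lambda>\<omega>. pJ S (Suc k) \<omega> (W \<omega>)) (\<lambda>\<omega>. hx \<omega> (W \<omega>)) \<and>
               cond_msd_le M F' (\<lambda>\<omega>. pJ S (Suc k) \<omega> (W \<omega>)) (\<lambda>\<omega>. hx \<omega> (W \<omega>))
                 (\<lambda>\<omega>. \<sigma>g2\<^sup>2 * (norm (W \<omega>))\<^sup>2)))"

text \<open>\<open>Inl (l, j)\<close> stands for the \<open>j\<close>-th sign of \<open>u\<^sub>l\<close> and \<open>Inr (l, a)\<close> for the \<open>a\<close>-th sign of \<open>\<xi>\<^sub>l\<close>.\<close>

definition rademacher_probes ::
  "('l, 'y, 'b) layout \<Rightarrow> ('w, 'd::finite, 'l::finite, 'y::finite, 'b::finite) process \<Rightarrow> bool" where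
  "rademacher_probes D S \<longleftrightarrow>
     (\<forall>k. let M = pM S;
            I = {Inl (l, j) | l j. j < ncol D l} \<union> {Inr (l, a) | l a. a < nred D l};
            s = (\<lambda>c \<omega>. case c of Inl (l, j) \<Rightarrow> pu S (Suc k) \<omega> l j | Inr (l, a) \<Rightarrow> pxi S (Suc k) \<omega> l a)
        in
          (\<forall>c\<in>I. rademacher M (s c)) \<and>
          prob_space.indep_vars M (\<lambda>_. borel) s I \<and>
          prob_space.indep_set M (sigma_sets (space M) (gen_probes D S (Suc k)))
            (sigma_sets (space M) (sets (FilP D S k) \<union> \<Union> (set (est_algebras S (Suc k))))))"

definition haar_projectors ::
  "('l, 'y, 'b) layout \<Rightarrow> ('w, 'd::finite, 'l::finite, 'y::finite, 'b::finite) process \<Rightarrow> bool" where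
  "haar_projectors D S \<longleftrightarrow>
     (\<forall>k l. (\<lambda>\<omega>. pP S k \<omega> l) \<in> pM S \<rightarrow>\<^sub>M mat_space (nrow D l) (nred D l)) \<and>
     (\<exists>\<nu>. (\<forall>l. frame_law (nrow D l) (nred D l) (\<nu> l)) \<and>
        (\<forall>k A. (\<forall>l. A l \<in> sets (mat_space (nrow D l) (nred D l))) \<longrightarrow>
           (AE \<omega> in pM S.
              real_cond_exp (pM S) (Fil D S k) (indicator {\<omega> \<in> space (pM S). \<forall>l. pP S k \<omega> l \<in> A l}) \<omega>
              = (\<Prod>l\<in>UNIV. measure (\<nu> l) (A l)))))"

definition embed_block ::
  "('l, 'y, 'b::finite) layout \<Rightarrow> 'l \<Rightarrow> rmat \<Rightarrow> real ^ 'b" where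
  "embed_block D t W = unblock (posB D) (\<lambda>l. if l = t then W else (\<lambda>_. 0))"

definition Ztil :: "('l, 'y::finite, 'b) layout \<Rightarrow> ('l \<Rightarrow> rmat) \<Rightarrow> real ^ 'y \<Rightarrow> 'l \<Rightarrow> rmat" where
  "Ztil D P Z t = mm (nrow D t) (tr (P t)) (block (posY D) Z t)"

definition Ablk ::
  "('l, 'y::finite, 'b::finite) layout \<Rightarrow> ('l \<Rightarrow> rmat) \<Rightarrow> ((real ^ 'b) \<Rightarrow>\<^sub>L (real ^ 'b)) \<Rightarrow> real ^ 'y \<Rightarrow>
   'l \<Rightarrow> 'l \<Rightarrow> rmat" where
  "Ablk D P H Z t l =
     mm (nred D l) (P l) (block (posB D) (blinfun_apply H (embed_block D t (Ztil D P Z t))) l)"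

definition Mblk ::
  "('l, 'y, 'b::finite) layout \<Rightarrow> ((real ^ 'b) \<Rightarrow>\<^sub>L (real ^ 'b)) \<Rightarrow> ('l \<Rightarrow> rvec) \<Rightarrow> ('l \<Rightarrow> rvec) \<Rightarrow>
   'l \<Rightarrow> rmat" where
  "Mblk D H u \<xi> = block (posB D) (blinfun_apply H (unblock (posB D) (\<lambda>l. outer (\<xi> l) (u l))))"

definition Chat ::
  "('l, 'y::finite, 'b::finite) layout \<Rightarrow> ((real ^ 'b) \<Rightarrow>\<^sub>L (real ^ 'b)) \<Rightarrow> ('l \<Rightarrow> rvec) \<Rightarrow> ('l \<Rightarrow> rvec) \<Rightarrow>
   real ^ 'y \<Rightarrow> 'l \<Rightarrow> rmat" where
  "Chat D H u \<xi> Z t =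
     mm (ncol D t) (block (posY D) Z t) (outer (mv (nred D t) (tr (Mblk D H u \<xi> t)) (\<xi> t)) (u t))"

definition Bhat ::
  "('l, 'y::finite, 'b::finite) layout \<Rightarrow> ('l \<Rightarrow> rmat) \<Rightarrow> ((real ^ 'b) \<Rightarrow>\<^sub>L (real ^ 'b)) \<Rightarrow>
   ('l \<Rightarrow> rvec) \<Rightarrow> ('l \<Rightarrow> rvec) \<Rightarrow> real ^ 'y \<Rightarrow> 'l \<Rightarrow> rmat" where
  "Bhat D P H u \<xi> Z t =
     mm (nred D t) (P t)
       (outer (\<xi> t) (mv (nred D t) (tr (Mblk D H u \<xi> t)) (mv (ncol D t) (Ztil D P Z t) (u t))))"

definition hess_diag ::
  "('l, 'y::finite, 'b::finite) layout \<Rightarrow> ('l \<Rightarrow> rmat) \<Rightarrow> ((real ^ 'b) \<Rightarrow>\<^sub>L (real ^ 'b)) \<Rightarrow>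
   ('l \<Rightarrow> rvec) \<Rightarrow> ('l \<Rightarrow> rvec) \<Rightarrow> real ^ 'y \<Rightarrow> 'l \<Rightarrow> rmat" where
  "hess_diag D P H u \<xi> Z t =
     (let m = real (nrow D t); r = real (nred D t); A = Ablk D P H Z t t;
          C = Chat D H u \<xi> Z t; B = Bhat D P H u \<xi> Z t
      in (\<lambda>ij. r * (m - 1) * (m + 2) / (m * (m * r + m - 2)) * A ij
             - (m - r) / (m * r + m - 2) * C ij
             + r * (m - 1) * (m - r) / (m * (r - 1) * (m * r + m - 2)) * (A ij - B ij)))"

definition hess_action ::
  "('l::finite, 'y::finite, 'b::finite) layout \<Rightarrow> ('l \<Rightarrow> rmat) \<Rightarrow> ((real ^ 'b) \<Rightarrow>\<^sub>L (real ^ 'b)) \<Rightarrow>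
   ('l \<Rightarrow> rvec) \<Rightarrow> ('l \<Rightarrow> rvec) \<Rightarrow> real ^ 'y \<Rightarrow> real ^ 'y" where
  "hess_action D P H u \<xi> Z =
     unblock (posY D) (\<lambda>l ij. hess_diag D P H u \<xi> Z l ij + (\<Sum>t\<in>UNIV - {l}. Ablk D P H Z t l ij))"

definition bros_recursion ::
  "('l, 'y, 'b) layout \<Rightarrow> real ^ 'd \<Rightarrow> real ^ 'y \<Rightarrow> real ^ 'y \<Rightarrow>
   (nat \<Rightarrow> real) \<Rightarrow> (nat \<Rightarrow> real) \<Rightarrow> (nat \<Rightarrow> real) \<Rightarrow> (nat \<Rightarrow> real) \<Rightarrow>
   ('w, 'd::finite, 'l::finite, 'y::finite, 'b::finite) process \<Rightarrow> bool" where
  "bros_recursion D x0 Y0 Z0 \<alpha> \<beta> \<gamma> \<theta> S \<longleftrightarrow>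
     (\<forall>\<omega>\<in>space (pM S).
        px S 0 \<omega> = x0 \<and> pY S 0 \<omega> = Y0 \<and> pZ S 0 \<omega> = Z0 \<and> ph S 0 \<omega> = 0 \<and>
        (\<forall>k. let P = pP S k \<omega>;
               V = lift D P (pV S (Suc k) \<omega>);
               T = hess_action D P (pH S (Suc k) \<omega>) (pu S (Suc k) \<omega>) (pxi S (Suc k) \<omega>) (pZ S k \<omega>)
                     - lift D P (pUY S (Suc k) \<omega>);
               W = pUx S (Suc k) \<omega> - blinfun_apply (pJ S (Suc k) \<omega>) (compress D P (pZ S k \<omega>))
           in
             px S (Suc k) \<omega> = px S k \<omega> - \<alpha> k *\<^sub>R ph S k \<omega> \<and>
             pY S (Suc k) \<omega> = pY S k \<omega> - \<beta> k *\<^sub>R V \<and>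
             pZ S (Suc k) \<omega> = pZ S k \<omega> - \<gamma> k *\<^sub>R T \<and>
             ph S (Suc k) \<omega> = (1 - \<theta> k) *\<^sub>R ph S k \<omega> + \<theta> k *\<^sub>R W))"

definition bros_run ::
  "('l, 'y, 'b) layout \<Rightarrow> ((real ^ 'd) \<times> (real ^ 'y) \<Rightarrow> real) \<Rightarrow> ((real ^ 'd) \<times> (real ^ 'y) \<Rightarrow> real) \<Rightarrow>
   real \<Rightarrow> real \<Rightarrow> real \<Rightarrow> real \<Rightarrow> real ^ 'd \<Rightarrow> real ^ 'y \<Rightarrow> real ^ 'y \<Rightarrow>
   (nat \<Rightarrow> real) \<Rightarrow> (nat \<Rightarrow> real) \<Rightarrow> (nat \<Rightarrow> real) \<Rightarrow> (nat \<Rightarrow> real) \<Rightarrow>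
   ('w, 'd::finite, 'l::finite, 'y::finite, 'b::finite) process \<Rightarrow> bool" where
  "bros_run D f g \<sigma>f1 \<sigma>f2 \<sigma>g1 \<sigma>g2 x0 Y0 Z0 \<alpha> \<beta> \<gamma> \<theta> S \<longleftrightarrow>
     prob_space (pM S) \<and>
     estimator_moments D f g \<sigma>f1 \<sigma>f2 \<sigma>g1 \<sigma>g2 S \<and>
     rademacher_probes D S \<and>
     haar_projectors D S \<and>
     bros_recursion D x0 Y0 Z0 \<alpha> \<beta> \<gamma> \<theta> S"

definition uniform_index ::
  "('l, 'y, 'b) layout \<Rightarrow> ('w, 'd::finite, 'l::finite, 'y::finite, 'b::finite) process \<Rightarrow>
   nat \<Rightarrow> ('w \<Rightarrow> nat) \<Rightarrow> bool" where
  "uniform_index D S K R \<longleftrightarrow>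
     R \<in> pM S \<rightarrow>\<^sub>M count_space UNIV \<and>
     distr (pM S) (count_space UNIV) R = measure_pmf (pmf_of_set {..<K}) \<and>
     prob_space.indep_set (pM S) (gen (pM S) R (count_space UNIV)) (sets (FilAll D S))"

definition sq_grad_at ::
  "((real ^ 'd) \<times> (real ^ 'y) \<Rightarrow> real) \<Rightarrow> ((real ^ 'd) \<times> (real ^ 'y) \<Rightarrow> real) \<Rightarrow>
   ('w, 'd::finite, 'l, 'y::finite, 'b::finite) process \<Rightarrow> ('w \<Rightarrow> nat) \<Rightarrow> 'w \<Rightarrow> real" where
  "sq_grad_at f g S R \<omega> = (norm (grad (Phi f g) (px S (R \<omega>) \<omega>)))\<^sup>2"

definition avg_sq_grad ::
  "((real ^ 'd) \<times> (real ^ 'y) \<Rightarrow> real) \<Rightarrow> ((real ^ 'd) \<times> (real ^ 'y) \<Rightarrow> real) \<Rightarrow>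
   ('w, 'd::finite, 'l, 'y::finite, 'b::finite) process \<Rightarrow> nat \<Rightarrow> real" where
  "avg_sq_grad f g S K = 1 / real K * (\<Sum>k<K. \<integral>\<omega>. sq_grad_at f g S (\<lambda>_. k) \<omega> \<partial>pM S)"

end

theory Submission
  imports Defs
begin

text \<open>A frame satisfies \<open>E (P P\<^sup>T) = I\<close>, so the projected gradients lift to unbiased estimators, but the lifted
  Hessian action is quadratic in \<open>P P\<^sup>T\<close> within each layer. Invariance under permutations, sign changes and
  rotations determines \<open>E ((P P\<^sup>T) \<otimes> (P P\<^sup>T))\<close> up to two coefficients, and the corrected Hessian action inverts
  the resulting linear map exactly; the probes estimate its two remaining terms. Hence the directions for \<open>Y\<close>, \<open>Z\<close>
  and \<open>h\<close> have conditional means \<open>\<nabla>\<^sub>y g\<close>, \<open>\<nabla>\<^sup>2\<^sub>y\<^sub>y g [Z] - \<nabla>\<^sub>y f\<close> and \<open>\<nabla>\<^sub>x f - \<nabla>\<^sup>2\<^sub>x\<^sub>y g [Z]\<close> and second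
  moments that are affine in the squared errors. The errors of \<open>Y\<close> and \<open>Z\<close> against \<open>Y\<^sup>*(x)\<close> and
  \<open>Z\<^sup>*(x) = (\<nabla>\<^sup>2\<^sub>y\<^sub>y g)\<^sup>-\<^sup>1 \<nabla>\<^sub>y f\<close> and of \<open>h\<close> against \<open>\<nabla>\<Phi>(x)\<close> contract; a weighted sum of \<open>\<Phi>\<close>
  and these errors is a Lyapunov function, whose decrease bounds the averaged squared gradient.\<close>

section \<open>Calculus of the bilevel problem\<close>

text \<open>Conditional means are used only in weak form: tested against a square-integrable
  quantity measurable for the past, then integrated. The relation \<open>eqE\<close> carries these
  identities, and each unbiasedness proof strips the randomness from the latest source to the
  earliest: oracle, probes, frames. Two obstacles shape the rest. The oracle controls the random
  Hessian only one direction at a time, so the corrected action, which is linear in the operator, is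
  expanded in matrix units and each random coefficient is absorbed into the queried direction. And
  nothing is known about the regularity of \<open>Ystar\<close> beyond what strong convexity yields,
  so a Lipschitz bound together with Taylor remainders replaces the implicit function theorem.
  Finally, the constants have to be chosen before the probability space. They may depend on the
  dimensions, so frames enter through crude entrywise bounds; and although they are defined in a
  locale that contains a run, they involve only the problem data.\<close>

lemma GDERIV_unique:
  assumes "GDERIV F z :> d" "GDERIV F z :> e"
  shows "d = e"
proof -
  have "(\<lambda>h. inner h d) = (\<lambda>h. inner h e)"
    using assms has_derivative_unique unfolding gderiv_def by blast
  then have "inner (d - e) d = inner (d - e) e" by metis
  then have "inner (d - e) (d - e) = 0" by (simp add: inner_diff_right)
  then show ?thesis by simp
qed

lemma grad_eq: "GDERIV F z :> d \<Longrightarrow> grad F z = d"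
  unfolding grad_def using GDERIV_unique by blast

lemma differentiable_GDERIV:
  fixes F :: "'a::euclidean_space \<Rightarrow> real"
  assumes "F differentiable (at z)"
  shows "GDERIV F z :> grad F z"
proof -
  obtain F' where F': "(F has_derivative F') (at z)"
    using assms unfolding differentiable_def by blast
  have "linear F'" using F' has_derivative_linear by blast
  then have "F' = (\<lambda>h. inner h (adjoint F' 1))"
    using adjoint_works[of F' _ 1] by (auto simp: fun_eq_iff)
  then have "GDERIV F z :> adjoint F' 1" using F' unfolding gderiv_def by simp
  then show ?thesis using grad_eq by metis
qed

lemma GDERIV_snd:
  assumes "GDERIV F (x, y) :> d"
  shows "GDERIV (\<lambda>y. F (x, y)) y :> snd d"
proof -
  have "((\<lambda>y. (x, y)) has_derivative (\<lambda>h. (0, h))) (at y)"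
    by (auto intro!: derivative_eq_intros)
  from has_derivative_compose[OF this assms[unfolded gderiv_def]]
  show ?thesis unfolding gderiv_def by (cases d) simp
qed

lemma GDERIV_fst:
  assumes "GDERIV F (x, y) :> d"
  shows "GDERIV (\<lambda>x. F (x, y)) x :> fst d"
proof -
  have "((\<lambda>x. (x, y)) has_derivative (\<lambda>h. (h, 0))) (at x)"
    by (auto intro!: derivative_eq_intros)
  from has_derivative_compose[OF this assms[unfolded gderiv_def]]
  show ?thesis unfolding gderiv_def by (cases d) simp
qed

lemma has_derivative_hess:
  assumes "grad F differentiable (at z)"
  shows "(grad F has_derivative blinfun_apply (hess F z)) (at z)"
proof -
  have d: "(grad F has_derivative frechet_derivative (grad F) (at z)) (at z)"
    using assms frechet_derivative_works by blast
  then have "bounded_linear (frechet_derivative (grad F) (at z))"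
    by (rule has_derivative_bounded_linear)
  then show ?thesis using d unfolding hess_def by (simp add: bounded_linear_Blinfun_apply)
qed

lemma norm_fst_diff_le: "norm (fst a - fst b) \<le> norm (a - b)"
  by (metis norm_fst_le fst_diff prod.collapse)

lemma norm_snd_diff_le: "norm (snd a - snd b) \<le> norm (a - b)"
  by (metis norm_snd_le snd_diff prod.collapse)

text \<open>Inequalities about derivatives are first proved for a finite increment with an error
  proportional to \<open>e\<close>; this lemma lets \<open>e\<close> tend to 0 whatever the sign of
  the factor \<open>C\<close>.\<close>

lemma le_if_le_add_mult:
  fixes A B C :: real
  assumes "\<And>e. 0 < e \<Longrightarrow> A \<le> B + e * C"
  shows "A \<le> B"
proof (cases "C \<le> 0")
  case True
  then show ?thesis using assms[of 1] by simp
next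
  case False
  show ?thesis
  proof (rule field_le_epsilon)
    fix e :: real assume "0 < e"
    then have "0 < e / C" using False by simp
    from assms[OF this] show "A \<le> B + e" using False by simp
  qed
qed

text \<open>A single small step along \<open>v\<close> is all that the limit arguments below
  consume, so differentiability is packaged as the existence of one such step.\<close>

lemma has_derivative_near:
  assumes "(F has_derivative F') (at z)" "0 < e"
  obtains t :: real where "0 < t" "t \<le> 1"
    "norm (F (z + t *\<^sub>R v) - F z - t *\<^sub>R F' v) \<le> e * t * norm v"
proof -
  obtain d where d: "0 < d" "\<And>y. norm (y - z) < d \<Longrightarrow> norm (F y - F z - F' (y - z)) \<le> e * norm (y - z)"
    using assms unfolding has_derivative_at_alt by blast
  \<comment> \<open>The \<open>+ 1\<close> keeps the quotient meaningful when \<open>v = 0\<close>;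
    the factor 2 makes the step strictly shorter than \<open>d\<close>.\<close>
  define t where "t = min 1 (d / (2 * (norm v + 1)))"
  have t: "0 < t" "t \<le> 1" using d(1) by (auto simp: t_def add_nonneg_pos)
  have "t * norm v \<le> d / (2 * (norm v + 1)) * norm v"
    by (rule mult_right_mono) (auto simp: t_def)
  also have "\<dots> = d * (norm v / (2 * (norm v + 1)))" by simp
  also have "\<dots> < d * 1"
    using d(1) by (intro mult_strict_left_mono) (auto simp: divide_less_eq add_nonneg_pos intro: add_nonneg_pos)
  finally have "norm ((z + t *\<^sub>R v) - z) < d" using t by simp
  from d(2)[OF this] have "norm (F (z + t *\<^sub>R v) - F z - F' (t *\<^sub>R v)) \<le> e * norm (t *\<^sub>R v)" by simp
  moreover have "F' (t *\<^sub>R v) = t *\<^sub>R F' v"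
    using assms(1) has_derivative_linear linear_scale by blast
  ultimately show thesis using t that by (simp add: mult.assoc)
qed

lemma derivative_norm_le_lipschitz:
  assumes F: "(F has_derivative F') (at z)"
    and L: "\<And>y. norm (F y - F z) \<le> L * norm (y - z)"
  shows "norm (F' v) \<le> L * norm v"
proof (rule le_if_le_add_mult)
  fix e :: real assume "0 < e"
  then obtain t where t: "0 < t" "norm (F (z + t *\<^sub>R v) - F z - t *\<^sub>R F' v) \<le> e * t * norm v"
    using has_derivative_near[OF F] by metis
  have "t * norm (F' v) = norm (t *\<^sub>R F' v)" using t by simp
  also have "\<dots> \<le> norm (F (z + t *\<^sub>R v) - F z) + norm (F (z + t *\<^sub>R v) - F z - t *\<^sub>R F' v)"
    using norm_triangle_sub[of "t *\<^sub>R F' v" "F (z + t *\<^sub>R v) - F z"] by (simp add: norm_minus_commute)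
  also have "\<dots> \<le> t * (L * norm v + e * norm v)"
    using t L[of "z + t *\<^sub>R v"] by (simp add: algebra_simps)
  finally show "norm (F' v) \<le> L * norm v + e * norm v" using t(1) by simp
qed

text \<open>Mean value inequality for \<open>F\<close> minus its linearisation at \<open>z\<close>
  on the ball of radius \<open>norm u\<close>, where the derivative of the difference is at most
  \<open>L * norm u\<close>. The sharper factor 1/2 would need integration along the segment and is
  not sought.\<close>

lemma quadratic_remainder:
  fixes F :: "'a::real_normed_vector \<Rightarrow> 'b::real_normed_vector"
  assumes D: "\<And>w. (F has_derivative F' w) (at w)"
    and L: "\<And>w v. norm (F' w v - F' z v) \<le> L * norm (w - z) * norm v" and "0 \<le> L"
  shows "norm (F (z + u) - F z - F' z u) \<le> L * (norm u)\<^sup>2"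
proof -
  interpret z: bounded_linear "F' z" using D has_derivative_bounded_linear by blast
  have "norm ((F (z + u) - F' z (z + u)) - (F z - F' z z)) \<le> (L * norm u) * norm ((z + u) - z)"
  proof (rule differentiable_bound[where S = "cball z (norm u)" and f = "\<lambda>w. F w - F' z w" and f' = "\<lambda>w v. F' w v - F' z v"])
    fix w assume w: "w \<in> cball z (norm u)"
    have "((\<lambda>w. F' z w) has_derivative F' z) (at w)"
      by (rule bounded_linear_imp_has_derivative) (rule z.bounded_linear_axioms)
    from has_derivative_diff[OF has_derivative_at_withinI[OF D[of w]] has_derivative_at_withinI[OF this]]
    show "((\<lambda>w. F w - F' z w) has_derivative (\<lambda>v. F' w v - F' z v)) (at w within cball z (norm u))" .
    show "onorm (\<lambda>v. F' w v - F' z v) \<le> L * norm u"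
    proof (rule onorm_bound)
      show "0 \<le> L * norm u" using \<open>0 \<le> L\<close> by simp
      fix v :: 'a
      have "norm (w - z) \<le> norm u" using w by (simp add: dist_norm norm_minus_commute)
      then have "L * norm (w - z) * norm v \<le> L * norm u * norm v"
        using \<open>0 \<le> L\<close> by (intro mult_mono) auto
      then show "norm (F' w v - F' z v) \<le> L * norm u * norm v" using L[of w v] by simp
    qed
  qed (auto simp: dist_norm)
  then show ?thesis by (simp add: z.add algebra_simps power2_eq_square)
qed

text \<open>The convexity inequality on a segment is divided by the segment parameter
  \<open>t\<close>, and \<open>t\<close> is sent to 0; both the derivative error and the loss from
  the factor \<open>1 - t\<close> are of order \<open>e\<close>.\<close>

lemma strongly_convex_first_order:
  fixes F :: "'a::real_inner \<Rightarrow> real"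
  assumes sc: "strongly_convex \<mu> F" and D: "GDERIV F y :> d"
  shows "F y + inner d (z - y) + \<mu> / 2 * (norm (z - y))\<^sup>2 \<le> F z"
proof -
  define a where "a = \<mu> / 2 * (norm (z - y))\<^sup>2"
  have "inner d (z - y) \<le> F z - F y - a + e * (norm (z - y) + \<bar>a\<bar>)" if e: "0 < e" for e
  proof -
    have near: "\<exists>t>0. t \<le> e \<and> t \<le> 1 \<and> \<bar>F (y + t *\<^sub>R (z - y)) - F y - t * inner d (z - y)\<bar> \<le> e * t * norm (z - y)"
    proof -
      \<comment> \<open>Shrinking the direction by \<open>min e 1\<close> forces the total step
        below \<open>e\<close>, whereas \<open>has_derivative_near\<close> by itself only gives a
        step of at most 1.\<close>
      define e' where "e' = min e 1"
      have e': "0 < e'" using e by (simp add: e'_def)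
      obtain t :: real where t: "0 < t" "t \<le> 1" "norm (F (y + t *\<^sub>R (e' *\<^sub>R (z - y))) - F y - t *\<^sub>R inner (e' *\<^sub>R (z - y)) d) \<le> e * t * norm (e' *\<^sub>R (z - y))"
        using has_derivative_near[OF D[unfolded gderiv_def] e] by metis
      have "t * e' \<le> 1 * e'" using t e' by (intro mult_right_mono) auto
      then have "t * e' \<le> e" "t * e' \<le> 1" by (auto simp: e'_def)
      then show ?thesis using t e'
        by (intro exI[of _ "t * e'"]) (auto simp: inner_commute mult.assoc)
    qed
    then obtain t where t: "0 < t" "t \<le> e" "t \<le> 1"
      "\<bar>F (y + t *\<^sub>R (z - y)) - F y - t * inner d (z - y)\<bar> \<le> e * t * norm (z - y)" by blast
    have "F ((1 - t) *\<^sub>R y + t *\<^sub>R z) \<le> (1 - t) * F y + t * F z - \<mu> / 2 * t * (1 - t) * (norm (y - z))\<^sup>2"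
      using sc t unfolding strongly_convex_def by auto
    moreover have "(1 - t) *\<^sub>R y + t *\<^sub>R z = y + t *\<^sub>R (z - y)" by (simp add: algebra_simps)
    moreover have "\<mu> / 2 * t * (1 - t) * (norm (y - z))\<^sup>2 = t * ((1 - t) * a)"
      by (simp add: a_def norm_minus_commute)
    ultimately have "t * inner d (z - y) \<le> t * (F z - F y - (1 - t) * a + e * norm (z - y))"
      using t(4) by (simp add: algebra_simps)
    then have "inner d (z - y) \<le> F z - F y - (1 - t) * a + e * norm (z - y)" using t(1) by simp
    moreover have "t * a \<le> e * \<bar>a\<bar>" 
      using t by (intro order_trans[OF mult_left_mono[OF abs_ge_self] mult_right_mono]) auto
    ultimately show ?thesis by (simp add: algebra_simps)
  qed
  from le_if_le_add_mult[OF this] show ?thesis by (simp add: a_def)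
qed

section \<open>Partial derivatives and the candidate for the hypergradient\<close>

definition grad_x :: "('a::real_inner \<times> 'c::real_inner \<Rightarrow> real) \<Rightarrow> 'a \<Rightarrow> 'c \<Rightarrow> 'a" where
  "grad_x F x y = fst (grad F (x, y))"

definition grad_y :: "('a::real_inner \<times> 'c::real_inner \<Rightarrow> real) \<Rightarrow> 'a \<Rightarrow> 'c \<Rightarrow> 'c" where
  "grad_y F x y = snd (grad F (x, y))"

definition hess_yy :: "('a::real_inner \<times> 'c::real_inner \<Rightarrow> real) \<Rightarrow> 'a \<Rightarrow> 'c \<Rightarrow> 'c \<Rightarrow> 'c" where
  "hess_yy F x y v = snd (hess F (x, y) (0, v))"

definition jac_xy :: "('a::real_inner \<times> 'c::real_inner \<Rightarrow> real) \<Rightarrow> 'a \<Rightarrow> 'c \<Rightarrow> 'c \<Rightarrow> 'a" where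
  "jac_xy F x y v = fst (hess F (x, y) (0, v))"

text \<open>The adjoint vector of implicit differentiation: the gradient of \<open>Phi\<close> needs
  the inverse Hessian only through its action on \<open>grad_y f\<close>. The description is proper
  by \<open>hess_yy_Zstar\<close>.\<close>

definition Zstar :: "('a::real_inner \<times> 'c::real_inner \<Rightarrow> real) \<Rightarrow> ('a \<times> 'c \<Rightarrow> real) \<Rightarrow> 'a \<Rightarrow> 'c" where
  "Zstar f g x = (THE z. hess_yy g x (Ystar g x) z = grad_y f x (Ystar g x))"

definition hypergrad :: "('a::real_inner \<times> 'c::real_inner \<Rightarrow> real) \<Rightarrow> ('a \<times> 'c \<Rightarrow> real) \<Rightarrow> 'a \<Rightarrow> 'a" where
  "hypergrad f g x = grad_x f x (Ystar g x) - jac_xy g x (Ystar g x) (Zstar f g x)"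

locale bilevel =
  fixes f g :: "'a::euclidean_space \<times> 'c::euclidean_space \<Rightarrow> real"
    and \<mu> Lf0 Lf1 Lg1 Lg2 :: real
  assumes smooth: "smooth_bilevel f g \<mu> Lf0 Lf1 Lg1 Lg2"
begin

lemma pos: "0 < \<mu>" "0 < Lf0" "0 < Lf1" "0 < Lg1" "0 < Lg2"
  using smooth unfolding smooth_bilevel_def by auto

lemma differentiable: "f differentiable (at z)" "g differentiable (at z)" "grad g differentiable (at z)"
  using smooth unfolding smooth_bilevel_def by blast+

lemma GDERIV_f: "GDERIV f z :> grad f z" and GDERIV_g: "GDERIV g z :> grad g z"
  using differentiable by (simp_all add: differentiable_GDERIV)

lemma hess_g: "(grad g has_derivative blinfun_apply (hess g z)) (at z)"
  using differentiable by (simp add: has_derivative_hess)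

lemma lipschitz_f: "norm (grad f z - grad f z') \<le> Lf1 * norm (z - z')"
  and lipschitz_g: "norm (grad g z - grad g z') \<le> Lg1 * norm (z - z')"
  and lipschitz_hess: "norm (hess g z - hess g z') \<le> Lg2 * norm (z - z')"
  using smooth unfolding smooth_bilevel_def dist_norm[symmetric] by (auto dest: lipschitz_onD)

lemma lipschitz_hess_apply: "norm (hess g z v - hess g z' v) \<le> Lg2 * norm (z - z') * norm v"
proof -
  have "norm (hess g z v - hess g z' v) \<le> norm (hess g z - hess g z') * norm v"
    by (metis blinfun.diff_left norm_blinfun)
  also have "\<dots> \<le> Lg2 * norm (z - z') * norm v"
    by (intro mult_right_mono lipschitz_hess) auto
  finally show ?thesis .
qed

lemma hess_bound: "norm (hess g z v) \<le> Lg1 * norm v"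
  by (rule derivative_norm_le_lipschitz[OF hess_g]) (rule lipschitz_g)

lemma grad_y_eq: "grad (\<lambda>y. f (x, y)) y = grad_y f x y" "grad (\<lambda>y. g (x, y)) y = grad_y g x y"
  unfolding grad_y_def by (auto intro!: grad_eq GDERIV_snd GDERIV_f GDERIV_g)

lemma taylor_f: "\<bar>f (z + u) - f z - inner (grad f z) u\<bar> \<le> Lf1 * (norm u)\<^sup>2"
proof -
  have "norm (f (z + u) - f z - inner u (grad f z)) \<le> Lf1 * (norm u)\<^sup>2"
  proof (rule quadratic_remainder[where F' = "\<lambda>w h. inner h (grad f w)"])
    show "(f has_derivative (\<lambda>h. inner h (grad f w))) (at w)" for w
      using GDERIV_f unfolding gderiv_def .
    fix w v
    have "norm (inner v (grad f w) - inner v (grad f z)) \<le> norm v * norm (grad f w - grad f z)"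
      unfolding inner_diff_right[symmetric] real_norm_def by (rule Cauchy_Schwarz_ineq2)
    also have "\<dots> \<le> norm v * (Lf1 * norm (w - z))" by (intro mult_left_mono lipschitz_f) auto
    finally show "norm (inner v (grad f w) - inner v (grad f z)) \<le> Lf1 * norm (w - z) * norm v"
      by (simp add: ac_simps)
  qed (use pos in auto)
  then show ?thesis by (simp add: inner_commute)
qed

lemma taylor_grad_g: "norm (grad g (z + u) - grad g z - hess g z u) \<le> Lg2 * (norm u)\<^sup>2"
  by (rule quadratic_remainder[OF hess_g]) (use pos lipschitz_hess_apply in auto)

text \<open>The mixed second difference of \<open>g\<close> is symmetric in \<open>u\<close> and \<open>v\<close>, and by the Taylor bound
  it equals \<open>\<langle>hess g z u, v\<rangle>\<close> up to a cubic error.\<close>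

lemma hess_symmetric: "inner (hess g z u) v = inner u (hess g z v)"
proof -
  define \<Delta> where "\<Delta> u v = g (z + u + v) - g (z + u) - g (z + v) + g z" for u v
  have sym: "\<Delta> u v = \<Delta> v u" for u v by (simp add: \<Delta>_def ac_simps)
  have \<Delta>: "\<bar>\<Delta> u v - inner (hess g z u) v\<bar> \<le> 2 * Lg2 * (norm u + norm v) ^ 3" for u v
  proof -
    define d where "d t = inner v (grad g (z + u + t *\<^sub>R v) - grad g (z + t *\<^sub>R v))" for t
    have der: "((\<lambda>t. g (w + t *\<^sub>R v)) has_derivative (\<lambda>h. inner (h *\<^sub>R v) (grad g (w + t *\<^sub>R v)))) (at t)" for w t
      by (rule has_derivative_compose[of "\<lambda>t. w + t *\<^sub>R v" "\<lambda>h. h *\<^sub>R v", OF _ GDERIV_g[unfolded gderiv_def]])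
        (auto intro!: derivative_eq_intros)
    have "DERIV (\<lambda>t. g (z + u + t *\<^sub>R v) - g (z + t *\<^sub>R v)) t :> d t" for t
      unfolding has_field_derivative_def
      by (rule has_derivative_eq_rhs[OF has_derivative_diff[OF der der]])
        (simp add: d_def fun_eq_iff inner_diff_right algebra_simps)
    from MVT2[of 0 1 "\<lambda>t. g (z + u + t *\<^sub>R v) - g (z + t *\<^sub>R v)" d, OF _ this]
    obtain t where t: "0 < t" "t < 1" and eq: "\<Delta> u v = d t"
      by (auto simp: \<Delta>_def algebra_simps)
    let ?a = "grad g (z + (u + t *\<^sub>R v)) - grad g z - hess g z (u + t *\<^sub>R v)"
    let ?b = "grad g (z + t *\<^sub>R v) - grad g z - hess g z (t *\<^sub>R v)"
    have "d t - inner (hess g z u) v = inner v (?a - ?b)"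
      by (simp add: d_def inner_diff_right blinfun.add_right inner_commute algebra_simps)
    also have "\<bar>\<dots>\<bar> \<le> norm v * norm (?a - ?b)" by (rule Cauchy_Schwarz_ineq2)
    also have "\<dots> \<le> norm v * (norm ?a + norm ?b)" by (intro mult_left_mono norm_triangle_ineq4) auto
    also have "\<dots> \<le> norm v * (Lg2 * (norm u + norm v)\<^sup>2 + Lg2 * (norm u + norm v)\<^sup>2)"
    proof (intro mult_left_mono add_mono)
      have tv: "norm (t *\<^sub>R v) \<le> norm v" using t by (simp add: mult_left_le_one_le)
      have "norm ?a \<le> Lg2 * (norm (u + t *\<^sub>R v))\<^sup>2" by (rule taylor_grad_g)
      also have "\<dots> \<le> Lg2 * (norm u + norm v)\<^sup>2"
        using pos tv norm_triangle_ineq[of u "t *\<^sub>R v"] by (intro mult_left_mono power_mono) auto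
      finally show "norm ?a \<le> Lg2 * (norm u + norm v)\<^sup>2" .
      have "norm ?b \<le> Lg2 * (norm (t *\<^sub>R v))\<^sup>2" by (rule taylor_grad_g)
      also have "\<dots> \<le> Lg2 * (norm u + norm v)\<^sup>2"
        using pos tv by (intro mult_left_mono power_mono) (auto intro: add_increasing)
      finally show "norm ?b \<le> Lg2 * (norm u + norm v)\<^sup>2" .
    qed auto
    also have "\<dots> = 2 * Lg2 * (norm v * (norm u + norm v)\<^sup>2)" by simp
    also have "\<dots> \<le> 2 * Lg2 * ((norm u + norm v) * (norm u + norm v)\<^sup>2)"
      using pos by (intro mult_left_mono mult_right_mono) auto
    also have "\<dots> = 2 * Lg2 * (norm u + norm v) ^ 3" by (simp add: power3_eq_cube power2_eq_square)
    finally show ?thesis using eq by simp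
  qed
  \<comment> \<open>Scaling both arguments by \<open>t\<close> multiplies the bilinear form by the
    square of \<open>t\<close> but the error by its cube, so after division the error vanishes with
    \<open>t\<close>.\<close>
  have "\<bar>inner (hess g z u) v - inner (hess g z v) u\<bar> \<le> 0 + t * (4 * Lg2 * (norm u + norm v) ^ 3)" if "0 < t" for t
  proof -
    have eq: "inner (hess g z (t *\<^sub>R u)) (t *\<^sub>R v) - inner (hess g z (t *\<^sub>R v)) (t *\<^sub>R u)
        = t\<^sup>2 * (inner (hess g z u) v - inner (hess g z v) u)" for u v
      by (simp add: blinfun.scaleR_right algebra_simps power2_eq_square)
    have "\<bar>inner (hess g z (t *\<^sub>R u)) (t *\<^sub>R v) - inner (hess g z (t *\<^sub>R v)) (t *\<^sub>R u)\<bar>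
       \<le> 4 * Lg2 * (norm (t *\<^sub>R u) + norm (t *\<^sub>R v)) ^ 3"
      using \<Delta>[of "t *\<^sub>R u" "t *\<^sub>R v"] \<Delta>[of "t *\<^sub>R v" "t *\<^sub>R u"] sym[of "t *\<^sub>R u" "t *\<^sub>R v"]
      by (simp add: add.commute)
    also have "norm (t *\<^sub>R u) + norm (t *\<^sub>R v) = t * (norm u + norm v)" using that by (simp add: algebra_simps)
    finally have "t\<^sup>2 * \<bar>inner (hess g z u) v - inner (hess g z v) u\<bar> \<le> t\<^sup>2 * (t * (4 * Lg2 * (norm u + norm v) ^ 3))"
      unfolding eq abs_mult by (simp add: power_mult_distrib power2_eq_square power3_eq_cube ac_simps)
    then show ?thesis using that by simp
  qed
  from le_if_le_add_mult[OF this] show ?thesis by (simp add: inner_commute)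
qed

lemma strongly_monotone: "\<mu> * (norm (y - y'))\<^sup>2 \<le> inner (grad_y g x y - grad_y g x y') (y - y')"
proof -
  have sc: "strongly_convex \<mu> (\<lambda>y. g (x, y))" using smooth unfolding smooth_bilevel_def by auto
  note fo = strongly_convex_first_order[OF sc GDERIV_snd[OF GDERIV_g], folded grad_y_def]
  show ?thesis using fo[of y y'] fo[of y' y]
    by (simp add: norm_minus_commute inner_diff_left inner_diff_right)
qed

lemma lipschitz_grad_y: "norm (grad_y g x y - grad_y g x y') \<le> Lg1 * norm (y - y')"
proof -
  have "norm (grad_y g x y - grad_y g x y') \<le> norm (grad g (x, y) - grad g (x, y'))"
    unfolding grad_y_def by (metis norm_snd_le snd_diff prod.collapse)
  also have "\<dots> \<le> Lg1 * norm ((x, y) - (x, y'))" by (rule lipschitz_g)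
  finally show ?thesis by (simp add: norm_Pair)
qed

text \<open>The gradient step \<open>y - \<tau> \<nabla>\<^sub>y g (x, y)\<close> with a small \<open>\<tau>\<close> is a contraction.\<close>

lemma ex_stationary: "\<exists>y. grad_y g x y = 0"
proof -
  \<comment> \<open>Small enough for two purposes: \<open>\<tau>\<close> times the square of
    \<open>Lg1\<close> stays below \<open>\<mu>\<close>, so the quadratic term eats at most half of
    the linear gain, and \<open>\<tau> * \<mu> \<le> 1\<close>, so the contraction factor is a real
    square root.\<close>
  define \<tau> where "\<tau> = \<mu> / (Lg1\<^sup>2 + \<mu>\<^sup>2)"
  have \<tau>: "0 < \<tau>" using pos by (simp add: \<tau>_def add_pos_pos)
  have \<tau>L: "\<tau> * Lg1\<^sup>2 \<le> \<mu>"
    using pos by (simp add: \<tau>_def divide_le_eq add_pos_pos algebra_simps)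
  have \<tau>\<mu>: "\<tau> * \<mu> \<le> 1"
    using pos by (simp add: \<tau>_def divide_le_eq add_pos_pos power2_eq_square)
  let ?T = "\<lambda>y. y - \<tau> *\<^sub>R grad_y g x y"
  have "\<exists>!y. ?T y = y"
  proof (rule banach_fix_type)
    show "0 \<le> sqrt (1 - \<tau> * \<mu>)" "sqrt (1 - \<tau> * \<mu>) < 1" using \<tau> \<tau>\<mu> pos by auto
    show "\<forall>y y'. dist (?T y) (?T y') \<le> sqrt (1 - \<tau> * \<mu>) * dist y y'"
    proof (intro allI)
      fix y y'
      let ?d = "y - y'" and ?G = "grad_y g x y - grad_y g x y'"
      have "(norm (?T y - ?T y'))\<^sup>2 = (norm (?d - \<tau> *\<^sub>R ?G))\<^sup>2" by (simp add: algebra_simps)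
      also have "\<dots> = (norm ?d)\<^sup>2 - 2 * \<tau> * inner ?G ?d + \<tau>\<^sup>2 * (norm ?G)\<^sup>2"
        unfolding power2_norm_eq_inner
        by (simp add: inner_diff_left inner_diff_right inner_commute power2_eq_square algebra_simps)
      also have "\<dots> \<le> (norm ?d)\<^sup>2 - 2 * \<tau> * (\<mu> * (norm ?d)\<^sup>2) + \<tau>\<^sup>2 * (Lg1 * norm ?d)\<^sup>2"
        using strongly_monotone[of y y' x] lipschitz_grad_y[of x y y'] \<tau>
        by (intro add_mono diff_mono mult_left_mono power_mono) auto
      also have "\<dots> = (norm ?d)\<^sup>2 * (1 - 2 * \<tau> * \<mu> + \<tau> * (\<tau> * Lg1\<^sup>2))"
        by (simp add: power2_eq_square algebra_simps)
      also have "\<dots> \<le> (norm ?d)\<^sup>2 * (1 - 2 * \<tau> * \<mu> + \<tau> * \<mu>)"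
        using \<tau>L \<tau> by (intro mult_left_mono add_mono) auto
      also have "\<dots> = (sqrt (1 - \<tau> * \<mu>) * norm ?d)\<^sup>2"
        using \<tau>\<mu> by (simp add: power_mult_distrib algebra_simps)
      finally have sq: "(norm (?T y - ?T y'))\<^sup>2 \<le> (sqrt (1 - \<tau> * \<mu>) * norm ?d)\<^sup>2" .
      show "dist (?T y) (?T y') \<le> sqrt (1 - \<tau> * \<mu>) * dist y y'"
        unfolding dist_norm by (rule power2_le_imp_le[OF sq]) (use \<tau>\<mu> in auto)
    qed
  qed
  then obtain y where "\<tau> *\<^sub>R grad_y g x y = 0" by auto
  then show ?thesis using \<tau> by auto
qed

text \<open>\<open>arg_min\<close> is a mere choice. A stationary point is a minimiser with
  quadratic growth around it, hence the only minimiser, hence the chosen one.\<close>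

lemma grad_y_Ystar: "grad_y g x (Ystar g x) = 0"
proof -
  obtain y where y: "grad_y g x y = 0" using ex_stationary by blast
  have sc: "strongly_convex \<mu> (\<lambda>y. g (x, y))" using smooth unfolding smooth_bilevel_def by auto
  note fo = strongly_convex_first_order[OF sc GDERIV_snd[OF GDERIV_g], folded grad_y_def]
  have le: "g (x, y) + \<mu> / 2 * (norm (z - y))\<^sup>2 \<le> g (x, z)" for z using fo[of y z] y by simp
  have "is_arg_min (\<lambda>y. g (x, y)) (\<lambda>_. True) (Ystar g x)"
    unfolding Ystar_def
  proof (rule arg_minI[where x = y])
    fix z
    have "0 \<le> \<mu> / 2 * (norm (z - y))\<^sup>2" using pos by simp
    then show "\<not> g (x, z) < g (x, y)" using le[of z] by linarith
  qed (auto simp: is_arg_min_def)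
  then have "g (x, Ystar g x) \<le> g (x, y)" by (auto simp: is_arg_min_def not_less)
  then have "\<mu> / 2 * (norm (Ystar g x - y))\<^sup>2 \<le> 0" using le[of "Ystar g x"] by simp
  then have "Ystar g x = y" using pos by (simp add: mult_le_0_iff)
  then show ?thesis using y by simp
qed

section \<open>Blocks of the Hessian of the lower-level function\<close>

lemma hess_yy_linear: "linear (hess_yy g x y)"
proof (rule linearI)
  show "hess_yy g x y (a + b) = hess_yy g x y a + hess_yy g x y b" for a b
  proof -
    have "(0, a + b) = (0, a) + ((0, b) :: 'a \<times> 'c)" by simp
    then show ?thesis unfolding hess_yy_def by (metis blinfun.add_right snd_add)
  qed
  show "hess_yy g x y (r *\<^sub>R b) = r *\<^sub>R hess_yy g x y b" for r b
  proof -
    have "(0, r *\<^sub>R b) = r *\<^sub>R ((0, b) :: 'a \<times> 'c)" by simp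
    then show ?thesis unfolding hess_yy_def by (metis blinfun.scaleR_right snd_scaleR)
  qed
qed

lemma jac_xy_linear: "linear (jac_xy g x y)"
proof (rule linearI)
  show "jac_xy g x y (a + b) = jac_xy g x y a + jac_xy g x y b" for a b
  proof -
    have "(0, a + b) = (0, a) + ((0, b) :: 'a \<times> 'c)" by simp
    then show ?thesis unfolding jac_xy_def by (metis blinfun.add_right fst_add)
  qed
  show "jac_xy g x y (r *\<^sub>R b) = r *\<^sub>R jac_xy g x y b" for r b
  proof -
    have "(0, r *\<^sub>R b) = r *\<^sub>R ((0, b) :: 'a \<times> 'c)" by simp
    then show ?thesis unfolding jac_xy_def by (metis blinfun.scaleR_right fst_scaleR)
  qed
qed

lemma hess_yy_symmetric: "inner (hess_yy g x y u) v = inner u (hess_yy g x y v)"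
  using hess_symmetric[of "(x, y)" "(0, u)" "(0, v)"] by (simp add: hess_yy_def inner_prod_def)

lemma hess_yy_bound: "norm (hess_yy g x y v) \<le> Lg1 * norm v"
  unfolding hess_yy_def using hess_bound[of "(x, y)" "(0, v)"] norm_snd_le[of "hess g (x, y) (0, v)"]
  by (simp add: norm_Pair) (metis norm_snd_le order_trans prod.collapse)

lemma jac_xy_bound: "norm (jac_xy g x y v) \<le> Lg1 * norm v"
  unfolding jac_xy_def using hess_bound[of "(x, y)" "(0, v)"]
  by (simp add: norm_Pair) (metis norm_fst_le order_trans prod.collapse)

lemma hess_yy_lipschitz:
  "norm (hess_yy g x y v - hess_yy g x' y' v) \<le> Lg2 * (norm (x - x') + norm (y - y')) * norm v"
  and jac_xy_lipschitz:
  "norm (jac_xy g x y v - jac_xy g x' y' v) \<le> Lg2 * (norm (x - x') + norm (y - y')) * norm v"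
proof -
  have "norm (hess g (x, y) (0, v) - hess g (x', y') (0, v)) \<le> Lg2 * norm ((x, y) - (x', y')) * norm ((0, v) :: 'a \<times> 'c)"
    by (rule lipschitz_hess_apply)
  also have "\<dots> \<le> Lg2 * (norm (x - x') + norm (y - y')) * norm v"
    using pos norm_Pair_le[of "x - x'" "y - y'"] by (auto intro!: mult_right_mono simp: norm_Pair)
  finally have *: "norm (hess g (x, y) (0, v) - hess g (x', y') (0, v)) \<le> Lg2 * (norm (x - x') + norm (y - y')) * norm v" .
  show "norm (hess_yy g x y v - hess_yy g x' y' v) \<le> Lg2 * (norm (x - x') + norm (y - y')) * norm v"
    unfolding hess_yy_def by (rule order_trans[OF norm_snd_diff_le *])
  show "norm (jac_xy g x y v - jac_xy g x' y' v) \<le> Lg2 * (norm (x - x') + norm (y - y')) * norm v"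
    unfolding jac_xy_def by (rule order_trans[OF norm_fst_diff_le *])
qed

lemma grad_lipschitz:
  "norm (grad_y f x y - grad_y f x' y') \<le> Lf1 * (norm (x - x') + norm (y - y'))"
  "norm (grad_x f x y - grad_x f x' y') \<le> Lf1 * (norm (x - x') + norm (y - y'))"
  "norm (grad_y g x y - grad_y g x' y') \<le> Lg1 * (norm (x - x') + norm (y - y'))"
proof -
  have np: "norm ((x, y) - (x', y')) \<le> norm (x - x') + norm (y - y')"
    using norm_Pair_le[of "x - x'" "y - y'"] by simp
  have "norm (grad f (x, y) - grad f (x', y')) \<le> Lf1 * (norm (x - x') + norm (y - y'))"
    using order_trans[OF lipschitz_f[of "(x, y)" "(x', y')"] mult_left_mono[OF np]] pos by simp
  then show "norm (grad_y f x y - grad_y f x' y') \<le> Lf1 * (norm (x - x') + norm (y - y'))"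
    and "norm (grad_x f x y - grad_x f x' y') \<le> Lf1 * (norm (x - x') + norm (y - y'))"
    unfolding grad_y_def grad_x_def
    using order_trans[OF norm_snd_diff_le] order_trans[OF norm_fst_diff_le] by blast+
  have "norm (grad g (x, y) - grad g (x', y')) \<le> Lg1 * (norm (x - x') + norm (y - y'))"
    using order_trans[OF lipschitz_g[of "(x, y)" "(x', y')"] mult_left_mono[OF np]] pos by simp
  then show "norm (grad_y g x y - grad_y g x' y') \<le> Lg1 * (norm (x - x') + norm (y - y'))"
    unfolding grad_y_def by (rule order_trans[OF norm_snd_diff_le])
qed

text \<open>Strong monotonicity is applied to the points \<open>y\<close> and
  \<open>y + t *\<^sub>R v\<close> and divided by the square of \<open>t\<close>; the deviation of
  the gradient increment from its linear part is a fraction \<open>e\<close> of the step.\<close>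

lemma hess_yy_coercive: "\<mu> * (norm v)\<^sup>2 \<le> inner v (hess_yy g x y v)"
proof (rule le_if_le_add_mult)
  fix e :: real assume "0 < e"
  then obtain t where t: "0 < t" "norm (grad g ((x, y) + t *\<^sub>R (0, v)) - grad g (x, y) - t *\<^sub>R hess g (x, y) (0, v)) \<le> e * t * norm ((0, v) :: 'a \<times> 'c)"
    using has_derivative_near[OF hess_g] by metis
  define r where "r = grad_y g x (y + t *\<^sub>R v) - grad_y g x y - t *\<^sub>R hess_yy g x y v"
  have "norm r \<le> norm (grad g ((x, y) + t *\<^sub>R (0, v)) - grad g (x, y) - t *\<^sub>R hess g (x, y) (0, v))"
    unfolding r_def grad_y_def hess_yy_def snd_scaleR[symmetric] snd_diff[symmetric]
    using norm_snd_le by (metis (no_types, lifting) add_Pair add.right_neutral prod.collapse scaleR_Pair scaleR_zero_right)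
  then have r: "norm r \<le> e * t * norm v" using t(2) by (simp add: norm_Pair)
  have "\<mu> * (norm (t *\<^sub>R v))\<^sup>2 \<le> inner (t *\<^sub>R hess_yy g x y v + r) (t *\<^sub>R v)"
    using strongly_monotone[of "y + t *\<^sub>R v" y x] by (simp add: r_def)
  also have "\<dots> = t * (t * inner v (hess_yy g x y v) + inner r v)"
    by (simp add: inner_add_left inner_commute algebra_simps)
  also have "\<dots> \<le> t * (t * inner v (hess_yy g x y v) + e * t * norm v * norm v)"
  proof -
    have "inner r v \<le> norm r * norm v" by (rule norm_cauchy_schwarz)
    also have "\<dots> \<le> e * t * norm v * norm v" using r by (intro mult_right_mono) auto
    finally show ?thesis using t(1) by simp
  qed
  finally have "t\<^sup>2 * (\<mu> * (norm v)\<^sup>2) \<le> t\<^sup>2 * (inner v (hess_yy g x y v) + e * (norm v)\<^sup>2)"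
    using t(1) by (simp add: power2_eq_square algebra_simps)
  then show "\<mu> * (norm v)\<^sup>2 \<le> inner v (hess_yy g x y v) + e * (norm v)\<^sup>2"
    using t(1) by simp
qed

lemma coercive_norm: "\<mu> * norm v \<le> norm (hess_yy g x y v)"
proof (cases "v = 0")
  case False
  have "\<mu> * norm v * norm v \<le> norm (hess_yy g x y v) * norm v"
    using hess_yy_coercive[of v x y] norm_cauchy_schwarz[of v "hess_yy g x y v"]
    by (simp add: power2_eq_square ac_simps)
  then show ?thesis using False by simp
qed simp

text \<open>Coercivity makes the Hessian block injective, and in finite dimension therefore
  bijective, which justifies the description in \<open>Zstar\<close>.\<close>

lemma hess_yy_Zstar: "hess_yy g x (Ystar g x) (Zstar f g x) = grad_y f x (Ystar g x)"
proof -
  have inj: "inj (hess_yy g x (Ystar g x))"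
  proof (rule linear_injective_0[THEN iffD2, OF hess_yy_linear], intro allI impI)
    fix v assume "hess_yy g x (Ystar g x) v = 0"
    then show "v = 0" using coercive_norm[of v x "Ystar g x"] pos by (simp add: mult_le_0_iff)
  qed
  then have "surj (hess_yy g x (Ystar g x))"
    using linear_injective_imp_surjective[OF hess_yy_linear] by blast
  then obtain z where "hess_yy g x (Ystar g x) z = grad_y f x (Ystar g x)" by (metis surjD)
  then have "\<exists>!z. hess_yy g x (Ystar g x) z = grad_y f x (Ystar g x)"
    using inj by (metis injD)
  then show ?thesis unfolding Zstar_def by (rule theI')
qed

text \<open>\<open>kY\<close> and \<open>kZ\<close> turn out to be Lipschitz constants of
  \<open>Ystar\<close> and \<open>Zstar\<close>, and \<open>kZ0\<close> a uniform bound for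
  \<open>Zstar\<close>.\<close>

definition "kY = Lg1 / \<mu>"
definition "kZ0 = Lf0 / \<mu>"
definition "kZ = (Lf1 + Lg2 * kZ0) * (1 + kY) / \<mu>"

text \<open>One constant that dominates every Lipschitz and growth constant needed below, so that
  the error recursions can share it. All summands are nonnegative, hence each is below the sum; the
  summand 1 makes it usable as a bound for the identity map too.\<close>

definition "Lc = 1 + Lg1 + Lf0 + Lf1 + kY + kZ0 + kZ + (Lf1 + Lg2 * kZ0)
  + (Lf1 + Lg2 * kZ0) * (1 + kY\<^sup>2) + ((Lf1 + Lg2 * kZ0) * (1 + kY) + Lg1 * kZ)"

lemma k_nonneg: "0 \<le> kY" "0 \<le> kZ0" "0 \<le> kZ" "0 \<le> Lf1 + Lg2 * kZ0"
  "0 \<le> (Lf1 + Lg2 * kZ0) * (1 + kY\<^sup>2)" "0 \<le> (Lf1 + Lg2 * kZ0) * (1 + kY)" "0 \<le> Lg1 * kZ"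
proof -
  show *: "0 \<le> kY" "0 \<le> kZ0" using pos by (auto simp: kY_def kZ0_def)
  show "0 \<le> kZ" "0 \<le> Lf1 + Lg2 * kZ0"
    "0 \<le> (Lf1 + Lg2 * kZ0) * (1 + kY\<^sup>2)" "0 \<le> (Lf1 + Lg2 * kZ0) * (1 + kY)" "0 \<le> Lg1 * kZ"
    using pos * by (auto simp: kZ_def)
qed

lemma Lc_ge: "1 \<le> Lc" "Lg1 \<le> Lc" "Lf0 \<le> Lc" "Lf1 \<le> Lc" "kY \<le> Lc" "kZ0 \<le> Lc" "kZ \<le> Lc" "Lf1 + Lg2 * kZ0 \<le> Lc"
  "(Lf1 + Lg2 * kZ0) * (1 + kY\<^sup>2) \<le> Lc" "(Lf1 + Lg2 * kZ0) * (1 + kY) + Lg1 * kZ \<le> Lc"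
  using k_nonneg pos unfolding Lc_def by linarith+

text \<open>Strong monotonicity at \<open>x\<close> is tested on the two minimisers. Both gradients
  at their own base points vanish, so what remains is the change of the gradient at one fixed point
  when \<open>x\<close> moves to \<open>x'\<close>.\<close>

lemma Ystar_lipschitz_kY: "norm (Ystar g x - Ystar g x') \<le> kY * norm (x - x')"
proof (cases "Ystar g x = Ystar g x'")
  case False
  let ?y = "Ystar g x" and ?y' = "Ystar g x'"
  have "\<mu> * (norm (?y - ?y'))\<^sup>2 \<le> inner (grad_y g x' ?y' - grad_y g x ?y') (?y - ?y')"
    using strongly_monotone[of ?y ?y' x] by (simp add: grad_y_Ystar)
  also have "\<dots> \<le> norm (grad_y g x' ?y' - grad_y g x ?y') * norm (?y - ?y')"
    by (rule norm_cauchy_schwarz)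
  also have "\<dots> \<le> Lg1 * norm (x - x') * norm (?y - ?y')"
    using grad_lipschitz(3)[of x' ?y' x ?y'] by (intro mult_right_mono) (auto simp: norm_minus_commute)
  finally have "(\<mu> * norm (?y - ?y')) * norm (?y - ?y') \<le> (Lg1 * norm (x - x')) * norm (?y - ?y')"
    by (simp add: power2_eq_square mult.assoc)
  then have "\<mu> * norm (?y - ?y') \<le> Lg1 * norm (x - x')" using False by simp
  then show ?thesis using pos by (simp add: kY_def field_simps)
qed (simp add: k_nonneg)

lemma Zstar_bound: "norm (Zstar f g x) \<le> kZ0"
proof -
  have "\<mu> * norm (Zstar f g x) \<le> norm (grad_y f x (Ystar g x))"
    using coercive_norm[of "Zstar f g x" x "Ystar g x"] by (simp add: hess_yy_Zstar)
  also have "\<dots> \<le> Lf0" using smooth unfolding smooth_bilevel_def grad_y_eq by blast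
  finally show ?thesis using pos by (simp add: kZ0_def field_simps)
qed

text \<open>The two linear systems are subtracted so that the difference of the operators acts on
  the uniformly bounded \<open>Zstar f g x'\<close>; coercivity then bounds the difference of the
  solutions.\<close>

lemma Zstar_lipschitz_kZ: "norm (Zstar f g x - Zstar f g x') \<le> kZ * norm (x - x')"
proof -
  let ?y = "Ystar g x" and ?y' = "Ystar g x'" and ?z = "Zstar f g x" and ?z' = "Zstar f g x'"
  let ?d = "norm (x - x') + norm (?y - ?y')"
  have d: "?d \<le> (1 + kY) * norm (x - x')" using Ystar_lipschitz_kY[of x x'] by (simp add: algebra_simps)
  have "hess_yy g x ?y (?z - ?z') = grad_y f x ?y - grad_y f x' ?y' - (hess_yy g x ?y ?z' - hess_yy g x' ?y' ?z')"
    by (simp add: linear_diff[OF hess_yy_linear] hess_yy_Zstar)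
  then have "\<mu> * norm (?z - ?z') \<le> norm (grad_y f x ?y - grad_y f x' ?y' - (hess_yy g x ?y ?z' - hess_yy g x' ?y' ?z'))"
    using coercive_norm by metis
  also have "\<dots> \<le> norm (grad_y f x ?y - grad_y f x' ?y') + norm (hess_yy g x ?y ?z' - hess_yy g x' ?y' ?z')"
    by (rule norm_triangle_ineq4)
  also have "\<dots> \<le> Lf1 * ?d + Lg2 * ?d * kZ0"
  proof (rule add_mono[OF grad_lipschitz(1)])
    have "Lg2 * ?d * norm ?z' \<le> Lg2 * ?d * kZ0" using pos Zstar_bound by (intro mult_left_mono) auto
    then show "norm (hess_yy g x ?y ?z' - hess_yy g x' ?y' ?z') \<le> Lg2 * ?d * kZ0"
      using hess_yy_lipschitz order_trans by blast
  qed
  also have "\<dots> = (Lf1 + Lg2 * kZ0) * ?d" by (simp add: algebra_simps)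
  also have "\<dots> \<le> (Lf1 + Lg2 * kZ0) * ((1 + kY) * norm (x - x'))"
    using d k_nonneg by (intro mult_left_mono) auto
  finally show ?thesis using pos by (simp add: kZ_def field_simps)
qed

text \<open>The splitting applies the difference of the Jacobians to \<open>z\<close> alone. With
  \<open>z = Zstar f g x\<close>, which is bounded, the estimate stays linear in the errors although
  \<open>z'\<close> may be an unbounded iterate.\<close>

lemma surrogate_lipschitz:
  "norm (grad_x f x y - jac_xy g x y z - (grad_x f x' y' - jac_xy g x' y' z'))
    \<le> (Lf1 + Lg2 * norm z) * (norm (x - x') + norm (y - y')) + Lg1 * norm (z - z')"
proof -
  have "grad_x f x y - jac_xy g x y z - (grad_x f x' y' - jac_xy g x' y' z')
      = (grad_x f x y - grad_x f x' y') - (jac_xy g x y z - jac_xy g x' y' z) - jac_xy g x' y' (z - z')"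
    by (simp add: linear_diff[OF jac_xy_linear])
  also have "norm \<dots> \<le> norm (grad_x f x y - grad_x f x' y') + norm (jac_xy g x y z - jac_xy g x' y' z) + norm (jac_xy g x' y' (z - z'))"
    by (intro order_trans[OF norm_triangle_ineq4] add_right_mono norm_triangle_ineq4)
  also have "\<dots> \<le> Lf1 * (norm (x - x') + norm (y - y')) + Lg2 * (norm (x - x') + norm (y - y')) * norm z + Lg1 * norm (z - z')"
    by (intro add_mono grad_lipschitz jac_xy_lipschitz jac_xy_bound)
  finally show ?thesis by (simp add: algebra_simps)
qed

lemma hypergrad_bias:
  "norm (hypergrad f g x - (grad_x f x y - jac_xy g x y z)) \<le> Lc * (norm (y - Ystar g x) + norm (z - Zstar f g x))"
proof -
  have "norm (hypergrad f g x - (grad_x f x y - jac_xy g x y z))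
    \<le> (Lf1 + Lg2 * norm (Zstar f g x)) * norm (y - Ystar g x) + Lg1 * norm (z - Zstar f g x)"
    unfolding hypergrad_def using surrogate_lipschitz[of x "Ystar g x" "Zstar f g x" x y z]
    by (simp add: norm_minus_commute)
  also have "\<dots> \<le> Lc * norm (y - Ystar g x) + Lc * norm (z - Zstar f g x)"
  proof (intro add_mono mult_right_mono)
    have "Lg2 * norm (Zstar f g x) \<le> Lg2 * kZ0" using pos Zstar_bound by (intro mult_left_mono) auto
    then show "Lf1 + Lg2 * norm (Zstar f g x) \<le> Lc" using Lc_ge by linarith
  qed (use Lc_ge in auto)
  finally show ?thesis by (simp add: algebra_simps)
qed

lemma hypergrad_lipschitz: "norm (hypergrad f g x - hypergrad f g x') \<le> Lc * norm (x - x')"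
proof -
  let ?y = "Ystar g x" and ?y' = "Ystar g x'" and ?z = "Zstar f g x" and ?z' = "Zstar f g x'"
  have "norm (hypergrad f g x - hypergrad f g x') \<le>
    (Lf1 + Lg2 * norm ?z) * (norm (x - x') + norm (?y - ?y')) + Lg1 * norm (?z - ?z')"
    unfolding hypergrad_def by (rule surrogate_lipschitz)
  also have "\<dots> \<le> (Lf1 + Lg2 * kZ0) * ((1 + kY) * norm (x - x')) + Lg1 * (kZ * norm (x - x'))"
    using Ystar_lipschitz_kY[of x x'] pos Zstar_bound k_nonneg Zstar_lipschitz_kZ
    by (intro add_mono mult_mono mult_left_mono) (auto simp: algebra_simps)
  also have "\<dots> = ((Lf1 + Lg2 * kZ0) * (1 + kY) + Lg1 * kZ) * norm (x - x')" by (simp add: algebra_simps)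
  also have "\<dots> \<le> Lc * norm (x - x')" using Lc_ge by (intro mult_right_mono) auto
  finally show ?thesis .
qed

lemma Ystar_lipschitz: "norm (Ystar g x - Ystar g x') \<le> Lc * norm (x - x')"
  using Ystar_lipschitz_kY[of x x'] mult_right_mono[OF Lc_ge(5) norm_ge_zero[of "x - x'"]] by linarith

lemma Zstar_lipschitz: "norm (Zstar f g x - Zstar f g x') \<le> Lc * norm (x - x')"
  using Zstar_lipschitz_kZ[of x x'] mult_right_mono[OF Lc_ge(7) norm_ge_zero[of "x - x'"]] by linarith

text \<open>\<open>Ystar\<close> is not differentiated. In the expansion of \<open>f\<close>, the
  term \<open>grad_y f\<close> against the increment of \<open>Ystar\<close> equals
  \<open>Zstar\<close> against the Hessian of that increment. The gradient in \<open>y\<close>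
  vanishes at both ends, so its Taylor expansion trades this Hessian term for the mixed derivative
  in direction \<open>u\<close>, up to a quadratic error.\<close>

lemma Phi_expansion: "\<bar>Phi f g (x + u) - Phi f g x - inner (hypergrad f g x) u\<bar> \<le> Lc * (norm u)\<^sup>2"
proof -
  let ?y = "Ystar g x" and ?z = "Zstar f g x"
  define \<delta> where "\<delta> = Ystar g (x + u) - ?y"
  define w where "w = (u, \<delta>)"
  have z: "(x, ?y) + w = (x + u, Ystar g (x + u))" by (simp add: w_def \<delta>_def)
  have \<delta>: "norm \<delta> \<le> kY * norm u" using Ystar_lipschitz_kY[of "x + u" x] by (simp add: \<delta>_def)
  have w2: "(norm w)\<^sup>2 \<le> (1 + kY\<^sup>2) * (norm u)\<^sup>2"
    using power_mono[OF \<delta>, of 2] by (simp add: w_def norm_Pair power_mult_distrib algebra_simps)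
  have f: "\<bar>Phi f g (x + u) - Phi f g x - inner (grad f (x, ?y)) w\<bar> \<le> Lf1 * (norm w)\<^sup>2"
    using taylor_f[of "(x, ?y)" w] unfolding z Phi_def .
  have gw: "inner (grad f (x, ?y)) w = inner (grad_x f x ?y) u + inner ?z (hess_yy g x ?y \<delta>)"
    by (simp add: w_def inner_prod_def grad_x_def hess_yy_symmetric[symmetric] hess_yy_Zstar grad_y_def)
  have hw: "hess g (x, ?y) w = hess g (x, ?y) (u, 0) + hess g (x, ?y) (0, \<delta>)"
    by (simp add: w_def blinfun.add_right[symmetric])
  have "norm (grad g ((x, ?y) + w) - grad g (x, ?y) - hess g (x, ?y) w) \<le> Lg2 * (norm w)\<^sup>2"
    by (rule taylor_grad_g)
  then have "norm (snd (grad g ((x, ?y) + w) - grad g (x, ?y) - hess g (x, ?y) w)) \<le> Lg2 * (norm w)\<^sup>2"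
    by (metis norm_snd_le order_trans prod.collapse)
  moreover have "snd (grad g ((x, ?y) + w) - grad g (x, ?y) - hess g (x, ?y) w)
      = - (snd (hess g (x, ?y) (u, 0)) + hess_yy g x ?y \<delta>)"
    using grad_y_Ystar[of x] grad_y_Ystar[of "x + u"] by (simp add: z hw grad_y_def hess_yy_def)
  ultimately have e: "norm (snd (hess g (x, ?y) (u, 0)) + hess_yy g x ?y \<delta>) \<le> Lg2 * (norm w)\<^sup>2"
    by (metis norm_minus_cancel)
  \<comment> \<open>Symmetry of the full Hessian moves the mixed derivative from \<open>u\<close>
    onto \<open>Zstar\<close>, where it becomes the Jacobian term of
    \<open>hypergrad\<close>.\<close>
  have J: "inner ?z (snd (hess g (x, ?y) (u, 0))) = inner (jac_xy g x ?y ?z) u"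
    using hess_symmetric[of "(x, ?y)" "(0, ?z)" "(u, 0)"] by (simp add: jac_xy_def inner_prod_def)
  have "\<bar>inner ?z (snd (hess g (x, ?y) (u, 0)) + hess_yy g x ?y \<delta>)\<bar> \<le> norm ?z * norm (snd (hess g (x, ?y) (u, 0)) + hess_yy g x ?y \<delta>)"
    by (rule Cauchy_Schwarz_ineq2)
  also have "\<dots> \<le> kZ0 * (Lg2 * (norm w)\<^sup>2)" using e Zstar_bound k_nonneg by (intro mult_mono) auto
  finally have "\<bar>inner (jac_xy g x ?y ?z) u + inner ?z (hess_yy g x ?y \<delta>)\<bar> \<le> kZ0 * (Lg2 * (norm w)\<^sup>2)"
    by (simp add: inner_add_right J)
  then have "\<bar>Phi f g (x + u) - Phi f g x - inner (hypergrad f g x) u\<bar> \<le> Lf1 * (norm w)\<^sup>2 + kZ0 * (Lg2 * (norm w)\<^sup>2)"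
    using f unfolding gw hypergrad_def inner_diff_left by linarith
  also have "\<dots> = (Lf1 + Lg2 * kZ0) * (norm w)\<^sup>2" by (simp add: algebra_simps)
  also have "\<dots> \<le> (Lf1 + Lg2 * kZ0) * ((1 + kY\<^sup>2) * (norm u)\<^sup>2)"
    using w2 k_nonneg by (intro mult_left_mono) auto
  also have "\<dots> \<le> Lc * (norm u)\<^sup>2"
    using Lc_ge(9) by (simp only: mult.assoc[symmetric] mult_right_mono zero_le_power2)
  finally show ?thesis .
qed

lemma grad_Phi: "grad (Phi f g) x = hypergrad f g x"
proof (rule grad_eq)
  have Lc: "0 < Lc" using Lc_ge(1) by simp
  show "GDERIV (Phi f g) x :> hypergrad f g x"
    unfolding gderiv_def has_derivative_at_alt
  proof (intro conjI allI impI)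
    fix e :: real assume e: "0 < e"
    show "\<exists>d>0. \<forall>y. norm (y - x) < d \<longrightarrow> norm (Phi f g y - Phi f g x - inner (y - x) (hypergrad f g x)) \<le> e * norm (y - x)"
    proof (intro exI[of _ "e / Lc"] conjI allI impI)
      fix y assume y: "norm (y - x) < e / Lc"
      have "Lc * norm (y - x) \<le> e" using y Lc by (simp add: field_simps)
      then have "Lc * norm (y - x) * norm (y - x) \<le> e * norm (y - x)" by (rule mult_right_mono) simp
      then show "norm (Phi f g y - Phi f g x - inner (y - x) (hypergrad f g x)) \<le> e * norm (y - x)"
        using Phi_expansion[of x "y - x"] by (simp add: inner_commute power2_eq_square mult.assoc)
    qed (use e Lc in auto)
  qed (rule bounded_linear_inner_left)
qed

section \<open>Monotonicity and growth of the directions in terms of the tracking errors\<close>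

lemma Y_monotone: "\<mu> * (norm (y - Ystar g x))\<^sup>2 \<le> inner (y - Ystar g x) (grad_y g x y)"
  using strongly_monotone[of y "Ystar g x" x] by (simp add: grad_y_Ystar inner_commute)

lemma grad_y_bound: "norm (grad_y g x y) \<le> Lc * norm (y - Ystar g x)"
  using lipschitz_grad_y[of x y "Ystar g x"] mult_right_mono[OF Lc_ge(2), of "norm (y - Ystar g x)"]
  by (simp add: grad_y_Ystar)

text \<open>The equation solved by \<open>Zstar\<close> is subtracted. The residual caused by
  \<open>y\<close> differing from \<open>Ystar g x\<close> then multiplies \<open>Zstar\<close>, not
  the iterate, so the perturbation is linear in the error of \<open>y\<close> and no product of two
  unbounded errors is left in it.\<close>

lemma Z_monotone:
  "\<mu> * (norm (z - Zstar f g x))\<^sup>2 - Lc * norm (z - Zstar f g x) * norm (y - Ystar g x)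
    \<le> inner (z - Zstar f g x) (hess_yy g x y z - grad_y f x y)"
proof -
  let ?y = "Ystar g x" and ?z = "Zstar f g x"
  define r where "r = (hess_yy g x y ?z - hess_yy g x ?y ?z) - (grad_y f x y - grad_y f x ?y)"
  have eq: "hess_yy g x y z - grad_y f x y = hess_yy g x y (z - ?z) + r"
    by (simp add: r_def linear_diff[OF hess_yy_linear] hess_yy_Zstar)
  have "norm r \<le> Lg2 * norm (y - ?y) * norm ?z + Lf1 * norm (y - ?y)"
    unfolding r_def
    by (rule order_trans[OF norm_triangle_ineq4 add_mono])
      (use hess_yy_lipschitz[of x y ?z x ?y] grad_lipschitz(1)[of x y x ?y] in auto)
  also have "\<dots> \<le> Lg2 * norm (y - ?y) * kZ0 + Lf1 * norm (y - ?y)"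
    using pos Zstar_bound by (intro add_right_mono mult_left_mono) auto
  also have "\<dots> = (Lf1 + Lg2 * kZ0) * norm (y - ?y)" by (simp add: algebra_simps)
  also have "\<dots> \<le> Lc * norm (y - ?y)" using Lc_ge by (intro mult_right_mono) auto
  finally have r: "norm r \<le> Lc * norm (y - ?y)" .
  have "- inner (z - ?z) r \<le> norm (z - ?z) * norm r"
    using Cauchy_Schwarz_ineq2[of "z - ?z" r] by linarith
  also have "\<dots> \<le> norm (z - ?z) * (Lc * norm (y - ?y))" using r by (intro mult_left_mono) auto
  finally show ?thesis using hess_yy_coercive[of "z - ?z" x y] unfolding eq inner_add_right
    by (simp add: ac_simps)
qed

lemma Z_bound: "norm z \<le> Lc + norm (z - Zstar f g x)"
  using norm_triangle_sub[of z "Zstar f g x"] Zstar_bound[of x] Lc_ge(6) by linarith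

lemma grad_y_f_bound: "norm (grad_y f x y) \<le> Lc + Lc * norm (y - Ystar g x)"
proof -
  have "norm (grad_y f x (Ystar g x)) \<le> Lf0" using smooth unfolding smooth_bilevel_def grad_y_eq by blast
  moreover have "norm (grad_y f x y - grad_y f x (Ystar g x)) \<le> Lf1 * norm (y - Ystar g x)"
    using grad_lipschitz(1)[of x y x "Ystar g x"] by simp
  moreover have "Lf1 * norm (y - Ystar g x) \<le> Lc * norm (y - Ystar g x)"
    using Lc_ge by (intro mult_right_mono) auto
  ultimately show ?thesis
    using norm_triangle_sub[of "grad_y f x y" "grad_y f x (Ystar g x)"] Lc_ge(3) by linarith
qed

end

section \<open>Second moments of Haar frames\<close>

text \<open>An entry of \<open>A A^T\<close> formed from the first \<open>q\<close> columns. The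
  lifted actions depend on the frame only through these entries.\<close>

definition row_gram :: "nat \<Rightarrow> rmat \<Rightarrow> nat \<Rightarrow> nat \<Rightarrow> real" where
  "row_gram q A x y = (\<Sum>a<q. A (x, a) * A (y, a))"

lemma row_gram_commute: "row_gram q A x y = row_gram q A y x"
  by (simp add: row_gram_def mult.commute)

text \<open>The plane reflection with rows \<open>(c, s)\<close> and \<open>(s, - c)\<close> in the
  coordinates \<open>i\<close> and \<open>k\<close>. One family supplies all three invariances:
  \<open>(- 1, 0)\<close> changes the sign of row \<open>i\<close>, \<open>(0, 1)\<close> exchanges
  the rows, and equal entries mix them at 45 degrees. The restriction keeps the matrix in
  \<open>mat_space\<close>, whose points are extensional functions.\<close>

definition reflection_mat :: "nat \<Rightarrow> nat \<Rightarrow> nat \<Rightarrow> real \<Rightarrow> real \<Rightarrow> rmat" where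
  "reflection_mat p i k c s = restrict (\<lambda>(x, y).
     if x = i then (if y = i then c else if y = k then s else 0)
     else if x = k then (if y = i then s else if y = k then - c else 0)
     else (if x = y then 1 else 0)) ({..<p} \<times> {..<p})"

lemma sum_split2:
  fixes f :: "nat \<Rightarrow> real"
  assumes "i < p" "k < p" "i \<noteq> k"
  shows "(\<Sum>a<p. f a) = f i + f k + (\<Sum>a\<in>{..<p} - {i, k}. f a)"
proof -
  have "(\<Sum>a<p. f a) = f i + (\<Sum>a\<in>{..<p} - {i}. f a)" using assms by (intro sum.remove) auto
  also have "(\<Sum>a\<in>{..<p} - {i}. f a) = f k + (\<Sum>a\<in>{..<p} - {i} - {k}. f a)" using assms by (intro sum.remove) auto
  also have "{..<p} - {i} - {k} = {..<p} - {i, k}" by auto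
  finally show ?thesis by (simp add: add.assoc)
qed

lemma mm_reflection_mat:
  assumes ik: "i < p" "k < p" "i \<noteq> k" and x: "x < p"
  shows "mm p (reflection_mat p i k c s) A (x, b) =
    (if x = i then c * A (i, b) + s * A (k, b) else if x = k then s * A (i, b) - c * A (k, b) else A (x, b))"
proof -
  have "mm p (reflection_mat p i k c s) A (x, b) = (\<Sum>a<p. reflection_mat p i k c s (x, a) * A (a, b))"
    by (simp add: mm_def)
  also have "\<dots> = reflection_mat p i k c s (x, i) * A (i, b) + reflection_mat p i k c s (x, k) * A (k, b)
      + (\<Sum>a\<in>{..<p} - {i, k}. reflection_mat p i k c s (x, a) * A (a, b))"
    by (rule sum_split2[OF ik])
  also have "(\<Sum>a\<in>{..<p} - {i, k}. reflection_mat p i k c s (x, a) * A (a, b))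
      = (\<Sum>a\<in>{..<p} - {i, k}. if a = x then A (x, b) else 0)"
    using ik x by (intro sum.cong) (auto simp: reflection_mat_def)
  also have "\<dots> = (if x = i \<or> x = k then 0 else A (x, b))" using x by simp
  also have "reflection_mat p i k c s (x, i) = (if x = i then c else if x = k then s else 0)"
    using ik x by (auto simp: reflection_mat_def)
  also have "reflection_mat p i k c s (x, k) = (if x = i then s else if x = k then - c else 0)"
    using ik x by (auto simp: reflection_mat_def)
  finally show ?thesis using ik x by auto
qed

lemma reflection_mat_orthogonal:
  assumes ik: "i < p" "k < p" "i \<noteq> k" and cs: "c\<^sup>2 + s\<^sup>2 = 1"
  shows "reflection_mat p i k c s \<in> orthogonal_mats p"
  unfolding orthogonal_mats_def
proof (intro CollectI conjI allI impI)
  show "reflection_mat p i k c s \<in> space (mat_space p p)"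
    by (auto simp: mat_space_def space_PiM reflection_mat_def)
  fix x y assume x: "x < p" and y: "y < p"
  have tr: "tr (reflection_mat p i k c s) (x, a) = reflection_mat p i k c s (x, a)" if "a < p" for a
    using ik x that by (auto simp: tr_def reflection_mat_def)
  have "mm p (tr (reflection_mat p i k c s)) (reflection_mat p i k c s) (x, y)
    = mm p (reflection_mat p i k c s) (reflection_mat p i k c s) (x, y)"
    unfolding mm_def using tr by simp
  also have "\<dots> = (if x = y then 1 else 0)"
    unfolding mm_reflection_mat[OF ik x] using ik x y cs by (auto simp: reflection_mat_def power2_eq_square)
  finally show "mm p (tr (reflection_mat p i k c s)) (reflection_mat p i k c s) (x, y) = (if x = y then 1 else 0)" .
qed

locale haar =
  fixes p q :: nat and \<mu> :: "rmat measure"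
  assumes haar: "haar_orthogonal p \<mu>" and q: "1 \<le> q" "q \<le> p" and p: "2 \<le> p"
begin

sublocale prob_space \<mu> using haar unfolding haar_orthogonal_def by simp

lemma sets_haar: "sets \<mu> = sets (mat_space p p)"
  using haar unfolding haar_orthogonal_def by simp

lemma measurable_entry: "x < p \<Longrightarrow> a < p \<Longrightarrow> (\<lambda>A. A (x, a)) \<in> borel_measurable (mat_space p p)"
  unfolding mat_space_def by (rule measurable_component_singleton) auto

lemma measurable_row_gram: "x < p \<Longrightarrow> y < p \<Longrightarrow> (\<lambda>A. row_gram q A x y) \<in> borel_measurable (mat_space p p)"
  unfolding row_gram_def using q
  by (intro borel_measurable_sum borel_measurable_times measurable_entry) auto

lemma integral_reflection:
  assumes ik: "i < p" "k < p" "i \<noteq> k" and cs: "c\<^sup>2 + s\<^sup>2 = 1"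
    and F: "F \<in> borel_measurable (mat_space p p)"
  shows "(\<integral>A. F (restrict (mm p (reflection_mat p i k c s) A) ({..<p} \<times> {..<p})) \<partial>\<mu>) = (\<integral>A. F A \<partial>\<mu> :: real)"
proof -
  let ?T = "\<lambda>A. restrict (mm p (reflection_mat p i k c s) A) ({..<p} \<times> {..<p})"
  have "distr \<mu> (mat_space p p) ?T = \<mu>"
    using haar reflection_mat_orthogonal[OF ik cs] unfolding haar_orthogonal_def by blast
  then have "(\<integral>A. F A \<partial>\<mu>) = (\<integral>A. F A \<partial>distr \<mu> (mat_space p p) ?T)" by simp
  also have "\<dots> = (\<integral>A. F (?T A) \<partial>\<mu>)"
  proof (rule integral_distr[OF _ F])
    have "(\<lambda>A. mm p (reflection_mat p i k c s) A (x, y)) \<in> borel_measurable (mat_space p p)" if "x < p" "y < p" for x y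
      unfolding mm_def using that by (auto intro!: borel_measurable_sum borel_measurable_times measurable_entry)
    then have "?T \<in> mat_space p p \<rightarrow>\<^sub>M mat_space p p"
      unfolding mat_space_def by (intro measurable_restrict) (auto simp: mat_space_def)
    then show "?T \<in> \<mu> \<rightarrow>\<^sub>M mat_space p p" using measurable_cong_sets[OF sets_haar refl] by blast
  qed
  finally show ?thesis by simp
qed

lemma AE_orthonormal:
  "AE A in \<mu>. \<forall>i<p. \<forall>j<p. (\<Sum>x<p. A (x, i) * A (x, j)) = (if i = j then 1 else 0)"
proof -
  have "AE A in \<mu>. A \<in> orthogonal_mats p" using haar unfolding haar_orthogonal_def by simp
  then show ?thesis by eventually_elim (simp add: orthogonal_mats_def mm_def tr_def)
qed

lemma AE_entry_bound: "AE A in \<mu>. \<forall>x<p. \<forall>a<p. \<bar>A (x, a)\<bar> \<le> 1"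
  using AE_orthonormal
proof eventually_elim
  case (elim A)
  show ?case
  proof (intro allI impI)
    fix x a assume "x < p" "a < p"
    have "(A (x, a))\<^sup>2 \<le> (\<Sum>x<p. A (x, a) * A (x, a))"
      unfolding power2_eq_square using \<open>x < p\<close> by (intro member_le_sum) auto
    then have "(A (x, a))\<^sup>2 \<le> 1\<^sup>2" using elim \<open>a < p\<close> by simp
    then show "\<bar>A (x, a)\<bar> \<le> 1" using abs_le_square_iff[of "A (x, a)" 1] by simp
  qed
qed

lemma AE_row_gram_bound: "AE A in \<mu>. \<forall>x<p. \<forall>y<p. \<bar>row_gram q A x y\<bar> \<le> real q"
  using AE_entry_bound
proof eventually_elim
  case (elim A)
  show ?case
  proof (intro allI impI)
    fix x y assume xy: "x < p" "y < p"
    have "\<bar>row_gram q A x y\<bar> \<le> (\<Sum>a<q. \<bar>A (x, a) * A (y, a)\<bar>)" unfolding row_gram_def by (rule sum_abs)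
    also have "\<dots> \<le> (\<Sum>a<q. 1)"
    proof (rule sum_mono)
      fix a assume "a \<in> {..<q}"
      then have "\<bar>A (x, a)\<bar> \<le> 1" "\<bar>A (y, a)\<bar> \<le> 1" using elim xy q by auto
      then show "\<bar>A (x, a) * A (y, a)\<bar> \<le> 1" by (simp add: abs_mult mult_le_one)
    qed
    finally show "\<bar>row_gram q A x y\<bar> \<le> real q" by simp
  qed
qed

lemma integrable_gram: "x < p \<Longrightarrow> y < p \<Longrightarrow> integrable \<mu> (\<lambda>A. row_gram q A x y)"
proof (rule integrable_const_bound[where B = "real q"])
  assume xy: "x < p" "y < p"
  show "AE A in \<mu>. norm (row_gram q A x y) \<le> real q"
    using AE_row_gram_bound by eventually_elim (use xy in auto)
  show "(\<lambda>A. row_gram q A x y) \<in> borel_measurable \<mu>"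
    using measurable_row_gram[OF xy] measurable_cong_sets[OF sets_haar refl] by blast
qed

lemma integrable_gram2: "x < p \<Longrightarrow> y < p \<Longrightarrow> z < p \<Longrightarrow> w < p \<Longrightarrow> integrable \<mu> (\<lambda>A. row_gram q A x y * row_gram q A z w)"
proof (rule integrable_const_bound[where B = "real q * real q"])
  assume xy: "x < p" "y < p" "z < p" "w < p"
  show "AE A in \<mu>. norm (row_gram q A x y * row_gram q A z w) \<le> real q * real q"
    using AE_row_gram_bound by eventually_elim (use xy in \<open>auto simp: abs_mult intro!: mult_mono\<close>)
  show "(\<lambda>A. row_gram q A x y * row_gram q A z w) \<in> borel_measurable \<mu>"
    using borel_measurable_times[OF measurable_row_gram[OF xy(1,2)] measurable_row_gram[OF xy(3,4)]]
      measurable_cong_sets[OF sets_haar refl] by blast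
qed

section \<open>First and second moments of the Gram entries under Haar measure\<close>

definition "M1 x y = (\<integral>A. row_gram q A x y \<partial>\<mu>)"
definition "M2 x y z w = (\<integral>A. row_gram q A x y * row_gram q A z w \<partial>\<mu>)"

lemma M2_symmetries: "M2 x y z w = M2 y x z w" "M2 x y z w = M2 x y w z" "M2 x y z w = M2 z w x y"
  unfolding M2_def by (simp_all add: row_gram_commute[of q _ x y] row_gram_commute[of q _ z w] mult.commute)

abbreviation (input) rfl :: "nat \<Rightarrow> nat \<Rightarrow> real \<Rightarrow> real \<Rightarrow> rmat \<Rightarrow> rmat" where
  "rfl i k c s A \<equiv> restrict (mm p (reflection_mat p i k c s) A) ({..<p} \<times> {..<p})"

lemma M1_reflection:
  assumes "i < p" "k < p" "i \<noteq> k" "c\<^sup>2 + s\<^sup>2 = 1" "x < p" "y < p"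
  shows "M1 x y = (\<integral>A. row_gram q (rfl i k c s A) x y \<partial>\<mu>)"
  unfolding M1_def by (rule integral_reflection[OF assms(1-4) measurable_row_gram[OF assms(5,6)], symmetric])

lemma M2_reflection:
  assumes "i < p" "k < p" "i \<noteq> k" "c\<^sup>2 + s\<^sup>2 = 1" "x < p" "y < p" "z < p" "w < p"
  shows "M2 x y z w = (\<integral>A. row_gram q (rfl i k c s A) x y * row_gram q (rfl i k c s A) z w \<partial>\<mu>)"
  unfolding M2_def
  by (rule integral_reflection[OF assms(1-4), symmetric])
    (intro borel_measurable_times measurable_row_gram assms)

definition "sg i x = (if x = i then - 1 else 1 :: real)" for i x :: nat

text \<open>A sign change is expressed through \<open>reflection_mat\<close>, which acts on two
  rows; the partner row is left unchanged by it.\<close>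

lemma other: "i < p \<Longrightarrow> \<exists>k<p. i \<noteq> k"
  using p by (cases "i = 0") (auto intro: exI[of _ 0] exI[of _ 1])

lemma row_gram_flip:
  assumes "i < p" "k < p" "i \<noteq> k" "x < p" "y < p"
  shows "row_gram q (rfl i k (- 1) 0 A) x y = sg i x * sg i y * row_gram q A x y"
  unfolding row_gram_def sum_distrib_left
proof (rule sum.cong[OF refl])
  fix a assume "a \<in> {..<q}"
  then have "a < p" using q by simp
  then show "rfl i k (- 1) 0 A (x, a) * rfl i k (- 1) 0 A (y, a) = sg i x * sg i y * (A (x, a) * A (y, a))"
    using assms by (auto simp: mm_reflection_mat sg_def)
qed

lemma M1_flip: "i < p \<Longrightarrow> x < p \<Longrightarrow> y < p \<Longrightarrow> M1 x y = sg i x * sg i y * M1 x y"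
  using other[of i] M1_reflection[of i _ "-1" 0 x y] by (auto simp: row_gram_flip M1_def)

text \<open>If \<open>i\<close> occurs an odd number of times among the four indices the sign is
  negative, so the moment vanishes.\<close>

lemma M2_flip: "i < p \<Longrightarrow> x < p \<Longrightarrow> y < p \<Longrightarrow> z < p \<Longrightarrow> w < p \<Longrightarrow>
    M2 x y z w = (sg i x * sg i y * sg i z * sg i w) * M2 x y z w"
proof -
  assume a: "i < p" "x < p" "y < p" "z < p" "w < p"
  obtain k where k: "k < p" "i \<noteq> k" using other[OF a(1)] by blast
  have "M2 x y z w = (\<integral>A. (sg i x * sg i y * sg i z * sg i w) * (row_gram q A x y * row_gram q A z w) \<partial>\<mu>)"
    unfolding M2_reflection[OF a(1) k, of "-1" 0, simplified, OF a(2-)]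
    by (simp add: row_gram_flip a k ac_simps)
  then show ?thesis by (simp add: M2_def)
qed

definition "tp i k x = (if x = i then k else if x = k then i else x)" for i k x :: nat

lemma row_gram_swap:
  assumes "i < p" "k < p" "i \<noteq> k" "x < p" "y < p"
  shows "row_gram q (rfl i k 0 1 A) x y = row_gram q A (tp i k x) (tp i k y)"
  unfolding row_gram_def
proof (rule sum.cong[OF refl])
  fix a assume "a \<in> {..<q}"
  then have "a < p" using q by simp
  then show "rfl i k 0 1 A (x, a) * rfl i k 0 1 A (y, a) = A (tp i k x, a) * A (tp i k y, a)"
    using assms by (auto simp: mm_reflection_mat tp_def)
qed

lemma M1_swap: "i < p \<Longrightarrow> k < p \<Longrightarrow> x < p \<Longrightarrow> y < p \<Longrightarrow> M1 x y = M1 (tp i k x) (tp i k y)"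
proof (cases "i = k")
  case False
  assume "i < p" "k < p" "x < p" "y < p"
  then show ?thesis using False M1_reflection[of i k 0 1 x y] by (simp add: row_gram_swap M1_def)
qed (auto simp: tp_def)

lemma M2_swap: "i < p \<Longrightarrow> k < p \<Longrightarrow> x < p \<Longrightarrow> y < p \<Longrightarrow> z < p \<Longrightarrow> w < p \<Longrightarrow>
   M2 x y z w = M2 (tp i k x) (tp i k y) (tp i k z) (tp i k w)"
proof (cases "i = k")
  case False
  assume "i < p" "k < p" "x < p" "y < p" "z < p" "w < p"
  then show ?thesis using False M2_reflection[of i k 0 1 x y z w] by (simp add: row_gram_swap M2_def)
qed (auto simp: tp_def)

text \<open>Permutations and sign changes still leave three unknown moments. Mixing two rows at 45
  degrees relates the fourth-order moment of one row to those of two rows, which supplies the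
  missing equation.\<close>

lemma M2_rotation:
  assumes ik: "i < p" "k < p" "i \<noteq> k"
  shows "M2 i i i i = (M2 i i i i + M2 k k k k + 2 * M2 i i k k) / 4 + M2 i k i k"
proof -
  define c where "c = sqrt (1 / 2 :: real)"
  have c: "c * c = 1 / 2" by (simp add: c_def)
  have cs: "c\<^sup>2 + c\<^sup>2 = 1" by (simp add: power2_eq_square c)
  have g: "row_gram q (rfl i k c c A) i i = (row_gram q A i i + row_gram q A k k) / 2 + row_gram q A i k" for A
  proof -
    have "row_gram q (rfl i k c c A) i i = (\<Sum>a<q. (A (i, a) * A (i, a) + A (k, a) * A (k, a)) / 2 + A (i, a) * A (k, a))"
      unfolding row_gram_def
    proof (rule sum.cong[OF refl])
      fix a assume "a \<in> {..<q}"
      then have "rfl i k c c A (i, a) = c * (A (i, a) + A (k, a))"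
        using q ik by (simp add: mm_reflection_mat algebra_simps)
      then have "rfl i k c c A (i, a) * rfl i k c c A (i, a) = (c * c) * ((A (i, a) + A (k, a)) * (A (i, a) + A (k, a)))"
        by (simp add: ac_simps)
      then show "rfl i k c c A (i, a) * rfl i k c c A (i, a) = (A (i, a) * A (i, a) + A (k, a) * A (k, a)) / 2 + A (i, a) * A (k, a)"
        unfolding c by (simp add: field_simps)
    qed
    then show ?thesis by (simp add: row_gram_def sum.distrib sum_divide_distrib[symmetric])
  qed
  have "M2 i i i i = (\<integral>A. ((row_gram q A i i * row_gram q A i i + row_gram q A k k * row_gram q A k k
      + 2 * (row_gram q A i i * row_gram q A k k)) / 4 + row_gram q A i k * row_gram q A i k)
      + (row_gram q A i i * row_gram q A i k + row_gram q A k k * row_gram q A i k) \<partial>\<mu>)"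
    unfolding M2_reflection[OF ik cs ik(1) ik(1) ik(1) ik(1)] g
    by (intro Bochner_Integration.integral_cong refl) (simp add: field_simps)
  also have "\<dots> = (M2 i i i i + M2 k k k k + 2 * M2 i i k k) / 4 + M2 i k i k + (M2 i i i k + M2 k k i k)"
    unfolding M2_def using ik by (simp add: integrable_gram2)
  \<comment> \<open>In both remaining mixed moments the index \<open>i\<close> occurs an odd number
    of times, so the sign change removes them.\<close>
  finally show ?thesis
    using M2_flip[of i i i i k] M2_flip[of i k k i k] ik by (simp add: sg_def)
qed

lemma M2_diag: "x < p \<Longrightarrow> M2 x x x x = M2 0 0 0 0"
  using M2_swap[of x 0 x x x x] p by (simp add: tp_def)

lemma M2_offdiag:
  assumes "x < p" "z < p" "x \<noteq> z"
  shows "M2 x x z z = M2 0 0 1 1" "M2 x z x z = M2 0 1 0 1"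
proof -
  have p1: "0 < p" "1 < p" using p by auto
  \<comment> \<open>The image of \<open>z\<close> under the exchange of \<open>x\<close> with 0. It
    is not 0, so exchanging it with 1 afterwards leaves 0 fixed, and two transpositions bring the
    pair to \<open>(0, 1)\<close>.\<close>
  define z' where "z' = tp x 0 z"
  have z': "z' < p" "z' \<noteq> 0" using assms p1 by (auto simp: z'_def tp_def)
  have "M2 x x z z = M2 0 0 z' z'" using M2_swap[of x 0 x x z z] assms p1 by (simp add: tp_def z'_def)
  also have "\<dots> = M2 0 0 1 1" using M2_swap[of z' 1 0 0 z' z'] z' p1 by (simp add: tp_def)
  finally show "M2 x x z z = M2 0 0 1 1" .
  have "M2 x z x z = M2 0 z' 0 z'" using M2_swap[of x 0 x z x z] assms p1 by (simp add: tp_def z'_def)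
  also have "\<dots> = M2 0 1 0 1" using M2_swap[of z' 1 0 z' 0 z'] z' p1 by (simp add: tp_def)
  finally show "M2 x z x z = M2 0 1 0 1" .
qed

lemma sum_diag_offdiag: "(\<Sum>x<p. \<Sum>z<p. if x = z then u else v) = real p * u + real p * (real p - 1) * (v :: real)"
proof -
  have row: "(\<Sum>z<p. if x = z then u else v) = u + (real p - 1) * v" if "x < p" for x
  proof -
    have "(\<Sum>z<p. if x = z then u else v) = u + (\<Sum>z\<in>{..<p} - {x}. if x = z then u else v)"
      using that by (subst sum.remove[of _ x]) auto
    also have "(\<Sum>z\<in>{..<p} - {x}. if x = z then u else v) = (\<Sum>z\<in>{..<p} - {x}. v)" by (intro sum.cong) auto
    also have "\<dots> = (real p - 1) * v" using that p by (simp add: of_nat_diff)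
    finally show ?thesis .
  qed
  have "(\<Sum>x<p. \<Sum>z<p. if x = z then u else v) = (\<Sum>x<p. u + (real p - 1) * v)"
    by (intro sum.cong refl row) simp
  then show ?thesis by (simp add: algebra_simps)
qed

lemma trace_identity1: "AE A in \<mu>. (\<Sum>x<p. row_gram q A x x) = real q"
  using AE_orthonormal
proof eventually_elim
  case (elim A)
  have "(\<Sum>x<p. row_gram q A x x) = (\<Sum>a<q. \<Sum>x<p. A (x, a) * A (x, a))"
    unfolding row_gram_def by (rule sum.swap)
  also have "\<dots> = (\<Sum>a<q. 1)" using elim q by (intro sum.cong) auto
  finally show ?case by simp
qed

text \<open>For orthonormal columns the Gram matrix is an orthogonal projection of rank
  \<open>q\<close>; its squared Frobenius norm is the trace of the projection again.\<close>

lemma trace_identity2: "AE A in \<mu>. (\<Sum>x<p. \<Sum>z<p. row_gram q A x z * row_gram q A x z) = real q"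
  using AE_orthonormal
proof eventually_elim
  case (elim A)
  have "(\<Sum>x<p. \<Sum>z<p. row_gram q A x z * row_gram q A x z)
    = (\<Sum>x<p. \<Sum>z<p. \<Sum>a<q. \<Sum>b<q. (A (x, a) * A (x, b)) * (A (z, a) * A (z, b)))"
    unfolding row_gram_def sum_product by (simp add: ac_simps)
  also have "\<dots> = (\<Sum>a<q. \<Sum>x<p. \<Sum>z<p. \<Sum>b<q. (A (x, a) * A (x, b)) * (A (z, a) * A (z, b)))"
    by (subst (2) sum.swap) (rule sum.swap)
  also have "\<dots> = (\<Sum>a<q. \<Sum>b<q. \<Sum>x<p. \<Sum>z<p. (A (x, a) * A (x, b)) * (A (z, a) * A (z, b)))"
    by (rule sum.cong[OF refl]) (rule trans[OF sum.cong[OF refl sum.swap] sum.swap])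
  also have "\<dots> = (\<Sum>a<q. \<Sum>b<q. (\<Sum>x<p. A (x, a) * A (x, b)) * (\<Sum>z<p. A (z, a) * A (z, b)))"
    by (simp add: sum_product)
  also have "\<dots> = (\<Sum>a<q. \<Sum>b<q. if a = b then 1 else 0)" using elim q by (intro sum.cong refl) auto
  also have "\<dots> = real q" by simp
  finally show ?case .
qed

lemma M1_eq: "x < p \<Longrightarrow> y < p \<Longrightarrow> M1 x y = (if x = y then real q / real p else 0)"
proof -
  assume xy: "x < p" "y < p"
  show ?thesis
  proof (cases "x = y")
    case False
    then show ?thesis using M1_flip[of x x y] xy by (simp add: sg_def)
  next
    case True
    have "(\<Sum>z<p. M1 z z) = (\<integral>A. (\<Sum>z<p. row_gram q A z z) \<partial>\<mu>)"
      unfolding M1_def by (simp add: Bochner_Integration.integral_sum integrable_gram)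
    also have "\<dots> = (\<integral>A. real q \<partial>\<mu>)"
      using trace_identity1
      by (intro integral_cong_AE) (auto simp: sets_haar measurable_cong_sets[OF sets_haar refl] intro!: borel_measurable_sum measurable_row_gram)
    also have "\<dots> = real q" by (simp add: prob_space)
    finally have "(\<Sum>z<p. M1 z z) = real q" .
    moreover have "M1 z z = M1 x x" if "z < p" for z using M1_swap[of z x z z] xy that by (simp add: tp_def)
    ultimately have "real p * M1 x x = real q" by simp
    then show ?thesis using True p by (simp add: field_simps)
  qed
qed

text \<open>Three linear equations for the three moments that survive the symmetries: the squared
  trace, the trace of the square, and the mixing of two rows.\<close>

lemma M2_system:
  "real p * M2 0 0 0 0 + real p * (real p - 1) * M2 0 0 1 1 = (real q)\<^sup>2"
  "real p * M2 0 0 0 0 + real p * (real p - 1) * M2 0 1 0 1 = real q"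
  "M2 0 0 0 0 = M2 0 0 1 1 + 2 * M2 0 1 0 1"
proof -
  have diag1: "M2 x x z z = (if x = z then M2 0 0 0 0 else M2 0 0 1 1)"
    and diag2: "M2 x z x z = (if x = z then M2 0 0 0 0 else M2 0 1 0 1)" if "x < p" "z < p" for x z
    using M2_diag[OF that(1)] M2_offdiag[OF that] by (cases "x = z"; simp)+
  have "(\<Sum>x<p. \<Sum>z<p. M2 x x z z) = (\<integral>A. (\<Sum>x<p. \<Sum>z<p. row_gram q A x x * row_gram q A z z) \<partial>\<mu>)"
    unfolding M2_def
    by (subst Bochner_Integration.integral_sum, force intro!: Bochner_Integration.integrable_sum integrable_gram2,
        rule sum.cong[OF refl], subst Bochner_Integration.integral_sum, force intro!: integrable_gram2, simp)
  also have "\<dots> = (\<integral>A. (real q)\<^sup>2 \<partial>\<mu>)"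
  proof (rule integral_cong_AE)
    show "AE A in \<mu>. (\<Sum>x<p. \<Sum>z<p. row_gram q A x x * row_gram q A z z) = (real q)\<^sup>2"
      using trace_identity1 by eventually_elim (simp add: sum_product[symmetric] power2_eq_square)
  qed (auto simp: measurable_cong_sets[OF sets_haar refl] intro!: borel_measurable_sum borel_measurable_times measurable_row_gram)
  also have "\<dots> = (real q)\<^sup>2" by (simp add: prob_space)
  also have "(\<Sum>x<p. \<Sum>z<p. M2 x x z z) = (\<Sum>x<p. \<Sum>z<p. if x = z then M2 0 0 0 0 else M2 0 0 1 1)"
    by (intro sum.cong refl diag1) auto
  finally show "real p * M2 0 0 0 0 + real p * (real p - 1) * M2 0 0 1 1 = (real q)\<^sup>2"
    by (simp only: sum_diag_offdiag)
  have "(\<Sum>x<p. \<Sum>z<p. M2 x z x z) = (\<integral>A. (\<Sum>x<p. \<Sum>z<p. row_gram q A x z * row_gram q A x z) \<partial>\<mu>)"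
    unfolding M2_def
    by (subst Bochner_Integration.integral_sum, force intro!: Bochner_Integration.integrable_sum integrable_gram2,
        rule sum.cong[OF refl], subst Bochner_Integration.integral_sum, force intro!: integrable_gram2, simp)
  also have "\<dots> = (\<integral>A. real q \<partial>\<mu>)"
    using trace_identity2
    by (intro integral_cong_AE) (auto simp: measurable_cong_sets[OF sets_haar refl] intro!: borel_measurable_sum borel_measurable_times measurable_row_gram)
  also have "\<dots> = real q" by (simp add: prob_space)
  also have "(\<Sum>x<p. \<Sum>z<p. M2 x z x z) = (\<Sum>x<p. \<Sum>z<p. if x = z then M2 0 0 0 0 else M2 0 1 0 1)"
    by (intro sum.cong refl diag2) auto
  finally show "real p * M2 0 0 0 0 + real p * (real p - 1) * M2 0 1 0 1 = real q"
    by (simp only: sum_diag_offdiag)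
  have "M2 1 1 1 1 = M2 0 0 0 0" using p by (intro M2_diag) simp
  moreover have "M2 0 0 0 0 = (M2 0 0 0 0 + M2 1 1 1 1 + 2 * M2 0 0 1 1) / 4 + M2 0 1 0 1"
    using p by (intro M2_rotation) auto
  moreover have "a = b + 2 * c" if "d = a" "a = (a + d + 2 * b) / 4 + c" for a b c d :: real
    using that by (simp add: field_simps)
  ultimately show "M2 0 0 0 0 = M2 0 0 1 1 + 2 * M2 0 1 0 1" by blast
qed

text \<open>Sign changes kill every index pattern that is not a union of two pairs, and permutations
  reduce the pairs to the indices 0 and 1. When all four indices agree, all three pairings hold at
  once, and the third equation of \<open>M2_system\<close> is exactly the consistency of the formula
  there.\<close>

lemma M2_pattern:
  assumes "x < p" "y < p" "z < p" "w < p"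
  shows "M2 x y z w = M2 0 0 1 1 * (of_bool (x = y) * of_bool (z = w))
    + M2 0 1 0 1 * (of_bool (x = z) * of_bool (y = w) + of_bool (x = w) * of_bool (y = z))"
proof -
  note fl = M2_flip[OF _ assms]
  consider "x = y" "z \<noteq> w" | "x = y" "z = w" "x = z" | "x = y" "z = w" "x \<noteq> z"
    | "x \<noteq> y" "x = z" "y = w" | "x \<noteq> y" "x = w" "y = z"
    | "x \<noteq> y" "\<not> (x = z \<and> y = w)" "\<not> (x = w \<and> y = z)" by blast
  then show ?thesis
  proof cases
    case 1 then show ?thesis using fl[of z] assms by (auto simp: sg_def split: if_splits)
  next
    case 2 then show ?thesis using M2_diag[of x] M2_system(3) assms by simp
  next
    case 3 then show ?thesis using M2_offdiag(1)[of x z] assms by simp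
  next
    case 4 then show ?thesis using M2_offdiag(2)[of x y] assms by simp
  next
    case 5 then show ?thesis using M2_offdiag(2)[of x y] M2_symmetries(2)[of x y y x] assms by simp
  next
    case 6 then show ?thesis using fl[of x] fl[of y] assms by (auto simp: sg_def split: if_splits)
  qed
qed

end

text \<open>With \<open>G = P P\<^sup>T\<close>, \<open>E (G\<^sub>x\<^sub>y G\<^sub>z\<^sub>w) = A \<delta>\<^sub>x\<^sub>y \<delta>\<^sub>z\<^sub>w + B (\<delta>\<^sub>x\<^sub>z \<delta>\<^sub>y\<^sub>w + \<delta>\<^sub>x\<^sub>w \<delta>\<^sub>y\<^sub>z)\<close>.\<close>

definition gramB :: "real \<Rightarrow> real \<Rightarrow> real" where
  "gramB m r = m * (m - r) / (r * (m - 1) * (m + 2))"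

definition gramA :: "real \<Rightarrow> real \<Rightarrow> real" where
  "gramA m r = 1 - 2 * gramB m r / m"

lemma frame_law_moments:
  assumes "frame_law p q \<nu>" "1 \<le> q" "q \<le> p" "2 \<le> p"
  shows frame_law_prob_space: "prob_space \<nu>"
    and frame_law_sets: "sets \<nu> = sets (mat_space p q)"
    and frame_law_bound: "AE P in \<nu>. \<forall>x<p. \<forall>a<q. \<bar>P (x, a)\<bar> \<le> real p"
    and frame_law_moment1: "\<And>x y. x < p \<Longrightarrow> y < p \<Longrightarrow> (\<integral>P. row_gram q P x y \<partial>\<nu>) = of_bool (x = y)"
    and frame_law_moment2: "\<And>x y z w. x < p \<Longrightarrow> y < p \<Longrightarrow> z < p \<Longrightarrow> w < p \<Longrightarrow>
        (\<integral>P. row_gram q P x y * row_gram q P z w \<partial>\<nu>) =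
          gramA (real p) (real q) * (of_bool (x = y) * of_bool (z = w))
          + gramB (real p) (real q) * (of_bool (x = z) * of_bool (y = w) + of_bool (x = w) * of_bool (y = z))"
proof -
  let ?T = "\<lambda>Q. \<lambda>ij\<in>{..<p} \<times> {..<q}. sqrt (real p / real q) * Q ij"
  obtain \<mu> where \<mu>: "haar_orthogonal p \<mu>" and \<nu>: "\<nu> = distr \<mu> (mat_space p q) ?T"
    using assms(1) unfolding frame_law_def by blast
  interpret haar p q \<mu> using \<mu> assms by unfold_locales auto
  have "?T \<in> mat_space p p \<rightarrow>\<^sub>M mat_space p q"
    unfolding mat_space_def[of p q]
    using q by (intro measurable_restrict borel_measurable_times borel_measurable_const)
      (auto intro: measurable_entry)
  then have T: "?T \<in> \<mu> \<rightarrow>\<^sub>M mat_space p q" using measurable_cong_sets[OF sets_haar refl] by blast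
  show "prob_space \<nu>" unfolding \<nu> by (rule prob_space_distr[OF T])
  show "sets \<nu> = sets (mat_space p q)" unfolding \<nu> by simp
  \<comment> \<open>A crude bound is enough: frame entries have to be bounded by some quantity that
    depends on the dimensions only.\<close>
  have "sqrt (real p / real q) \<le> sqrt ((real p)\<^sup>2)"
  proof (rule real_sqrt_le_mono)
    have "real p / real q \<le> real p" using q by (simp add: divide_le_eq mult_le_cancel_left1)
    also have "\<dots> \<le> (real p)\<^sup>2" using p by (simp add: power2_eq_square)
    finally show "real p / real q \<le> (real p)\<^sup>2" .
  qed
  then have sq: "sqrt (real p / real q) \<le> real p" by simp
  have meas_e: "(\<lambda>P. P (x, a)) \<in> borel_measurable (mat_space p q)" if "x < p" "a < q" for x a
    unfolding mat_space_def using that by (intro measurable_component_singleton) auto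
  have "AE Q in \<mu>. \<forall>x<p. \<forall>a<q. \<bar>?T Q (x, a)\<bar> \<le> real p"
    using AE_entry_bound
  proof eventually_elim
    case (elim A)
    show ?case
    proof (intro allI impI)
      fix x a assume "x < p" "a < q"
      then have "sqrt (real p / real q) * \<bar>A (x, a)\<bar> \<le> real p * 1"
        using elim q sq by (intro mult_mono) auto
      then show "\<bar>?T A (x, a)\<bar> \<le> real p" using \<open>x < p\<close> \<open>a < q\<close> by (simp add: abs_mult)
    qed
  qed
  then have "AE Q in \<mu>. \<bar>?T Q (x, a)\<bar> \<le> real p" if "x < p" "a < q" for x a
    by eventually_elim (use that in blast)
  then have "AE P in \<nu>. \<bar>P (x, a)\<bar> \<le> real p" if "x < p" "a < q" for x a
    unfolding \<nu> using that
    by (subst AE_distr_iff[OF T]) (auto intro!: borel_measurable_le borel_measurable_abs meas_e)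
  then have "AE P in \<nu>. \<forall>x\<in>{..<p}. \<forall>a\<in>{..<q}. \<bar>P (x, a)\<bar> \<le> real p"
    by (intro AE_finite_allI) auto
  then show "AE P in \<nu>. \<forall>x<p. \<forall>a<q. \<bar>P (x, a)\<bar> \<le> real p"
    by eventually_elim auto
  have g: "row_gram q (?T Q) x y = real p / real q * row_gram q Q x y" if "x < p" "y < p" for Q x y
  proof -
    have "?T Q (x, a) * ?T Q (y, a) = real p / real q * (Q (x, a) * Q (y, a))" if "a < q" for a
    proof -
      have "?T Q (x, a) * ?T Q (y, a) = (sqrt (real p / real q) * sqrt (real p / real q)) * (Q (x, a) * Q (y, a))"
        using that \<open>x < p\<close> \<open>y < p\<close> by (simp add: ac_simps)
      then show ?thesis by simp
    qed
    then show ?thesis by (simp add: row_gram_def sum_distrib_left)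
  qed
  have mg: "(\<lambda>P. row_gram q P x y) \<in> borel_measurable (mat_space p q)" if "x < p" "y < p" for x y
    unfolding row_gram_def using that by (intro borel_measurable_sum borel_measurable_times meas_e) auto
  show "(\<integral>P. row_gram q P x y \<partial>\<nu>) = of_bool (x = y)" if xy: "x < p" "y < p" for x y
  proof -
    have "(\<integral>P. row_gram q P x y \<partial>\<nu>) = (\<integral>Q. row_gram q (?T Q) x y \<partial>\<mu>)"
      unfolding \<nu> by (rule integral_distr[OF T mg[OF xy]])
    also have "\<dots> = real p / real q * M1 x y" by (simp add: g xy M1_def)
    finally show ?thesis using M1_eq[OF xy] q p by simp
  qed
  let ?m = "real p" and ?r = "real q"
  have mr: "?m > 0" "?r > 0" "?m - 1 > 0" "?m + 2 > 0" using p q by auto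
  \<comment> \<open>The normalisation of the frame scales each Gram entry by \<open>m / r\<close>,
    hence a product of two entries by its square.\<close>
  define k where "k = (?m / ?r)\<^sup>2"
  have kr: "k * ?r\<^sup>2 = ?m\<^sup>2" "k * ?r = ?m\<^sup>2 / ?r" using mr by (auto simp: k_def power2_eq_square field_simps)
  define e2 e3 where "e2 = k * M2 0 0 1 1" and "e3 = k * M2 0 1 0 1"
  have "k * (?m * (M2 0 0 1 1 + 2 * M2 0 1 0 1) + ?m * (?m - 1) * M2 0 0 1 1) = ?m\<^sup>2"
    using M2_system(1,3) kr by simp
  then have "?m * (?m * e2 + 2 * e3) = ?m * ?m" unfolding e2_def e3_def by (simp add: algebra_simps power2_eq_square)
  \<comment> \<open>The squared-trace identity after scaling. Solved for \<open>e2\<close> it gives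
    \<open>gramA\<close> once \<open>e3\<close> has been identified with
    \<open>gramB\<close>.\<close>
  then have s1: "?m * e2 + 2 * e3 = ?m" using mr by simp
  have "k * (?m * (M2 0 0 1 1 + 2 * M2 0 1 0 1) + ?m * (?m - 1) * M2 0 1 0 1) = ?m\<^sup>2 / ?r"
    using M2_system(2,3) kr by simp
  then have "?m * (e2 + (?m + 1) * e3) = ?m * (?m / ?r)" unfolding e2_def e3_def by (simp add: algebra_simps power2_eq_square)
  then have s2: "e2 + (?m + 1) * e3 = ?m / ?r" by (subst (asm) mult_left_cancel) (use mr in auto)
  have "?m * (e2 + (?m + 1) * e3) - (?m * e2 + 2 * e3) = ?m * (?m / ?r) - ?m" using s1 s2 by simp
  then have "(?m - 1) * (?m + 2) * e3 = ?m * (?m / ?r) - ?m" by (simp add: algebra_simps)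
  then have "(?m - 1) * (?m + 2) * e3 * ?r = (?m * (?m / ?r) - ?m) * ?r" by simp
  also have "\<dots> = ?m * (?m - ?r)" using mr by (simp add: field_simps)
  finally have e3: "e3 = gramB ?m ?r"
    unfolding gramB_def by (subst nonzero_eq_divide_eq) (use mr in \<open>auto simp: ac_simps\<close>)
  have e2: "e2 = gramA ?m ?r" using s1 mr unfolding gramA_def e3[symmetric] by (simp add: field_simps)
  show "(\<integral>P. row_gram q P x y * row_gram q P z w \<partial>\<nu>) =
      gramA ?m ?r * (of_bool (x = y) * of_bool (z = w))
      + gramB ?m ?r * (of_bool (x = z) * of_bool (y = w) + of_bool (x = w) * of_bool (y = z))"
    if xy: "x < p" "y < p" "z < p" "w < p" for x y z w
  proof -
    have "(\<integral>P. row_gram q P x y * row_gram q P z w \<partial>\<nu>) = (\<integral>Q. row_gram q (?T Q) x y * row_gram q (?T Q) z w \<partial>\<mu>)"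
      unfolding \<nu> by (rule integral_distr[OF T]) (intro borel_measurable_times mg xy)
    also have "\<dots> = (\<integral>Q. k * (row_gram q Q x y * row_gram q Q z w) \<partial>\<mu>)"
      by (intro Bochner_Integration.integral_cong refl)
        (simp only: g[OF xy(1,2)] g[OF xy(3,4)], simp add: k_def power2_eq_square)
    also have "\<dots> = k * M2 x y z w" by (simp add: M2_def)
    finally show ?thesis unfolding M2_pattern[OF xy] e2[symmetric] e3[symmetric] e2_def e3_def
      by (simp add: algebra_simps)
  qed
qed

section \<open>Coordinates of the layered matrix spaces\<close>

lemma sum_pos:
  fixes e :: "'i::finite \<Rightarrow> 'l::finite \<times> nat \<times> nat"
  assumes "bij_betw e UNIV (entries p q)"
  shows "(\<Sum>c\<in>UNIV. F (e c)) = (\<Sum>l\<in>UNIV. \<Sum>i<p l. \<Sum>j<q l. F (l, i, j))"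
proof -
  have "entries p q = Sigma UNIV (\<lambda>l. {..<p l} \<times> {..<q l})" by (auto simp: entries_def)
  then have "(\<Sum>c\<in>UNIV. F (e c)) = (\<Sum>x\<in>Sigma UNIV (\<lambda>l. {..<p l} \<times> {..<q l}). F x)"
    using sum.reindex_bij_betw[OF assms, of F] by simp
  also have "\<dots> = (\<Sum>l\<in>UNIV. \<Sum>ij\<in>{..<p l} \<times> {..<q l}. F (l, ij))"
    by (subst sum.Sigma) (auto simp: case_prod_unfold)
  also have "\<dots> = (\<Sum>l\<in>UNIV. \<Sum>i<p l. \<Sum>j<q l. F (l, i, j))"
    by (simp add: sum.cartesian_product case_prod_unfold)
  finally show ?thesis .
qed

lemma pos_inv:
  assumes "bij_betw e UNIV (entries p q)"
  shows "i < p l \<Longrightarrow> j < q l \<Longrightarrow> e (inv e (l, i, j)) = (l, i, j)"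
    and "inv e (e c) = c"
    and "e c = (l, i, j) \<Longrightarrow> i < p l \<and> j < q l"
proof -
  show "i < p l \<Longrightarrow> j < q l \<Longrightarrow> e (inv e (l, i, j)) = (l, i, j)"
    using bij_betw_inv_into_right[OF assms] by (simp add: entries_def)
  show "inv e (e c) = c" using assms by (simp add: bij_betw_def)
  show "e c = (l, i, j) \<Longrightarrow> i < p l \<and> j < q l"
    using bij_betwE[OF assms, rule_format, of c] by (auto simp: entries_def)
qed

lemma block_unblock:
  assumes "bij_betw e UNIV (entries p q)" "i < p l" "j < q l"
  shows "block e (unblock e A) l (i, j) = A l (i, j)"
  using pos_inv(1)[OF assms(1), of i l j] assms by (simp add: block_def unblock_def)

lemma nth_eq_block:
  assumes "bij_betw e UNIV (entries p q)" "e c = (l, i, j)"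
  shows "V $ c = block e V l (i, j)"
  using pos_inv(2)[OF assms(1), of c] assms(2) by (simp add: block_def)

lemma block_linear:
  "block e (V + W) l ij = block e V l ij + block e W l ij"
  "block e (s *\<^sub>R V) l ij = s * block e V l ij"
  by (cases ij; simp add: block_def)+

lemma block_bound: "\<bar>block e V l (i, j)\<bar> \<le> norm V"
  by (simp add: block_def component_le_norm_cart)

lemma inner_blocks:
  fixes e :: "'i::finite \<Rightarrow> 'l::finite \<times> nat \<times> nat"
  assumes b: "bij_betw e UNIV (entries p q)"
  shows "inner U V = (\<Sum>l\<in>UNIV. \<Sum>i<p l. \<Sum>j<q l. block e U l (i, j) * block e V l (i, j))"
proof -
  have "inner U V = (\<Sum>c\<in>UNIV. (\<lambda>(l, i, j). block e U l (i, j) * block e V l (i, j)) (e c))"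
    unfolding inner_vec_def by (intro sum.cong refl) (auto simp: nth_eq_block[OF b] split: prod.split)
  then show ?thesis unfolding sum_pos[OF b] by simp
qed

lemma linear_coordinates:
  fixes H :: "real ^ 'i::finite \<Rightarrow> real ^ 'k::finite"
  assumes "linear H"
  shows "H V $ k = (\<Sum>c\<in>UNIV. V $ c * H (axis c 1) $ k)"
proof -
  have V: "(\<Sum>c\<in>UNIV. V $ c *\<^sub>R axis c 1) = V"
    using basis_expansion[of V] by (simp add: scalar_mult_eq_scaleR)
  have "H V = H (\<Sum>c\<in>UNIV. V $ c *\<^sub>R axis c 1)" by (simp only: V)
  also have "\<dots> = (\<Sum>c\<in>UNIV. V $ c *\<^sub>R H (axis c 1))"
    unfolding linear_sum[OF assms] by (rule sum.cong[OF refl]) (rule linear_scale[OF assms])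
  finally show ?thesis by simp
qed

lemma linear_blinfun: "linear (blinfun_apply H)"
  by (rule bounded_linear.linear[OF blinfun.bounded_linear_right])

text \<open>The matrix of \<open>H\<close> in the coordinates (layer, row, column): \<open>s\<close>
  is the output coordinate and \<open>s'\<close> the input coordinate.\<close>

definition hcoef :: "('i::finite \<Rightarrow> 'l \<times> nat \<times> nat) \<Rightarrow> (real ^ 'i \<Rightarrow> real ^ 'i) \<Rightarrow> 'l \<times> nat \<times> nat \<Rightarrow> 'l \<times> nat \<times> nat \<Rightarrow> real" where
  "hcoef e H s s' = H (axis (inv e s') 1) $ inv e s"

lemma block_linear_map:
  fixes e :: "'i::finite \<Rightarrow> 'l::finite \<times> nat \<times> nat"
  assumes b: "bij_betw e UNIV (entries p q)" and H: "linear H"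
  shows "block e (H V) l (i, j) = (\<Sum>t\<in>UNIV. \<Sum>i'<p t. \<Sum>j'<q t. hcoef e H (l, i, j) (t, i', j') * block e V t (i', j'))"
proof -
  have "block e (H V) l (i, j) = (\<Sum>c\<in>UNIV. V $ c * H (axis c 1) $ inv e (l, i, j))"
    unfolding block_def prod.case by (rule linear_coordinates[OF H])
  also have "\<dots> = (\<Sum>c\<in>UNIV. (\<lambda>(t, i', j'). hcoef e H (l, i, j) (t, i', j') * block e V t (i', j')) (e c))"
  proof (rule sum.cong[OF refl])
    fix c
    obtain t i' j' where c: "e c = (t, i', j')" by (cases "e c")
    then have "inv e (t, i', j') = c" using pos_inv(2)[OF b, of c] by simp
    then show "V $ c * H (axis c 1) $ inv e (l, i, j)
      = (\<lambda>(t, i', j'). hcoef e H (l, i, j) (t, i', j') * block e V t (i', j')) (e c)"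
      by (simp add: c hcoef_def block_def)
  qed
  finally show ?thesis unfolding sum_pos[OF b] by simp
qed

lemma sum_delta3:
  fixes F :: "'l::finite \<Rightarrow> nat \<Rightarrow> nat \<Rightarrow> real"
  assumes "a < p l" "j < q l"
  shows "(\<Sum>t\<in>UNIV. \<Sum>i<p t. \<Sum>k<q t. F t i k * of_bool ((t, i, k) = (l, a, j))) = F l a j"
proof -
  have "(\<Sum>t\<in>UNIV. \<Sum>i<p t. \<Sum>k<q t. F t i k * of_bool ((t, i, k) = (l, a, j)))
    = (\<Sum>t\<in>UNIV. if t = l then (\<Sum>i<p l. if i = a then (\<Sum>k<q l. if k = j then F l a j else 0) else 0) else 0)"
  proof (rule sum.cong[OF refl])
    fix t
    show "(\<Sum>i<p t. \<Sum>k<q t. F t i k * of_bool ((t, i, k) = (l, a, j)))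
      = (if t = l then (\<Sum>i<p l. if i = a then (\<Sum>k<q l. if k = j then F l a j else 0) else 0) else 0)"
    proof (cases "t = l")
      case True
      have "(\<Sum>k<q l. F l i k * of_bool (i = a \<and> k = j)) = (if i = a then (\<Sum>k<q l. if k = j then F l a j else 0) else 0)" for i
        by (cases "i = a") (auto intro!: sum.cong simp del: sum_of_bool_mult_eq sum_mult_of_bool_eq sum.delta sum.delta')
      then show ?thesis using True by (simp del: sum_of_bool_mult_eq sum_mult_of_bool_eq)
    qed simp
  qed
  also have "\<dots> = (\<Sum>i<p l. if i = a then (\<Sum>k<q l. if k = j then F l a j else 0) else 0)" by simp
  also have "\<dots> = F l a j" using assms by simp
  finally show ?thesis .
qed

section \<open>Lifting, compression and the projected Hessian in block coordinates\<close>

locale shaped =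
  fixes D :: "('l::finite, 'y::finite, 'b::finite) layout"
  assumes valid: "valid_layout D"
begin

abbreviation "m \<equiv> nrow D"
abbreviation "n \<equiv> ncol D"
abbreviation "r \<equiv> nred D"
abbreviation "blkY \<equiv> block (posY D)"
abbreviation "blkB \<equiv> block (posB D)"

lemma bijY: "bij_betw (posY D) UNIV (entries m n)" and bijB: "bij_betw (posB D) UNIV (entries r n)"
  using valid unfolding valid_layout_def by auto

lemma dims: "1 \<le> n l" "2 \<le> r l" "r l \<le> m l"
  using valid unfolding valid_layout_def by auto

lemma block_lift: "i < m l \<Longrightarrow> j < n l \<Longrightarrow> blkY (lift D P B) l (i, j) = (\<Sum>a<r l. P l (i, a) * blkB B l (a, j))"
  unfolding lift_def by (simp add: block_unblock[OF bijY] mm_def)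

lemma block_compress: "a < r l \<Longrightarrow> j < n l \<Longrightarrow> blkB (compress D P U) l (a, j) = (\<Sum>i<m l. P l (i, a) * blkY U l (i, j))"
  unfolding compress_def by (simp add: block_unblock[OF bijB] mm_def tr_def)

lemma Ztil_eq: "Ztil D P Z t (a, j) = (\<Sum>i<m t. P t (i, a) * blkY Z t (i, j))"
  by (simp add: Ztil_def mm_def tr_def)

lemma lift_compress: "i < m l \<Longrightarrow> j < n l \<Longrightarrow>
   blkY (lift D P (compress D P U)) l (i, j) = (\<Sum>i'<m l. row_gram (r l) (P l) i i' * blkY U l (i', j))"
proof -
  assume ij: "i < m l" "j < n l"
  have "blkY (lift D P (compress D P U)) l (i, j) = (\<Sum>a<r l. \<Sum>i'<m l. P l (i, a) * (P l (i', a) * blkY U l (i', j)))"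
    using ij by (simp add: block_lift block_compress sum_distrib_left)
  also have "\<dots> = (\<Sum>i'<m l. \<Sum>a<r l. P l (i, a) * (P l (i', a) * blkY U l (i', j)))" by (rule sum.swap)
  also have "\<dots> = (\<Sum>i'<m l. row_gram (r l) (P l) i i' * blkY U l (i', j))"
    by (simp add: row_gram_def sum_distrib_right mult.assoc)
  finally show ?thesis .
qed

text \<open>Lifting and compression are mutually adjoint. Linearity of both maps and the formulas
  for the projected gradients, Hessian and Jacobian are all drawn from this identity.\<close>

lemma inner_lift: "inner (lift D P B) U = inner B (compress D P U)"
proof -
  have "inner (lift D P B) U = (\<Sum>l\<in>UNIV. \<Sum>i<m l. \<Sum>j<n l. \<Sum>a<r l. P l (i, a) * blkB B l (a, j) * blkY U l (i, j))"
    unfolding inner_blocks[OF bijY] by (intro sum.cong refl) (simp add: block_lift sum_distrib_right)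
  also have "\<dots> = (\<Sum>l\<in>UNIV. \<Sum>a<r l. \<Sum>j<n l. \<Sum>i<m l. P l (i, a) * blkB B l (a, j) * blkY U l (i, j))"
  proof (rule sum.cong[OF refl])
    fix l
    have "(\<Sum>i<m l. \<Sum>j<n l. \<Sum>a<r l. P l (i, a) * blkB B l (a, j) * blkY U l (i, j))
      = (\<Sum>i<m l. \<Sum>a<r l. \<Sum>j<n l. P l (i, a) * blkB B l (a, j) * blkY U l (i, j))"
      by (intro sum.cong refl sum.swap)
    also have "\<dots> = (\<Sum>a<r l. \<Sum>i<m l. \<Sum>j<n l. P l (i, a) * blkB B l (a, j) * blkY U l (i, j))" by (rule sum.swap)
    also have "\<dots> = (\<Sum>a<r l. \<Sum>j<n l. \<Sum>i<m l. P l (i, a) * blkB B l (a, j) * blkY U l (i, j))"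
      by (intro sum.cong refl sum.swap)
    finally show "(\<Sum>i<m l. \<Sum>j<n l. \<Sum>a<r l. P l (i, a) * blkB B l (a, j) * blkY U l (i, j))
      = (\<Sum>a<r l. \<Sum>j<n l. \<Sum>i<m l. P l (i, a) * blkB B l (a, j) * blkY U l (i, j))" .
  qed
  also have "\<dots> = inner B (compress D P U)"
    unfolding inner_blocks[OF bijB] by (intro sum.cong refl) (simp add: block_compress sum_distrib_left ac_simps)
  finally show ?thesis .
qed

lemma lift_linear: "linear (lift D P)"
  by (rule linearI; rule vector_eq_ldot[THEN iffD1]; intro allI;
      simp add: inner_commute[of _ "lift D P _"] inner_lift inner_add_left inner_add_right)

lemma compress_linear: "linear (compress D P)"
  by (rule linearI; rule vector_eq_ldot[THEN iffD1]; intro allI;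
      simp add: inner_lift[symmetric] inner_add_right)

text \<open>For the projected Hessian \<open>H = compress \<circ> HY \<circ> lift\<close> the lifted actions depend on \<open>P\<close> only through \<open>P P\<^sup>T\<close>.\<close>

lemma hcoef_sandwich:
  assumes H: "linear HY" and i: "a < r l" "j < n l" "a' < r t" "j' < n t"
  shows "hcoef (posB D) (\<lambda>W. compress D P (HY (lift D P W))) (l, a, j) (t, a', j')
    = (\<Sum>i<m l. \<Sum>i'<m t. P l (i, a) * P t (i', a') * hcoef (posY D) HY (l, i, j) (t, i', j'))"
proof -
  let ?e = "axis (inv (posB D) (t, a', j')) (1::real) :: real ^ 'b"
  have e: "blkB ?e s (c, k) = of_bool ((s, c, k) = (t, a', j'))" if "c < r s" "k < n s" for s c k
  proof -
    have "inv (posB D) (s, c, k) = inv (posB D) (t, a', j') \<longleftrightarrow> (s, c, k) = (t, a', j')"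
      using pos_inv(1)[OF bijB, of c s k] pos_inv(1)[OF bijB, of a' t j'] that i by metis
    then show ?thesis by (auto simp: block_def axis_def)
  qed
  have l: "blkY (lift D P ?e) s (i', k) = P s (i', a') * of_bool (s = t \<and> k = j')" if "i' < m s" "k < n s" for s i' k
  proof -
    have "blkY (lift D P ?e) s (i', k) = (\<Sum>c<r s. P s (i', c) * of_bool ((s, c, k) = (t, a', j')))"
      using that by (simp add: block_lift e)
    also have "\<dots> = (\<Sum>c<r s. if c = a' then P s (i', a') * of_bool (s = t \<and> k = j') else 0)"
      by (intro sum.cong refl) auto
    also have "\<dots> = P s (i', a') * of_bool (s = t \<and> k = j')" using i by auto
    finally show ?thesis .
  qed
  have "hcoef (posB D) (\<lambda>W. compress D P (HY (lift D P W))) (l, a, j) (t, a', j')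
    = blkB (compress D P (HY (lift D P ?e))) l (a, j)" by (simp add: hcoef_def block_def)
  also have "\<dots> = (\<Sum>i<m l. P l (i, a) * blkY (HY (lift D P ?e)) l (i, j))" using i by (simp add: block_compress)
  also have "\<dots> = (\<Sum>i<m l. \<Sum>i'<m t. P l (i, a) * P t (i', a') * hcoef (posY D) HY (l, i, j) (t, i', j'))"
  proof (intro sum.cong refl)
    fix i
    let ?h = "hcoef (posY D) HY (l, i, j)"
    have "blkY (HY (lift D P ?e)) l (i, j) = (\<Sum>s\<in>UNIV. \<Sum>i'<m s. \<Sum>k<n s. ?h (s, i', k) * blkY (lift D P ?e) s (i', k))"
      by (rule block_linear_map[OF bijY H])
    also have "\<dots> = (\<Sum>s\<in>UNIV. \<Sum>i'<m s. \<Sum>k<n s. if k = j' \<and> s = t then ?h (t, i', j') * P t (i', a') else 0)"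
      by (intro sum.cong refl) (auto simp: l)
    also have "\<dots> = (\<Sum>s\<in>UNIV. if s = t then \<Sum>i'<m t. ?h (t, i', j') * P t (i', a') else 0)"
      using i by (intro sum.cong[OF refl]) auto
    also have "\<dots> = (\<Sum>i'<m t. ?h (t, i', j') * P t (i', a'))" by simp
    finally show "P l (i, a) * blkY (HY (lift D P ?e)) l (i, j)
      = (\<Sum>i'<m t. P l (i, a) * P t (i', a') * ?h (t, i', j'))"
      by (simp add: sum_distrib_left ac_simps)
  qed
  finally show ?thesis .
qed

lemma block_embed: "i < r l \<Longrightarrow> j < n l \<Longrightarrow> blkB (embed_block D t W) l (i, j) = (if l = t then W (i, j) else 0)"
  unfolding embed_block_def by (simp add: block_unblock[OF bijB])

lemma Ablk_eq: "i < m l \<Longrightarrow> j < n l \<Longrightarrow>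
   Ablk D P H Z t l (i, j) = blkY (lift D P (H (embed_block D t (Ztil D P Z t)))) l (i, j)"
  by (simp add: Ablk_def block_lift mm_def)

lemma block_lift_embed: "i < m l \<Longrightarrow> j < n l \<Longrightarrow>
   blkY (lift D P (embed_block D t (Ztil D P Z t))) l (i, j) =
     (if l = t then \<Sum>i'<m t. row_gram (r t) (P t) i i' * blkY Z t (i', j) else 0)"
proof -
  assume ij: "i < m l" "j < n l"
  show ?thesis
  proof (cases "l = t")
    case True
    have "blkY (lift D P (embed_block D t (Ztil D P Z t))) l (i, j) = blkY (lift D P (compress D P Z)) l (i, j)"
      using ij True by (simp add: block_lift block_embed block_compress Ztil_eq)
    then show ?thesis using lift_compress[OF ij] True by simp
  qed (use ij in \<open>simp add: block_lift block_embed\<close>)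
qed

text \<open>One Gram factor acts on the output rows and the other on the rows of \<open>Z\<close>.
  This exposes the product of two Gram entries whose mean the frame moments give.\<close>

lemma Ablk_sandwich:
  assumes H: "linear HY" "\<And>W. blinfun_apply HB W = compress D P (HY (lift D P W))"
    and i: "i < m l" "j < n l"
  shows "Ablk D P HB Z t l (i, j) = (\<Sum>i1<m l. \<Sum>i2<m t. \<Sum>j'<n t. \<Sum>i3<m t.
    (row_gram (r l) (P l) i i1 * row_gram (r t) (P t) i2 i3) * (hcoef (posY D) HY (l, i1, j) (t, i2, j') * blkY Z t (i3, j')))"
proof -
  let ?V = "lift D P (embed_block D t (Ztil D P Z t))"
  let ?S = "\<lambda>l. row_gram (r l) (P l)"
  have "Ablk D P HB Z t l (i, j) = (\<Sum>i1<m l. ?S l i i1 * blkY (HY ?V) l (i1, j))"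
    using i by (simp add: Ablk_eq H(2) lift_compress)
  also have "\<dots> = (\<Sum>i1<m l. \<Sum>i2<m t. \<Sum>j'<n t. \<Sum>i3<m t.
    (?S l i i1 * ?S t i2 i3) * (hcoef (posY D) HY (l, i1, j) (t, i2, j') * blkY Z t (i3, j')))"
  proof (intro sum.cong refl)
    fix i1
    have "blkY (HY ?V) l (i1, j) = (\<Sum>s\<in>UNIV. \<Sum>i2<m s. \<Sum>j'<n s. hcoef (posY D) HY (l, i1, j) (s, i2, j') * blkY ?V s (i2, j'))"
      by (rule block_linear_map[OF bijY H(1)])
    also have "\<dots> = (\<Sum>s\<in>UNIV. if s = t then (\<Sum>i2<m t. \<Sum>j'<n t. hcoef (posY D) HY (l, i1, j) (t, i2, j') *
        (\<Sum>i3<m t. ?S t i2 i3 * blkY Z t (i3, j'))) else 0)"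
      by (intro sum.cong refl) (auto simp: block_lift_embed)
    also have "\<dots> = (\<Sum>i2<m t. \<Sum>j'<n t. hcoef (posY D) HY (l, i1, j) (t, i2, j') * (\<Sum>i3<m t. ?S t i2 i3 * blkY Z t (i3, j')))"
      by simp
    finally show "?S l i i1 * blkY (HY ?V) l (i1, j) = (\<Sum>i2<m t. \<Sum>j'<n t. \<Sum>i3<m t.
        (?S l i i1 * ?S t i2 i3) * (hcoef (posY D) HY (l, i1, j) (t, i2, j') * blkY Z t (i3, j')))"
      by (simp add: sum_distrib_left ac_simps)
  qed
  finally show ?thesis .
qed

lemma Mblk_eq: "a < r l \<Longrightarrow> j < n l \<Longrightarrow>
  Mblk D H u \<xi> l (a, j) = (\<Sum>t\<in>UNIV. \<Sum>a'<r t. \<Sum>j'<n t. hcoef (posB D) (blinfun_apply H) (l, a, j) (t, a', j') * (\<xi> t a' * u t j'))"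
  unfolding Mblk_def
  by (subst block_linear_map[OF bijB linear_blinfun]) (simp add: block_unblock[OF bijB] outer_def)

text \<open>\<open>Cbar\<close> and \<open>Bbar\<close> are the means of \<open>Chat\<close> and \<open>Bhat\<close> over the probes: only the terms survive in
  which the two probe entries \<open>\<xi> l a * u l j\<close> and \<open>\<xi> t a' * u t j'\<close> coincide.\<close>

lemma Chat_eq: "i < m l \<Longrightarrow> j < n l \<Longrightarrow>
  Chat D H u \<xi> Z l (i, j) = (\<Sum>k<n l. \<Sum>a<r l. \<Sum>t\<in>UNIV. \<Sum>a'<r t. \<Sum>j'<n t.
     (blkY Z l (i, k) * hcoef (posB D) (blinfun_apply H) (l, a, k) (t, a', j')) * ((\<xi> l a * u l j) * (\<xi> t a' * u t j')))"
proof -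
  assume ij: "i < m l" "j < n l"
  have "Chat D H u \<xi> Z l (i, j) = (\<Sum>k<n l. blkY Z l (i, k) * ((\<Sum>a<r l. Mblk D H u \<xi> l (a, k) * \<xi> l a) * u l j))"
    by (simp add: Chat_def mm_def outer_def mv_def tr_def)
  also have "\<dots> = (\<Sum>k<n l. \<Sum>a<r l. blkY Z l (i, k) * (Mblk D H u \<xi> l (a, k) * (\<xi> l a * u l j)))"
    by (simp add: sum_distrib_left sum_distrib_right ac_simps)
  also have "\<dots> = (\<Sum>k<n l. \<Sum>a<r l. \<Sum>t\<in>UNIV. \<Sum>a'<r t. \<Sum>j'<n t.
     (blkY Z l (i, k) * hcoef (posB D) (blinfun_apply H) (l, a, k) (t, a', j')) * ((\<xi> l a * u l j) * (\<xi> t a' * u t j')))"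
    by (intro sum.cong refl) (simp add: Mblk_eq sum_distrib_left sum_distrib_right ac_simps)
  finally show ?thesis .
qed

lemma Bhat_eq: "i < m l \<Longrightarrow> j < n l \<Longrightarrow>
  Bhat D P H u \<xi> Z l (i, j) = (\<Sum>a<r l. \<Sum>a'<r l. \<Sum>k<n l. \<Sum>t\<in>UNIV. \<Sum>a''<r t. \<Sum>j'<n t.
     (P l (i, a) * Ztil D P Z l (a', k) * hcoef (posB D) (blinfun_apply H) (l, a', j) (t, a'', j'))
       * ((\<xi> l a * u l k) * (\<xi> t a'' * u t j')))"
proof -
  assume ij: "i < m l" "j < n l"
  have "Bhat D P H u \<xi> Z l (i, j) = (\<Sum>a<r l. P l (i, a) * (\<xi> l a * (\<Sum>a'<r l. Mblk D H u \<xi> l (a', j) * (\<Sum>k<n l. Ztil D P Z l (a', k) * u l k))))"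
    by (simp add: Bhat_def mm_def outer_def mv_def tr_def)
  also have "\<dots> = (\<Sum>a<r l. \<Sum>a'<r l. \<Sum>k<n l. (P l (i, a) * Ztil D P Z l (a', k) * (\<xi> l a * u l k)) * Mblk D H u \<xi> l (a', j))"
    by (simp add: sum_distrib_left sum_distrib_right ac_simps)
  also have "\<dots> = (\<Sum>a<r l. \<Sum>a'<r l. \<Sum>k<n l. \<Sum>t\<in>UNIV. \<Sum>a''<r t. \<Sum>j'<n t.
     (P l (i, a) * Ztil D P Z l (a', k) * hcoef (posB D) (blinfun_apply H) (l, a', j) (t, a'', j'))
       * ((\<xi> l a * u l k) * (\<xi> t a'' * u t j')))"
    using ij by (intro sum.cong refl) (simp add: Mblk_eq sum_distrib_left sum_distrib_right ac_simps)
  finally show ?thesis .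
qed

definition Cbar :: "((real ^ 'b) \<Rightarrow>\<^sub>L (real ^ 'b)) \<Rightarrow> real ^ 'y \<Rightarrow> 'l \<Rightarrow> rmat" where
  "Cbar H Z l = (\<lambda>(i, j). \<Sum>k<n l. \<Sum>a<r l. blkY Z l (i, k) * hcoef (posB D) (blinfun_apply H) (l, a, k) (l, a, j))"

definition Bbar :: "('l \<Rightarrow> rmat) \<Rightarrow> ((real ^ 'b) \<Rightarrow>\<^sub>L (real ^ 'b)) \<Rightarrow> real ^ 'y \<Rightarrow> 'l \<Rightarrow> rmat" where
  "Bbar P H Z l = (\<lambda>(i, j). \<Sum>a<r l. \<Sum>a'<r l. \<Sum>k<n l.
     P l (i, a) * Ztil D P Z l (a', k) * hcoef (posB D) (blinfun_apply H) (l, a', j) (l, a, k))"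

text \<open>The sum is blown up to all probe entries so that it matches \<open>Chat_eq\<close>
  summand by summand, with a Kronecker delta in place of the product of probes.\<close>

lemma Cbar_delta: "i < m l \<Longrightarrow> j < n l \<Longrightarrow>
  Cbar H Z l (i, j) = (\<Sum>k<n l. \<Sum>a<r l. \<Sum>t\<in>UNIV. \<Sum>a'<r t. \<Sum>j'<n t.
     (blkY Z l (i, k) * hcoef (posB D) (blinfun_apply H) (l, a, k) (t, a', j')) * of_bool ((t, a', j') = (l, a, j)))"
  unfolding Cbar_def prod.case by (intro sum.cong refl) (subst sum_delta3, auto)

lemma Bbar_delta: "i < m l \<Longrightarrow> j < n l \<Longrightarrow>
  Bbar P H Z l (i, j) = (\<Sum>a<r l. \<Sum>a'<r l. \<Sum>k<n l. \<Sum>t\<in>UNIV. \<Sum>a''<r t. \<Sum>j'<n t.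
     (P l (i, a) * Ztil D P Z l (a', k) * hcoef (posB D) (blinfun_apply H) (l, a', j) (t, a'', j'))
       * of_bool ((t, a'', j') = (l, a, k)))"
  unfolding Bbar_def prod.case by (intro sum.cong refl) (subst sum_delta3, auto)

text \<open>The trace over the compressed row index joins the two frame factors into a single Gram
  entry, so only the first moment of the frame matters for this term.\<close>

lemma Cbar_sandwich:
  assumes H: "linear HY" "\<And>W. blinfun_apply HB W = compress D P (HY (lift D P W))"
    and i: "i < m l" "j < n l"
  shows "Cbar HB Z l (i, j) = (\<Sum>k<n l. \<Sum>i1<m l. \<Sum>i2<m l.
    row_gram (r l) (P l) i1 i2 * (hcoef (posY D) HY (l, i1, k) (l, i2, j) * blkY Z l (i, k)))"
  unfolding Cbar_def prod.case
proof (rule sum.cong[OF refl])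
  fix k assume k: "k \<in> {..<n l}"
  have HB: "blinfun_apply HB = (\<lambda>W. compress D P (HY (lift D P W)))" using H(2) by auto
  let ?h = "\<lambda>i1 i2. hcoef (posY D) HY (l, i1, k) (l, i2, j)"
  have "(\<Sum>a<r l. blkY Z l (i, k) * hcoef (posB D) (blinfun_apply HB) (l, a, k) (l, a, j))
    = (\<Sum>a<r l. \<Sum>i1<m l. \<Sum>i2<m l. blkY Z l (i, k) * (P l (i1, a) * P l (i2, a) * ?h i1 i2))"
    using k i unfolding HB by (intro sum.cong refl) (simp add: hcoef_sandwich[OF H(1)] sum_distrib_left)
  also have "\<dots> = (\<Sum>i1<m l. \<Sum>i2<m l. \<Sum>a<r l. blkY Z l (i, k) * (P l (i1, a) * P l (i2, a) * ?h i1 i2))"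
    by (rule trans[OF sum.swap sum.cong[OF refl sum.swap]])
  also have "\<dots> = (\<Sum>i1<m l. \<Sum>i2<m l. row_gram (r l) (P l) i1 i2 * (?h i1 i2 * blkY Z l (i, k)))"
    by (intro sum.cong refl) (simp add: row_gram_def sum_distrib_left ac_simps)
  finally show "(\<Sum>a<r l. blkY Z l (i, k) * hcoef (posB D) (blinfun_apply HB) (l, a, k) (l, a, j))
    = (\<Sum>i1<m l. \<Sum>i2<m l. row_gram (r l) (P l) i1 i2 * (?h i1 i2 * blkY Z l (i, k)))" .
qed

text \<open>Compared with \<open>Ablk_sandwich\<close> the Gram indices are crossed:
  \<open>i\<close> is joined to the input row \<open>i2\<close> of the Hessian and \<open>i3\<close>
  to its output row \<open>i1\<close>. Taking the mean therefore exchanges the roles of two of the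
  three pairings, which is what makes this term usable as a correction.\<close>

lemma Bbar_sandwich:
  assumes H: "linear HY" "\<And>W. blinfun_apply HB W = compress D P (HY (lift D P W))"
    and i: "i < m l" "j < n l"
  shows "Bbar P HB Z l (i, j) = (\<Sum>k<n l. \<Sum>i1<m l. \<Sum>i2<m l. \<Sum>i3<m l.
    (row_gram (r l) (P l) i i2 * row_gram (r l) (P l) i1 i3) * (hcoef (posY D) HY (l, i1, j) (l, i2, k) * blkY Z l (i3, k)))"
proof -
  have HB: "blinfun_apply HB = (\<lambda>W. compress D P (HY (lift D P W)))" using H(2) by auto
  let ?S = "row_gram (r l) (P l)"
  have "Bbar P HB Z l (i, j) = (\<Sum>a<r l. \<Sum>k<n l. \<Sum>a'<r l. P l (i, a) * Ztil D P Z l (a', k) * hcoef (posB D) (blinfun_apply HB) (l, a', j) (l, a, k))"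
    unfolding Bbar_def prod.case by (intro sum.cong refl sum.swap)
  also have "\<dots> = (\<Sum>k<n l. \<Sum>a<r l. \<Sum>a'<r l. P l (i, a) * Ztil D P Z l (a', k) * hcoef (posB D) (blinfun_apply HB) (l, a', j) (l, a, k))"
    by (rule sum.swap)
  also have "\<dots> = (\<Sum>k<n l. \<Sum>i1<m l. \<Sum>i2<m l. \<Sum>i3<m l.
    (?S i i2 * ?S i1 i3) * (hcoef (posY D) HY (l, i1, j) (l, i2, k) * blkY Z l (i3, k)))"
  proof (rule sum.cong[OF refl])
    fix k assume k: "k \<in> {..<n l}"
    let ?h = "\<lambda>i1 i2. hcoef (posY D) HY (l, i1, j) (l, i2, k)"
    let ?z = "\<lambda>a'. Ztil D P Z l (a', k)"
    have z: "(\<Sum>a'<r l. P l (i1, a') * ?z a') = (\<Sum>i3<m l. ?S i1 i3 * blkY Z l (i3, k))" if "i1 < m l" for i1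
    proof -
      have "(\<Sum>a'<r l. P l (i1, a') * ?z a') = blkY (lift D P (compress D P Z)) l (i1, k)"
        using that k by (simp add: block_lift block_compress Ztil_eq)
      then show ?thesis using that k by (simp add: lift_compress)
    qed
    have "(\<Sum>a<r l. \<Sum>a'<r l. P l (i, a) * ?z a' * hcoef (posB D) (blinfun_apply HB) (l, a', j) (l, a, k))
      = (\<Sum>a<r l. \<Sum>a'<r l. \<Sum>i1<m l. \<Sum>i2<m l. (P l (i, a) * P l (i2, a)) * (P l (i1, a') * ?z a') * ?h i1 i2)"
      using k i unfolding HB by (intro sum.cong refl) (simp add: hcoef_sandwich[OF H(1)] sum_distrib_left ac_simps)
    also have "\<dots> = (\<Sum>a<r l. \<Sum>i1<m l. \<Sum>i2<m l. \<Sum>a'<r l. (P l (i, a) * P l (i2, a)) * (P l (i1, a') * ?z a') * ?h i1 i2)"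
      by (intro sum.cong refl trans[OF sum.swap sum.cong[OF refl sum.swap]])
    also have "\<dots> = (\<Sum>i1<m l. \<Sum>i2<m l. \<Sum>a<r l. \<Sum>a'<r l. (P l (i, a) * P l (i2, a)) * (P l (i1, a') * ?z a') * ?h i1 i2)"
      by (rule trans[OF sum.swap sum.cong[OF refl sum.swap]])
    also have "\<dots> = (\<Sum>i1<m l. \<Sum>i2<m l. ?S i i2 * (\<Sum>a'<r l. P l (i1, a') * ?z a') * ?h i1 i2)"
      by (simp only: row_gram_def sum_product, simp only: sum_distrib_right)
    also have "\<dots> = (\<Sum>i1<m l. \<Sum>i2<m l. \<Sum>i3<m l. (?S i i2 * ?S i1 i3) * (?h i1 i2 * blkY Z l (i3, k)))"
      by (intro sum.cong refl) (simp add: z sum_distrib_left sum_distrib_right ac_simps)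
    finally show "(\<Sum>a<r l. \<Sum>a'<r l. P l (i, a) * ?z a' * hcoef (posB D) (blinfun_apply HB) (l, a', j) (l, a, k))
      = (\<Sum>i1<m l. \<Sum>i2<m l. \<Sum>i3<m l. (?S i i2 * ?S i1 i3) * (?h i1 i2 * blkY Z l (i3, k)))" .
  qed
  finally show ?thesis .
qed

end

text \<open>Each of the terms queries the operator linearly, so the whole estimator is linear in it
  once frame, probes and \<open>Z\<close> are fixed.\<close>

lemma hess_action_linear: "linear (\<lambda>H. hess_action D P H u \<xi> Z)"
proof -
  have M: "Mblk D (H + H') u \<xi> l ij = Mblk D H u \<xi> l ij + Mblk D H' u \<xi> l ij"
    "Mblk D (s *\<^sub>R H) u \<xi> l ij = s * Mblk D H u \<xi> l ij" for H H' s l ij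
    by (simp_all add: Mblk_def blinfun.add_left blinfun.scaleR_left block_linear)
  have A: "Ablk D P (H + H') Z t l ij = Ablk D P H Z t l ij + Ablk D P H' Z t l ij"
    "Ablk D P (s *\<^sub>R H) Z t l ij = s * Ablk D P H Z t l ij" for H H' s t l ij
    by (cases ij; simp add: Ablk_def mm_def blinfun.add_left blinfun.scaleR_left block_linear
        sum.distrib sum_distrib_left algebra_simps)+
  have C: "Chat D (H + H') u \<xi> Z l ij = Chat D H u \<xi> Z l ij + Chat D H' u \<xi> Z l ij"
    "Chat D (s *\<^sub>R H) u \<xi> Z l ij = s * Chat D H u \<xi> Z l ij" for H H' s l ij
    by (cases ij; simp add: Chat_def mm_def outer_def mv_def tr_def M sum.distrib sum_distrib_left
        sum_distrib_right algebra_simps)+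
  have B: "Bhat D P (H + H') u \<xi> Z l ij = Bhat D P H u \<xi> Z l ij + Bhat D P H' u \<xi> Z l ij"
    "Bhat D P (s *\<^sub>R H) u \<xi> Z l ij = s * Bhat D P H u \<xi> Z l ij" for H H' s l ij
    by (cases ij; simp add: Bhat_def mm_def outer_def mv_def tr_def M sum.distrib sum_distrib_left
        sum_distrib_right algebra_simps)+
  have lin: "k1 * (a + a') - k2 * (c + c') + k3 * ((a + a') - (b + b'))
      = (k1 * a - k2 * c + k3 * (a - b)) + (k1 * a' - k2 * c' + k3 * (a' - b'))"
    "k1 * (s * a) - k2 * (s * c) + k3 * (s * a - s * b) = s * (k1 * a - k2 * c + k3 * (a - b))"
    for k1 k2 k3 a a' b b' c c' s :: real by (simp_all add: algebra_simps)
  have Dg: "hess_diag D P (H + H') u \<xi> Z l ij = hess_diag D P H u \<xi> Z l ij + hess_diag D P H' u \<xi> Z l ij"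
    "hess_diag D P (s *\<^sub>R H) u \<xi> Z l ij = s * hess_diag D P H u \<xi> Z l ij" for H H' s l ij
    unfolding hess_diag_def Let_def A B C by (rule lin)+
  show ?thesis
    by (rule linearI; simp add: vec_eq_iff hess_action_def unblock_def Dg A
        sum.distrib sum_distrib_left distrib_left split: prod.split)
qed

text \<open>The matrix unit with its entry 1 in row \<open>b\<close> and column
  \<open>b'\<close>.\<close>

definition elem_blinfun :: "'b::finite \<Rightarrow> 'b \<Rightarrow> (real ^ 'b) \<Rightarrow>\<^sub>L (real ^ 'b)" where
  "elem_blinfun b b' = Blinfun (\<lambda>v. (v $ b') *\<^sub>R axis b 1)"

lemma elem_blinfun_apply: "elem_blinfun b b' v = (v $ b') *\<^sub>R axis b 1"
  unfolding elem_blinfun_def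
  by (intro bounded_linear_Blinfun_apply[THEN fun_cong] bounded_linear_scaleR_const bounded_linear_vec_nth)

lemma blinfun_expand: "(\<Sum>b\<in>UNIV. \<Sum>b'\<in>UNIV. (blinfun_apply H (axis b' 1) $ b) *\<^sub>R elem_blinfun b b') = H"
proof (rule blinfun_eqI)
  fix v
  show "(\<Sum>b\<in>UNIV. \<Sum>b'\<in>UNIV. (blinfun_apply H (axis b' 1) $ b) *\<^sub>R elem_blinfun b b') v = H v"
    by (simp add: vec_eq_iff blinfun.sum_left blinfun.scaleR_left elem_blinfun_apply axis_def
        linear_coordinates[OF linear_blinfun, of H v] if_distrib mult.commute cong: if_cong)
      (intro allI, subst sum.swap, simp)
qed

text \<open>Separates the coefficients, functions of frame, probes and \<open>Z\<close>, from the
  entries of the random operator, so that the oracle relations can be used one entry at a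
  time.\<close>

lemma hess_action_expand:
  "hess_action D P H u \<xi> Z $ c =
    (\<Sum>b\<in>UNIV. \<Sum>b'\<in>UNIV. hess_action D P (elem_blinfun b b') u \<xi> Z $ c * (blinfun_apply H (axis b' 1) $ b))"
proof -
  let ?f = "\<lambda>H. hess_action D P H u \<xi> Z"
  have "?f H = ?f (\<Sum>b\<in>UNIV. \<Sum>b'\<in>UNIV. (blinfun_apply H (axis b' 1) $ b) *\<^sub>R elem_blinfun b b')"
    by (simp add: blinfun_expand)
  also have "\<dots> = (\<Sum>b\<in>UNIV. \<Sum>b'\<in>UNIV. (blinfun_apply H (axis b' 1) $ b) *\<^sub>R ?f (elem_blinfun b b'))"
    by (simp add: linear_sum[OF hess_action_linear] linear_scale[OF hess_action_linear])
  finally show ?thesis by (simp add: mult.commute)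
qed

section \<open>Dimension-dependent bounds for the lifted actions\<close>

lemma abs_sum_le:
  fixes f :: "nat \<Rightarrow> real"
  assumes "\<And>a. a < q \<Longrightarrow> \<bar>f a\<bar> \<le> B" "real q \<le> N" "0 \<le> B"
  shows "\<bar>\<Sum>a<q. f a\<bar> \<le> N * B"
proof -
  have "\<bar>\<Sum>a<q. f a\<bar> \<le> (\<Sum>a<q. B)" by (rule order_trans[OF sum_abs sum_mono]) (use assms in auto)
  also have "\<dots> \<le> N * B" using assms by (simp add: mult_right_mono)
  finally show ?thesis .
qed

lemma abs_mult_le: "\<bar>x\<bar> \<le> X \<Longrightarrow> \<bar>y\<bar> \<le> Y \<Longrightarrow> \<bar>x * y\<bar> \<le> X * (Y :: real)"
  by (simp add: abs_mult mult_mono')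

lemma norm_le_card_mult:
  fixes v :: "real ^ 'i::finite"
  assumes "\<And>c. \<bar>v $ c\<bar> \<le> B"
  shows "norm v \<le> real CARD('i) * B"
  using order_trans[OF norm_le_l1_cart sum_mono[of UNIV "\<lambda>c. \<bar>v $ c\<bar>" "\<lambda>_. B"]] assms by simp

context shaped
begin

text \<open>\<open>NN\<close> dominates every index range and every frame entry; \<open>KK\<close>
  passes from a bound on the entries of a vector to a bound on its norm.\<close>

definition "NN = real (\<Sum>l\<in>UNIV. m l + n l)"
definition "KK = real CARD('y) + real CARD('b)"

text \<open>These pointwise conditions hold almost surely in a run; isolating them makes all the
  norm estimates below deterministic.\<close>

definition bounded_frames :: "('l \<Rightarrow> rmat) \<Rightarrow> bool" where
  "bounded_frames P \<longleftrightarrow> (\<forall>l. \<forall>i<m l. \<forall>a<r l. \<bar>P l (i, a)\<bar> \<le> real (m l))"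

definition bounded_probes :: "('l \<Rightarrow> rvec) \<Rightarrow> ('l \<Rightarrow> rvec) \<Rightarrow> bool" where
  "bounded_probes u \<xi> \<longleftrightarrow> (\<forall>l. (\<forall>j<n l. \<bar>u l j\<bar> \<le> 1) \<and> (\<forall>a<r l. \<bar>\<xi> l a\<bar> \<le> 1))"

lemma NN_ge: "real (m l) \<le> NN" "real (n l) \<le> NN" "real (r l) \<le> NN" "1 \<le> NN"
proof -
  have le: "m l + n l \<le> (\<Sum>l\<in>UNIV. m l + n l)" by (rule member_le_sum) auto
  then show "real (m l) \<le> NN" "real (n l) \<le> NN" "real (r l) \<le> NN" "1 \<le> NN"
    using dims[of l] unfolding NN_def by linarith+
qed

lemma KK_ge: "1 \<le> KK" "real CARD('y) \<le> KK" "real CARD('b) \<le> KK"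
  using zero_less_card_finite[where 'a = 'y] by (auto simp: KK_def simp del: zero_less_card_finite)

lemma nonneg: "0 \<le> NN" "0 \<le> KK"
  using NN_ge(4) KK_ge(1) by auto

lemma frame_entry: "bounded_frames P \<Longrightarrow> i < m l \<Longrightarrow> a < r l \<Longrightarrow> \<bar>P l (i, a)\<bar> \<le> NN"
  using NN_ge(1)[of l] unfolding bounded_frames_def by (meson order_trans)

lemma norm_le_blockY:
  fixes V :: "real ^ 'y"
  assumes "\<And>l i j. i < m l \<Longrightarrow> j < n l \<Longrightarrow> \<bar>blkY V l (i, j)\<bar> \<le> B"
  shows "norm V \<le> KK * B"
proof -
  have "\<bar>V $ c\<bar> \<le> B" for c
    using assms pos_inv(3)[OF bijY, of c] nth_eq_block[OF bijY, of c _ _ _ V] by (cases "posY D c") auto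
  then have "norm V \<le> real CARD('y) * B" "0 \<le> B" by (auto intro!: norm_le_card_mult intro: order_trans[OF abs_ge_zero])
  then show ?thesis using mult_right_mono[OF KK_ge(2), of B] by linarith
qed

lemma norm_le_blockB:
  fixes V :: "real ^ 'b"
  assumes "\<And>l i j. i < r l \<Longrightarrow> j < n l \<Longrightarrow> \<bar>blkB V l (i, j)\<bar> \<le> B"
  shows "norm V \<le> KK * B"
proof -
  have "\<bar>V $ c\<bar> \<le> B" for c
    using assms pos_inv(3)[OF bijB, of c] nth_eq_block[OF bijB, of c _ _ _ V] by (cases "posB D c") auto
  then have "norm V \<le> real CARD('b) * B" "0 \<le> B" by (auto intro!: norm_le_card_mult intro: order_trans[OF abs_ge_zero])
  then show ?thesis using mult_right_mono[OF KK_ge(3), of B] by linarith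
qed

lemma lift_bound: "bounded_frames P \<Longrightarrow> norm (lift D P B) \<le> KK * (NN * (NN * norm B))"
  by (rule norm_le_blockY)
    (auto simp: block_lift NN_ge nonneg intro!: abs_sum_le abs_mult_le frame_entry block_bound)

lemma compress_bound: "bounded_frames P \<Longrightarrow> norm (compress D P U) \<le> KK * (NN * (NN * norm U))"
  by (rule norm_le_blockB)
    (auto simp: block_compress NN_ge nonneg intro!: abs_sum_le abs_mult_le frame_entry block_bound)

lemma Ztil_bound: "bounded_frames P \<Longrightarrow> a < r t \<Longrightarrow> \<bar>Ztil D P Z t (a, j)\<bar> \<le> NN * (NN * norm Z)"
  by (auto simp: Ztil_eq NN_ge nonneg intro!: abs_sum_le abs_mult_le frame_entry block_bound)

lemma Ablk_bound:
  assumes "bounded_frames P" "i < m l"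
  shows "\<bar>Ablk D P H Z t l (i, j)\<bar> \<le> NN * (NN * (norm H * (KK * (NN * (NN * norm Z)))))"
proof -
  have "norm (embed_block D t (Ztil D P Z t)) \<le> KK * (NN * (NN * norm Z))"
    by (rule norm_le_blockB) (use assms in \<open>auto simp: block_embed nonneg intro!: Ztil_bound\<close>)
  then have "norm (H (embed_block D t (Ztil D P Z t))) \<le> norm H * (KK * (NN * (NN * norm Z)))"
    by (meson norm_blinfun mult_left_mono norm_ge_zero order_trans)
  then show ?thesis unfolding Ablk_def mm_def using assms
    by (auto simp: NN_ge nonneg intro!: abs_sum_le abs_mult_le frame_entry order_trans[OF block_bound])
qed

lemma Mblk_bound: "bounded_probes u \<xi> \<Longrightarrow> \<bar>Mblk D H u \<xi> l (a, j)\<bar> \<le> norm H * KK"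
proof -
  assume b: "bounded_probes u \<xi>"
  have "norm (unblock (posB D) (\<lambda>l. outer (\<xi> l) (u l))) \<le> KK * (1 * 1)"
    by (rule norm_le_blockB, unfold block_unblock[OF bijB] outer_def prod.case, rule abs_mult_le)
      (use b in \<open>auto simp: bounded_probes_def\<close>)
  then have "norm H * norm (unblock (posB D) (\<lambda>l. outer (\<xi> l) (u l)) :: real ^ 'b) \<le> norm H * KK"
    by (intro mult_left_mono) auto
  then have "norm (H (unblock (posB D) (\<lambda>l. outer (\<xi> l) (u l)))) \<le> norm H * KK"
    by (rule order_trans[OF norm_blinfun])
  then show ?thesis unfolding Mblk_def by (rule order_trans[OF block_bound])
qed

lemma Chat_bound: "bounded_probes u \<xi> \<Longrightarrow> j < n l \<Longrightarrow>
  \<bar>Chat D H u \<xi> Z l (i, j)\<bar> \<le> NN * (norm Z * ((NN * ((norm H * KK) * 1)) * 1))"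
  unfolding Chat_def mm_def outer_def mv_def tr_def prod.case
  by (intro abs_sum_le abs_mult_le block_bound Mblk_bound NN_ge) (auto simp: bounded_probes_def nonneg)

lemma Bhat_bound: "bounded_frames P \<Longrightarrow> bounded_probes u \<xi> \<Longrightarrow> i < m l \<Longrightarrow> j < n l \<Longrightarrow>
  \<bar>Bhat D P H u \<xi> Z l (i, j)\<bar> \<le> NN * (NN * (1 * (NN * ((norm H * KK) * (NN * ((NN * (NN * norm Z)) * 1))))))"
  unfolding Bhat_def mm_def outer_def mv_def tr_def prod.case
  by (intro abs_sum_le abs_mult_le Mblk_bound NN_ge frame_entry Ztil_bound) (auto simp: bounded_probes_def nonneg)

text \<open>The constant depends on the layout alone, so it can be fixed before any run is
  given.\<close>

lemma hess_action_bound: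
  "\<exists>C\<ge>0. \<forall>P H u \<xi> Z. bounded_frames P \<longrightarrow> bounded_probes u \<xi> \<longrightarrow> norm (hess_action D P H u \<xi> Z) \<le> C * (norm H * norm Z)"
proof -
  define k1 where "k1 l = real (r l) * (real (m l) - 1) * (real (m l) + 2) / (real (m l) * (real (m l) * real (r l) + real (m l) - 2))" for l
  define k2 where "k2 l = (real (m l) - real (r l)) / (real (m l) * real (r l) + real (m l) - 2)" for l
  define k3 where "k3 l = real (r l) * (real (m l) - 1) * (real (m l) - real (r l)) / (real (m l) * (real (r l) - 1) * (real (m l) * real (r l) + real (m l) - 2))" for l
  define cA where "cA = NN * (NN * (KK * (NN * NN)))"
  define cC where "cC = NN * (NN * KK)"
  define cB where "cB = NN * (NN * (NN * (KK * (NN * (NN * NN)))))"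
  have c0: "0 \<le> cA" "0 \<le> cB" "0 \<le> cC" using nonneg by (auto simp: cA_def cB_def cC_def)
  define c where "c l = \<bar>k1 l\<bar> * cA + \<bar>k2 l\<bar> * cC + \<bar>k3 l\<bar> * (cA + cB) + real CARD('l) * cA" for l
  have cpos: "0 \<le> c l" for l using c0 by (auto simp: c_def)
  show ?thesis
  proof (intro exI[of _ "KK * (\<Sum>l\<in>UNIV. c l)"] conjI allI impI)
    show "0 \<le> KK * (\<Sum>l\<in>UNIV. c l)" using nonneg cpos by (intro mult_nonneg_nonneg sum_nonneg) auto
    fix P u \<xi> and Z :: "real ^ 'y" and H :: "(real ^ 'b) \<Rightarrow>\<^sub>L (real ^ 'b)"
    assume P: "bounded_frames P" and u: "bounded_probes u \<xi>"
    let ?w = "norm H * norm Z"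
    have "norm (hess_action D P H u \<xi> Z) \<le> KK * ((\<Sum>l\<in>UNIV. c l) * ?w)"
    proof (rule norm_le_blockY)
      fix l i j assume ij: "i < m l" "j < n l"
      have A: "\<bar>Ablk D P H Z t l (i, j)\<bar> \<le> cA * ?w" for t
        using Ablk_bound[OF P ij(1), of H Z t j] by (simp add: cA_def ac_simps)
      have C: "\<bar>Chat D H u \<xi> Z l (i, j)\<bar> \<le> cC * ?w"
        using Chat_bound[OF u ij(2), of H Z i] by (simp add: cC_def ac_simps)
      have B: "\<bar>Bhat D P H u \<xi> Z l (i, j)\<bar> \<le> cB * ?w"
        using Bhat_bound[OF P u ij, of H Z] by (simp add: cB_def ac_simps)
      have AB: "\<bar>Ablk D P H Z l l (i, j) - Bhat D P H u \<xi> Z l (i, j)\<bar> \<le> (cA + cB) * ?w"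
        using A[of l] B unfolding distrib_right by linarith
      have 1: "\<bar>k1 l * Ablk D P H Z l l (i, j)\<bar> \<le> \<bar>k1 l\<bar> * (cA * ?w)"
        by (intro abs_mult_le A order_refl)
      have 2: "\<bar>k2 l * Chat D H u \<xi> Z l (i, j)\<bar> \<le> \<bar>k2 l\<bar> * (cC * ?w)"
        by (intro abs_mult_le C order_refl)
      have 3: "\<bar>k3 l * (Ablk D P H Z l l (i, j) - Bhat D P H u \<xi> Z l (i, j))\<bar> \<le> \<bar>k3 l\<bar> * ((cA + cB) * ?w)"
        by (intro abs_mult_le AB order_refl)
      have "\<bar>\<Sum>t\<in>UNIV - {l}. Ablk D P H Z t l (i, j)\<bar> \<le> (\<Sum>t\<in>UNIV - {l}. cA * ?w)"
        by (rule order_trans[OF sum_abs sum_mono]) (rule A)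
      also have "\<dots> \<le> (\<Sum>t\<in>(UNIV :: 'l set). cA * ?w)"
        using c0 by (intro sum_mono2) auto
      also have "\<dots> = real CARD('l) * (cA * ?w)" by simp
      finally have 4: "\<bar>\<Sum>t\<in>UNIV - {l}. Ablk D P H Z t l (i, j)\<bar> \<le> real CARD('l) * (cA * ?w)" .
      have "blkY (hess_action D P H u \<xi> Z) l (i, j) = k1 l * Ablk D P H Z l l (i, j) - k2 l * Chat D H u \<xi> Z l (i, j)
          + k3 l * (Ablk D P H Z l l (i, j) - Bhat D P H u \<xi> Z l (i, j)) + (\<Sum>t\<in>UNIV - {l}. Ablk D P H Z t l (i, j))"
        unfolding hess_action_def block_unblock[OF bijY ij] hess_diag_def Let_def k1_def k2_def k3_def ..
      then have "\<bar>blkY (hess_action D P H u \<xi> Z) l (i, j)\<bar>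
        \<le> \<bar>k1 l\<bar> * (cA * ?w) + \<bar>k2 l\<bar> * (cC * ?w) + \<bar>k3 l\<bar> * ((cA + cB) * ?w) + real CARD('l) * (cA * ?w)"
        unfolding abs_le_iff using 1[THEN abs_le_D1] 1[THEN abs_le_D2] 2[THEN abs_le_D1] 2[THEN abs_le_D2]
          3[THEN abs_le_D1] 3[THEN abs_le_D2] 4[THEN abs_le_D1] 4[THEN abs_le_D2] by linarith
      also have "\<dots> = c l * ?w" by (simp add: c_def algebra_simps)
      also have "\<dots> \<le> (\<Sum>l\<in>UNIV. c l) * ?w"
      proof (rule mult_right_mono)
        show "c l \<le> (\<Sum>l\<in>UNIV. c l)" by (rule member_le_sum) (simp_all add: cpos)
      qed simp
      finally show "\<bar>blkY (hess_action D P H u \<xi> Z) l (i, j)\<bar> \<le> (\<Sum>l\<in>UNIV. c l) * ?w" .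
    qed
    then show "norm (hess_action D P H u \<xi> Z) \<le> KK * (\<Sum>l\<in>UNIV. c l) * (norm H * norm Z)"
      by (simp add: mult.assoc)
  qed
qed

end

section \<open>Square integrability and conditional laws\<close>

definition sq_int :: "'w measure \<Rightarrow> ('w \<Rightarrow> 'a::euclidean_space) \<Rightarrow> bool" where
  "sq_int M X \<longleftrightarrow> X \<in> borel_measurable M \<and> integrable M (\<lambda>\<omega>. (norm (X \<omega>))\<^sup>2)"

lemma sq_intD: "sq_int M X \<Longrightarrow> X \<in> borel_measurable M" "sq_int M X \<Longrightarrow> integrable M (\<lambda>\<omega>. (norm (X \<omega>))\<^sup>2)"
  by (auto simp: sq_int_def)

lemma sq_int_bound:
  assumes "X \<in> borel_measurable M" "sq_int M Y" "AE \<omega> in M. norm (X \<omega>) \<le> C * norm (Y \<omega>)"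
  shows "sq_int M X" "(\<integral>\<omega>. (norm (X \<omega>))\<^sup>2 \<partial>M) \<le> C\<^sup>2 * (\<integral>\<omega>. (norm (Y \<omega>))\<^sup>2 \<partial>M)"
proof -
  have le: "AE \<omega> in M. (norm (X \<omega>))\<^sup>2 \<le> C\<^sup>2 * (norm (Y \<omega>))\<^sup>2"
    using assms(3) by eventually_elim (metis norm_ge_zero power_mono power_mult_distrib)
  have iY: "integrable M (\<lambda>\<omega>. C\<^sup>2 * (norm (Y \<omega>))\<^sup>2)" using assms(2) by (simp add: sq_int_def)
  have iX: "integrable M (\<lambda>\<omega>. (norm (X \<omega>))\<^sup>2)"
    by (rule Bochner_Integration.integrable_bound[OF iY]) (use assms(1) le in auto)
  then show "sq_int M X" using assms(1) by (simp add: sq_int_def)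
  show "(\<integral>\<omega>. (norm (X \<omega>))\<^sup>2 \<partial>M) \<le> C\<^sup>2 * (\<integral>\<omega>. (norm (Y \<omega>))\<^sup>2 \<partial>M)"
    using integral_mono_AE[OF iX iY le] by simp
qed

lemma norm_add_sq: "(norm (x + y :: 'a::real_normed_vector))\<^sup>2 \<le> 2 * (norm x)\<^sup>2 + 2 * (norm y)\<^sup>2"
proof -
  have "(norm (x + y))\<^sup>2 \<le> (norm x + norm y)\<^sup>2" by (intro power_mono norm_triangle_ineq) auto
  also have "\<dots> \<le> 2 * (norm x)\<^sup>2 + 2 * (norm y)\<^sup>2"
    using sum_squares_bound[of "norm x" "norm y"] by (simp add: power2_sum)
  finally show ?thesis .
qed

lemma sq_int_add:
  assumes "sq_int M X" "sq_int M Y"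
  shows "sq_int M (\<lambda>\<omega>. X \<omega> + Y \<omega>)"
    "(\<integral>\<omega>. (norm (X \<omega> + Y \<omega>))\<^sup>2 \<partial>M) \<le> 2 * (\<integral>\<omega>. (norm (X \<omega>))\<^sup>2 \<partial>M) + 2 * (\<integral>\<omega>. (norm (Y \<omega>))\<^sup>2 \<partial>M)"
proof -
  have i: "integrable M (\<lambda>\<omega>. 2 * (norm (X \<omega>))\<^sup>2 + 2 * (norm (Y \<omega>))\<^sup>2)"
    using assms by (simp add: sq_int_def)
  have m: "(\<lambda>\<omega>. X \<omega> + Y \<omega>) \<in> borel_measurable M"
    by (intro borel_measurable_add sq_intD assms)
  have iXY: "integrable M (\<lambda>\<omega>. (norm (X \<omega> + Y \<omega>))\<^sup>2)"
    by (rule Bochner_Integration.integrable_bound[OF i]) (use m norm_add_sq in \<open>auto simp: abs_of_nonneg\<close>)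
  then show "sq_int M (\<lambda>\<omega>. X \<omega> + Y \<omega>)" using m by (simp add: sq_int_def)
  show "(\<integral>\<omega>. (norm (X \<omega> + Y \<omega>))\<^sup>2 \<partial>M) \<le> 2 * (\<integral>\<omega>. (norm (X \<omega>))\<^sup>2 \<partial>M) + 2 * (\<integral>\<omega>. (norm (Y \<omega>))\<^sup>2 \<partial>M)"
    using integral_mono[OF iXY i norm_add_sq] assms by (simp add: sq_int_def)
qed

lemma sq_int_scaleR: "sq_int M X \<Longrightarrow> sq_int M (\<lambda>\<omega>. c *\<^sub>R X \<omega>)"
  unfolding sq_int_def by (auto simp: power_mult_distrib)

lemma sq_int_minus: "sq_int M X \<Longrightarrow> sq_int M (\<lambda>\<omega>. - X \<omega>)"
  by (simp add: sq_int_def)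

lemma sq_int_diff:
  assumes "sq_int M X" "sq_int M Y"
  shows "sq_int M (\<lambda>\<omega>. X \<omega> - Y \<omega>)"
    "(\<integral>\<omega>. (norm (X \<omega> - Y \<omega>))\<^sup>2 \<partial>M) \<le> 2 * (\<integral>\<omega>. (norm (X \<omega>))\<^sup>2 \<partial>M) + 2 * (\<integral>\<omega>. (norm (Y \<omega>))\<^sup>2 \<partial>M)"
  using sq_int_add[OF assms(1) sq_int_minus[OF assms(2)]] by simp_all

lemma (in finite_measure) sq_int_const: "sq_int M (\<lambda>_. c)"
  by (simp add: sq_int_def)

lemma (in finite_measure) sq_int_sum: "(\<And>i. i \<in> I \<Longrightarrow> sq_int M (X i)) \<Longrightarrow> sq_int M (\<lambda>\<omega>. \<Sum>i\<in>I. X i \<omega>)"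
  by (induction I rule: infinite_finite_induct) (auto simp: sq_int_const intro: sq_int_add)

lemma sq_int_norm: "sq_int M X \<Longrightarrow> sq_int M (\<lambda>\<omega>. norm (X \<omega>))"
  unfolding sq_int_def by auto

lemma sq_int_inner:
  assumes "sq_int M X" "sq_int M Y"
  shows "integrable M (\<lambda>\<omega>. inner (X \<omega>) (Y \<omega>))"
proof (rule Bochner_Integration.integrable_bound)
  show "integrable M (\<lambda>\<omega>. (norm (X \<omega>))\<^sup>2 + (norm (Y \<omega>))\<^sup>2)" using assms by (simp add: sq_int_def)
  show "(\<lambda>\<omega>. inner (X \<omega>) (Y \<omega>)) \<in> borel_measurable M"
    by (intro borel_measurable_inner sq_intD assms)
  show "AE \<omega> in M. norm (inner (X \<omega>) (Y \<omega>)) \<le> norm ((norm (X \<omega>))\<^sup>2 + (norm (Y \<omega>))\<^sup>2)"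
  proof (rule AE_I2)
    fix \<omega>
    have "\<bar>inner (X \<omega>) (Y \<omega>)\<bar> \<le> norm (X \<omega>) * norm (Y \<omega>)" by (rule Cauchy_Schwarz_ineq2)
    also have "\<dots> \<le> (norm (X \<omega>))\<^sup>2 + (norm (Y \<omega>))\<^sup>2"
      using sum_squares_bound[of "norm (X \<omega>)" "norm (Y \<omega>)"] mult_nonneg_nonneg[OF norm_ge_zero norm_ge_zero, of "X \<omega>" "Y \<omega>"]
      by linarith
    finally show "norm (inner (X \<omega>) (Y \<omega>)) \<le> norm ((norm (X \<omega>))\<^sup>2 + (norm (Y \<omega>))\<^sup>2)" by simp
  qed
qed

lemma sq_int_mult: "sq_int M X \<Longrightarrow> sq_int M Y \<Longrightarrow> integrable M (\<lambda>\<omega>. X \<omega> * Y \<omega> :: real)"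
  using sq_int_inner[of M X Y] by simp

lemma (in finite_measure) sq_int_integrable:
  fixes X :: "'a \<Rightarrow> real"
  shows "sq_int M X \<Longrightarrow> integrable M X"
  using sq_int_mult[OF _ sq_int_const[of "1 :: real"], of X] by simp

lemma borel_vec_nth:
  fixes X :: "'w \<Rightarrow> real ^ 'i::finite"
  shows "X \<in> borel_measurable M \<Longrightarrow> (\<lambda>\<omega>. X \<omega> $ i) \<in> borel_measurable M"
  unfolding cart_eq_inner_axis by (intro borel_measurable_inner borel_measurable_const)

lemma sq_int_nth: "sq_int M X \<Longrightarrow> sq_int M (\<lambda>\<omega>. X \<omega> $ i)"
  for X :: "'w \<Rightarrow> real ^ 'i::finite"
  by (rule sq_int_bound(1)[where C = 1 and Y = X])
    (auto simp: component_le_norm_cart dest: sq_intD intro!: borel_vec_nth)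

lemma borel_measurable_vec:
  fixes X :: "'w \<Rightarrow> real ^ 'i::finite"
  assumes "\<And>i. (\<lambda>\<omega>. X \<omega> $ i) \<in> borel_measurable M"
  shows "X \<in> borel_measurable M"
  by (subst borel_measurable_euclidean_space) (use assms in \<open>auto simp: Basis_vec_def inner_axis\<close>)

lemma (in finite_measure) sq_int_vec:
  fixes X :: "'a \<Rightarrow> real ^ 'i::finite"
  assumes "\<And>i. sq_int M (\<lambda>\<omega>. X \<omega> $ i)"
  shows "sq_int M X"
proof -
  have "(norm (X \<omega>))\<^sup>2 = (\<Sum>i\<in>UNIV. (X \<omega> $ i)\<^sup>2)" for \<omega>
    unfolding power2_norm_eq_inner inner_vec_def by (simp add: power2_eq_square)
  then show ?thesis using assms by (auto simp: sq_int_def intro: borel_measurable_vec)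
qed

text \<open>Integrability is recorded together with the equality of the integrals; only then can
  such relations be added, scaled, summed and chained without side conditions.\<close>

definition eqE :: "'w measure \<Rightarrow> ('w \<Rightarrow> real) \<Rightarrow> ('w \<Rightarrow> real) \<Rightarrow> bool" where
  "eqE M f g \<longleftrightarrow> integrable M f \<and> integrable M g \<and> (\<integral>\<omega>. f \<omega> \<partial>M) = (\<integral>\<omega>. g \<omega> \<partial>M)"

lemma eqE_refl: "integrable M f \<Longrightarrow> eqE M f f"
  by (simp add: eqE_def)

lemma eqE_trans: "eqE M f g \<Longrightarrow> eqE M g h \<Longrightarrow> eqE M f h"
  by (simp add: eqE_def)

lemma eqE_add: "eqE M f g \<Longrightarrow> eqE M f' g' \<Longrightarrow> eqE M (\<lambda>\<omega>. f \<omega> + f' \<omega>) (\<lambda>\<omega>. g \<omega> + g' \<omega>)"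
  by (simp add: eqE_def)

lemma eqE_diff: "eqE M f g \<Longrightarrow> eqE M f' g' \<Longrightarrow> eqE M (\<lambda>\<omega>. f \<omega> - f' \<omega>) (\<lambda>\<omega>. g \<omega> - g' \<omega>)"
  by (simp add: eqE_def)

lemma eqE_cmult: "eqE M f g \<Longrightarrow> eqE M (\<lambda>\<omega>. c * f \<omega>) (\<lambda>\<omega>. c * g \<omega>)"
  by (simp add: eqE_def)

lemma eqE_sum: "(\<And>i. i \<in> I \<Longrightarrow> eqE M (f i) (g i)) \<Longrightarrow> eqE M (\<lambda>\<omega>. \<Sum>i\<in>I. f i \<omega>) (\<lambda>\<omega>. \<Sum>i\<in>I. g i \<omega>)"
  by (simp add: eqE_def)

lemma eqE_cong:
  assumes "eqE M f g" "\<And>\<omega>. \<omega> \<in> space M \<Longrightarrow> f' \<omega> = f \<omega>" "\<And>\<omega>. \<omega> \<in> space M \<Longrightarrow> g' \<omega> = g \<omega>"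
  shows "eqE M f' g'"
proof -
  have "integrable M f' = integrable M f" "integrable M g' = integrable M g"
    by (rule Bochner_Integration.integrable_cong; simp add: assms)+
  moreover have "integral\<^sup>L M f' = integral\<^sup>L M f" "integral\<^sup>L M g' = integral\<^sup>L M g"
    by (rule Bochner_Integration.integral_cong; simp add: assms)+
  ultimately show ?thesis using assms(1) by (simp add: eqE_def)
qed

lemma integrable_mult_AE_bounded:
  fixes f g :: "'w \<Rightarrow> real"
  assumes "integrable M f" "g \<in> borel_measurable M" "AE \<omega> in M. \<bar>g \<omega>\<bar> \<le> C"
  shows "integrable M (\<lambda>\<omega>. f \<omega> * g \<omega>)"
proof (rule Bochner_Integration.integrable_bound)
  show "integrable M (\<lambda>\<omega>. C * f \<omega>)" using assms by simp
  show "(\<lambda>\<omega>. f \<omega> * g \<omega>) \<in> borel_measurable M" using assms by auto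
  show "AE \<omega> in M. norm (f \<omega> * g \<omega>) \<le> norm (C * f \<omega>)"
    using assms(3)
  proof eventually_elim
    case (elim \<omega>)
    then have "\<bar>g \<omega>\<bar> * \<bar>f \<omega>\<bar> \<le> \<bar>C\<bar> * \<bar>f \<omega>\<bar>" by (intro mult_right_mono) auto
    then show ?case by (simp add: abs_mult mult.commute)
  qed
qed

section \<open>From conditional statements to equalities of integrals\<close>

context prob_space
begin

lemma subalgebra_sigma_finite: "subalgebra M F \<Longrightarrow> sigma_finite_subalgebra M F"
  by (intro finite_measure_subalgebra_is_sigma_finite finite_measure_subalgebra.intro
      finite_measure_subalgebra_axioms.intro) unfold_locales

text \<open>Integrating the conditional bound shows that the squared deviation has a finite
  integral, so square integrability is a consequence of the hypothesis and not a further
  assumption.\<close>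

lemma cond_msd_sq_int:
  assumes F: "subalgebra M F" and c: "cond_msd_le M F X Y v"
    and m: "X \<in> borel_measurable M" "Y \<in> borel_measurable M" and v: "integrable M v" "\<And>\<omega>. 0 \<le> v \<omega>"
  shows "sq_int M (\<lambda>\<omega>. X \<omega> - Y \<omega>)" "(\<integral>\<omega>. (norm (X \<omega> - Y \<omega>))\<^sup>2 \<partial>M) \<le> (\<integral>\<omega>. v \<omega> \<partial>M)"
proof -
  interpret sigma_finite_subalgebra M F by (rule subalgebra_sigma_finite[OF F])
  let ?f = "\<lambda>\<omega>. ennreal ((norm (X \<omega> - Y \<omega>))\<^sup>2)"
  have mf: "?f \<in> borel_measurable M" using m by measurable
  have "(\<integral>\<^sup>+\<omega>. ?f \<omega> \<partial>M) = (\<integral>\<^sup>+\<omega>. nn_cond_exp M F ?f \<omega> \<partial>M)"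
    using nn_cond_exp_intg[of "\<lambda>_. 1" ?f] mf by simp
  also have "\<dots> \<le> (\<integral>\<^sup>+\<omega>. ennreal (v \<omega>) \<partial>M)"
    using c unfolding cond_msd_le_def by (rule nn_integral_mono_AE)
  also have "\<dots> = ennreal (\<integral>\<omega>. v \<omega> \<partial>M)" using v by (intro nn_integral_eq_integral) auto
  finally have le: "(\<integral>\<^sup>+\<omega>. ?f \<omega> \<partial>M) \<le> ennreal (\<integral>\<omega>. v \<omega> \<partial>M)" .
  have i: "integrable M (\<lambda>\<omega>. (norm (X \<omega> - Y \<omega>))\<^sup>2)"
  proof (rule integrableI_bounded)
    show "(\<integral>\<^sup>+\<omega>. ennreal (norm ((norm (X \<omega> - Y \<omega>))\<^sup>2)) \<partial>M) < \<infinity>"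
      using order.strict_trans1[OF le ennreal_less_top] by simp
  qed (use m in measurable)
  then show "sq_int M (\<lambda>\<omega>. X \<omega> - Y \<omega>)" using m by (simp add: sq_int_def)
  have "ennreal (\<integral>\<omega>. (norm (X \<omega> - Y \<omega>))\<^sup>2 \<partial>M) = (\<integral>\<^sup>+\<omega>. ?f \<omega> \<partial>M)"
    using i by (intro nn_integral_eq_integral[symmetric]) auto
  then have "ennreal (\<integral>\<omega>. (norm (X \<omega> - Y \<omega>))\<^sup>2 \<partial>M) \<le> ennreal (\<integral>\<omega>. v \<omega> \<partial>M)" using le by simp
  then show "(\<integral>\<omega>. (norm (X \<omega> - Y \<omega>))\<^sup>2 \<partial>M) \<le> (\<integral>\<omega>. v \<omega> \<partial>M)"
    by (subst (asm) ennreal_le_iff) (auto intro: v integral_nonneg_AE)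
qed

text \<open>The weak form of a conditional mean: the measurable weight is pulled out and the
  conditional expectation integrated away. Integrability on the side of \<open>Y\<close> follows
  from that on the side of \<open>X\<close>.\<close>

lemma cond_mean_eqE:
  assumes F: "subalgebra M F" and c: "has_cond_mean M F X Y" and b: "b \<in> Basis"
    and m: "X \<in> borel_measurable M" "Y \<in> borel_measurable M" "\<alpha> \<in> borel_measurable F"
    and i: "integrable M (\<lambda>\<omega>. \<alpha> \<omega> * inner (X \<omega>) b)"
  shows "eqE M (\<lambda>\<omega>. \<alpha> \<omega> * inner (X \<omega>) b) (\<lambda>\<omega>. \<alpha> \<omega> * inner (Y \<omega>) b)"
proof -
  interpret sigma_finite_subalgebra M F by (rule subalgebra_sigma_finite[OF F])
  let ?X = "\<lambda>\<omega>. inner (X \<omega>) b"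
  have mX: "?X \<in> borel_measurable M" using m by measurable
  have \<alpha>: "\<alpha> \<in> borel_measurable M" by (rule measurable_from_subalg[OF F m(3)])
  have AE: "AE \<omega> in M. \<alpha> \<omega> * real_cond_exp M F ?X \<omega> = \<alpha> \<omega> * inner (Y \<omega>) b"
    using c b unfolding has_cond_mean_def by auto
  have mr: "(\<lambda>\<omega>. \<alpha> \<omega> * real_cond_exp M F ?X \<omega>) \<in> borel_measurable M"
    using \<alpha> by (intro borel_measurable_times borel_measurable_cond_exp2)
  have mY: "(\<lambda>\<omega>. \<alpha> \<omega> * inner (Y \<omega>) b) \<in> borel_measurable M" using m \<alpha> by measurable
  note r = real_cond_exp_intg[OF i m(3) mX]
  have "integrable M (\<lambda>\<omega>. \<alpha> \<omega> * inner (Y \<omega>) b)" using r(1) integrable_cong_AE[OF mr mY AE] by simp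
  moreover have "(\<integral>\<omega>. \<alpha> \<omega> * ?X \<omega> \<partial>M) = (\<integral>\<omega>. \<alpha> \<omega> * inner (Y \<omega>) b \<partial>M)"
    using r(2) integral_cong_AE[OF mr mY AE] by simp
  ultimately show ?thesis using i by (simp add: eqE_def)
qed

lemma indep_set_eqE:
  assumes ind: "indep_set G1 G2"
    and f: "f \<in> borel_measurable A1" "sets A1 \<subseteq> G1" "space A1 = space M" "integrable M f"
    and g: "g \<in> borel_measurable A2" "sets A2 \<subseteq> G2" "space A2 = space M" "integrable M g"
  shows "eqE M (\<lambda>\<omega>. f \<omega> * g \<omega>) (\<lambda>\<omega>. f \<omega> * expectation g)"
proof -
  have sub: "sigma_sets (space M) {X -` A \<inter> space M | A. A \<in> sets borel} \<subseteq> G"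
    if "X \<in> borel_measurable A1" "sets A1 \<subseteq> G" "space A1 = space M" for X :: "'a \<Rightarrow> real" and A1 G
  proof -
    have "{X -` A \<inter> space M | A. A \<in> sets borel} \<subseteq> sets A1"
      using measurable_sets[OF that(1)] that(3) by auto
    then show ?thesis using sets.sigma_sets_subset[of _ A1] that by auto
  qed
  have "indep_set (sigma_sets (space M) {f -` A \<inter> space M | A. A \<in> sets borel})
      (sigma_sets (space M) {g -` A \<inter> space M | A. A \<in> sets borel})"
    using sub[OF f(1-3)] sub[OF g(1-3)] indep_setD_ev1[OF ind] indep_setD_ev2[OF ind] indep_setD[OF ind]
    by (intro indep_setI) blast+
  then have "indep_var borel f borel g" using f g by (auto simp: indep_var_eq)
  from indep_var_lebesgue_integral[OF this f(4) g(4)] indep_var_integrable[OF this f(4) g(4)]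
  show ?thesis using f by (simp add: eqE_def)
qed

text \<open>A conditional law with a deterministic right-hand side says that the variables are
  independent of \<open>F\<close> and of one another; the two conclusions are the factorisation over
  events and the identification of the marginals.\<close>

lemma cond_law_distr:
  fixes X :: "'l::finite \<Rightarrow> 'a \<Rightarrow> 'c"
  assumes F: "subalgebra M F"
    and X: "\<And>l. X l \<in> M \<rightarrow>\<^sub>M N l" and \<nu>: "\<And>l. prob_space (\<nu> l)" "\<And>l. sets (\<nu> l) = sets (N l)"
    and law: "\<And>A. (\<And>l. A l \<in> sets (N l)) \<Longrightarrow>
      AE \<omega> in M. real_cond_exp M F (indicator {\<omega> \<in> space M. \<forall>l. X l \<omega> \<in> A l}) \<omega> = (\<Prod>l\<in>UNIV. measure (\<nu> l) (A l))"
  shows cond_law_prob: "\<And>A B. (\<And>l. A l \<in> sets (N l)) \<Longrightarrow> B \<in> sets F \<Longrightarrow>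
      prob (B \<inter> {\<omega> \<in> space M. \<forall>l. X l \<omega> \<in> A l}) = prob B * (\<Prod>l\<in>UNIV. measure (\<nu> l) (A l))"
    and cond_law_marginal: "\<And>l. distr M (N l) (X l) = \<nu> l"
proof -
  interpret sigma_finite_subalgebra M F by (rule subalgebra_sigma_finite[OF F])
  show prob: "prob (B \<inter> {\<omega> \<in> space M. \<forall>l. X l \<omega> \<in> A l}) = prob B * (\<Prod>l\<in>UNIV. measure (\<nu> l) (A l))"
    if A: "\<And>l. A l \<in> sets (N l)" and B: "B \<in> sets F" for A B
  proof -
    let ?E = "{\<omega> \<in> space M. \<forall>l. X l \<omega> \<in> A l}"
    have E: "?E \<in> events"
    proof -
      have "?E = (\<Inter>l. X l -` A l \<inter> space M)" by auto
      also have "\<dots> \<in> events" using measurable_sets[OF X A] by (intro sets.finite_INT) auto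
      finally show ?thesis .
    qed
    have BM: "B \<in> events" using F B by (auto simp: subalgebra_def)
    have mi: "(indicator ?E :: 'a \<Rightarrow> real) \<in> borel_measurable M" using E by simp
    have mB: "(indicator B :: 'a \<Rightarrow> real) \<in> borel_measurable F" using B by simp
    have i: "integrable M (\<lambda>\<omega>. indicator B \<omega> * indicator ?E \<omega> :: real)"
      unfolding indicator_inter_arith[symmetric] using BM E by (simp add: integrable_indicator_iff less_top[symmetric])
    have "prob (B \<inter> ?E) = (\<integral>\<omega>. indicator B \<omega> * indicator ?E \<omega> \<partial>M)"
      unfolding indicator_inter_arith[symmetric] using BM E by simp
    also have "\<dots> = (\<integral>\<omega>. indicator B \<omega> * real_cond_exp M F (indicator ?E) \<omega> \<partial>M)"
      by (rule real_cond_exp_intg(2)[OF i mB mi, symmetric])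
    also have "\<dots> = (\<integral>\<omega>. indicator B \<omega> * (\<Prod>l\<in>UNIV. measure (\<nu> l) (A l)) \<partial>M)"
      using law[OF A] BM by (intro integral_cong_AE) (auto intro!: borel_measurable_times borel_measurable_cond_exp2)
    also have "\<dots> = prob B * (\<Prod>l\<in>UNIV. measure (\<nu> l) (A l))" using BM by simp
    finally show ?thesis .
  qed
  fix l
  show "distr M (N l) (X l) = \<nu> l"
  proof (rule measure_eqI)
    show "sets (distr M (N l) (X l)) = sets (\<nu> l)" using \<nu> by simp
    fix C assume "C \<in> sets (distr M (N l) (X l))"
    then have C: "C \<in> sets (N l)" by simp
    \<comment> \<open>All other coordinates get the whole space and the event in \<open>F\<close> is
      the sure event, so the product collapses to one marginal.\<close>
    let ?A = "\<lambda>l'. if l' = l then C else space (N l')"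
    have "prob (space M \<inter> {\<omega> \<in> space M. \<forall>l'. X l' \<omega> \<in> ?A l'}) = prob (space M) * (\<Prod>l'\<in>UNIV. measure (\<nu> l') (?A l'))"
      using F C sets.top[of F] by (intro prob) (auto simp: subalgebra_def)
    moreover have "space M \<inter> {\<omega> \<in> space M. \<forall>l'. X l' \<omega> \<in> ?A l'} = X l -` C \<inter> space M"
      using measurable_space[OF X] by (auto split: if_splits)
    moreover have "(\<Prod>l'\<in>UNIV. measure (\<nu> l') (?A l')) = (\<Prod>l'\<in>UNIV. if l' = l then measure (\<nu> l) C else 1)"
      using prob_space.prob_space[OF \<nu>(1)] sets_eq_imp_space_eq[OF \<nu>(2)] by (intro prod.cong) auto
    ultimately have "prob (X l -` C \<inter> space M) = measure (\<nu> l) C" by (simp add: prob_space)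
    then show "emeasure (distr M (N l) (X l)) C = emeasure (\<nu> l) C"
      using C X by (simp add: emeasure_distr emeasure_eq_measure finite_measure.emeasure_eq_measure[OF prob_space.finite_measure[OF \<nu>(1)]])
  qed
qed

lemma cond_law_eqE:
  fixes X :: "'l::finite \<Rightarrow> 'a \<Rightarrow> 'c" and h :: "'l \<Rightarrow> 'c \<Rightarrow> real"
  assumes F: "subalgebra M F"
    and X: "\<And>l. X l \<in> M \<rightarrow>\<^sub>M N l" and \<nu>: "\<And>l. prob_space (\<nu> l)" "\<And>l. sets (\<nu> l) = sets (N l)"
    and law: "\<And>A. (\<And>l. A l \<in> sets (N l)) \<Longrightarrow>
      AE \<omega> in M. real_cond_exp M F (indicator {\<omega> \<in> space M. \<forall>l. X l \<omega> \<in> A l}) \<omega> = (\<Prod>l\<in>UNIV. measure (\<nu> l) (A l))"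
    and h: "\<And>l. h l \<in> borel_measurable (N l)" "\<And>l. integrable (\<nu> l) (h l)"
    and \<phi>: "\<phi> \<in> borel_measurable F" "integrable M \<phi>"
  shows "eqE M (\<lambda>\<omega>. \<phi> \<omega> * (\<Prod>l\<in>UNIV. h l (X l \<omega>))) (\<lambda>\<omega>. \<phi> \<omega> * (\<Prod>l\<in>UNIV. (\<integral>x. h l x \<partial>\<nu> l)))"
proof -
  have probs: "prob (B \<inter> {\<omega> \<in> space M. \<forall>l. X l \<omega> \<in> A l}) = prob B * (\<Prod>l\<in>UNIV. measure (\<nu> l) (A l))"
    if "\<And>l. A l \<in> sets (N l)" "B \<in> sets F" for A B
    using F X \<nu> law that by (rule cond_law_prob)
  have marg: "distr M (N l) (X l) = \<nu> l" for l
    using F X \<nu> law by (rule cond_law_marginal)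
  \<comment> \<open>\<open>None\<close> carries the weight measurable for the past and
    \<open>Some l\<close> the factor of coordinate \<open>l\<close>, so that one finite family of
    independent variables covers both kinds of independence.\<close>
  define Y where "Y i = (case i of None \<Rightarrow> \<phi> | Some l \<Rightarrow> (\<lambda>\<omega>. h l (X l \<omega>)))" for i
  have U: "(UNIV :: 'l option set) = insert None (range Some)" by (rule UNIV_option_conv)
  have prodU: "(\<Prod>i\<in>(UNIV :: 'l option set). G i) = G None * (\<Prod>l\<in>UNIV. G (Some l))" for G :: "'l option \<Rightarrow> real"
    unfolding U by (simp add: prod.reindex)
  have mY: "Y i \<in> borel_measurable M" for i
    unfolding Y_def using measurable_compose[OF X h(1)] measurable_from_subalg[OF F \<phi>(1)] by (auto split: option.split)
  have "indep_vars (\<lambda>_. borel) Y UNIV"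
    unfolding indep_vars_def2
  proof (intro conjI ballI mY)
    show "indep_sets (\<lambda>i. {Y i -` A \<inter> space M | A. A \<in> sets borel}) UNIV"
    proof (subst indep_sets_finite)
      show "space M \<in> {Y i -` A \<inter> space M | A. A \<in> sets borel}" for i by (auto intro: exI[of _ UNIV])
      show "{Y i -` A \<inter> space M | A. A \<in> sets borel} \<subseteq> events" for i using measurable_sets[OF mY] by auto
      show "\<forall>A\<in>\<Pi> i\<in>UNIV. {Y i -` A \<inter> space M | A. A \<in> sets borel}. prob (\<Inter>j\<in>UNIV. A j) = (\<Prod>j\<in>UNIV. prob (A j))"
      proof
        fix A assume A: "A \<in> (\<Pi> i\<in>UNIV. {Y i -` A \<inter> space M | A. A \<in> sets borel})"
        have "\<forall>i. \<exists>C. A i = Y i -` C \<inter> space M \<and> C \<in> sets borel" using A by (auto simp: Pi_iff)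
        then obtain C where C: "\<And>i. A i = Y i -` C i \<inter> space M" "\<And>i. C i \<in> sets borel" by metis
        \<comment> \<open>Events about \<open>h l (X l \<omega>)\<close> are pulled back to events
          about \<open>X l\<close>, for which the factorisation is known.\<close>
        define A' where "A' l = h l -` C (Some l) \<inter> space (N l)" for l
        have A': "A' l \<in> sets (N l)" for l unfolding A'_def by (rule measurable_sets[OF h(1) C(2)])
        have AS: "A (Some l) = X l -` A' l \<inter> space M" for l
          using measurable_space[OF X] by (auto simp: C(1) Y_def A'_def)
        have AN: "A None \<in> sets F"
          using measurable_sets[OF \<phi>(1) C(2)[of None]] F by (simp add: C(1) Y_def subalgebra_def)
        have "(\<Inter>j\<in>UNIV. A j) = A None \<inter> {\<omega> \<in> space M. \<forall>l. X l \<omega> \<in> A' l}"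
          unfolding U using AS by (auto simp: C(1)[of None])
        then have "prob (\<Inter>j\<in>UNIV. A j) = prob (A None) * (\<Prod>l\<in>UNIV. measure (\<nu> l) (A' l))"
          using probs[OF A' AN] by simp
        moreover have "measure (\<nu> l) (A' l) = prob (A (Some l))" for l
          using A'[of l] X by (simp add: marg[of l, symmetric] measure_distr AS)
        ultimately show "prob (\<Inter>j\<in>UNIV. A j) = (\<Prod>j\<in>UNIV. prob (A j))" by (simp add: prodU)
      qed
    qed auto
  qed
  moreover have iY: "integrable M (Y i)" for i
  proof (cases i)
    case (Some l)
    have "integrable (distr M (N l) (X l)) (h l)" unfolding marg by (rule h)
    then show ?thesis using Some integrable_distr[OF X] by (simp add: Y_def)
  qed (simp add: Y_def \<phi>)
  ultimately have *: "(\<integral>\<omega>. (\<Prod>i\<in>UNIV. Y i \<omega>) \<partial>M) = (\<Prod>i\<in>UNIV. expectation (Y i))" "integrable M (\<lambda>\<omega>. (\<Prod>i\<in>UNIV. Y i \<omega>))"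
    by (auto intro!: indep_vars_lebesgue_integral indep_vars_integrable)
  have "expectation (Y (Some l)) = (\<integral>x. h l x \<partial>\<nu> l)" for l
    unfolding marg[of l, symmetric] Y_def by (simp add: integral_distr[OF X h(1)])
  then show ?thesis using * \<phi> by (simp add: eqE_def prodU Y_def)
qed

end

section \<open>Filtrations and measurability of a run\<close>

lemma gen_measurable:
  assumes "gen M X N \<subseteq> sets F" "space F = space M" "X \<in> space M \<rightarrow> space N"
  shows "X \<in> F \<rightarrow>\<^sub>M N"
  using assms in_vimage_algebra[of _ N X "space M"] unfolding gen_def by (intro measurableI) auto

lemma gen_subset: "X \<in> M \<rightarrow>\<^sub>M N \<Longrightarrow> gen M X N \<subseteq> sets M"
  unfolding gen_def by (subst sets_vimage_algebra2) (auto dest: measurable_space measurable_sets)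

lemma gen_Pow: "gen M X N \<subseteq> Pow (space M)"
  unfolding gen_def using sets.space_closed[of "vimage_algebra (space M) X N"] by simp

lemma borel_blinfun_apply:
  assumes "H \<in> borel_measurable N"
  shows "(\<lambda>\<omega>. blinfun_apply (H \<omega>) v) \<in> borel_measurable N"
  using measurable_compose[OF assms borel_measurable_continuous_onI[of "\<lambda>h. blinfun_apply h v"]]
  by (simp add: linear_continuous_on blinfun.bounded_linear_left)

text \<open>Coordinates of the random argument turn the value into a finite sum, so measurability at
  fixed vectors suffices and no measurable structure on the space of operators is needed.\<close>

lemma borel_linear_apply:
  fixes H :: "'w \<Rightarrow> real ^ 'i::finite \<Rightarrow> real ^ 'k::finite"
  assumes lin: "\<And>\<omega>. linear (H \<omega>)" and H: "\<And>v. (\<lambda>\<omega>. H \<omega> v) \<in> borel_measurable N" and V: "V \<in> borel_measurable N"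
  shows "(\<lambda>\<omega>. H \<omega> (V \<omega>)) \<in> borel_measurable N"
proof (rule borel_measurable_vec)
  fix k
  show "(\<lambda>\<omega>. H \<omega> (V \<omega>) $ k) \<in> borel_measurable N"
    unfolding linear_coordinates[OF lin, where V = "V _"]
    by (intro borel_measurable_sum borel_measurable_times borel_vec_nth V H)
qed

section \<open>Measurability of the blockwise operations\<close>

context shaped
begin

lemma grad_lift:
  assumes "GDERIV F (x, y + lift D P B) :> grad F (x, y + lift D P B)"
  shows "grad (\<lambda>B. F (x, y + lift D P B)) B = compress D P (grad_y F x (y + lift D P B))"
proof (rule grad_eq)
  have bl: "bounded_linear (lift D P)" using lift_linear linear_conv_bounded_linear by blast
  have "((\<lambda>B. (x, y + lift D P B)) has_derivative (\<lambda>h. (0, lift D P h))) (at B)"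
    by (auto intro!: derivative_eq_intros bounded_linear_imp_has_derivative[OF bl])
  from has_derivative_compose[OF this assms[unfolded gderiv_def]]
  show "GDERIV (\<lambda>B. F (x, y + lift D P B)) B :> compress D P (grad_y F x (y + lift D P B))"
    unfolding gderiv_def by (simp add: inner_prod_def inner_lift grad_y_def)
qed

lemma borel_frame_entry:
  assumes "\<And>l. (\<lambda>\<omega>. P \<omega> l) \<in> N \<rightarrow>\<^sub>M mat_space (m l) (r l)" "i < m l" "a < r l"
  shows "(\<lambda>\<omega>. P \<omega> l (i, a)) \<in> borel_measurable N"
  using measurable_compose[OF assms(1)[of l, unfolded mat_space_def] measurable_component_singleton[of "(i, a)"]] assms
  by simp

lemma borel_block: "V \<in> borel_measurable N \<Longrightarrow> (\<lambda>\<omega>. block e (V \<omega>) l (i, j)) \<in> borel_measurable N"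
  unfolding block_def prod.case by (rule borel_vec_nth)

lemma borel_vecY:
  fixes V :: "'w \<Rightarrow> real ^ 'y"
  assumes "\<And>l i j. i < m l \<Longrightarrow> j < n l \<Longrightarrow> (\<lambda>\<omega>. blkY (V \<omega>) l (i, j)) \<in> borel_measurable N"
  shows "V \<in> borel_measurable N"
proof (rule borel_measurable_vec)
  fix c
  obtain l i j where c: "posY D c = (l, i, j)" by (cases "posY D c")
  show "(\<lambda>\<omega>. V \<omega> $ c) \<in> borel_measurable N"
    using assms[of i l j] pos_inv(3)[OF bijY c] by (simp add: nth_eq_block[OF bijY c])
qed

lemma borel_vecB:
  fixes V :: "'w \<Rightarrow> real ^ 'b"
  assumes "\<And>l i j. i < r l \<Longrightarrow> j < n l \<Longrightarrow> (\<lambda>\<omega>. blkB (V \<omega>) l (i, j)) \<in> borel_measurable N"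
  shows "V \<in> borel_measurable N"
proof (rule borel_measurable_vec)
  fix c
  obtain l i j where c: "posB D c = (l, i, j)" by (cases "posB D c")
  show "(\<lambda>\<omega>. V \<omega> $ c) \<in> borel_measurable N"
    using assms[of i l j] pos_inv(3)[OF bijB c] by (simp add: nth_eq_block[OF bijB c])
qed

lemma borel_lift:
  assumes "\<And>l. (\<lambda>\<omega>. P \<omega> l) \<in> N \<rightarrow>\<^sub>M mat_space (m l) (r l)" "B \<in> borel_measurable N"
  shows "(\<lambda>\<omega>. lift D (P \<omega>) (B \<omega>)) \<in> borel_measurable N"
  by (rule borel_vecY) (auto simp: block_lift intro!: borel_measurable_sum borel_measurable_times borel_frame_entry borel_block assms)

lemma borel_compress:
  assumes "\<And>l. (\<lambda>\<omega>. P \<omega> l) \<in> N \<rightarrow>\<^sub>M mat_space (m l) (r l)" "U \<in> borel_measurable N"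
  shows "(\<lambda>\<omega>. compress D (P \<omega>) (U \<omega>)) \<in> borel_measurable N"
  by (rule borel_vecB) (auto simp: block_compress intro!: borel_measurable_sum borel_measurable_times borel_frame_entry borel_block assms)

lemma borel_Ztil:
  assumes "\<And>l. (\<lambda>\<omega>. P \<omega> l) \<in> N \<rightarrow>\<^sub>M mat_space (m l) (r l)" "Z \<in> borel_measurable N" "a < r t"
  shows "(\<lambda>\<omega>. Ztil D (P \<omega>) (Z \<omega>) t (a, j)) \<in> borel_measurable N"
  unfolding Ztil_eq using assms(3) by (auto intro!: borel_measurable_sum borel_measurable_times borel_frame_entry borel_block assms)

lemma borel_hess_action:
  fixes H :: "'w \<Rightarrow> (real ^ 'b) \<Rightarrow>\<^sub>L (real ^ 'b)"
  assumes P: "\<And>l. (\<lambda>\<omega>. P \<omega> l) \<in> N \<rightarrow>\<^sub>M mat_space (m l) (r l)"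
    and H: "\<And>v. (\<lambda>\<omega>. blinfun_apply (H \<omega>) v) \<in> borel_measurable N"
    and u: "\<And>l j. j < n l \<Longrightarrow> (\<lambda>\<omega>. u \<omega> l j) \<in> borel_measurable N"
    and \<xi>: "\<And>l a. a < r l \<Longrightarrow> (\<lambda>\<omega>. \<xi> \<omega> l a) \<in> borel_measurable N"
    and Z: "Z \<in> borel_measurable N"
  shows "(\<lambda>\<omega>. hess_action D (P \<omega>) (H \<omega>) (u \<omega>) (\<xi> \<omega>) (Z \<omega>)) \<in> borel_measurable N"
proof (rule borel_vecY)
  fix l i j assume ij: "i < m l" "j < n l"
  note HV = borel_linear_apply[where H = "\<lambda>\<omega>. blinfun_apply (H \<omega>)", OF linear_blinfun H]
  have emb: "(\<lambda>\<omega>. embed_block D t (Ztil D (P \<omega>) (Z \<omega>) t)) \<in> borel_measurable N" for t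
  proof (rule borel_vecB)
    fix l i j assume "i < r l" "j < n l"
    then show "(\<lambda>\<omega>. blkB (embed_block D t (Ztil D (P \<omega>) (Z \<omega>) t)) l (i, j)) \<in> borel_measurable N"
      by (cases "l = t") (simp_all add: block_embed borel_Ztil P Z)
  qed
  have A: "(\<lambda>\<omega>. Ablk D (P \<omega>) (H \<omega>) (Z \<omega>) t l (i, j)) \<in> borel_measurable N" for t
    unfolding Ablk_def mm_def prod.case
    using ij by (auto intro!: borel_measurable_sum borel_measurable_times borel_frame_entry P borel_block HV emb)
  have out: "(\<lambda>\<omega>. unblock (posB D) (\<lambda>l. outer (\<xi> \<omega> l) (u \<omega> l)) :: real ^ 'b) \<in> borel_measurable N"
    by (rule borel_vecB) (auto simp: block_unblock[OF bijB] outer_def intro!: borel_measurable_times u \<xi>)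
  have Mb: "(\<lambda>\<omega>. Mblk D (H \<omega>) (u \<omega>) (\<xi> \<omega>) l (a, k)) \<in> borel_measurable N" for a k
    unfolding Mblk_def by (intro borel_block HV out)
  have C: "(\<lambda>\<omega>. Chat D (H \<omega>) (u \<omega>) (\<xi> \<omega>) (Z \<omega>) l (i, j)) \<in> borel_measurable N"
    unfolding Chat_def mm_def outer_def mv_def tr_def prod.case
    using ij by (auto intro!: borel_measurable_sum borel_measurable_times borel_block Z Mb u \<xi>)
  have B: "(\<lambda>\<omega>. Bhat D (P \<omega>) (H \<omega>) (u \<omega>) (\<xi> \<omega>) (Z \<omega>) l (i, j)) \<in> borel_measurable N"
    unfolding Bhat_def mm_def outer_def mv_def tr_def prod.case
    using ij by (auto intro!: borel_measurable_sum borel_measurable_times borel_frame_entry P Mb u \<xi> borel_Ztil Z)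
  show "(\<lambda>\<omega>. blkY (hess_action D (P \<omega>) (H \<omega>) (u \<omega>) (\<xi> \<omega>) (Z \<omega>)) l (i, j)) \<in> borel_measurable N"
    unfolding hess_action_def block_unblock[OF bijY ij] hess_diag_def Let_def
    by (intro borel_measurable_add borel_measurable_diff borel_measurable_times borel_measurable_const
        borel_measurable_sum A B C)
qed

end

section \<open>A fixed run of the algorithm\<close>

locale bros = shaped D + bilevel f g \<mu>g Lf0 Lf1 Lg1 Lg2
  for D :: "('l::finite, 'y::finite, 'b::finite) layout"
    and f g :: "(real ^ 'd::finite) \<times> (real ^ 'y) \<Rightarrow> real"
    and \<mu>g Lf0 Lf1 Lg1 Lg2 +
  fixes \<sigma>f1 \<sigma>f2 \<sigma>g1 \<sigma>g2 :: real and x0 :: "real ^ 'd" and Y0 Z0 :: "real ^ 'y"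
    and \<alpha> \<beta> \<gamma> \<theta> :: "nat \<Rightarrow> real"
    and S :: "('w, 'd, 'l, 'y, 'b) process"
  assumes run: "bros_run D f g \<sigma>f1 \<sigma>f2 \<sigma>g1 \<sigma>g2 x0 Y0 Z0 \<alpha> \<beta> \<gamma> \<theta> S"
begin

abbreviation "M \<equiv> pM S"

sublocale prob_space M using run unfolding bros_run_def by simp

definition "Vhat k \<omega> = lift D (pP S k \<omega>) (pV S (Suc k) \<omega>)"
definition "That k \<omega> = hess_action D (pP S k \<omega>) (pH S (Suc k) \<omega>) (pu S (Suc k) \<omega>) (pxi S (Suc k) \<omega>) (pZ S k \<omega>)
  - lift D (pP S k \<omega>) (pUY S (Suc k) \<omega>)"
definition "What k \<omega> = pUx S (Suc k) \<omega> - blinfun_apply (pJ S (Suc k) \<omega>) (compress D (pP S k \<omega>) (pZ S k \<omega>))"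

lemma init: "\<omega> \<in> space M \<Longrightarrow> px S 0 \<omega> = x0 \<and> pY S 0 \<omega> = Y0 \<and> pZ S 0 \<omega> = Z0 \<and> ph S 0 \<omega> = 0"
  using run unfolding bros_run_def bros_recursion_def by blast

lemma step:
  assumes "\<omega> \<in> space M"
  shows "px S (Suc k) \<omega> = px S k \<omega> - \<alpha> k *\<^sub>R ph S k \<omega>"
    "pY S (Suc k) \<omega> = pY S k \<omega> - \<beta> k *\<^sub>R Vhat k \<omega>"
    "pZ S (Suc k) \<omega> = pZ S k \<omega> - \<gamma> k *\<^sub>R That k \<omega>"
    "ph S (Suc k) \<omega> = (1 - \<theta> k) *\<^sub>R ph S k \<omega> + \<theta> k *\<^sub>R What k \<omega>"
  using run assms unfolding bros_run_def bros_recursion_def Vhat_def That_def What_def Let_def by blast+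

lemma P_measurable: "(\<lambda>\<omega>. pP S k \<omega> l) \<in> M \<rightarrow>\<^sub>M mat_space (m l) (r l)"
  using run unfolding bros_run_def haar_projectors_def by blast

lemma est_measurable: "pUx S (Suc k) \<in> borel_measurable M" "pUY S (Suc k) \<in> borel_measurable M"
  "pV S (Suc k) \<in> borel_measurable M" "pH S (Suc k) \<in> borel_measurable M" "pJ S (Suc k) \<in> borel_measurable M"
  using run unfolding bros_run_def estimator_moments_def Let_def by blast+

definition "probe_index = {Inl (l, j) | l j. j < n l} \<union> {Inr (l, a) | l a. a < r l}"
definition "probe k c \<omega> = (case c of Inl (l, j) \<Rightarrow> pu S (Suc k) \<omega> l j | Inr (l, a) \<Rightarrow> pxi S (Suc k) \<omega> l a)"

lemma probes: "c \<in> probe_index \<Longrightarrow> rademacher M (probe k c)" "indep_vars (\<lambda>_. borel) (probe k) probe_index"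
  "indep_set (sigma_sets (space M) (gen_probes D S (Suc k)))
     (sigma_sets (space M) (sets (FilP D S k) \<union> \<Union> (set (est_algebras S (Suc k)))))"
proof -
  have "rademacher_probes D S" using run unfolding bros_run_def by blast
  then have *: "(\<forall>c\<in>probe_index. rademacher M (probe k c)) \<and> indep_vars (\<lambda>_. borel) (probe k) probe_index \<and>
    indep_set (sigma_sets (space M) (gen_probes D S (Suc k)))
     (sigma_sets (space M) (sets (FilP D S k) \<union> \<Union> (set (est_algebras S (Suc k)))))"
    unfolding rademacher_probes_def Let_def probe_index_def probe_def by blast
  show "c \<in> probe_index \<Longrightarrow> rademacher M (probe k c)" "indep_vars (\<lambda>_. borel) (probe k) probe_index"
    "indep_set (sigma_sets (space M) (gen_probes D S (Suc k)))
     (sigma_sets (space M) (sets (FilP D S k) \<union> \<Union> (set (est_algebras S (Suc k)))))"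
    using * by blast+
qed

lemma probe_index_iff: "Inl (l, j) \<in> probe_index \<longleftrightarrow> j < n l" "Inr (l, a) \<in> probe_index \<longleftrightarrow> a < r l"
  by (auto simp: probe_index_def)

lemma finite_probe_index: "finite probe_index"
proof -
  have "probe_index \<subseteq> Inl ` (UNIV \<times> {..<Max (range n)}) \<union> Inr ` (UNIV \<times> {..<Max (range r)})"
    unfolding probe_index_def by (auto intro!: image_eqI intro: less_le_trans)
  then show ?thesis by (rule finite_subset) auto
qed

lemma probe_measurable: "j < n l \<Longrightarrow> (\<lambda>\<omega>. pu S (Suc k) \<omega> l j) \<in> borel_measurable M"
  "a < r l \<Longrightarrow> (\<lambda>\<omega>. pxi S (Suc k) \<omega> l a) \<in> borel_measurable M"
  using probes(1)[of "Inl (l, j)" k] probes(1)[of "Inr (l, a)" k]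
  by (auto simp: probe_index_iff rademacher_def probe_def[abs_def])

lemma probe_AE: "c \<in> probe_index \<Longrightarrow> AE \<omega> in M. probe k c \<omega> = 1 \<or> probe k c \<omega> = - 1"
proof -
  assume c: "c \<in> probe_index"
  have r: "probe k c \<in> borel_measurable M" "prob {\<omega> \<in> space M. probe k c \<omega> = 1} = 1 / 2"
    "prob {\<omega> \<in> space M. probe k c \<omega> = - 1} = 1 / 2"
    using probes(1)[OF c, of k] by (auto simp: rademacher_def)
  have s: "{\<omega> \<in> space M. probe k c \<omega> = v} \<in> events" for v using r(1) by measurable
  have "prob ({\<omega> \<in> space M. probe k c \<omega> = 1} \<union> {\<omega> \<in> space M. probe k c \<omega> = - 1}) = 1"
    by (subst finite_measure_Union) (use s r in auto)
  then have "AE \<omega> in M. \<omega> \<in> {\<omega> \<in> space M. probe k c \<omega> = 1} \<union> {\<omega> \<in> space M. probe k c \<omega> = - 1}"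
    using s by (intro AE_prob_1) auto
  then show ?thesis by eventually_elim auto
qed

text \<open>Powers are needed because a product of four probe entries may contain the same sign
  several times.\<close>

lemma probe_mean: "c \<in> probe_index \<Longrightarrow> integrable M (\<lambda>\<omega>. probe k c \<omega> ^ e) \<and> expectation (\<lambda>\<omega>. probe k c \<omega> ^ e) = of_bool (even e)"
proof -
  assume c: "c \<in> probe_index"
  let ?A = "{\<omega> \<in> space M. probe k c \<omega> = 1}" and ?B = "{\<omega> \<in> space M. probe k c \<omega> = - 1}"
  have r: "probe k c \<in> borel_measurable M" "prob ?A = 1 / 2" "prob ?B = 1 / 2"
    using probes(1)[OF c, of k] by (auto simp: rademacher_def)
  have s: "{\<omega> \<in> space M. probe k c \<omega> = v} \<in> events" for v using r(1) by measurable
  have AE: "AE \<omega> in M. probe k c \<omega> ^ e = indicator ?A \<omega> + (- 1) ^ e * indicator ?B \<omega>"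
    using probe_AE[OF c, of k] by (rule AE_mp) (auto simp: indicator_def)
  have m: "(\<lambda>\<omega>. probe k c \<omega> ^ e) \<in> borel_measurable M" using r by measurable
  have m': "(\<lambda>\<omega>. indicator ?A \<omega> + (- 1) ^ e * indicator ?B \<omega> :: real) \<in> borel_measurable M"
    using s by (intro borel_measurable_add borel_measurable_times borel_measurable_const borel_measurable_indicator) auto
  have i: "integrable M (indicator {\<omega> \<in> space M. probe k c \<omega> = v} :: _ \<Rightarrow> real)" for v
    using s by (simp add: integrable_indicator_iff less_top[symmetric])
  have "integrable M (\<lambda>\<omega>. indicator ?A \<omega> + (- 1) ^ e * indicator ?B \<omega> :: real)" using i by simp
  moreover have "expectation (\<lambda>\<omega>. indicator ?A \<omega> + (- 1) ^ e * indicator ?B \<omega> :: real) = prob ?A + (- 1) ^ e * prob ?B"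
    using i s by simp
  moreover have "\<dots> = 1 / 2 + (- 1) ^ e * (1 / 2)" unfolding r(2,3) ..
  ultimately show ?thesis
    using integrable_cong_AE[OF m m' AE] integral_cong_AE[OF m m' AE] by (cases "even e") auto
qed

lemma bounded_probes_AE: "AE \<omega> in M. bounded_probes (pu S (Suc k) \<omega>) (pxi S (Suc k) \<omega>)"
proof -
  have "AE \<omega> in M. \<forall>c\<in>probe_index. probe k c \<omega> = 1 \<or> probe k c \<omega> = - 1"
    using finite_probe_index probe_AE by (intro AE_finite_allI) auto
  then show ?thesis
  proof eventually_elim
    case (elim \<omega>)
    show ?case unfolding bounded_probes_def
    proof (intro allI conjI impI)
      fix l j assume "j < n l"
      then show "\<bar>pu S (Suc k) \<omega> l j\<bar> \<le> 1" using elim[THEN bspec, of "Inl (l, j)"] by (auto simp: probe_index_iff probe_def)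
    next
      fix l a assume "a < r l"
      then show "\<bar>pxi S (Suc k) \<omega> l a\<bar> \<le> 1" using elim[THEN bspec, of "Inr (l, a)"] by (auto simp: probe_index_iff probe_def)
    qed
  qed
qed

lemma Vhat_measurable: "Vhat k \<in> borel_measurable M"
  unfolding Vhat_def[abs_def] by (intro borel_lift P_measurable est_measurable)

lemma That_measurable: "pZ S k \<in> borel_measurable M \<Longrightarrow> That k \<in> borel_measurable M"
  unfolding That_def[abs_def]
  by (intro borel_measurable_diff borel_hess_action borel_lift P_measurable est_measurable borel_blinfun_apply probe_measurable)

lemma What_measurable: "pZ S k \<in> borel_measurable M \<Longrightarrow> What k \<in> borel_measurable M"
  unfolding What_def[abs_def]
  by (rule borel_measurable_diff[OF est_measurable(1)
      borel_linear_apply[where H = "\<lambda>\<omega>. blinfun_apply (pJ S (Suc k) \<omega>)", OF linear_blinfun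
        borel_blinfun_apply[OF est_measurable(5)] borel_compress[OF P_measurable]]])

lemma states_measurable:
  "px S k \<in> borel_measurable M \<and> pY S k \<in> borel_measurable M \<and> pZ S k \<in> borel_measurable M \<and> ph S k \<in> borel_measurable M"
proof (induction k)
  case 0
  show ?case
    using init measurable_cong[of M "px S 0" "\<lambda>_. x0" borel] measurable_cong[of M "pY S 0" "\<lambda>_. Y0" borel]
      measurable_cong[of M "pZ S 0" "\<lambda>_. Z0" borel] measurable_cong[of M "ph S 0" "\<lambda>_. 0" borel] by simp
next
  case (Suc k)
  then have m: "px S k \<in> borel_measurable M" "pY S k \<in> borel_measurable M" "pZ S k \<in> borel_measurable M" "ph S k \<in> borel_measurable M"
    by auto
  have "(\<lambda>\<omega>. px S k \<omega> - \<alpha> k *\<^sub>R ph S k \<omega>) \<in> borel_measurable M"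
    "(\<lambda>\<omega>. pY S k \<omega> - \<beta> k *\<^sub>R Vhat k \<omega>) \<in> borel_measurable M"
    "(\<lambda>\<omega>. pZ S k \<omega> - \<gamma> k *\<^sub>R That k \<omega>) \<in> borel_measurable M"
    "(\<lambda>\<omega>. (1 - \<theta> k) *\<^sub>R ph S k \<omega> + \<theta> k *\<^sub>R What k \<omega>) \<in> borel_measurable M"
    using m by (auto intro!: borel_measurable_diff borel_measurable_add borel_measurable_scaleR
        Vhat_measurable That_measurable What_measurable)
  then show ?case
    using measurable_cong[of M "px S (Suc k)", OF step(1)] measurable_cong[of M "pY S (Suc k)", OF step(2)]
      measurable_cong[of M "pZ S (Suc k)", OF step(3)] measurable_cong[of M "ph S (Suc k)", OF step(4)] by blast
qed

section \<open>The filtrations as subalgebras\<close>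

lemma sets_Fil: "space (Fil D S k) = space M" "sets (Fil D S k) = sigma_sets (space M) ((\<Union>i\<le>k. gen_states S i) \<union> (\<Union>i<k. gen_P D S i))"
  and sets_FilP: "space (FilP D S k) = space M" "sets (FilP D S k) = sigma_sets (space M) (sets (Fil D S k) \<union> gen_P D S k)"
  and sets_FilPP: "space (FilPP D S k) = space M" "sets (FilPP D S k) = sigma_sets (space M) (sets (FilP D S k) \<union> gen_probes D S (Suc k))"
proof -
  have st: "gen_states S i \<subseteq> Pow (space M)" "gen_P D S i \<subseteq> Pow (space M)" "gen_probes D S i \<subseteq> Pow (space M)" for i
    unfolding gen_states_def gen_P_def gen_probes_def by (intro Un_least UN_least gen_Pow)+
  have 1: "(\<Union>i\<le>k. gen_states S i) \<union> (\<Union>i<k. gen_P D S i) \<subseteq> Pow (space M)" using st by blast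
  then show F: "space (Fil D S k) = space M" "sets (Fil D S k) = sigma_sets (space M) ((\<Union>i\<le>k. gen_states S i) \<union> (\<Union>i<k. gen_P D S i))"
    unfolding Fil_def by (simp_all add: space_measure_of sets_measure_of)
  have 2: "sets (Fil D S k) \<union> gen_P D S k \<subseteq> Pow (space M)" using st sets.space_closed[of "Fil D S k"] F(1) by auto
  then show FP: "space (FilP D S k) = space M" "sets (FilP D S k) = sigma_sets (space M) (sets (Fil D S k) \<union> gen_P D S k)"
    unfolding FilP_def by (simp_all add: space_measure_of sets_measure_of)
  have "sets (FilP D S k) \<union> gen_probes D S (Suc k) \<subseteq> Pow (space M)" using st sets.space_closed[of "FilP D S k"] FP(1) by auto
  then show "space (FilPP D S k) = space M" "sets (FilPP D S k) = sigma_sets (space M) (sets (FilP D S k) \<union> gen_probes D S (Suc k))"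
    unfolding FilPP_def by (simp_all add: space_measure_of sets_measure_of)
qed

lemma gens_subset: "gen_states S i \<subseteq> sets M" "gen_P D S i \<subseteq> sets M" "gen_probes D S (Suc i) \<subseteq> sets M"
  unfolding gen_states_def gen_P_def gen_probes_def using states_measurable[of i]
  by (intro Un_least UN_least gen_subset P_measurable probe_measurable; simp)+

lemma subalg: "subalgebra M (Fil D S k)" "subalgebra M (FilP D S k)" "subalgebra M (FilPP D S k)"
  "sets (Fil D S k) \<subseteq> sets (FilP D S k)" "sets (FilP D S k) \<subseteq> sets (FilPP D S k)"
proof -
  have 1: "sets (Fil D S k) \<subseteq> sets M"
    unfolding sets_Fil(2) using gens_subset by (intro sets.sigma_sets_subset) blast
  have 2: "sets (FilP D S k) \<subseteq> sets M"
    unfolding sets_FilP(2) using gens_subset 1 by (intro sets.sigma_sets_subset) blast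
  have 3: "sets (FilPP D S k) \<subseteq> sets M"
    unfolding sets_FilPP(2) using gens_subset 2 by (intro sets.sigma_sets_subset) blast
  show "subalgebra M (Fil D S k)" "subalgebra M (FilP D S k)" "subalgebra M (FilPP D S k)"
    using 1 2 3 sets_Fil(1) sets_FilP(1) sets_FilPP(1) by (simp_all add: subalgebra_def)
  show "sets (Fil D S k) \<subseteq> sets (FilP D S k)" "sets (FilP D S k) \<subseteq> sets (FilPP D S k)"
    unfolding sets_FilP(2) sets_FilPP(2) by auto
qed

lemma Fil_FilP: "X \<in> Fil D S k \<rightarrow>\<^sub>M N \<Longrightarrow> X \<in> FilP D S k \<rightarrow>\<^sub>M N"
  and FilP_FilPP: "X \<in> FilP D S k \<rightarrow>\<^sub>M N \<Longrightarrow> X \<in> FilPP D S k \<rightarrow>\<^sub>M N"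
  using subalg(4,5) measurable_mono[of N N "Fil D S k" "FilP D S k"] measurable_mono[of N N "FilP D S k" "FilPP D S k"]
  by (auto simp: sets_Fil(1) sets_FilP(1) sets_FilPP(1))

lemma Fil_M: "X \<in> Fil D S k \<rightarrow>\<^sub>M N \<Longrightarrow> X \<in> M \<rightarrow>\<^sub>M N"
  and FilP_M: "X \<in> FilP D S k \<rightarrow>\<^sub>M N \<Longrightarrow> X \<in> M \<rightarrow>\<^sub>M N"
  and FilPP_M: "X \<in> FilPP D S k \<rightarrow>\<^sub>M N \<Longrightarrow> X \<in> M \<rightarrow>\<^sub>M N"
  using subalg(1-3) measurable_from_subalg by blast+

lemma states_Fil: "px S k \<in> borel_measurable (Fil D S k)" "pY S k \<in> borel_measurable (Fil D S k)"
  "pZ S k \<in> borel_measurable (Fil D S k)" "ph S k \<in> borel_measurable (Fil D S k)"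
  by (rule gen_measurable[where M = M]; use sets_Fil[of k] in \<open>force simp: gen_states_def intro: sigma_sets.Basic\<close>)+

lemma P_FilP: "(\<lambda>\<omega>. pP S k \<omega> l) \<in> FilP D S k \<rightarrow>\<^sub>M mat_space (m l) (r l)"
proof (rule gen_measurable[where M = M])
  show "gen M (\<lambda>\<omega>. pP S k \<omega> l) (mat_space (m l) (r l)) \<subseteq> sets (FilP D S k)"
    unfolding sets_FilP gen_P_def by (auto intro: sigma_sets.Basic)
  show "(\<lambda>\<omega>. pP S k \<omega> l) \<in> space M \<rightarrow> space (mat_space (m l) (r l))"
    using measurable_space[OF P_measurable] by auto
qed (simp add: sets_FilP)

lemma probes_FilPP: "j < n l \<Longrightarrow> (\<lambda>\<omega>. pu S (Suc k) \<omega> l j) \<in> borel_measurable (FilPP D S k)"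
  "a < r l \<Longrightarrow> (\<lambda>\<omega>. pxi S (Suc k) \<omega> l a) \<in> borel_measurable (FilPP D S k)"
proof -
  assume j: "j < n l"
  have "gen M (\<lambda>\<omega>. pu S (Suc k) \<omega> l j) borel \<subseteq> sets (FilPP D S k)"
    unfolding sets_FilPP gen_probes_def using j by (blast intro: sigma_sets.Basic)
  then show "(\<lambda>\<omega>. pu S (Suc k) \<omega> l j) \<in> borel_measurable (FilPP D S k)"
    by (rule gen_measurable) (simp_all add: sets_FilPP)
next
  assume a: "a < r l"
  have "gen M (\<lambda>\<omega>. pxi S (Suc k) \<omega> l a) borel \<subseteq> sets (FilPP D S k)"
    unfolding sets_FilPP gen_probes_def using a by (blast intro: sigma_sets.Basic)
  then show "(\<lambda>\<omega>. pxi S (Suc k) \<omega> l a) \<in> borel_measurable (FilPP D S k)"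
    by (rule gen_measurable) (simp_all add: sets_FilPP)
qed

end

section \<open>Projected derivatives and conditional expectations\<close>

lemma continuous_on_pair:
  fixes H :: "'a::real_normed_vector \<Rightarrow> 'b::real_normed_vector \<Rightarrow> 'c::real_normed_vector"
  assumes L: "\<And>x y x' y'. norm (H x y - H x' y') \<le> C * (norm (x - x') + norm (y - y'))" and "0 \<le> C"
  shows "continuous_on UNIV (\<lambda>z. H (fst z) (snd z))"
proof (rule lipschitz_on_continuous_on)
  show "(C * 2)-lipschitz_on UNIV (\<lambda>z. H (fst z) (snd z))"
  proof (rule lipschitz_onI)
    fix z z' :: "'a \<times> 'b"
    have "norm (fst z - fst z') + norm (snd z - snd z') \<le> 2 * norm (z - z')"
      using norm_fst_diff_le[of z z'] norm_snd_diff_le[of z z'] by linarith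
    then have "C * (norm (fst z - fst z') + norm (snd z - snd z')) \<le> C * (2 * norm (z - z'))"
      using \<open>0 \<le> C\<close> by (rule mult_left_mono)
    then show "dist (H (fst z) (snd z)) (H (fst z') (snd z')) \<le> C * 2 * dist z z'"
      using L[of "fst z" "snd z" "fst z'" "snd z'"] by (simp add: dist_norm mult.assoc)
  qed (use \<open>0 \<le> C\<close> in simp)
qed

lemma borel_pair:
  fixes H :: "'a::euclidean_space \<Rightarrow> 'b::euclidean_space \<Rightarrow> 'c::euclidean_space"
  assumes L: "\<And>x y x' y'. norm (H x y - H x' y') \<le> C * (norm (x - x') + norm (y - y'))" "0 \<le> C"
    and X: "X \<in> borel_measurable N" and Y: "Y \<in> borel_measurable N"
  shows "(\<lambda>\<omega>. H (X \<omega>) (Y \<omega>)) \<in> borel_measurable N"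
  using borel_measurable_continuous_Pair[OF X Y continuous_on_pair[OF L]] by simp

text \<open>A Lipschitz map grows at most linearly away from its value at the origin, and constants
  are square integrable for a finite measure.\<close>

lemma (in finite_measure) sq_int_pair:
  fixes H :: "'b::euclidean_space \<Rightarrow> 'c::euclidean_space \<Rightarrow> 'e::euclidean_space"
  assumes L: "\<And>x y x' y'. norm (H x y - H x' y') \<le> C * (norm (x - x') + norm (y - y'))" "0 \<le> C"
    and X: "sq_int M X" and Y: "sq_int M Y"
  shows "sq_int M (\<lambda>\<omega>. H (X \<omega>) (Y \<omega>))"
proof (rule sq_int_bound(1)[where C = 1])
  show "(\<lambda>\<omega>. H (X \<omega>) (Y \<omega>)) \<in> borel_measurable M"
    by (rule borel_pair[OF L]) (use X Y sq_intD in auto)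
  show "sq_int M (\<lambda>\<omega>. norm (H 0 0) + (C *\<^sub>R norm (X \<omega>) + C *\<^sub>R norm (Y \<omega>)))"
    by (intro sq_int_add sq_int_scaleR sq_int_norm X Y sq_int_const)
  show "AE \<omega> in M. norm (H (X \<omega>) (Y \<omega>)) \<le> 1 * norm (norm (H 0 0) + (C *\<^sub>R norm (X \<omega>) + C *\<^sub>R norm (Y \<omega>)))"
  proof (rule AE_I2)
    fix \<omega>
    have "norm (H (X \<omega>) (Y \<omega>)) \<le> norm (H 0 0) + C * (norm (X \<omega>) + norm (Y \<omega>))"
      using norm_triangle_sub[of "H (X \<omega>) (Y \<omega>)" "H 0 0"] L(1)[of "X \<omega>" "Y \<omega>" 0 0] by simp
    then show "norm (H (X \<omega>) (Y \<omega>)) \<le> 1 * norm (norm (H 0 0) + (C *\<^sub>R norm (X \<omega>) + C *\<^sub>R norm (Y \<omega>)))"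
      using \<open>0 \<le> C\<close> by (simp add: algebra_simps abs_of_nonneg)
  qed
qed

context prob_space
begin

lemma indep_set_eqE':
  assumes ind: "indep_set G1 G2"
    and f: "f \<in> borel_measurable A2" "sets A2 \<subseteq> G2" "space A2 = space M" "integrable M f"
    and g: "g \<in> borel_measurable A1" "sets A1 \<subseteq> G1" "space A1 = space M" "integrable M g"
  shows "eqE M (\<lambda>\<omega>. f \<omega> * g \<omega>) (\<lambda>\<omega>. f \<omega> * expectation g)"
proof -
  have "indep_set G2 G1"
  proof (rule indep_setI)
    fix a b assume "a \<in> G2" "b \<in> G1"
    then have "prob (b \<inter> a) = prob b * prob a" by (intro indep_setD[OF ind])
    then show "prob (a \<inter> b) = prob a * prob b" by (simp add: Int_commute mult.commute)
  qed (rule indep_setD_ev1[OF ind] indep_setD_ev2[OF ind])+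
  from indep_set_eqE[OF this f g] show ?thesis .
qed

end

context bilevel
begin

lemma borel_grads:
  assumes "X \<in> borel_measurable N" "Y \<in> borel_measurable N"
  shows "(\<lambda>\<omega>. grad_x f (X \<omega>) (Y \<omega>)) \<in> borel_measurable N"
    "(\<lambda>\<omega>. grad_y f (X \<omega>) (Y \<omega>)) \<in> borel_measurable N"
    "(\<lambda>\<omega>. grad_y g (X \<omega>) (Y \<omega>)) \<in> borel_measurable N"
    "(\<lambda>\<omega>. hess_yy g (X \<omega>) (Y \<omega>) v) \<in> borel_measurable N"
    "(\<lambda>\<omega>. jac_xy g (X \<omega>) (Y \<omega>) v) \<in> borel_measurable N"
proof -
  show "(\<lambda>\<omega>. grad_x f (X \<omega>) (Y \<omega>)) \<in> borel_measurable N"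
    by (rule borel_pair[OF grad_lipschitz(2) _ assms]) (use pos in auto)
  show "(\<lambda>\<omega>. grad_y f (X \<omega>) (Y \<omega>)) \<in> borel_measurable N"
    by (rule borel_pair[OF grad_lipschitz(1) _ assms]) (use pos in auto)
  show "(\<lambda>\<omega>. grad_y g (X \<omega>) (Y \<omega>)) \<in> borel_measurable N"
    by (rule borel_pair[OF grad_lipschitz(3) _ assms]) (use pos in auto)
  have lip: "norm (hess_yy g x y v - hess_yy g x' y' v) \<le> (Lg2 * norm v) * (norm (x - x') + norm (y - y'))"
    "norm (jac_xy g x y v - jac_xy g x' y' v) \<le> (Lg2 * norm v) * (norm (x - x') + norm (y - y'))" for x y x' y'
    using hess_yy_lipschitz[of x y v x' y'] jac_xy_lipschitz[of x y v x' y'] by (simp_all add: ac_simps)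
  show "(\<lambda>\<omega>. hess_yy g (X \<omega>) (Y \<omega>) v) \<in> borel_measurable N"
    by (rule borel_pair[OF lip(1) _ assms]) (use pos in auto)
  show "(\<lambda>\<omega>. jac_xy g (X \<omega>) (Y \<omega>) v) \<in> borel_measurable N"
    by (rule borel_pair[OF lip(2) _ assms]) (use pos in auto)
qed

end

context shaped
begin

definition "cP = KK * (NN * NN)"

lemma cP_nonneg: "0 \<le> cP"
  using nonneg by (simp add: cP_def)

lemma lift_le: "bounded_frames P \<Longrightarrow> norm (lift D P B) \<le> cP * norm B"
  and compress_le: "bounded_frames P \<Longrightarrow> norm (compress D P U) \<le> cP * norm U"
  using lift_bound[of P B] compress_bound[of P U] by (simp_all add: cP_def ac_simps)

end

section \<open>Derivatives of the projected functions\<close>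

context bros
begin

lemma projected_grad_x: "grad (\<lambda>x. projected D S f k \<omega> (x, 0)) (px S k \<omega>) = grad_x f (px S k \<omega>) (pY S k \<omega>)"
  unfolding projected_def prod.case linear_0[OF lift_linear] add_0_right grad_x_def
  by (rule grad_eq[OF GDERIV_fst[OF GDERIV_f]])

lemma projected_grad_B:
  "grad (\<lambda>B. projected D S f k \<omega> (x, B)) B = compress D (pP S k \<omega>) (grad_y f x (pY S k \<omega> + lift D (pP S k \<omega>) B))"
  "grad (\<lambda>B. projected D S g k \<omega> (x, B)) B = compress D (pP S k \<omega>) (grad_y g x (pY S k \<omega> + lift D (pP S k \<omega>) B))"
  unfolding projected_def prod.case by (rule grad_lift[OF GDERIV_f] grad_lift[OF GDERIV_g])+

definition "HB k \<omega> = hess (\<lambda>B. projected D S g k \<omega> (px S k \<omega>, B)) 0"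

text \<open>Two applications of the chain rule: lifting is the inner linear map, and its adjoint
  comes out in front as the compression. At \<open>0\<close> the lift vanishes, so the base point is
  the current iterate.\<close>

lemma HB_apply: "blinfun_apply (HB k \<omega>) W
   = compress D (pP S k \<omega>) (hess_yy g (px S k \<omega>) (pY S k \<omega>) (lift D (pP S k \<omega>) W))"
proof -
  let ?P = "pP S k \<omega>" and ?x = "px S k \<omega>" and ?y = "pY S k \<omega>"
  let ?F = "\<lambda>B. projected D S g k \<omega> (?x, B)"
  have bl: "bounded_linear (lift D ?P)" using lift_linear linear_conv_bounded_linear by blast
  have bc: "bounded_linear (compress D ?P)" using compress_linear linear_conv_bounded_linear by blast
  have d1: "((\<lambda>B. (?x, ?y + lift D ?P B)) has_derivative (\<lambda>h. (0, lift D ?P h))) (at 0)"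
    by (auto intro!: derivative_eq_intros bounded_linear_imp_has_derivative[OF bl])
  have d2: "((\<lambda>B. grad g (?x, ?y + lift D ?P B)) has_derivative (\<lambda>h. hess g (?x, ?y) (0, lift D ?P h))) (at 0)"
    using has_derivative_compose[OF d1 hess_g] by (simp add: linear_0[OF lift_linear])
  have d3: "((\<lambda>B. compress D ?P (snd (grad g (?x, ?y + lift D ?P B))))
      has_derivative (\<lambda>h. compress D ?P (snd (hess g (?x, ?y) (0, lift D ?P h))))) (at 0)"
    by (rule bounded_linear.has_derivative[OF bc has_derivative_snd[OF d2]])
  have eq: "grad ?F = (\<lambda>B. compress D ?P (snd (grad g (?x, ?y + lift D ?P B))))"
    unfolding projected_grad_B grad_y_def ..
  have fd: "frechet_derivative (grad ?F) (at 0) = (\<lambda>h. compress D ?P (snd (hess g (?x, ?y) (0, lift D ?P h))))"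
    unfolding eq by (rule frechet_derivative_at[OF d3, symmetric])
  have "HB k \<omega> = Blinfun (\<lambda>h. compress D ?P (snd (hess g (?x, ?y) (0, lift D ?P h))))"
    unfolding HB_def hess_def[of ?F] fd ..
  then show ?thesis
    using has_derivative_bounded_linear[OF d3] by (simp add: bounded_linear_Blinfun_apply hess_yy_def)
qed

text \<open>The Jacobian is defined as an adjoint, so it is identified through its inner products;
  symmetry of the full Hessian of \<open>g\<close> exchanges the order of the mixed
  derivatives.\<close>

lemma projected_jac: "hess_xY (projected D S g k \<omega>) (px S k \<omega>) 0 W
   = jac_xy g (px S k \<omega>) (pY S k \<omega>) (lift D (pP S k \<omega>) W)"
proof -
  let ?P = "pP S k \<omega>" and ?x = "px S k \<omega>" and ?y = "pY S k \<omega>"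
  have bc: "bounded_linear (compress D ?P)" using compress_linear linear_conv_bounded_linear by blast
  have d1: "((\<lambda>x. (x, ?y)) has_derivative (\<lambda>h. (h, 0))) (at ?x)" by (auto intro!: derivative_eq_intros)
  have d3: "((\<lambda>x. compress D ?P (snd (grad g (x, ?y)))) has_derivative (\<lambda>h. compress D ?P (snd (hess g (?x, ?y) (h, 0))))) (at ?x)"
    by (rule bounded_linear.has_derivative[OF bc has_derivative_snd[OF has_derivative_compose[OF d1 hess_g]]])
  have eq: "(\<lambda>x'. grad (\<lambda>y'. projected D S g k \<omega> (x', y')) 0) = (\<lambda>x. compress D ?P (snd (grad g (x, ?y))))"
    by (simp add: projected_grad_B linear_0[OF lift_linear] grad_y_def)
  have fd: "frechet_derivative (\<lambda>x'. grad (\<lambda>y'. projected D S g k \<omega> (x', y')) 0) (at ?x)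
     = (\<lambda>h. compress D ?P (snd (hess g (?x, ?y) (h, 0))))"
    unfolding eq by (rule frechet_derivative_at[OF d3, symmetric])
  have "adjoint (\<lambda>h. compress D ?P (snd (hess g (?x, ?y) (h, 0)))) = (\<lambda>W. jac_xy g ?x ?y (lift D ?P W))"
  proof (rule adjoint_unique, intro allI)
    fix h W
    have "inner (compress D ?P (snd (hess g (?x, ?y) (h, 0)))) W = inner (lift D ?P W) (snd (hess g (?x, ?y) (h, 0)))"
      by (simp add: inner_lift inner_commute)
    also have "\<dots> = inner (hess g (?x, ?y) (h, 0)) (0, lift D ?P W)" by (simp add: inner_prod_def inner_commute)
    also have "\<dots> = inner h (jac_xy g ?x ?y (lift D ?P W))"
      unfolding hess_symmetric by (simp add: inner_prod_def jac_xy_def)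
    finally show "inner (compress D ?P (snd (hess g (?x, ?y) (h, 0)))) W = inner h (jac_xy g ?x ?y (lift D ?P W))" .
  qed
  then show ?thesis unfolding hess_xY_def fd by simp
qed

abbreviation "gX k \<omega> \<equiv> grad_x f (px S k \<omega>) (pY S k \<omega>)"
abbreviation "gF k \<omega> \<equiv> grad_y f (px S k \<omega>) (pY S k \<omega>)"
abbreviation "gG k \<omega> \<equiv> grad_y g (px S k \<omega>) (pY S k \<omega>)"
abbreviation "HY k \<omega> \<equiv> hess_yy g (px S k \<omega>) (pY S k \<omega>)"
abbreviation "JY k \<omega> \<equiv> jac_xy g (px S k \<omega>) (pY S k \<omega>)"

lemma estimators:
  "has_cond_mean M (FilP D S k) (pUx S (Suc k)) (gX k)"
  "cond_msd_le M (FilP D S k) (pUx S (Suc k)) (gX k) (\<lambda>_. \<sigma>f1\<^sup>2)"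
  "has_cond_mean M (FilP D S k) (pUY S (Suc k)) (\<lambda>\<omega>. compress D (pP S k \<omega>) (gF k \<omega>))"
  "cond_msd_le M (FilP D S k) (pUY S (Suc k)) (\<lambda>\<omega>. compress D (pP S k \<omega>) (gF k \<omega>)) (\<lambda>_. \<sigma>f2\<^sup>2)"
  "has_cond_mean M (FilP D S k) (pV S (Suc k)) (\<lambda>\<omega>. compress D (pP S k \<omega>) (gG k \<omega>))"
  "cond_msd_le M (FilP D S k) (pV S (Suc k)) (\<lambda>\<omega>. compress D (pP S k \<omega>) (gG k \<omega>)) (\<lambda>_. \<sigma>g1\<^sup>2)"
  and estimators_H: "\<And>W. W \<in> borel_measurable (FilPP D S k) \<Longrightarrow>
     has_cond_mean M (FilPP D S k) (\<lambda>\<omega>. pH S (Suc k) \<omega> (W \<omega>)) (\<lambda>\<omega>. HB k \<omega> (W \<omega>))"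
  "\<And>W. W \<in> borel_measurable (FilPP D S k) \<Longrightarrow>
     cond_msd_le M (FilPP D S k) (\<lambda>\<omega>. pH S (Suc k) \<omega> (W \<omega>)) (\<lambda>\<omega>. HB k \<omega> (W \<omega>)) (\<lambda>\<omega>. \<sigma>g2\<^sup>2 * (norm (W \<omega>))\<^sup>2)"
  and estimators_J: "\<And>W. W \<in> borel_measurable (FilPP D S k) \<Longrightarrow>
     has_cond_mean M (FilPP D S k) (\<lambda>\<omega>. pJ S (Suc k) \<omega> (W \<omega>)) (\<lambda>\<omega>. JY k \<omega> (lift D (pP S k \<omega>) (W \<omega>)))"
  "\<And>W. W \<in> borel_measurable (FilPP D S k) \<Longrightarrow>
     cond_msd_le M (FilPP D S k) (\<lambda>\<omega>. pJ S (Suc k) \<omega> (W \<omega>)) (\<lambda>\<omega>. JY k \<omega> (lift D (pP S k \<omega>) (W \<omega>))) (\<lambda>\<omega>. \<sigma>g2\<^sup>2 * (norm (W \<omega>))\<^sup>2)"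
proof -
  have em: "estimator_moments D f g \<sigma>f1 \<sigma>f2 \<sigma>g1 \<sigma>g2 S" using run unfolding bros_run_def by blast
  have l0: "lift D P 0 = 0" for P by (rule linear_0[OF lift_linear])
  note e = em[unfolded estimator_moments_def Let_def projected_grad_x projected_grad_B projected_jac l0 add_0_right,
      folded HB_def, rule_format, of k]
  show "has_cond_mean M (FilP D S k) (pUx S (Suc k)) (gX k)"
    "cond_msd_le M (FilP D S k) (pUx S (Suc k)) (gX k) (\<lambda>_. \<sigma>f1\<^sup>2)"
    "has_cond_mean M (FilP D S k) (pUY S (Suc k)) (\<lambda>\<omega>. compress D (pP S k \<omega>) (gF k \<omega>))"
    "cond_msd_le M (FilP D S k) (pUY S (Suc k)) (\<lambda>\<omega>. compress D (pP S k \<omega>) (gF k \<omega>)) (\<lambda>_. \<sigma>f2\<^sup>2)"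
    "has_cond_mean M (FilP D S k) (pV S (Suc k)) (\<lambda>\<omega>. compress D (pP S k \<omega>) (gG k \<omega>))"
    "cond_msd_le M (FilP D S k) (pV S (Suc k)) (\<lambda>\<omega>. compress D (pP S k \<omega>) (gG k \<omega>)) (\<lambda>_. \<sigma>g1\<^sup>2)"
    using e by blast+
  fix W :: "'w \<Rightarrow> real ^ 'b" assume W: "W \<in> borel_measurable (FilPP D S k)"
  interpret sf: sigma_finite_subalgebra M "FilPP D S k" by (rule subalgebra_sigma_finite[OF subalg(3)])
  \<comment> \<open>The proviso on the conditional second moment holds automatically: the squared
    norm of \<open>W\<close> is measurable for the conditioning algebra, hence equal to its own
    conditional expectation, and it is finite.\<close>
  have "AE \<omega> in M. ennreal ((norm (W \<omega>))\<^sup>2) = nn_cond_exp M (FilPP D S k) (\<lambda>\<omega>. ennreal ((norm (W \<omega>))\<^sup>2)) \<omega>"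
    by (rule sf.nn_cond_exp_F_meas) (use W in measurable)
  then have fin: "AE \<omega> in M. nn_cond_exp M (FilPP D S k) (\<lambda>\<omega>. ennreal ((norm (W \<omega>))\<^sup>2)) \<omega> < \<infinity>"
    by eventually_elim (metis ennreal_less_top infinity_ennreal_def)
  show "has_cond_mean M (FilPP D S k) (\<lambda>\<omega>. pH S (Suc k) \<omega> (W \<omega>)) (\<lambda>\<omega>. HB k \<omega> (W \<omega>))"
    "cond_msd_le M (FilPP D S k) (\<lambda>\<omega>. pH S (Suc k) \<omega> (W \<omega>)) (\<lambda>\<omega>. HB k \<omega> (W \<omega>)) (\<lambda>\<omega>. \<sigma>g2\<^sup>2 * (norm (W \<omega>))\<^sup>2)"
    "has_cond_mean M (FilPP D S k) (\<lambda>\<omega>. pJ S (Suc k) \<omega> (W \<omega>)) (\<lambda>\<omega>. JY k \<omega> (lift D (pP S k \<omega>) (W \<omega>)))"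
    "cond_msd_le M (FilPP D S k) (\<lambda>\<omega>. pJ S (Suc k) \<omega> (W \<omega>)) (\<lambda>\<omega>. JY k \<omega> (lift D (pP S k \<omega>) (W \<omega>))) (\<lambda>\<omega>. \<sigma>g2\<^sup>2 * (norm (W \<omega>))\<^sup>2)"
    using e W fin by blast+
qed

section \<open>Moments of the frames and of the probes given the past\<close>

lemma haar_frames:
  obtains \<nu> where "\<And>l. frame_law (m l) (r l) (\<nu> l)"
    "\<And>k A. (\<And>l. A l \<in> sets (mat_space (m l) (r l))) \<Longrightarrow>
      AE \<omega> in M. real_cond_exp M (Fil D S k) (indicator {\<omega> \<in> space M. \<forall>l. pP S k \<omega> l \<in> A l}) \<omega> = (\<Prod>l\<in>UNIV. measure (\<nu> l) (A l))"
proof -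
  have "haar_projectors D S" using run unfolding bros_run_def by blast
  then obtain \<nu> where "\<forall>l. frame_law (m l) (r l) (\<nu> l)" "\<forall>k A. (\<forall>l. A l \<in> sets (mat_space (m l) (r l))) \<longrightarrow>
      (AE \<omega> in M. real_cond_exp M (Fil D S k) (indicator {\<omega> \<in> space M. \<forall>l. pP S k \<omega> l \<in> A l}) \<omega> = (\<Prod>l\<in>UNIV. measure (\<nu> l) (A l)))"
    unfolding haar_projectors_def by blast
  then show thesis using that by blast
qed

lemma dims': "1 \<le> r l" "2 \<le> m l"
  using dims[of l] by auto

lemma bounded_frames_AE: "AE \<omega> in M. bounded_frames (pP S k \<omega>)"
proof -
  obtain \<nu> where \<nu>: "\<And>l. frame_law (m l) (r l) (\<nu> l)"
    "\<And>k A. (\<And>l. A l \<in> sets (mat_space (m l) (r l))) \<Longrightarrow>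
      AE \<omega> in M. real_cond_exp M (Fil D S k) (indicator {\<omega> \<in> space M. \<forall>l. pP S k \<omega> l \<in> A l}) \<omega> = (\<Prod>l\<in>UNIV. measure (\<nu> l) (A l))"
    using haar_frames by blast
  note fl = \<nu>(1) dims'(1) dims(3) dims'(2)
  have marg: "distr M (mat_space (m l) (r l)) (\<lambda>\<omega>. pP S k \<omega> l) = \<nu> l" for l
    using cond_law_marginal[of "Fil D S k" "\<lambda>l \<omega>. pP S k \<omega> l" "\<lambda>l. mat_space (m l) (r l)" \<nu>, OF subalg(1) P_measurable
        frame_law_prob_space[OF fl] frame_law_sets[OF fl] \<nu>(2)] by simp
  have "AE \<omega> in M. \<forall>i<m l. \<forall>a<r l. \<bar>pP S k \<omega> l (i, a)\<bar> \<le> real (m l)" for l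
    using AE_distrD[OF P_measurable[of k l], unfolded marg, OF frame_law_bound[OF fl]] .
  then have "AE \<omega> in M. \<forall>l\<in>UNIV. \<forall>i<m l. \<forall>a<r l. \<bar>pP S k \<omega> l (i, a)\<bar> \<le> real (m l)"
    by (intro AE_finite_allI) auto
  then show ?thesis by (simp add: bounded_frames_def)
qed

abbreviation "gram k \<omega> l \<equiv> row_gram (r l) (pP S k \<omega> l)"

text \<open>Within one layer the second moment of the frame law applies; in two different layers the
  frames are independent and each Gram entry contributes its mean.\<close>

lemma gram_pair_eqE:
  assumes \<phi>: "\<phi> \<in> borel_measurable (Fil D S k)" "integrable M \<phi>"
    and i: "i < m l" "i' < m l" "j < m t" "j' < m t"
  shows "eqE M (\<lambda>\<omega>. \<phi> \<omega> * (gram k \<omega> l i i' * gram k \<omega> t j j'))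
    (\<lambda>\<omega>. \<phi> \<omega> * (if l = t then gramA (real (m l)) (real (r l)) * (of_bool (i = i') * of_bool (j = j'))
        + gramB (real (m l)) (real (r l)) * (of_bool (i = j) * of_bool (i' = j') + of_bool (i = j') * of_bool (i' = j))
      else of_bool (i = i') * of_bool (j = j')))" (is ?pair)
    and "eqE M (\<lambda>\<omega>. \<phi> \<omega> * gram k \<omega> l i i') (\<lambda>\<omega>. \<phi> \<omega> * of_bool (i = i'))" (is ?single)
proof -
  obtain \<nu> where \<nu>: "\<And>l. frame_law (m l) (r l) (\<nu> l)"
    "\<And>k A. (\<And>l. A l \<in> sets (mat_space (m l) (r l))) \<Longrightarrow>
      AE \<omega> in M. real_cond_exp M (Fil D S k) (indicator {\<omega> \<in> space M. \<forall>l. pP S k \<omega> l \<in> A l}) \<omega> = (\<Prod>l\<in>UNIV. measure (\<nu> l) (A l))"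
    using haar_frames by blast
  note fl = \<nu>(1) dims'(1) dims(3) dims'(2)
  have ps: "prob_space (\<nu> l)" and ss: "sets (\<nu> l) = sets (mat_space (m l) (r l))" for l
    using frame_law_prob_space[OF fl] frame_law_sets[OF fl] by auto
  have mg: "(\<lambda>P. row_gram (r l) P i i') \<in> borel_measurable (mat_space (m l) (r l))" if "i < m l" "i' < m l" for l i i'
    unfolding row_gram_def mat_space_def using that
    by (intro borel_measurable_sum borel_measurable_times measurable_component_singleton) auto
  have bg: "AE P in \<nu> l. \<bar>row_gram (r l) P i i'\<bar> \<le> real (r l) * (real (m l) * real (m l))" if "i < m l" "i' < m l" for l i i'
    using frame_law_bound[OF fl, of l]
  proof eventually_elim
    case (elim P)
    then show ?case unfolding row_gram_def using that by (intro abs_sum_le abs_mult_le) auto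
  qed
  have eq: "eqE M (\<lambda>\<omega>. \<phi> \<omega> * (\<Prod>l'\<in>UNIV. h l' (pP S k \<omega> l'))) (\<lambda>\<omega>. \<phi> \<omega> * (\<Prod>l'\<in>UNIV. (\<integral>x. h l' x \<partial>\<nu> l')))"
    if "\<And>l'. h l' \<in> borel_measurable (mat_space (m l') (r l'))" "\<And>l'. integrable (\<nu> l') (h l')" for h
    by (rule cond_law_eqE[where F = "Fil D S k" and N = "\<lambda>l. mat_space (m l) (r l)" and X = "\<lambda>l \<omega>. pP S k \<omega> l"])
      (use subalg(1) P_measurable ps ss \<nu>(2) that \<phi> in auto)
  \<comment> \<open>A factor for every layer whose product is the required product of two Gram
    entries. Layers not involved contribute 1, and for \<open>l = t\<close> both entries fall into
    the same factor.\<close>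
  define h where "h l' = (\<lambda>P. (if l' = l then row_gram (r l) P i i' else 1) * (if l' = t then row_gram (r t) P j j' else 1))" for l'
  have mh: "h l' \<in> borel_measurable (mat_space (m l') (r l'))" for l'
    unfolding h_def using mg i by (cases "l' = l"; cases "l' = t") auto
  have ih: "integrable (\<nu> l') (h l')" for l'
  proof -
    interpret p: prob_space "\<nu> l'" by (rule ps)
    have mh': "h l' \<in> borel_measurable (\<nu> l')" using mh measurable_cong_sets[OF ss refl] by blast
    let ?c = "real (r l') * (real (m l') * real (m l'))"
    have "AE P in \<nu> l'. \<bar>h l' P\<bar> \<le> max 1 ?c * max 1 ?c"
    proof -
      have 1: "AE P in \<nu> l'. \<bar>if l' = l then row_gram (r l) P i i' else 1\<bar> \<le> max 1 ?c"
        using bg[of i l i'] i by (cases "l' = l") (auto elim!: AE_mp)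
      have 2: "AE P in \<nu> l'. \<bar>if l' = t then row_gram (r t) P j j' else 1\<bar> \<le> max 1 ?c"
        using bg[of j t j'] i by (cases "l' = t") (auto elim!: AE_mp)
      from 1 2 show ?thesis unfolding h_def by eventually_elim (rule abs_mult_le)
    qed
    then show ?thesis using mh' by (intro p.integrable_const_bound[where B = "max 1 ?c * max 1 ?c"]) auto
  qed
  have p1: "(\<Prod>l'\<in>UNIV. h l' (P l')) = row_gram (r l) (P l) i i' * row_gram (r t) (P t) j j'" for P :: "'l \<Rightarrow> rmat"
    unfolding h_def prod.distrib by (simp add: prod.delta)
  have int1: "(\<integral>P. 1 \<partial>\<nu> l') = (1::real)" for l' using prob_space.prob_space[OF ps[of l']] by simp
  note m1 = frame_law_moment1[OF fl] and m2 = frame_law_moment2[OF fl]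
  have p2: "(\<Prod>l'\<in>UNIV. (\<integral>x. h l' x \<partial>\<nu> l')) = (if l = t then gramA (real (m l)) (real (r l)) * (of_bool (i = i') * of_bool (j = j'))
        + gramB (real (m l)) (real (r l)) * (of_bool (i = j) * of_bool (i' = j') + of_bool (i = j') * of_bool (i' = j))
      else of_bool (i = i') * of_bool (j = j'))"
  proof (cases "l = t")
    case True
    have "(\<integral>x. h l' x \<partial>\<nu> l') = (if l' = l then (\<integral>x. row_gram (r l) x i i' * row_gram (r l) x j j' \<partial>\<nu> l) else 1)" for l'
      using True int1 by (auto simp: h_def)
    then show ?thesis using True m2[of i l i' j j'] i by (simp add: prod.delta)
  next
    case False
    have "(\<integral>x. h l' x \<partial>\<nu> l') = (if l' = l then of_bool (i = i') else 1) * (if l' = t then of_bool (j = j') else 1)" for l'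
      using False int1 m1[of i l i'] m1[of j t j'] i by (auto simp: h_def)
    then show ?thesis using False by (simp add: prod.distrib prod.delta)
  qed
  show ?pair using eq[OF mh ih] unfolding p1 p2 .
  define h1 where "h1 l' = (\<lambda>P. if l' = l then row_gram (r l) P i i' else 1)" for l'
  have mh1: "h1 l' \<in> borel_measurable (mat_space (m l') (r l'))" for l'
    unfolding h1_def using mg i by (cases "l' = l") auto
  have ih1: "integrable (\<nu> l') (h1 l')" for l'
  proof -
    interpret p: prob_space "\<nu> l'" by (rule ps)
    have mh': "h1 l' \<in> borel_measurable (\<nu> l')" using mh1 measurable_cong_sets[OF ss refl] by blast
    let ?c = "real (r l') * (real (m l') * real (m l'))"
    have "AE P in \<nu> l'. \<bar>h1 l' P\<bar> \<le> max 1 ?c"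
      using bg[of i l i'] i unfolding h1_def by (cases "l' = l") (auto elim!: AE_mp)
    then show ?thesis using mh' by (intro p.integrable_const_bound[where B = "max 1 ?c"]) auto
  qed
  have q1: "(\<Prod>l'\<in>UNIV. h1 l' (P l')) = row_gram (r l) (P l) i i'" for P :: "'l \<Rightarrow> rmat"
    unfolding h1_def by (simp add: prod.delta)
  have "(\<integral>x. h1 l' x \<partial>\<nu> l') = (if l' = l then of_bool (i = i') else 1)" for l'
    using int1 m1[of i l i'] i by (auto simp: h1_def)
  then have q2: "(\<Prod>l'\<in>UNIV. (\<integral>x. h1 l' x \<partial>\<nu> l')) = of_bool (i = i')" by (simp add: prod.delta)
  show ?single using eq[OF mh1 ih1] unfolding q1 q2 .
qed

lemma probe_product_mean:
  assumes "a < r l" "j < n l" "a' < r t" "j' < n t"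
  shows "integrable M (\<lambda>\<omega>. (pxi S (Suc k) \<omega> l a * pu S (Suc k) \<omega> l j) * (pxi S (Suc k) \<omega> t a' * pu S (Suc k) \<omega> t j'))"
    "expectation (\<lambda>\<omega>. (pxi S (Suc k) \<omega> l a * pu S (Suc k) \<omega> l j) * (pxi S (Suc k) \<omega> t a' * pu S (Suc k) \<omega> t j'))
      = of_bool ((t, a', j') = (l, a, j))"
proof -
  let ?c1 = "Inr (l, a) :: 'l \<times> nat + 'l \<times> nat" and ?c2 = "Inl (l, j) :: 'l \<times> nat + 'l \<times> nat"
  let ?c3 = "Inr (t, a') :: 'l \<times> nat + 'l \<times> nat" and ?c4 = "Inl (t, j') :: 'l \<times> nat + 'l \<times> nat"
  \<comment> \<open>The multiplicity of each sign in the product. By independence the mean is a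
    product of power means, which is 1 if all multiplicities are even and 0 otherwise.\<close>
  define e :: "'l \<times> nat + 'l \<times> nat \<Rightarrow> nat" where
    "e c = of_bool (c = ?c1) + of_bool (c = ?c2) + of_bool (c = ?c3) + of_bool (c = ?c4)" for c
  have I: "?c1 \<in> probe_index" "?c2 \<in> probe_index" "?c3 \<in> probe_index" "?c4 \<in> probe_index"
    using assms by (auto simp: probe_index_iff)
  have one: "(\<Prod>c\<in>probe_index. probe k c \<omega> ^ of_bool (c = c0)) = probe k c0 \<omega>" if "c0 \<in> probe_index" for c0 \<omega>
  proof -
    have "(\<Prod>c\<in>probe_index. probe k c \<omega> ^ of_bool (c = c0)) = (\<Prod>c\<in>probe_index. if c = c0 then probe k c0 \<omega> else 1)"
      by (intro prod.cong) auto
    then show ?thesis using that finite_probe_index by (simp add: prod.delta)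
  qed
  have pw: "(\<Prod>c\<in>probe_index. probe k c \<omega> ^ e c) = (pxi S (Suc k) \<omega> l a * pu S (Suc k) \<omega> l j) * (pxi S (Suc k) \<omega> t a' * pu S (Suc k) \<omega> t j')" for \<omega>
    unfolding e_def power_add prod.distrib one[OF I(1)] one[OF I(2)] one[OF I(3)] one[OF I(4)] by (simp add: probe_def mult.assoc)
  have iv: "indep_vars (\<lambda>_. borel) (\<lambda>c \<omega>. probe k c \<omega> ^ e c) probe_index"
    by (rule indep_vars_compose2[OF probes(2), where N = "\<lambda>_. borel" and Y = "\<lambda>c x. x ^ e c"]) simp
  have ii: "\<And>c. c \<in> probe_index \<Longrightarrow> integrable M (\<lambda>\<omega>. probe k c \<omega> ^ e c)" using probe_mean by blast
  show "integrable M (\<lambda>\<omega>. (pxi S (Suc k) \<omega> l a * pu S (Suc k) \<omega> l j) * (pxi S (Suc k) \<omega> t a' * pu S (Suc k) \<omega> t j'))"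
    using indep_vars_integrable[OF finite_probe_index iv ii] unfolding pw .
  have "expectation (\<lambda>\<omega>. (pxi S (Suc k) \<omega> l a * pu S (Suc k) \<omega> l j) * (pxi S (Suc k) \<omega> t a' * pu S (Suc k) \<omega> t j'))
     = (\<Prod>c\<in>probe_index. expectation (\<lambda>\<omega>. probe k c \<omega> ^ e c))"
    using indep_vars_lebesgue_integral[OF finite_probe_index iv ii] unfolding pw .
  also have "\<dots> = (\<Prod>c\<in>probe_index. of_bool (even (e c)))"
    by (intro prod.cong refl) (use probe_mean in blast)
  also have "\<dots> = of_bool ((t, a', j') = (l, a, j))"
  proof (cases "(t, a', j') = (l, a, j)")
    case True
    then have "even (e c)" for c by (auto simp: e_def)
    then show ?thesis using True by simp
  next
    case False
    \<comment> \<open>If the two entries of \<open>\<xi>\<close> differ, the first of them occurs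
      once; if they coincide, the two signs of \<open>u\<close> must differ and the first of these
      occurs once.\<close>
    have "\<exists>c\<in>probe_index. odd (e c)"
    proof (cases "(l, a) = (t, a')")
      case True
      then have "e ?c2 = 1" using False by (auto simp: e_def)
      then show ?thesis using I(2) by (metis odd_one)
    next
      case False
      then have "e ?c1 = 1" by (auto simp: e_def)
      then show ?thesis using I(1) by (metis odd_one)
    qed
    then have "(\<Prod>c\<in>probe_index. of_bool (even (e c))) = (0::real)"
      using finite_probe_index by (intro prod_zero) auto
    then show ?thesis using False by simp
  qed
  finally show "expectation (\<lambda>\<omega>. (pxi S (Suc k) \<omega> l a * pu S (Suc k) \<omega> l j) * (pxi S (Suc k) \<omega> t a' * pu S (Suc k) \<omega> t j'))
      = of_bool ((t, a', j') = (l, a, j))" .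
qed

lemma probe_pair_eqE:
  assumes \<phi>: "\<phi> \<in> borel_measurable (FilP D S k)" "integrable M \<phi>"
    and i: "a < r l" "j < n l" "a' < r t" "j' < n t"
  shows "eqE M (\<lambda>\<omega>. \<phi> \<omega> * ((pxi S (Suc k) \<omega> l a * pu S (Suc k) \<omega> l j) * (pxi S (Suc k) \<omega> t a' * pu S (Suc k) \<omega> t j')))
    (\<lambda>\<omega>. \<phi> \<omega> * of_bool ((t, a', j') = (l, a, j)))"
proof -
  define N where "N = sigma (space M) (gen_probes D S (Suc k))"
  have gp: "gen_probes D S (Suc k) \<subseteq> Pow (space M)"
    unfolding gen_probes_def by (intro Un_least UN_least gen_Pow)
  have N: "space N = space M" "sets N = sigma_sets (space M) (gen_probes D S (Suc k))"
    using gp by (simp_all add: N_def space_measure_of sets_measure_of)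
  have pu: "(\<lambda>\<omega>. pu S (Suc k) \<omega> l j) \<in> borel_measurable N" if "j < n l" for l j
  proof (rule gen_measurable[where M = M])
    show "gen M (\<lambda>\<omega>. pu S (Suc k) \<omega> l j) borel \<subseteq> sets N"
      unfolding N gen_probes_def using that by (blast intro: sigma_sets.Basic)
  qed (auto simp: N)
  have pxi: "(\<lambda>\<omega>. pxi S (Suc k) \<omega> l a) \<in> borel_measurable N" if "a < r l" for l a
  proof (rule gen_measurable[where M = M])
    show "gen M (\<lambda>\<omega>. pxi S (Suc k) \<omega> l a) borel \<subseteq> sets N"
      unfolding N gen_probes_def using that by (blast intro: sigma_sets.Basic)
  qed (auto simp: N)
  have "eqE M (\<lambda>\<omega>. \<phi> \<omega> * ((pxi S (Suc k) \<omega> l a * pu S (Suc k) \<omega> l j) * (pxi S (Suc k) \<omega> t a' * pu S (Suc k) \<omega> t j')))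
    (\<lambda>\<omega>. \<phi> \<omega> * expectation (\<lambda>\<omega>. (pxi S (Suc k) \<omega> l a * pu S (Suc k) \<omega> l j) * (pxi S (Suc k) \<omega> t a' * pu S (Suc k) \<omega> t j')))"
  proof (rule indep_set_eqE'[OF probes(3)[of k], where ?A2.0 = "FilP D S k" and ?A1.0 = N])
    show "sets (FilP D S k) \<subseteq> sigma_sets (space M) (sets (FilP D S k) \<union> \<Union> (set (est_algebras S (Suc k))))"
      by (auto intro: sigma_sets.Basic)
    show "(\<lambda>\<omega>. (pxi S (Suc k) \<omega> l a * pu S (Suc k) \<omega> l j) * (pxi S (Suc k) \<omega> t a' * pu S (Suc k) \<omega> t j')) \<in> borel_measurable N"
      by (intro borel_measurable_times pu pxi i)
    show "integrable M (\<lambda>\<omega>. (pxi S (Suc k) \<omega> l a * pu S (Suc k) \<omega> l j) * (pxi S (Suc k) \<omega> t a' * pu S (Suc k) \<omega> t j'))"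
      by (rule probe_product_mean(1)[OF i])
  qed (use \<phi> N sets_FilP in auto)
  then show ?thesis unfolding probe_product_mean(2)[OF i] .
qed

end

section \<open>Unbiasedness of the corrected Hessian action\<close>

lemma sum_of_bool: "i < q \<Longrightarrow> (\<Sum>a<q. of_bool (i = a) * f a) = (f i :: real)" for q :: nat
proof -
  assume "i < q"
  have "(\<Sum>a<q. of_bool (i = a) * f a) = (\<Sum>a<q. if a = i then f i else 0)" by (intro sum.cong) auto
  then show ?thesis using \<open>i < q\<close> by simp
qed

text \<open>This and the next lemma evaluate the three pairings of \<open>i\<close>,
  \<open>i1\<close>, \<open>i2\<close>, \<open>i3\<close> left by the frame moments; they become
  \<open>T1\<close>, \<open>T2\<close> and \<open>T3\<close> below.\<close>

lemma sum_contract1: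
  fixes F :: "nat \<Rightarrow> nat \<Rightarrow> nat \<Rightarrow> nat \<Rightarrow> real"
  assumes "i < q1"
  shows "(\<Sum>i1<q1. \<Sum>i2<q. \<Sum>k<p. \<Sum>i3<q. (of_bool (i = i1) * of_bool (i2 = i3)) * F i1 i2 k i3) = (\<Sum>a<q. \<Sum>k<p. F i a k a)"
proof -
  have "(\<Sum>i1<q1. \<Sum>i2<q. \<Sum>k<p. \<Sum>i3<q. (of_bool (i = i1) * of_bool (i2 = i3)) * F i1 i2 k i3)
    = (\<Sum>i1<q1. of_bool (i = i1) * (\<Sum>i2<q. \<Sum>k<p. \<Sum>i3<q. of_bool (i2 = i3) * F i1 i2 k i3))"
    by (simp only: sum_distrib_left mult.assoc)
  also have "\<dots> = (\<Sum>i2<q. \<Sum>k<p. \<Sum>i3<q. of_bool (i2 = i3) * F i i2 k i3)" by (rule sum_of_bool[OF assms])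
  also have "\<dots> = (\<Sum>a<q. \<Sum>k<p. F i a k a)" by (intro sum.cong refl sum_of_bool) auto
  finally show ?thesis .
qed

lemma sum_contract2:
  fixes F :: "nat \<Rightarrow> nat \<Rightarrow> nat \<Rightarrow> nat \<Rightarrow> real"
  assumes "i < q"
  shows "(\<Sum>i1<q. \<Sum>i2<q. \<Sum>k<p. \<Sum>i3<q. (of_bool (i = i2) * of_bool (i1 = i3)) * F i1 i2 k i3) = (\<Sum>a<q. \<Sum>k<p. F a i k a)"
    "(\<Sum>i1<q. \<Sum>i2<q. \<Sum>k<p. \<Sum>i3<q. (of_bool (i = i3) * of_bool (i1 = i2)) * F i1 i2 k i3) = (\<Sum>a<q. \<Sum>k<p. F a a k i)"
proof -
  have "(\<Sum>i1<q. \<Sum>i2<q. \<Sum>k<p. \<Sum>i3<q. (of_bool (i = i2) * of_bool (i1 = i3)) * F i1 i2 k i3)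
    = (\<Sum>i1<q. \<Sum>i2<q. of_bool (i = i2) * (\<Sum>k<p. \<Sum>i3<q. of_bool (i1 = i3) * F i1 i2 k i3))"
    by (simp only: sum_distrib_left mult.assoc)
  also have "\<dots> = (\<Sum>i1<q. \<Sum>k<p. \<Sum>i3<q. of_bool (i1 = i3) * F i1 i k i3)"
    by (intro sum.cong refl sum_of_bool assms)
  also have "\<dots> = (\<Sum>a<q. \<Sum>k<p. F a i k a)" by (intro sum.cong refl sum_of_bool) auto
  finally show "(\<Sum>i1<q. \<Sum>i2<q. \<Sum>k<p. \<Sum>i3<q. (of_bool (i = i2) * of_bool (i1 = i3)) * F i1 i2 k i3) = (\<Sum>a<q. \<Sum>k<p. F a i k a)" .
  have "(\<Sum>i1<q. \<Sum>i2<q. \<Sum>k<p. \<Sum>i3<q. (of_bool (i = i3) * of_bool (i1 = i2)) * F i1 i2 k i3)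
    = (\<Sum>i1<q. \<Sum>i2<q. of_bool (i1 = i2) * (\<Sum>k<p. \<Sum>i3<q. of_bool (i = i3) * F i1 i2 k i3))"
    by (simp only: sum_distrib_left mult.assoc mult.left_commute)
  also have "\<dots> = (\<Sum>i1<q. \<Sum>k<p. \<Sum>i3<q. of_bool (i = i3) * F i1 i1 k i3)"
    by (intro sum.cong refl sum_of_bool) auto
  also have "\<dots> = (\<Sum>a<q. \<Sum>k<p. F a a k i)" by (intro sum.cong refl sum_of_bool assms)
  finally show "(\<Sum>i1<q. \<Sum>i2<q. \<Sum>k<p. \<Sum>i3<q. (of_bool (i = i3) * of_bool (i1 = i2)) * F i1 i2 k i3) = (\<Sum>a<q. \<Sum>k<p. F a a k i)" .
qed

lemma sum_rotate: "(\<Sum>k\<in>K. \<Sum>a\<in>A. \<Sum>b\<in>B. G k a b) = (\<Sum>a\<in>A. \<Sum>b\<in>B. \<Sum>k\<in>K. (G k a b :: real))"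
  by (rule trans[OF sum.swap sum.cong[OF refl sum.swap]])

lemma sq_int_block: "sq_int M V \<Longrightarrow> sq_int M (\<lambda>\<omega>. block e (V \<omega>) l (i, j))"
  unfolding block_def prod.case by (rule sq_int_nth)

text \<open>With these three coefficients the bias of the projected Hessian action cancels.\<close>

lemma corrected_coefficients:
  fixes m r a b :: real
  assumes mr: "2 \<le> r" "r \<le> m" and a: "a = gramA m r" and b: "b = gramB m r"
  shows "r * (m - 1) * (m + 2) / (m * (m * r + m - 2)) * (a * T1 + b * (T2 + T3))
    - (m - r) / (m * r + m - 2) * T3
    + r * (m - 1) * (m - r) / (m * (r - 1) * (m * r + m - 2)) * ((a * T1 + b * (T2 + T3)) - (a * T2 + b * (T1 + T3))) = T1"
proof -
  define q where "q = m * r + m - 2"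
  have "0 \<le> m * r" using mr by simp
  moreover have "4 \<le> m * r" using mult_mono[of 2 m 2 r] mr by simp
  ultimately have pos: "0 < m" "0 < r" "0 < m - 1" "0 < m + 2" "0 < r - 1" "0 < q" using mr by (auto simp: q_def)
  define k1 where "k1 = r * (m - 1) * (m + 2) / (m * q)"
  define k2 where "k2 = (m - r) / q"
  define k3 where "k3 = r * (m - 1) * (m - r) / (m * (r - 1) * q)"
  have ab: "a + b = m * q / (r * (m - 1) * (m + 2))"
  proof -
    have "a + b = 1 + b * (m - 2) / m" unfolding a gramA_def b[symmetric] using pos by (simp add: field_simps)
    also have "b * (m - 2) / m = (m - r) * (m - 2) / (r * (m - 1) * (m + 2))"
      unfolding b gramB_def using pos by (simp add: divide_simps)
    also have "1 + \<dots> = (r * (m - 1) * (m + 2) + (m - r) * (m - 2)) / (r * (m - 1) * (m + 2))"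
      using pos by (simp add: add_divide_distrib)
    also have "r * (m - 1) * (m + 2) + (m - r) * (m - 2) = m * q" by (simp add: q_def algebra_simps)
    finally show ?thesis .
  qed
  \<comment> \<open>The three identities explain the coefficients. \<open>k1\<close> normalises the
    coefficient \<open>a + b\<close>, after which the mean of the uncorrected action is
    \<open>T1 + k2 * (T2 - T1) + k2 * T3\<close>. The probe term subtracts \<open>k2 * T3\<close>;
    the difference of the last two terms has mean \<open>(a - b) * (T1 - T2)\<close>, and
    \<open>k3\<close> scales it to cancel the rest.\<close>
  have 1: "k1 * (a + b) = 1" unfolding ab k1_def using pos by (simp add: divide_simps)
  have 2: "k1 * b = k2" unfolding b gramB_def k1_def k2_def using pos by (simp add: divide_simps)
  have amb: "a - b = m * (r - 1) / (r * (m - 1))"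
  proof -
    have "a - b = 1 - b * (m + 2) / m" unfolding a gramA_def b[symmetric] using pos by (simp add: field_simps)
    also have "b * (m + 2) / m = (m - r) / (r * (m - 1))"
      unfolding b gramB_def using pos by (simp add: divide_simps)
    also have "1 - \<dots> = (r * (m - 1) - (m - r)) / (r * (m - 1))" using pos by (simp add: diff_divide_distrib)
    also have "r * (m - 1) - (m - r) = m * (r - 1)" by (simp add: algebra_simps)
    finally show ?thesis .
  qed
  have 3: "k3 * (a - b) = k2" unfolding amb k3_def k2_def using pos by (simp add: divide_simps)
  have "k1 * (a * T1 + b * (T2 + T3)) - k2 * T3 + k3 * ((a * T1 + b * (T2 + T3)) - (a * T2 + b * (T1 + T3)))
    = (k1 * (a + b)) * T1 - (k1 * b) * T1 + (k1 * b) * T2 + (k1 * b) * T3 - k2 * T3 + (k3 * (a - b)) * (T1 - T2)"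
    by (simp add: algebra_simps)
  also have "\<dots> = T1" unfolding 1 2 3 by (simp add: algebra_simps)
  finally show ?thesis by (simp add: k1_def k2_def k3_def q_def)
qed

lemma (in prob_space) cond_mean_inner_eqE:
  assumes F: "subalgebra M F" and c: "has_cond_mean M F X Y"
    and m: "sq_int M X" "Y \<in> borel_measurable M" "A \<in> borel_measurable F" "sq_int M A"
  shows "eqE M (\<lambda>\<omega>. inner (A \<omega>) (X \<omega>)) (\<lambda>\<omega>. inner (A \<omega>) (Y \<omega>))"
proof -
  have "eqE M (\<lambda>\<omega>. \<Sum>b\<in>Basis. inner (A \<omega>) b * inner (X \<omega>) b) (\<lambda>\<omega>. \<Sum>b\<in>Basis. inner (A \<omega>) b * inner (Y \<omega>) b)"
  proof (rule eqE_sum)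
    fix b :: 'b assume b: "b \<in> Basis"
    have s: "sq_int M (\<lambda>\<omega>. inner (U \<omega>) b)" if "sq_int M U" for U :: "'a \<Rightarrow> 'b"
      by (rule sq_int_bound(1)[OF _ that, where C = 1])
        (use that b sq_intD in \<open>auto intro!: borel_measurable_inner simp: Basis_le_norm\<close>)
    show "eqE M (\<lambda>\<omega>. inner (A \<omega>) b * inner (X \<omega>) b) (\<lambda>\<omega>. inner (A \<omega>) b * inner (Y \<omega>) b)"
      by (rule cond_mean_eqE[OF F c b]) (use m sq_intD s in \<open>auto intro!: borel_measurable_inner sq_int_mult\<close>)
  qed
  then show ?thesis by (simp add: euclidean_inner[symmetric])
qed

section \<open>Lifted oracles tested against past vectors\<close>

context bros
begin

text \<open>Square integrability of the state at time \<open>k\<close> is carried as a hypothesis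
  through all moment estimates; these in turn give the inductive step that establishes it for every
  \<open>k\<close> in \<open>L2_all\<close>.\<close>

definition "L2 k \<longleftrightarrow> sq_int M (px S k) \<and> sq_int M (pY S k) \<and> sq_int M (pZ S k) \<and> sq_int M (ph S k)"

lemma L2D: "L2 k \<Longrightarrow> sq_int M (px S k)" "L2 k \<Longrightarrow> sq_int M (pY S k)" "L2 k \<Longrightarrow> sq_int M (pZ S k)" "L2 k \<Longrightarrow> sq_int M (ph S k)"
  by (auto simp: L2_def)

lemma sq_int_grads: "L2 k \<Longrightarrow> sq_int M (gX k)" "L2 k \<Longrightarrow> sq_int M (gF k)" "L2 k \<Longrightarrow> sq_int M (gG k)"
proof -
  assume L: "L2 k"
  show "sq_int M (gX k)" by (rule sq_int_pair[OF grad_lipschitz(2) _ L2D(1,2)[OF L]]) (use pos in auto)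
  show "sq_int M (gF k)" by (rule sq_int_pair[OF grad_lipschitz(1) _ L2D(1,2)[OF L]]) (use pos in auto)
  show "sq_int M (gG k)" by (rule sq_int_pair[OF grad_lipschitz(3) _ L2D(1,2)[OF L]]) (use pos in auto)
qed

lemma sq_int_compress: "sq_int M U \<Longrightarrow> sq_int M (\<lambda>\<omega>. compress D (pP S k \<omega>) (U \<omega>))"
  "sq_int M U \<Longrightarrow> (\<integral>\<omega>. (norm (compress D (pP S k \<omega>) (U \<omega>)))\<^sup>2 \<partial>M) \<le> cP\<^sup>2 * (\<integral>\<omega>. (norm (U \<omega>))\<^sup>2 \<partial>M)"
proof -
  assume U: "sq_int M U"
  have m: "(\<lambda>\<omega>. compress D (pP S k \<omega>) (U \<omega>)) \<in> borel_measurable M" by (rule borel_compress[OF P_measurable sq_intD(1)[OF U]])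
  have b: "AE \<omega> in M. norm (compress D (pP S k \<omega>) (U \<omega>)) \<le> cP * norm (U \<omega>)"
    using bounded_frames_AE by eventually_elim (rule compress_le)
  from sq_int_bound[OF m U b] show "sq_int M (\<lambda>\<omega>. compress D (pP S k \<omega>) (U \<omega>))"
    "(\<integral>\<omega>. (norm (compress D (pP S k \<omega>) (U \<omega>)))\<^sup>2 \<partial>M) \<le> cP\<^sup>2 * (\<integral>\<omega>. (norm (U \<omega>))\<^sup>2 \<partial>M)" .
qed

lemma sq_int_lift: "sq_int M B \<Longrightarrow> sq_int M (\<lambda>\<omega>. lift D (pP S k \<omega>) (B \<omega>))"
  "sq_int M B \<Longrightarrow> (\<integral>\<omega>. (norm (lift D (pP S k \<omega>) (B \<omega>)))\<^sup>2 \<partial>M) \<le> cP\<^sup>2 * (\<integral>\<omega>. (norm (B \<omega>))\<^sup>2 \<partial>M)"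
proof -
  assume B: "sq_int M B"
  have m: "(\<lambda>\<omega>. lift D (pP S k \<omega>) (B \<omega>)) \<in> borel_measurable M" by (rule borel_lift[OF P_measurable sq_intD(1)[OF B]])
  have b: "AE \<omega> in M. norm (lift D (pP S k \<omega>) (B \<omega>)) \<le> cP * norm (B \<omega>)"
    using bounded_frames_AE by eventually_elim (rule lift_le)
  from sq_int_bound[OF m B b] show "sq_int M (\<lambda>\<omega>. lift D (pP S k \<omega>) (B \<omega>))"
    "(\<integral>\<omega>. (norm (lift D (pP S k \<omega>) (B \<omega>)))\<^sup>2 \<partial>M) \<le> cP\<^sup>2 * (\<integral>\<omega>. (norm (B \<omega>))\<^sup>2 \<partial>M)" .
qed

lemma frame_mean_eqE:
  assumes A: "A \<in> borel_measurable (Fil D S k)" "sq_int M A" and G: "G \<in> borel_measurable (Fil D S k)" "sq_int M G"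
  shows "eqE M (\<lambda>\<omega>. inner (A \<omega>) (lift D (pP S k \<omega>) (compress D (pP S k \<omega>) (G \<omega>)))) (\<lambda>\<omega>. inner (A \<omega>) (G \<omega>))"
proof (rule eqE_cong)
  show "eqE M (\<lambda>\<omega>. \<Sum>l\<in>UNIV. \<Sum>i<m l. \<Sum>j<n l. \<Sum>i'<m l. (blkY (A \<omega>) l (i, j) * blkY (G \<omega>) l (i', j)) * gram k \<omega> l i i')
     (\<lambda>\<omega>. \<Sum>l\<in>UNIV. \<Sum>i<m l. \<Sum>j<n l. \<Sum>i'<m l. (blkY (A \<omega>) l (i, j) * blkY (G \<omega>) l (i', j)) * of_bool (i = i'))"
  proof (rule eqE_sum)+
    fix l i j i' assume "i \<in> {..<m l}" "j \<in> {..<n l}" "i' \<in> {..<m l}"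
    then show "eqE M (\<lambda>\<omega>. (blkY (A \<omega>) l (i, j) * blkY (G \<omega>) l (i', j)) * gram k \<omega> l i i')
      (\<lambda>\<omega>. (blkY (A \<omega>) l (i, j) * blkY (G \<omega>) l (i', j)) * of_bool (i = i'))"
      by (intro gram_pair_eqE(2) borel_measurable_times borel_block sq_int_mult sq_int_block A G) auto
  qed
  fix \<omega>
  show "inner (A \<omega>) (lift D (pP S k \<omega>) (compress D (pP S k \<omega>) (G \<omega>)))
    = (\<Sum>l\<in>UNIV. \<Sum>i<m l. \<Sum>j<n l. \<Sum>i'<m l. (blkY (A \<omega>) l (i, j) * blkY (G \<omega>) l (i', j)) * gram k \<omega> l i i')"
    unfolding inner_blocks[OF bijY] by (intro sum.cong refl) (simp add: lift_compress sum_distrib_left ac_simps)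
  show "inner (A \<omega>) (G \<omega>)
    = (\<Sum>l\<in>UNIV. \<Sum>i<m l. \<Sum>j<n l. \<Sum>i'<m l. (blkY (A \<omega>) l (i, j) * blkY (G \<omega>) l (i', j)) * of_bool (i = i'))"
    unfolding inner_blocks[OF bijY]
  proof (intro sum.cong refl)
    fix l i j assume i: "i \<in> {..<m l}"
    show "blkY (A \<omega>) l (i, j) * blkY (G \<omega>) l (i, j) = (\<Sum>i'<m l. (blkY (A \<omega>) l (i, j) * blkY (G \<omega>) l (i', j)) * of_bool (i = i'))"
      using sum_of_bool[of i "m l" "\<lambda>i'. blkY (A \<omega>) l (i, j) * blkY (G \<omega>) l (i', j)"] i by (simp add: mult.commute)
  qed
qed

lemma noise_sq_int:
  assumes L: "L2 k"
  shows "sq_int M (pUx S (Suc k))" "(\<integral>\<omega>. (norm (pUx S (Suc k) \<omega> - gX k \<omega>))\<^sup>2 \<partial>M) \<le> \<sigma>f1\<^sup>2"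
    "sq_int M (\<lambda>\<omega>. pUx S (Suc k) \<omega> - gX k \<omega>)"
    "sq_int M (pUY S (Suc k))" "(\<integral>\<omega>. (norm (pUY S (Suc k) \<omega>))\<^sup>2 \<partial>M) \<le> 2 * \<sigma>f2\<^sup>2 + 2 * (cP\<^sup>2 * (\<integral>\<omega>. (norm (gF k \<omega>))\<^sup>2 \<partial>M))"
    "sq_int M (pV S (Suc k))" "(\<integral>\<omega>. (norm (pV S (Suc k) \<omega>))\<^sup>2 \<partial>M) \<le> 2 * \<sigma>g1\<^sup>2 + 2 * (cP\<^sup>2 * (\<integral>\<omega>. (norm (gG k \<omega>))\<^sup>2 \<partial>M))"
proof -
  note g = sq_int_grads[OF L]
  have one: "expectation (\<lambda>_. c) = c" for c :: real by (simp add: prob_space)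
  note x = cond_msd_sq_int[OF subalg(2) estimators(2) est_measurable(1) sq_intD(1)[OF g(1)], unfolded one]
  show x1: "sq_int M (\<lambda>\<omega>. pUx S (Suc k) \<omega> - gX k \<omega>)" and "(\<integral>\<omega>. (norm (pUx S (Suc k) \<omega> - gX k \<omega>))\<^sup>2 \<partial>M) \<le> \<sigma>f1\<^sup>2"
    using x by auto
  show "sq_int M (pUx S (Suc k))" using sq_int_add(1)[OF x1 g(1)] by simp
  note y = cond_msd_sq_int[OF subalg(2) estimators(4) est_measurable(2) sq_intD(1)[OF sq_int_compress(1)[OF g(2)]], unfolded one]
  have y1: "sq_int M (\<lambda>\<omega>. pUY S (Suc k) \<omega> - compress D (pP S k \<omega>) (gF k \<omega>))"
    and y2: "(\<integral>\<omega>. (norm (pUY S (Suc k) \<omega> - compress D (pP S k \<omega>) (gF k \<omega>)))\<^sup>2 \<partial>M) \<le> \<sigma>f2\<^sup>2" using y by auto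
  show "sq_int M (pUY S (Suc k))" using sq_int_add(1)[OF y1 sq_int_compress(1)[OF g(2), of k]] by simp
  show "(\<integral>\<omega>. (norm (pUY S (Suc k) \<omega>))\<^sup>2 \<partial>M) \<le> 2 * \<sigma>f2\<^sup>2 + 2 * (cP\<^sup>2 * (\<integral>\<omega>. (norm (gF k \<omega>))\<^sup>2 \<partial>M))"
    using sq_int_add(2)[OF y1 sq_int_compress(1)[OF g(2), of k]] y2 sq_int_compress(2)[OF g(2), of k] by simp
  note v = cond_msd_sq_int[OF subalg(2) estimators(6) est_measurable(3) sq_intD(1)[OF sq_int_compress(1)[OF g(3)]], unfolded one]
  have v1: "sq_int M (\<lambda>\<omega>. pV S (Suc k) \<omega> - compress D (pP S k \<omega>) (gG k \<omega>))"
    and v2: "(\<integral>\<omega>. (norm (pV S (Suc k) \<omega> - compress D (pP S k \<omega>) (gG k \<omega>)))\<^sup>2 \<partial>M) \<le> \<sigma>g1\<^sup>2" using v by auto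
  show "sq_int M (pV S (Suc k))" using sq_int_add(1)[OF v1 sq_int_compress(1)[OF g(3), of k]] by simp
  show "(\<integral>\<omega>. (norm (pV S (Suc k) \<omega>))\<^sup>2 \<partial>M) \<le> 2 * \<sigma>g1\<^sup>2 + 2 * (cP\<^sup>2 * (\<integral>\<omega>. (norm (gG k \<omega>))\<^sup>2 \<partial>M))"
    using sq_int_add(2)[OF v1 sq_int_compress(1)[OF g(3), of k]] v2 sq_int_compress(2)[OF g(3), of k] by simp
qed

text \<open>Two conditionings in turn. Adjointness moves the lift onto the test vector, which is
  then measurable once the frame is known, so the oracle can be replaced by its mean; afterwards the
  frame is averaged given the past.\<close>

lemma lift_noise_eqE:
  assumes c: "has_cond_mean M (FilP D S k) X (\<lambda>\<omega>. compress D (pP S k \<omega>) (G \<omega>))" "sq_int M X"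
    and G: "G \<in> borel_measurable (Fil D S k)" "sq_int M G"
    and A: "A \<in> borel_measurable (Fil D S k)" "sq_int M A"
  shows "eqE M (\<lambda>\<omega>. inner (A \<omega>) (lift D (pP S k \<omega>) (X \<omega>))) (\<lambda>\<omega>. inner (A \<omega>) (G \<omega>))"
proof (rule eqE_trans)
  have "eqE M (\<lambda>\<omega>. inner (compress D (pP S k \<omega>) (A \<omega>)) (X \<omega>))
     (\<lambda>\<omega>. inner (compress D (pP S k \<omega>) (A \<omega>)) (compress D (pP S k \<omega>) (G \<omega>)))"
    by (rule cond_mean_inner_eqE[OF subalg(2) c(1)])
      (use c A G in \<open>auto intro!: sq_intD(1)[OF sq_int_compress(1)] sq_int_compress borel_compress[OF P_FilP Fil_FilP]\<close>)
  then show "eqE M (\<lambda>\<omega>. inner (A \<omega>) (lift D (pP S k \<omega>) (X \<omega>)))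
      (\<lambda>\<omega>. inner (A \<omega>) (lift D (pP S k \<omega>) (compress D (pP S k \<omega>) (G \<omega>))))"
    by (simp add: inner_commute[of "A _"] inner_lift) (simp add: inner_commute)
  show "eqE M (\<lambda>\<omega>. inner (A \<omega>) (lift D (pP S k \<omega>) (compress D (pP S k \<omega>) (G \<omega>)))) (\<lambda>\<omega>. inner (A \<omega>) (G \<omega>))"
    by (rule frame_mean_eqE[OF A G])
qed

lemma Vhat_eqE: "L2 k \<Longrightarrow> A \<in> borel_measurable (Fil D S k) \<Longrightarrow> sq_int M A \<Longrightarrow>
   eqE M (\<lambda>\<omega>. inner (A \<omega>) (Vhat k \<omega>)) (\<lambda>\<omega>. inner (A \<omega>) (gG k \<omega>))"
  unfolding Vhat_def
  by (rule lift_noise_eqE[OF estimators(5)]) (auto intro: noise_sq_int borel_grads states_Fil sq_int_grads)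

lemma UY_eqE: "L2 k \<Longrightarrow> A \<in> borel_measurable (Fil D S k) \<Longrightarrow> sq_int M A \<Longrightarrow>
   eqE M (\<lambda>\<omega>. inner (A \<omega>) (lift D (pP S k \<omega>) (pUY S (Suc k) \<omega>))) (\<lambda>\<omega>. inner (A \<omega>) (gF k \<omega>))"
  by (rule lift_noise_eqE[OF estimators(3)]) (auto intro: noise_sq_int borel_grads states_Fil sq_int_grads)

definition "CHB = cP * (Lg1 * cP)"

lemma HB_bound: "bounded_frames (pP S k \<omega>) \<Longrightarrow> norm (HB k \<omega> v) \<le> CHB * norm v"
proof -
  assume b: "bounded_frames (pP S k \<omega>)"
  have "norm (HB k \<omega> v) \<le> cP * norm (HY k \<omega> (lift D (pP S k \<omega>) v))" unfolding HB_apply by (rule compress_le[OF b])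
  also have "\<dots> \<le> cP * (Lg1 * norm (lift D (pP S k \<omega>) v))" by (intro mult_left_mono hess_yy_bound cP_nonneg)
  also have "\<dots> \<le> cP * (Lg1 * (cP * norm v))" using pos by (intro mult_left_mono lift_le[OF b] cP_nonneg) auto
  finally show ?thesis by (simp add: CHB_def ac_simps)
qed

lemma HB_FilP: "(\<lambda>\<omega>. HB k \<omega> v) \<in> borel_measurable (FilP D S k)"
  unfolding HB_apply
  by (rule borel_compress[OF P_FilP borel_linear_apply[where H = "\<lambda>\<omega>. HY k \<omega>", OF hess_yy_linear
        borel_grads(4)[OF Fil_FilP[OF states_Fil(1)] Fil_FilP[OF states_Fil(2)]]
        borel_lift[OF P_FilP borel_measurable_const]]])

lemma HB_measurable: "W \<in> borel_measurable M \<Longrightarrow> (\<lambda>\<omega>. HB k \<omega> (W \<omega>)) \<in> borel_measurable M"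
  by (rule borel_linear_apply[where H = "\<lambda>\<omega>. blinfun_apply (HB k \<omega>)", OF linear_blinfun FilP_M[OF HB_FilP]])

lemma HB_sq_int:
  assumes W: "sq_int M W"
  shows "sq_int M (\<lambda>\<omega>. HB k \<omega> (W \<omega>))" "(\<integral>\<omega>. (norm (HB k \<omega> (W \<omega>)))\<^sup>2 \<partial>M) \<le> CHB\<^sup>2 * (\<integral>\<omega>. (norm (W \<omega>))\<^sup>2 \<partial>M)"
proof -
  have b: "AE \<omega> in M. norm (HB k \<omega> (W \<omega>)) \<le> CHB * norm (W \<omega>)"
    using bounded_frames_AE by eventually_elim (rule HB_bound)
  from sq_int_bound[OF HB_measurable[OF sq_intD(1)[OF W]] W b]
  show "sq_int M (\<lambda>\<omega>. HB k \<omega> (W \<omega>))" "(\<integral>\<omega>. (norm (HB k \<omega> (W \<omega>)))\<^sup>2 \<partial>M) \<le> CHB\<^sup>2 * (\<integral>\<omega>. (norm (W \<omega>))\<^sup>2 \<partial>M)" .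
qed

lemma H_sq_int:
  assumes W: "sq_int M W" "W \<in> borel_measurable (FilPP D S k)"
  shows "sq_int M (\<lambda>\<omega>. pH S (Suc k) \<omega> (W \<omega>))"
    "(\<integral>\<omega>. (norm (pH S (Suc k) \<omega> (W \<omega>)))\<^sup>2 \<partial>M) \<le> (2 * \<sigma>g2\<^sup>2 + 2 * CHB\<^sup>2) * (\<integral>\<omega>. (norm (W \<omega>))\<^sup>2 \<partial>M)"
proof -
  have mH: "(\<lambda>\<omega>. pH S (Suc k) \<omega> (W \<omega>)) \<in> borel_measurable M"
    by (rule borel_linear_apply[where H = "\<lambda>\<omega>. blinfun_apply (pH S (Suc k) \<omega>)", OF linear_blinfun
        borel_blinfun_apply[OF est_measurable(4)] sq_intD(1)[OF W(1)]])
  note d = cond_msd_sq_int[OF subalg(3) estimators_H(2)[OF W(2)] mH HB_measurable[OF sq_intD(1)[OF W(1)]]]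
  have d1: "sq_int M (\<lambda>\<omega>. pH S (Suc k) \<omega> (W \<omega>) - HB k \<omega> (W \<omega>))"
    by (rule d(1)) (use W sq_intD(2) in auto)
  have d2: "(\<integral>\<omega>. (norm (pH S (Suc k) \<omega> (W \<omega>) - HB k \<omega> (W \<omega>)))\<^sup>2 \<partial>M) \<le> (\<integral>\<omega>. \<sigma>g2\<^sup>2 * (norm (W \<omega>))\<^sup>2 \<partial>M)"
    by (rule d(2)) (use W sq_intD(2) in auto)
  show "sq_int M (\<lambda>\<omega>. pH S (Suc k) \<omega> (W \<omega>))" using sq_int_add(1)[OF d1 HB_sq_int(1)[OF W(1), of k]] by simp
  show "(\<integral>\<omega>. (norm (pH S (Suc k) \<omega> (W \<omega>)))\<^sup>2 \<partial>M) \<le> (2 * \<sigma>g2\<^sup>2 + 2 * CHB\<^sup>2) * (\<integral>\<omega>. (norm (W \<omega>))\<^sup>2 \<partial>M)"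
    using sq_int_add(2)[OF d1 HB_sq_int(1)[OF W(1), of k]] d2 HB_sq_int(2)[OF W(1), of k] by (simp add: algebra_simps)
qed

lemma H_eqE:
  assumes W: "sq_int M W" "W \<in> borel_measurable (FilPP D S k)" and \<psi>: "\<psi> \<in> borel_measurable (FilPP D S k)" "sq_int M \<psi>"
  shows "eqE M (\<lambda>\<omega>. \<psi> \<omega> * pH S (Suc k) \<omega> (W \<omega>) $ b) (\<lambda>\<omega>. \<psi> \<omega> * HB k \<omega> (W \<omega>) $ b)"
proof -
  have "eqE M (\<lambda>\<omega>. \<psi> \<omega> * inner (pH S (Suc k) \<omega> (W \<omega>)) (axis b 1)) (\<lambda>\<omega>. \<psi> \<omega> * inner (HB k \<omega> (W \<omega>)) (axis b 1))"
  proof (rule cond_mean_eqE[OF subalg(3) estimators_H(1)[OF W(2)]])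
    show "axis b 1 \<in> (Basis :: (real ^ 'b) set)" by (simp add: axis_in_Basis_iff)
    show "integrable M (\<lambda>\<omega>. \<psi> \<omega> * inner (pH S (Suc k) \<omega> (W \<omega>)) (axis b 1))"
      unfolding cart_eq_inner_axis[symmetric] by (intro sq_int_mult \<psi> sq_int_nth H_sq_int W)
  qed (use W \<psi> H_sq_int(1)[OF W] HB_sq_int(1)[OF W(1)] sq_intD in auto)
  then show ?thesis by (simp add: cart_eq_inner_axis)
qed

text \<open>The choice is made from a statement about the layout only, so different runs share the
  same value.\<close>

definition "CHA = (SOME C. 0 \<le> C \<and> (\<forall>P H u \<xi> Z. bounded_frames P \<longrightarrow> bounded_probes u \<xi> \<longrightarrow>
   norm (hess_action D P H u \<xi> Z) \<le> C * (norm H * norm Z)))"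

lemma CHA: "0 \<le> CHA"
  "bounded_frames P \<Longrightarrow> bounded_probes u \<xi> \<Longrightarrow> norm (hess_action D P H u \<xi> Z) \<le> CHA * (norm H * norm Z)"
proof -
  have "\<exists>C. 0 \<le> C \<and> (\<forall>P H u \<xi> Z. bounded_frames P \<longrightarrow> bounded_probes u \<xi> \<longrightarrow>
     norm (hess_action D P H u \<xi> Z) \<le> C * (norm H * norm Z))"
    using hess_action_bound by blast
  from someI_ex[OF this] show "0 \<le> CHA"
    "bounded_frames P \<Longrightarrow> bounded_probes u \<xi> \<Longrightarrow> norm (hess_action D P H u \<xi> Z) \<le> CHA * (norm H * norm Z)"
    unfolding CHA_def[symmetric] by blast+
qed

abbreviation "ha k \<omega> H \<equiv> hess_action D (pP S k \<omega>) H (pu S (Suc k) \<omega>) (pxi S (Suc k) \<omega>) (pZ S k \<omega>)"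

text \<open>The coefficients of the expansion grow with \<open>Z\<close> and are merely square
  integrable, as is the weight. Each coefficient is therefore moved into the direction queried, for
  which the oracle relation with a random direction applies; the weight and the response then are
  both square integrable and their product has an integral.\<close>

lemma ha_eqE:
  assumes L: "L2 k" and \<psi>: "\<psi> \<in> borel_measurable (FilPP D S k)" "sq_int M \<psi>"
  shows "eqE M (\<lambda>\<omega>. \<psi> \<omega> * ha k \<omega> (pH S (Suc k) \<omega>) $ c) (\<lambda>\<omega>. \<psi> \<omega> * ha k \<omega> (HB k \<omega>) $ c)"
proof (rule eqE_cong)
  show "eqE M (\<lambda>\<omega>. \<Sum>b\<in>UNIV. \<Sum>b'\<in>UNIV. \<psi> \<omega> * pH S (Suc k) \<omega> ((ha k \<omega> (elem_blinfun b b') $ c) *\<^sub>R axis b' 1) $ b)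
    (\<lambda>\<omega>. \<Sum>b\<in>UNIV. \<Sum>b'\<in>UNIV. \<psi> \<omega> * HB k \<omega> ((ha k \<omega> (elem_blinfun b b') $ c) *\<^sub>R axis b' 1) $ b)"
  proof (rule eqE_sum)+
    fix b b' :: 'b
    let ?c = "\<lambda>\<omega>. ha k \<omega> (elem_blinfun b b') $ c"
    have mc: "?c \<in> borel_measurable (FilPP D S k)"
      by (intro borel_vec_nth borel_hess_action FilP_FilPP P_FilP probes_FilPP Fil_FilP states_Fil borel_measurable_const)
    have "AE \<omega> in M. norm (?c \<omega>) \<le> (CHA * norm (elem_blinfun b b')) * norm (pZ S k \<omega>)"
      using bounded_frames_AE[of k] bounded_probes_AE[of k]
    proof eventually_elim
      case (elim \<omega>)
      have "norm (?c \<omega>) \<le> norm (ha k \<omega> (elem_blinfun b b'))" by (simp add: component_le_norm_cart)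
      also have "\<dots> \<le> CHA * (norm (elem_blinfun b b') * norm (pZ S k \<omega>))" by (rule CHA(2)[OF elim])
      finally show ?case by (simp add: mult.assoc)
    qed
    then have sc: "sq_int M ?c" by (rule sq_int_bound(1)[OF FilPP_M[OF mc] L2D(3)[OF L]])
    have sW: "sq_int M (\<lambda>\<omega>. ?c \<omega> *\<^sub>R axis b' 1 :: real ^ 'b)"
      by (rule sq_int_bound(1)[OF _ sc, where C = 1]) (auto intro!: borel_measurable_scaleR FilPP_M[OF mc])
    show "eqE M (\<lambda>\<omega>. \<psi> \<omega> * pH S (Suc k) \<omega> (?c \<omega> *\<^sub>R axis b' 1) $ b) (\<lambda>\<omega>. \<psi> \<omega> * HB k \<omega> (?c \<omega> *\<^sub>R axis b' 1) $ b)"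
      by (rule H_eqE[OF sW _ \<psi>]) (intro borel_measurable_scaleR mc borel_measurable_const)
  qed
  fix \<omega>
  show "\<psi> \<omega> * ha k \<omega> (pH S (Suc k) \<omega>) $ c
     = (\<Sum>b\<in>UNIV. \<Sum>b'\<in>UNIV. \<psi> \<omega> * pH S (Suc k) \<omega> ((ha k \<omega> (elem_blinfun b b') $ c) *\<^sub>R axis b' 1) $ b)"
    "\<psi> \<omega> * ha k \<omega> (HB k \<omega>) $ c
     = (\<Sum>b\<in>UNIV. \<Sum>b'\<in>UNIV. \<psi> \<omega> * HB k \<omega> ((ha k \<omega> (elem_blinfun b b') $ c) *\<^sub>R axis b' 1) $ b)"
    by (subst hess_action_expand, simp add: sum_distrib_left blinfun.scaleR_right)+
qed

abbreviation "hY k \<omega> \<equiv> hcoef (posY D) (HY k \<omega>)"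

lemma hY_Fil: "(\<lambda>\<omega>. hY k \<omega> s s') \<in> borel_measurable (Fil D S k)"
  unfolding hcoef_def by (intro borel_vec_nth borel_grads states_Fil)

lemma hY_bound: "\<bar>hY k \<omega> s s'\<bar> \<le> Lg1"
  unfolding hcoef_def
  using order_trans[OF component_le_norm_cart hess_yy_bound[of "px S k \<omega>" "pY S k \<omega>" "axis (inv (posY D) s') 1"]] by simp

lemma hY_symmetric: "hY k \<omega> s s' = hY k \<omega> s' s"
proof -
  have "hY k \<omega> s s' = inner (HY k \<omega> (axis (inv (posY D) s') 1)) (axis (inv (posY D) s) 1)"
    by (simp add: hcoef_def inner_axis)
  also have "\<dots> = inner (axis (inv (posY D) s') 1) (HY k \<omega> (axis (inv (posY D) s) 1))" by (rule hess_yy_symmetric)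
  also have "\<dots> = hY k \<omega> s' s" by (simp add: hcoef_def inner_axis')
  finally show ?thesis .
qed

lemma hB_bound: "AE \<omega> in M. \<bar>hcoef (posB D) (blinfun_apply (HB k \<omega>)) s s'\<bar> \<le> CHB"
  using bounded_frames_AE[of k]
proof eventually_elim
  case (elim \<omega>)
  show ?case unfolding hcoef_def
    using order_trans[OF component_le_norm_cart HB_bound[OF elim, of "axis (inv (posB D) s') 1"]] by simp
qed

lemma hB_FilP: "(\<lambda>\<omega>. hcoef (posB D) (blinfun_apply (HB k \<omega>)) s s') \<in> borel_measurable (FilP D S k)"
  unfolding hcoef_def by (intro borel_vec_nth HB_FilP)

section \<open>Entrywise means of the terms of the corrected action\<close>

context
  fixes k :: nat and \<psi> :: "'w \<Rightarrow> real" and l :: 'l and i j :: nat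
  assumes L: "L2 k" and \<psi>: "\<psi> \<in> borel_measurable (Fil D S k)" "sq_int M \<psi>"
    and ij: "i < m l" "j < n l"
begin

abbreviation "ZB \<equiv> \<lambda>\<omega>. blkY (pZ S k \<omega>)"

lemma psi_h_Z: "(\<lambda>\<omega>. \<psi> \<omega> * (hY k \<omega> s s' * ZB \<omega> t (a, b))) \<in> borel_measurable (Fil D S k)"
  "integrable M (\<lambda>\<omega>. \<psi> \<omega> * (hY k \<omega> s s' * ZB \<omega> t (a, b)))"
proof -
  show "(\<lambda>\<omega>. \<psi> \<omega> * (hY k \<omega> s s' * ZB \<omega> t (a, b))) \<in> borel_measurable (Fil D S k)"
    by (intro borel_measurable_times \<psi> hY_Fil borel_block states_Fil)
  have "integrable M (\<lambda>\<omega>. (\<psi> \<omega> * ZB \<omega> t (a, b)) * hY k \<omega> s s')"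
    by (rule integrable_mult_AE_bounded[where C = Lg1])
      (auto intro!: sq_int_mult \<psi> sq_int_block L2D(3)[OF L] Fil_M[OF hY_Fil] hY_bound)
  then show "integrable M (\<lambda>\<omega>. \<psi> \<omega> * (hY k \<omega> s s' * ZB \<omega> t (a, b)))" by (simp add: ac_simps)
qed

text \<open>\<open>T1\<close> is the diagonal-block Hessian action itself, that is, the target;
  \<open>T2\<close> and \<open>T3\<close> are the parasitic contractions from the two other pairings
  of the Gram indices. \<open>Qt\<close> is the contribution of layer \<open>t\<close> to the true
  action.\<close>

definition "F4 \<omega> i1 i2 b i3 = hY k \<omega> (l, i1, j) (l, i2, b) * ZB \<omega> l (i3, b)"
definition "T1 \<omega> = (\<Sum>a<m l. \<Sum>b<n l. F4 \<omega> i a b a)"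
definition "T2 \<omega> = (\<Sum>a<m l. \<Sum>b<n l. F4 \<omega> a i b a)"
definition "T3 \<omega> = (\<Sum>a<m l. \<Sum>b<n l. F4 \<omega> a a b i)"
definition "Qt \<omega> t = (\<Sum>a<m t. \<Sum>b<n t. hY k \<omega> (l, i, j) (t, a, b) * ZB \<omega> t (a, b))"

abbreviation "gA \<equiv> gramA (real (m l)) (real (r l))"
abbreviation "gB \<equiv> gramB (real (m l)) (real (r l))"

text \<open>Different layers have independent frames, so both Gram factors average to the identity
  and the off-diagonal blocks need no correction.\<close>

lemma Ablk_offdiag_eqE:
  assumes t: "t \<noteq> l"
  shows "eqE M (\<lambda>\<omega>. \<psi> \<omega> * Ablk D (pP S k \<omega>) (HB k \<omega>) (pZ S k \<omega>) t l (i, j)) (\<lambda>\<omega>. \<psi> \<omega> * Qt \<omega> t)"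
proof (rule eqE_cong)
  show "eqE M (\<lambda>\<omega>. \<Sum>i1<m l. \<Sum>i2<m t. \<Sum>b<n t. \<Sum>i3<m t.
      (\<psi> \<omega> * (hY k \<omega> (l, i1, j) (t, i2, b) * ZB \<omega> t (i3, b))) * (gram k \<omega> l i i1 * gram k \<omega> t i2 i3))
    (\<lambda>\<omega>. \<Sum>i1<m l. \<Sum>i2<m t. \<Sum>b<n t. \<Sum>i3<m t.
      (\<psi> \<omega> * (hY k \<omega> (l, i1, j) (t, i2, b) * ZB \<omega> t (i3, b))) * (of_bool (i = i1) * of_bool (i2 = i3)))"
  proof (rule eqE_sum)+
    fix i1 i2 b i3 assume "i1 \<in> {..<m l}" "i2 \<in> {..<m t}" "i3 \<in> {..<m t}"
    then show "eqE M (\<lambda>\<omega>. (\<psi> \<omega> * (hY k \<omega> (l, i1, j) (t, i2, b) * ZB \<omega> t (i3, b))) * (gram k \<omega> l i i1 * gram k \<omega> t i2 i3))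
      (\<lambda>\<omega>. (\<psi> \<omega> * (hY k \<omega> (l, i1, j) (t, i2, b) * ZB \<omega> t (i3, b))) * (of_bool (i = i1) * of_bool (i2 = i3)))"
      using gram_pair_eqE(1)[OF psi_h_Z, of i l i1 i2 t i3] t ij by simp
  qed
  fix \<omega>
  show "\<psi> \<omega> * Ablk D (pP S k \<omega>) (HB k \<omega>) (pZ S k \<omega>) t l (i, j) = (\<Sum>i1<m l. \<Sum>i2<m t. \<Sum>b<n t. \<Sum>i3<m t.
      (\<psi> \<omega> * (hY k \<omega> (l, i1, j) (t, i2, b) * ZB \<omega> t (i3, b))) * (gram k \<omega> l i i1 * gram k \<omega> t i2 i3))"
    unfolding Ablk_sandwich[OF hess_yy_linear HB_apply ij] by (simp add: sum_distrib_left ac_simps)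
  have "\<psi> \<omega> * Qt \<omega> t = \<psi> \<omega> * (\<Sum>i1<m l. \<Sum>i2<m t. \<Sum>b<n t. \<Sum>i3<m t. (of_bool (i = i1) * of_bool (i2 = i3)) * (hY k \<omega> (l, i1, j) (t, i2, b) * ZB \<omega> t (i3, b)))"
    unfolding Qt_def sum_contract1[OF ij(1), where F = "\<lambda>i1 i2 b i3. hY k \<omega> (l, i1, j) (t, i2, b) * ZB \<omega> t (i3, b)"] ..
  then show "\<psi> \<omega> * Qt \<omega> t = (\<Sum>i1<m l. \<Sum>i2<m t. \<Sum>b<n t. \<Sum>i3<m t.
      (\<psi> \<omega> * (hY k \<omega> (l, i1, j) (t, i2, b) * ZB \<omega> t (i3, b))) * (of_bool (i = i1) * of_bool (i2 = i3)))"
    by (simp only: sum_distrib_left ac_simps)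
qed

lemma Ablk_diag_eqE:
  "eqE M (\<lambda>\<omega>. \<psi> \<omega> * Ablk D (pP S k \<omega>) (HB k \<omega>) (pZ S k \<omega>) l l (i, j)) (\<lambda>\<omega>. \<psi> \<omega> * (gA * T1 \<omega> + gB * (T2 \<omega> + T3 \<omega>)))"
proof (rule eqE_cong)
  let ?\<mu> = "\<lambda>i1 i2 i3. gA * (of_bool (i = i1) * of_bool (i2 = i3)) + gB * (of_bool (i = i2) * of_bool (i1 = i3) + of_bool (i = i3) * of_bool (i1 = i2))"
  show "eqE M (\<lambda>\<omega>. \<Sum>i1<m l. \<Sum>i2<m l. \<Sum>b<n l. \<Sum>i3<m l. (\<psi> \<omega> * F4 \<omega> i1 i2 b i3) * (gram k \<omega> l i i1 * gram k \<omega> l i2 i3))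
    (\<lambda>\<omega>. \<Sum>i1<m l. \<Sum>i2<m l. \<Sum>b<n l. \<Sum>i3<m l. (\<psi> \<omega> * F4 \<omega> i1 i2 b i3) * ?\<mu> i1 i2 i3)"
  proof (rule eqE_sum)+
    fix i1 i2 b i3 assume "i1 \<in> {..<m l}" "i2 \<in> {..<m l}" "i3 \<in> {..<m l}"
    then show "eqE M (\<lambda>\<omega>. (\<psi> \<omega> * F4 \<omega> i1 i2 b i3) * (gram k \<omega> l i i1 * gram k \<omega> l i2 i3)) (\<lambda>\<omega>. (\<psi> \<omega> * F4 \<omega> i1 i2 b i3) * ?\<mu> i1 i2 i3)"
      using gram_pair_eqE(1)[OF psi_h_Z, of i l i1 i2 l i3] ij unfolding F4_def by simp
  qed
  fix \<omega>
  show "\<psi> \<omega> * Ablk D (pP S k \<omega>) (HB k \<omega>) (pZ S k \<omega>) l l (i, j)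
    = (\<Sum>i1<m l. \<Sum>i2<m l. \<Sum>b<n l. \<Sum>i3<m l. (\<psi> \<omega> * F4 \<omega> i1 i2 b i3) * (gram k \<omega> l i i1 * gram k \<omega> l i2 i3))"
    unfolding Ablk_sandwich[OF hess_yy_linear HB_apply ij] F4_def by (simp add: sum_distrib_left ac_simps)
  have eq: "(\<Sum>i1<m l. \<Sum>i2<m l. \<Sum>b<n l. \<Sum>i3<m l. ?\<mu> i1 i2 i3 * F4 \<omega> i1 i2 b i3) = gA * T1 \<omega> + gB * (T2 \<omega> + T3 \<omega>)"
    unfolding T1_def T2_def T3_def sum_contract1[OF ij(1), symmetric] sum_contract2[OF ij(1), symmetric]
    by (simp only: distrib_left distrib_right sum.distrib sum_distrib_left mult.assoc)
  show "\<psi> \<omega> * (gA * T1 \<omega> + gB * (T2 \<omega> + T3 \<omega>))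
    = (\<Sum>i1<m l. \<Sum>i2<m l. \<Sum>b<n l. \<Sum>i3<m l. (\<psi> \<omega> * F4 \<omega> i1 i2 b i3) * ?\<mu> i1 i2 i3)"
    unfolding eq[symmetric] by (simp only: sum_distrib_left ac_simps)
qed

text \<open>The probes are averaged first, with the frame held fixed; the result is linear in the
  Gram entries, and averaging the frame leaves the trace over the row index.\<close>

lemma Chat_eqE:
  "eqE M (\<lambda>\<omega>. \<psi> \<omega> * Chat D (HB k \<omega>) (pu S (Suc k) \<omega>) (pxi S (Suc k) \<omega>) (pZ S k \<omega>) l (i, j)) (\<lambda>\<omega>. \<psi> \<omega> * T3 \<omega>)"
proof (rule eqE_trans)
  let ?h = "\<lambda>\<omega>. hcoef (posB D) (blinfun_apply (HB k \<omega>))"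
  show "eqE M (\<lambda>\<omega>. \<psi> \<omega> * Chat D (HB k \<omega>) (pu S (Suc k) \<omega>) (pxi S (Suc k) \<omega>) (pZ S k \<omega>) l (i, j)) (\<lambda>\<omega>. \<psi> \<omega> * Cbar (HB k \<omega>) (pZ S k \<omega>) l (i, j))"
  proof (rule eqE_cong)
    show "eqE M (\<lambda>\<omega>. \<Sum>b<n l. \<Sum>a<r l. \<Sum>t\<in>UNIV. \<Sum>a'<r t. \<Sum>j'<n t. (\<psi> \<omega> * (ZB \<omega> l (i, b) * ?h \<omega> (l, a, b) (t, a', j')))
         * ((pxi S (Suc k) \<omega> l a * pu S (Suc k) \<omega> l j) * (pxi S (Suc k) \<omega> t a' * pu S (Suc k) \<omega> t j')))
      (\<lambda>\<omega>. \<Sum>b<n l. \<Sum>a<r l. \<Sum>t\<in>UNIV. \<Sum>a'<r t. \<Sum>j'<n t. (\<psi> \<omega> * (ZB \<omega> l (i, b) * ?h \<omega> (l, a, b) (t, a', j'))) * of_bool ((t, a', j') = (l, a, j)))"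
    proof (rule eqE_sum)+
      fix b a t a' j' assume x: "a \<in> {..<r l}" "a' \<in> {..<r t}" "j' \<in> {..<n t}"
      have "integrable M (\<lambda>\<omega>. (\<psi> \<omega> * ZB \<omega> l (i, b)) * ?h \<omega> (l, a, b) (t, a', j'))"
        by (rule integrable_mult_AE_bounded[OF _ FilP_M[OF hB_FilP] hB_bound]) (intro sq_int_mult \<psi> sq_int_block L2D(3)[OF L])
      then have int: "integrable M (\<lambda>\<omega>. \<psi> \<omega> * (ZB \<omega> l (i, b) * ?h \<omega> (l, a, b) (t, a', j')))" by (simp add: mult.assoc)
      have meas: "(\<lambda>\<omega>. \<psi> \<omega> * (ZB \<omega> l (i, b) * ?h \<omega> (l, a, b) (t, a', j'))) \<in> borel_measurable (FilP D S k)"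
        by (intro borel_measurable_times borel_block Fil_FilP \<psi> states_Fil hB_FilP)
      show "eqE M (\<lambda>\<omega>. (\<psi> \<omega> * (ZB \<omega> l (i, b) * ?h \<omega> (l, a, b) (t, a', j')))
         * ((pxi S (Suc k) \<omega> l a * pu S (Suc k) \<omega> l j) * (pxi S (Suc k) \<omega> t a' * pu S (Suc k) \<omega> t j')))
        (\<lambda>\<omega>. (\<psi> \<omega> * (ZB \<omega> l (i, b) * ?h \<omega> (l, a, b) (t, a', j'))) * of_bool ((t, a', j') = (l, a, j)))"
        using probe_pair_eqE[OF meas int, of a l j a' t j'] x ij by simp
    qed
    fix \<omega>
    show "\<psi> \<omega> * Chat D (HB k \<omega>) (pu S (Suc k) \<omega>) (pxi S (Suc k) \<omega>) (pZ S k \<omega>) l (i, j)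
      = (\<Sum>b<n l. \<Sum>a<r l. \<Sum>t\<in>UNIV. \<Sum>a'<r t. \<Sum>j'<n t. (\<psi> \<omega> * (ZB \<omega> l (i, b) * ?h \<omega> (l, a, b) (t, a', j')))
         * ((pxi S (Suc k) \<omega> l a * pu S (Suc k) \<omega> l j) * (pxi S (Suc k) \<omega> t a' * pu S (Suc k) \<omega> t j')))"
      unfolding Chat_eq[OF ij] by (simp only: sum_distrib_left mult.assoc)
    show "\<psi> \<omega> * Cbar (HB k \<omega>) (pZ S k \<omega>) l (i, j)
      = (\<Sum>b<n l. \<Sum>a<r l. \<Sum>t\<in>UNIV. \<Sum>a'<r t. \<Sum>j'<n t. (\<psi> \<omega> * (ZB \<omega> l (i, b) * ?h \<omega> (l, a, b) (t, a', j'))) * of_bool ((t, a', j') = (l, a, j)))"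
      unfolding Cbar_delta[OF ij] by (simp only: sum_distrib_left mult.assoc)
  qed
  show "eqE M (\<lambda>\<omega>. \<psi> \<omega> * Cbar (HB k \<omega>) (pZ S k \<omega>) l (i, j)) (\<lambda>\<omega>. \<psi> \<omega> * T3 \<omega>)"
  proof (rule eqE_cong)
    show "eqE M (\<lambda>\<omega>. \<Sum>b<n l. \<Sum>i1<m l. \<Sum>i2<m l. (\<psi> \<omega> * (hY k \<omega> (l, i1, b) (l, i2, j) * ZB \<omega> l (i, b))) * gram k \<omega> l i1 i2)
      (\<lambda>\<omega>. \<Sum>b<n l. \<Sum>i1<m l. \<Sum>i2<m l. (\<psi> \<omega> * (hY k \<omega> (l, i1, b) (l, i2, j) * ZB \<omega> l (i, b))) * of_bool (i1 = i2))"
    proof (rule eqE_sum)+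
      fix b i1 i2 assume x: "i1 \<in> {..<m l}" "i2 \<in> {..<m l}"
      show "eqE M (\<lambda>\<omega>. (\<psi> \<omega> * (hY k \<omega> (l, i1, b) (l, i2, j) * ZB \<omega> l (i, b))) * gram k \<omega> l i1 i2)
        (\<lambda>\<omega>. (\<psi> \<omega> * (hY k \<omega> (l, i1, b) (l, i2, j) * ZB \<omega> l (i, b))) * of_bool (i1 = i2))"
        by (rule gram_pair_eqE(2)[where l = l and t = l and j = i and j' = i]) (use x ij psi_h_Z in auto)
    qed
    fix \<omega>
    show "\<psi> \<omega> * Cbar (HB k \<omega>) (pZ S k \<omega>) l (i, j)
      = (\<Sum>b<n l. \<Sum>i1<m l. \<Sum>i2<m l. (\<psi> \<omega> * (hY k \<omega> (l, i1, b) (l, i2, j) * ZB \<omega> l (i, b))) * gram k \<omega> l i1 i2)"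
      unfolding Cbar_sandwich[OF hess_yy_linear HB_apply ij] by (simp only: sum_distrib_left ac_simps)
    \<comment> \<open>The column index \<open>j\<close> stands on the input side here but on the
      output side in \<open>F4\<close>; symmetry of the Hessian reconciles the two.\<close>
    have "(\<Sum>i2<m l. (\<psi> \<omega> * (hY k \<omega> (l, i1, b) (l, i2, j) * ZB \<omega> l (i, b))) * of_bool (i1 = i2)) = \<psi> \<omega> * F4 \<omega> i1 i1 b i"
      if "i1 \<in> {..<m l}" for i1 b
      using sum_of_bool[of i1 "m l" "\<lambda>i2. \<psi> \<omega> * (hY k \<omega> (l, i1, b) (l, i2, j) * ZB \<omega> l (i, b))"] that
      by (simp add: F4_def mult.commute hY_symmetric[of k \<omega> "(l, i1, b)"])
    then have "(\<Sum>b<n l. \<Sum>i1<m l. \<Sum>i2<m l. (\<psi> \<omega> * (hY k \<omega> (l, i1, b) (l, i2, j) * ZB \<omega> l (i, b))) * of_bool (i1 = i2))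
      = (\<Sum>b<n l. \<Sum>i1<m l. \<psi> \<omega> * F4 \<omega> i1 i1 b i)" by (intro sum.cong refl)
    also have "\<dots> = (\<Sum>i1<m l. \<Sum>b<n l. \<psi> \<omega> * F4 \<omega> i1 i1 b i)" by (rule sum.swap)
    finally show "\<psi> \<omega> * T3 \<omega> = (\<Sum>b<n l. \<Sum>i1<m l. \<Sum>i2<m l. (\<psi> \<omega> * (hY k \<omega> (l, i1, b) (l, i2, j) * ZB \<omega> l (i, b))) * of_bool (i1 = i2))"
      by (simp add: T3_def sum_distrib_left)
  qed
qed

text \<open>The same two stages as for \<open>Chat_eqE\<close>. Because the Gram indices are
  crossed, \<open>T1\<close> and \<open>T2\<close> appear with exchanged coefficients.\<close>

lemma Bhat_eqE:
  "eqE M (\<lambda>\<omega>. \<psi> \<omega> * Bhat D (pP S k \<omega>) (HB k \<omega>) (pu S (Suc k) \<omega>) (pxi S (Suc k) \<omega>) (pZ S k \<omega>) l (i, j))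
    (\<lambda>\<omega>. \<psi> \<omega> * (gA * T2 \<omega> + gB * (T1 \<omega> + T3 \<omega>)))"
proof (rule eqE_trans)
  let ?h = "\<lambda>\<omega>. hcoef (posB D) (blinfun_apply (HB k \<omega>))"
  let ?P = "\<lambda>\<omega>. pP S k \<omega>"
  show "eqE M (\<lambda>\<omega>. \<psi> \<omega> * Bhat D (pP S k \<omega>) (HB k \<omega>) (pu S (Suc k) \<omega>) (pxi S (Suc k) \<omega>) (pZ S k \<omega>) l (i, j))
    (\<lambda>\<omega>. \<psi> \<omega> * Bbar (?P \<omega>) (HB k \<omega>) (pZ S k \<omega>) l (i, j))"
  proof (rule eqE_cong)
    let ?c = "\<lambda>\<omega> a a' b t a'' j'. ?P \<omega> l (i, a) * Ztil D (?P \<omega>) (pZ S k \<omega>) l (a', b) * ?h \<omega> (l, a', j) (t, a'', j')"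
    show "eqE M (\<lambda>\<omega>. \<Sum>a<r l. \<Sum>a'<r l. \<Sum>b<n l. \<Sum>t\<in>UNIV. \<Sum>a''<r t. \<Sum>j'<n t. (\<psi> \<omega> * ?c \<omega> a a' b t a'' j')
         * ((pxi S (Suc k) \<omega> l a * pu S (Suc k) \<omega> l b) * (pxi S (Suc k) \<omega> t a'' * pu S (Suc k) \<omega> t j')))
      (\<lambda>\<omega>. \<Sum>a<r l. \<Sum>a'<r l. \<Sum>b<n l. \<Sum>t\<in>UNIV. \<Sum>a''<r t. \<Sum>j'<n t. (\<psi> \<omega> * ?c \<omega> a a' b t a'' j') * of_bool ((t, a'', j') = (l, a, b)))"
    proof (rule eqE_sum)+
      fix a a' b t a'' j' assume x: "a \<in> {..<r l}" "a' \<in> {..<r l}" "b \<in> {..<n l}" "a'' \<in> {..<r t}" "j' \<in> {..<n t}"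
      have mP: "(\<lambda>\<omega>. ?P \<omega> l (i, a)) \<in> borel_measurable (FilP D S k)"
        using x ij by (intro borel_frame_entry P_FilP) auto
      have mZ: "(\<lambda>\<omega>. Ztil D (?P \<omega>) (pZ S k \<omega>) l (a', b)) \<in> borel_measurable (FilP D S k)"
        using x by (intro borel_Ztil P_FilP Fil_FilP states_Fil) auto
      have meas: "(\<lambda>\<omega>. \<psi> \<omega> * ?c \<omega> a a' b t a'' j') \<in> borel_measurable (FilP D S k)"
        by (intro borel_measurable_times mP mZ Fil_FilP \<psi> hB_FilP)
      have sZ: "sq_int M (\<lambda>\<omega>. Ztil D (?P \<omega>) (pZ S k \<omega>) l (a', b))"
      proof (rule sq_int_bound(1)[OF FilP_M[OF mZ] L2D(3)[OF L]])
        show "AE \<omega> in M. norm (Ztil D (?P \<omega>) (pZ S k \<omega>) l (a', b)) \<le> (NN * NN) * norm (pZ S k \<omega>)"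
          using bounded_frames_AE[of k]
        proof eventually_elim
          case (elim \<omega>)
          show ?case using Ztil_bound[OF elim, of a' l "pZ S k \<omega>" b] x by (simp add: mult.assoc)
        qed
      qed
      have bP: "AE \<omega> in M. \<bar>?P \<omega> l (i, a) * ?h \<omega> (l, a', j) (t, a'', j')\<bar> \<le> NN * CHB"
        using bounded_frames_AE[of k] hB_bound[of k "(l, a', j)" "(t, a'', j')"]
        by eventually_elim (use x ij in \<open>auto intro!: abs_mult_le frame_entry\<close>)
      have "integrable M (\<lambda>\<omega>. (\<psi> \<omega> * Ztil D (?P \<omega>) (pZ S k \<omega>) l (a', b)) * (?P \<omega> l (i, a) * ?h \<omega> (l, a', j) (t, a'', j')))"
        by (rule integrable_mult_AE_bounded[OF sq_int_mult[OF \<psi>(2) sZ] borel_measurable_times[OF FilP_M[OF mP] FilP_M[OF hB_FilP]] bP])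
      then have int: "integrable M (\<lambda>\<omega>. \<psi> \<omega> * ?c \<omega> a a' b t a'' j')" by (simp add: ac_simps)
      show "eqE M (\<lambda>\<omega>. (\<psi> \<omega> * ?c \<omega> a a' b t a'' j')
         * ((pxi S (Suc k) \<omega> l a * pu S (Suc k) \<omega> l b) * (pxi S (Suc k) \<omega> t a'' * pu S (Suc k) \<omega> t j')))
        (\<lambda>\<omega>. (\<psi> \<omega> * ?c \<omega> a a' b t a'' j') * of_bool ((t, a'', j') = (l, a, b)))"
        using probe_pair_eqE[OF meas int, of a l b a'' t j'] x ij by simp
    qed
    fix \<omega>
    show "\<psi> \<omega> * Bhat D (pP S k \<omega>) (HB k \<omega>) (pu S (Suc k) \<omega>) (pxi S (Suc k) \<omega>) (pZ S k \<omega>) l (i, j)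
      = (\<Sum>a<r l. \<Sum>a'<r l. \<Sum>b<n l. \<Sum>t\<in>UNIV. \<Sum>a''<r t. \<Sum>j'<n t. (\<psi> \<omega> * ?c \<omega> a a' b t a'' j')
         * ((pxi S (Suc k) \<omega> l a * pu S (Suc k) \<omega> l b) * (pxi S (Suc k) \<omega> t a'' * pu S (Suc k) \<omega> t j')))"
      unfolding Bhat_eq[OF ij] by (simp only: sum_distrib_left mult.assoc)
    show "\<psi> \<omega> * Bbar (?P \<omega>) (HB k \<omega>) (pZ S k \<omega>) l (i, j)
      = (\<Sum>a<r l. \<Sum>a'<r l. \<Sum>b<n l. \<Sum>t\<in>UNIV. \<Sum>a''<r t. \<Sum>j'<n t. (\<psi> \<omega> * ?c \<omega> a a' b t a'' j') * of_bool ((t, a'', j') = (l, a, b)))"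
      unfolding Bbar_delta[OF ij] by (simp only: sum_distrib_left mult.assoc)
  qed
  show "eqE M (\<lambda>\<omega>. \<psi> \<omega> * Bbar (?P \<omega>) (HB k \<omega>) (pZ S k \<omega>) l (i, j)) (\<lambda>\<omega>. \<psi> \<omega> * (gA * T2 \<omega> + gB * (T1 \<omega> + T3 \<omega>)))"
  proof (rule eqE_cong)
    let ?\<mu> = "\<lambda>i1 i2 i3. gA * (of_bool (i = i2) * of_bool (i1 = i3)) + gB * (of_bool (i = i1) * of_bool (i2 = i3) + of_bool (i = i3) * of_bool (i2 = i1))"
    show "eqE M (\<lambda>\<omega>. \<Sum>i1<m l. \<Sum>i2<m l. \<Sum>b<n l. \<Sum>i3<m l. (\<psi> \<omega> * F4 \<omega> i1 i2 b i3) * (gram k \<omega> l i i2 * gram k \<omega> l i1 i3))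
      (\<lambda>\<omega>. \<Sum>i1<m l. \<Sum>i2<m l. \<Sum>b<n l. \<Sum>i3<m l. (\<psi> \<omega> * F4 \<omega> i1 i2 b i3) * ?\<mu> i1 i2 i3)"
    proof (rule eqE_sum)+
      fix i1 i2 b i3 assume "i1 \<in> {..<m l}" "i2 \<in> {..<m l}" "i3 \<in> {..<m l}"
      then show "eqE M (\<lambda>\<omega>. (\<psi> \<omega> * F4 \<omega> i1 i2 b i3) * (gram k \<omega> l i i2 * gram k \<omega> l i1 i3)) (\<lambda>\<omega>. (\<psi> \<omega> * F4 \<omega> i1 i2 b i3) * ?\<mu> i1 i2 i3)"
        using gram_pair_eqE(1)[OF psi_h_Z, of i l i2 i1 l i3] ij unfolding F4_def by simp
    qed
    fix \<omega>
    show "\<psi> \<omega> * Bbar (?P \<omega>) (HB k \<omega>) (pZ S k \<omega>) l (i, j)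
      = (\<Sum>i1<m l. \<Sum>i2<m l. \<Sum>b<n l. \<Sum>i3<m l. (\<psi> \<omega> * F4 \<omega> i1 i2 b i3) * (gram k \<omega> l i i2 * gram k \<omega> l i1 i3))"
      unfolding trans[OF Bbar_sandwich[OF hess_yy_linear HB_apply ij] sum_rotate] F4_def
      by (simp add: sum_distrib_left ac_simps)
    have comm: "of_bool (i2 = i1) = (of_bool (i1 = i2) :: real)" for i1 i2 :: nat by auto
    have eq: "(\<Sum>i1<m l. \<Sum>i2<m l. \<Sum>b<n l. \<Sum>i3<m l. ?\<mu> i1 i2 i3 * F4 \<omega> i1 i2 b i3) = gA * T2 \<omega> + gB * (T1 \<omega> + T3 \<omega>)"
      unfolding T1_def T2_def T3_def sum_contract1[OF ij(1), symmetric] sum_contract2[OF ij(1), symmetric]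
      by (subst comm, simp only: distrib_left distrib_right sum.distrib sum_distrib_left mult.assoc)
    show "\<psi> \<omega> * (gA * T2 \<omega> + gB * (T1 \<omega> + T3 \<omega>))
      = (\<Sum>i1<m l. \<Sum>i2<m l. \<Sum>b<n l. \<Sum>i3<m l. (\<psi> \<omega> * F4 \<omega> i1 i2 b i3) * ?\<mu> i1 i2 i3)"
      unfolding eq[symmetric] by (simp only: sum_distrib_left ac_simps)
  qed
qed

lemma ha_mean_eqE: "eqE M (\<lambda>\<omega>. \<psi> \<omega> * blkY (ha k \<omega> (pH S (Suc k) \<omega>)) l (i, j)) (\<lambda>\<omega>. \<psi> \<omega> * blkY (HY k \<omega> (pZ S k \<omega>)) l (i, j))"
proof (rule eqE_trans)
  show "eqE M (\<lambda>\<omega>. \<psi> \<omega> * blkY (ha k \<omega> (pH S (Suc k) \<omega>)) l (i, j)) (\<lambda>\<omega>. \<psi> \<omega> * blkY (ha k \<omega> (HB k \<omega>)) l (i, j))"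
    unfolding block_def prod.case by (intro ha_eqE L FilP_FilPP Fil_FilP \<psi>)
  let ?k1 = "real (r l) * (real (m l) - 1) * (real (m l) + 2) / (real (m l) * (real (m l) * real (r l) + real (m l) - 2))"
  let ?k2 = "(real (m l) - real (r l)) / (real (m l) * real (r l) + real (m l) - 2)"
  let ?k3 = "real (r l) * (real (m l) - 1) * (real (m l) - real (r l)) / (real (m l) * (real (r l) - 1) * (real (m l) * real (r l) + real (m l) - 2))"
  let ?A = "\<lambda>\<omega> t. Ablk D (pP S k \<omega>) (HB k \<omega>) (pZ S k \<omega>) t l (i, j)"
  let ?C = "\<lambda>\<omega>. Chat D (HB k \<omega>) (pu S (Suc k) \<omega>) (pxi S (Suc k) \<omega>) (pZ S k \<omega>) l (i, j)"
  let ?B = "\<lambda>\<omega>. Bhat D (pP S k \<omega>) (HB k \<omega>) (pu S (Suc k) \<omega>) (pxi S (Suc k) \<omega>) (pZ S k \<omega>) l (i, j)"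
  let ?a = "\<lambda>\<omega>. gA * T1 \<omega> + gB * (T2 \<omega> + T3 \<omega>)" and ?b = "\<lambda>\<omega>. gA * T2 \<omega> + gB * (T1 \<omega> + T3 \<omega>)"
  show "eqE M (\<lambda>\<omega>. \<psi> \<omega> * blkY (ha k \<omega> (HB k \<omega>)) l (i, j)) (\<lambda>\<omega>. \<psi> \<omega> * blkY (HY k \<omega> (pZ S k \<omega>)) l (i, j))"
  proof (rule eqE_cong)
    show "eqE M (\<lambda>\<omega>. ((?k1 * (\<psi> \<omega> * ?A \<omega> l) - ?k2 * (\<psi> \<omega> * ?C \<omega>)) + ?k3 * (\<psi> \<omega> * ?A \<omega> l - \<psi> \<omega> * ?B \<omega>)) + (\<Sum>t\<in>UNIV - {l}. \<psi> \<omega> * ?A \<omega> t))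
      (\<lambda>\<omega>. ((?k1 * (\<psi> \<omega> * ?a \<omega>) - ?k2 * (\<psi> \<omega> * T3 \<omega>)) + ?k3 * (\<psi> \<omega> * ?a \<omega> - \<psi> \<omega> * ?b \<omega>)) + (\<Sum>t\<in>UNIV - {l}. \<psi> \<omega> * Qt \<omega> t))"
      by (intro eqE_add eqE_diff eqE_cmult eqE_sum Ablk_diag_eqE Chat_eqE Bhat_eqE Ablk_offdiag_eqE) auto
    fix \<omega>
    have "blkY (ha k \<omega> (HB k \<omega>)) l (i, j) = ((?k1 * ?A \<omega> l - ?k2 * ?C \<omega>) + ?k3 * (?A \<omega> l - ?B \<omega>)) + (\<Sum>t\<in>UNIV - {l}. ?A \<omega> t)"
      unfolding hess_action_def block_unblock[OF bijY ij] hess_diag_def Let_def ..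
    then show "\<psi> \<omega> * blkY (ha k \<omega> (HB k \<omega>)) l (i, j)
      = ((?k1 * (\<psi> \<omega> * ?A \<omega> l) - ?k2 * (\<psi> \<omega> * ?C \<omega>)) + ?k3 * (\<psi> \<omega> * ?A \<omega> l - \<psi> \<omega> * ?B \<omega>)) + (\<Sum>t\<in>UNIV - {l}. \<psi> \<omega> * ?A \<omega> t)"
      by (simp only: distrib_left right_diff_distrib sum_distrib_left mult.left_commute)
    have "blkY (HY k \<omega> (pZ S k \<omega>)) l (i, j) = (\<Sum>t\<in>UNIV. Qt \<omega> t)"
      unfolding Qt_def by (rule block_linear_map[OF bijY hess_yy_linear])
    \<comment> \<open>The summand of layer \<open>l\<close> in the true action is \<open>T1\<close>;
      it is then written as the corrected combination of the three means.\<close>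
    also have "\<dots> = T1 \<omega> + (\<Sum>t\<in>UNIV - {l}. Qt \<omega> t)"
      by (subst sum.remove[of UNIV l]) (auto simp: Qt_def T1_def F4_def)
    also have "T1 \<omega> = (?k1 * ?a \<omega> - ?k2 * T3 \<omega>) + ?k3 * (?a \<omega> - ?b \<omega>)"
      by (rule corrected_coefficients[symmetric]) (use dims in auto)
    finally have "blkY (HY k \<omega> (pZ S k \<omega>)) l (i, j) = ((?k1 * ?a \<omega> - ?k2 * T3 \<omega>) + ?k3 * (?a \<omega> - ?b \<omega>)) + (\<Sum>t\<in>UNIV - {l}. Qt \<omega> t)" .
    then show "\<psi> \<omega> * blkY (HY k \<omega> (pZ S k \<omega>)) l (i, j)
      = ((?k1 * (\<psi> \<omega> * ?a \<omega>) - ?k2 * (\<psi> \<omega> * T3 \<omega>)) + ?k3 * (\<psi> \<omega> * ?a \<omega> - \<psi> \<omega> * ?b \<omega>)) + (\<Sum>t\<in>UNIV - {l}. \<psi> \<omega> * Qt \<omega> t)"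
      by (simp only: distrib_left right_diff_distrib sum_distrib_left mult.left_commute)
  qed
qed

end

end

section \<open>Second moments and tracking errors\<close>

lemma norm_add_sq_weighted:
  fixes x y :: "'a::real_inner"
  assumes "0 < \<eta>"
  shows "(norm (x + y))\<^sup>2 \<le> (1 + \<eta>) * (norm x)\<^sup>2 + (1 + 1 / \<eta>) * (norm y)\<^sup>2"
proof -
  have "2 * inner x y \<le> 2 * (norm x * norm y)" using norm_cauchy_schwarz[of x y] by simp
  also have "\<dots> \<le> \<eta> * (norm x)\<^sup>2 + 1 / \<eta> * (norm y)\<^sup>2"
  proof -
    have "0 \<le> (\<eta> * norm x - norm y)\<^sup>2 / \<eta>" using assms by simp
    also have "\<dots> = \<eta> * (norm x)\<^sup>2 + 1 / \<eta> * (norm y)\<^sup>2 - 2 * (norm x * norm y)"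
      using assms by (simp add: power2_eq_square field_simps)
    finally show ?thesis by simp
  qed
  finally show ?thesis
    by (simp add: power2_norm_eq_inner inner_add_left inner_add_right inner_commute algebra_simps)
qed

text \<open>All three error recursions are instances: \<open>X\<close> is an error, \<open>T\<close>
  the direction taken, \<open>N\<close> the shift of the target during the step, and
  \<open>n\<close> the squared errors on which the bias of \<open>T\<close> depends.\<close>

lemma (in prob_space) tracking:
  fixes X T N :: "'a \<Rightarrow> 'b::euclidean_space"
  assumes X: "sq_int M X" and T: "sq_int M T" and N: "sq_int M N"
    and b: "0 < b" "0 < m" "b * m \<le> 1" "b * C \<le> m / 2" and nn: "0 \<le> C" "0 \<le> \<kappa>" "0 \<le> n"
    and drift: "m * (\<integral>\<omega>. (norm (X \<omega>))\<^sup>2 \<partial>M) - \<kappa> * n \<le> (\<integral>\<omega>. inner (X \<omega>) (T \<omega>) \<partial>M)"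
    and T2: "(\<integral>\<omega>. (norm (T \<omega>))\<^sup>2 \<partial>M) \<le> C * (1 + (\<integral>\<omega>. (norm (X \<omega>))\<^sup>2 \<partial>M) + n)"
    and N2: "(\<integral>\<omega>. (norm (N \<omega>))\<^sup>2 \<partial>M) \<le> s"
  shows "(\<integral>\<omega>. (norm (X \<omega> - b *\<^sub>R T \<omega> + N \<omega>))\<^sup>2 \<partial>M)
    \<le> (1 - b * m) * (\<integral>\<omega>. (norm (X \<omega>))\<^sup>2 \<partial>M) + b * (3 * \<kappa> + m) * n + 2 * C * b\<^sup>2 + 3 / (b * m) * s"
proof -
  define d where "d = (\<integral>\<omega>. (norm (X \<omega>))\<^sup>2 \<partial>M)"
  define u where "u = (\<integral>\<omega>. (norm (X \<omega> - b *\<^sub>R T \<omega>))\<^sup>2 \<partial>M)"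
  have d0: "0 \<le> d" by (simp add: d_def)
  have XT: "sq_int M (\<lambda>\<omega>. X \<omega> - b *\<^sub>R T \<omega>)" by (intro sq_int_diff(1) X sq_int_scaleR T)
  have iX: "integrable M (\<lambda>\<omega>. (norm (X \<omega>))\<^sup>2)" "integrable M (\<lambda>\<omega>. (norm (T \<omega>))\<^sup>2)" "integrable M (\<lambda>\<omega>. (norm (N \<omega>))\<^sup>2)"
    "integrable M (\<lambda>\<omega>. (norm (X \<omega> - b *\<^sub>R T \<omega>))\<^sup>2)" "integrable M (\<lambda>\<omega>. (norm (X \<omega> - b *\<^sub>R T \<omega> + N \<omega>))\<^sup>2)"
    using X T N XT sq_int_add(1)[OF XT N] by (auto dest: sq_intD)
  have iI: "integrable M (\<lambda>\<omega>. inner (X \<omega>) (T \<omega>))" by (rule sq_int_inner[OF X T])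
  have "u = (\<integral>\<omega>. (norm (X \<omega>))\<^sup>2 - 2 * b * inner (X \<omega>) (T \<omega>) + b\<^sup>2 * (norm (T \<omega>))\<^sup>2 \<partial>M)"
    unfolding u_def power2_norm_eq_inner
    by (intro Bochner_Integration.integral_cong refl)
      (simp add: inner_diff_left inner_diff_right inner_commute power2_eq_square algebra_simps)
  also have "\<dots> = d - 2 * b * (\<integral>\<omega>. inner (X \<omega>) (T \<omega>) \<partial>M) + b\<^sup>2 * (\<integral>\<omega>. (norm (T \<omega>))\<^sup>2 \<partial>M)"
    unfolding d_def using iX iI by simp
  also have "\<dots> \<le> d - 2 * b * (m * d - \<kappa> * n) + b\<^sup>2 * (C * (1 + d + n))"
    using drift T2 b unfolding d_def by (intro add_mono diff_mono mult_left_mono) auto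
  also have "\<dots> = d - 2 * b * (m * d - \<kappa> * n) + b * (b * C) * (d + n) + C * b\<^sup>2"
    by (simp add: power2_eq_square algebra_simps)
  \<comment> \<open>The smallness of \<open>b\<close> pays for the second moment: it costs a quarter
    of the contraction \<open>2 * b * m\<close>.\<close>
  also have "\<dots> \<le> d - 2 * b * (m * d - \<kappa> * n) + b * (m / 2) * (d + n) + C * b\<^sup>2"
    using b nn d0 by (intro add_mono mult_right_mono mult_left_mono order_refl) auto
  also have "\<dots> = (1 - 3 / 2 * (b * m)) * d + b * (2 * \<kappa> + m / 2) * n + C * b\<^sup>2" by (simp add: algebra_simps)
  finally have u: "u \<le> (1 - 3 / 2 * (b * m)) * d + b * (2 * \<kappa> + m / 2) * n + C * b\<^sup>2" .
  \<comment> \<open>The weight in splitting off the shift of the target; with it the factor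
    \<open>1 - 3 / 2 * (b * m)\<close> worsens to no more than \<open>1 - b * m\<close>.\<close>
  define \<eta> where "\<eta> = b * m / 2"
  have \<eta>: "0 < \<eta>" "\<eta> \<le> 1 / 2" using b by (auto simp: \<eta>_def)
  have "(\<integral>\<omega>. (norm (X \<omega> - b *\<^sub>R T \<omega> + N \<omega>))\<^sup>2 \<partial>M)
      \<le> (\<integral>\<omega>. (1 + \<eta>) * (norm (X \<omega> - b *\<^sub>R T \<omega>))\<^sup>2 + (1 + 1 / \<eta>) * (norm (N \<omega>))\<^sup>2 \<partial>M)"
    using iX norm_add_sq_weighted[OF \<eta>(1)] by (intro integral_mono) auto
  also have "\<dots> = (1 + \<eta>) * u + (1 + 1 / \<eta>) * (\<integral>\<omega>. (norm (N \<omega>))\<^sup>2 \<partial>M)" unfolding u_def using iX by simp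
  also have "\<dots> \<le> (1 + \<eta>) * ((1 - 3 / 2 * (b * m)) * d + b * (2 * \<kappa> + m / 2) * n + C * b\<^sup>2) + 3 / (b * m) * s"
  proof (rule add_mono)
    show "(1 + \<eta>) * u \<le> (1 + \<eta>) * ((1 - 3 / 2 * (b * m)) * d + b * (2 * \<kappa> + m / 2) * n + C * b\<^sup>2)"
      using u \<eta> by (intro mult_left_mono) auto
    have "1 + 1 / \<eta> \<le> 3 / (b * m)" using b by (simp add: \<eta>_def field_simps)
    then show "(1 + 1 / \<eta>) * (\<integral>\<omega>. (norm (N \<omega>))\<^sup>2 \<partial>M) \<le> 3 / (b * m) * s"
      using N2 b by (intro mult_mono) auto
  qed
  also have "(1 + \<eta>) * ((1 - 3 / 2 * (b * m)) * d + b * (2 * \<kappa> + m / 2) * n + C * b\<^sup>2)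
    \<le> (1 - b * m) * d + b * (3 * \<kappa> + m) * n + 2 * C * b\<^sup>2"
  proof -
    have "(1 + \<eta>) * ((1 - 3 / 2 * (b * m)) * d) = (1 - b * m) * d - 3 * \<eta>\<^sup>2 * d"
      by (simp add: \<eta>_def power2_eq_square algebra_simps)
    then have 1: "(1 + \<eta>) * ((1 - 3 / 2 * (b * m)) * d) \<le> (1 - b * m) * d" using d0 by simp
    have "(1 + \<eta>) * (b * (2 * \<kappa> + m / 2) * n) \<le> 3 / 2 * (b * (2 * \<kappa> + m / 2) * n)"
      using \<eta> b nn by (intro mult_right_mono) auto
    also have "\<dots> \<le> b * (3 * \<kappa> + m) * n"
      using b nn by (simp add: algebra_simps mult_nonneg_nonneg)
    finally have 2: "(1 + \<eta>) * (b * (2 * \<kappa> + m / 2) * n) \<le> b * (3 * \<kappa> + m) * n" .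
    have 3: "(1 + \<eta>) * (C * b\<^sup>2) \<le> 2 * (C * b\<^sup>2)" using \<eta> nn by (intro mult_right_mono) auto
    show ?thesis using 1 2 3 unfolding distrib_left[of "1 + \<eta>"] by linarith
  qed
  finally show ?thesis by (simp add: d_def)
qed

section \<open>Tracking errors and their sources\<close>

context bros
begin

definition "DY k \<omega> = pY S k \<omega> - Ystar g (px S k \<omega>)"
definition "DZ k \<omega> = pZ S k \<omega> - Zstar f g (px S k \<omega>)"
definition "DH k \<omega> = ph S k \<omega> - hypergrad f g (px S k \<omega>)"

lemma lipschitz_residual:
  fixes H :: "'e::real_normed_vector \<Rightarrow> 'c::real_normed_vector"
  assumes "\<And>x x'. norm (H x - H x') \<le> Lc * norm (x - x')"
  shows "norm ((y - H x) - (y' - H x')) \<le> Lc * (norm (x - x') + norm (y - y'))"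
proof -
  have "norm ((y - H x) - (y' - H x')) \<le> norm (y - y') + norm (H x - H x')"
    using norm_triangle_ineq4[of "y - y'" "H x - H x'"] by (simp add: algebra_simps)
  also have "\<dots> \<le> Lc * norm (y - y') + Lc * norm (x - x')"
    using assms[of x x'] mult_right_mono[OF Lc_ge(1), of "norm (y - y')"] by simp
  finally show ?thesis by (simp add: algebra_simps)
qed

lemma Lc_nonneg: "0 \<le> Lc"
  using Lc_ge(1) by simp

lemma residuals_Fil: "DY k \<in> borel_measurable (Fil D S k)" "DZ k \<in> borel_measurable (Fil D S k)" "DH k \<in> borel_measurable (Fil D S k)"
  unfolding DY_def[abs_def] DZ_def[abs_def] DH_def[abs_def]
  by (rule borel_pair[OF lipschitz_residual[OF Ystar_lipschitz] Lc_nonneg states_Fil(1,2)]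
      borel_pair[OF lipschitz_residual[OF Zstar_lipschitz] Lc_nonneg states_Fil(1,3)]
      borel_pair[OF lipschitz_residual[OF hypergrad_lipschitz] Lc_nonneg states_Fil(1,4)])+

lemma residuals_sq_int: "L2 k \<Longrightarrow> sq_int M (DY k)" "L2 k \<Longrightarrow> sq_int M (DZ k)" "L2 k \<Longrightarrow> sq_int M (DH k)"
proof -
  assume L: "L2 k"
  show "sq_int M (DY k)" unfolding DY_def[abs_def]
    by (rule sq_int_pair[OF lipschitz_residual[OF Ystar_lipschitz] Lc_nonneg L2D(1,2)[OF L]])
  show "sq_int M (DZ k)" unfolding DZ_def[abs_def]
    by (rule sq_int_pair[OF lipschitz_residual[OF Zstar_lipschitz] Lc_nonneg L2D(1,3)[OF L]])
  show "sq_int M (DH k)" unfolding DH_def[abs_def]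
    by (rule sq_int_pair[OF lipschitz_residual[OF hypergrad_lipschitz] Lc_nonneg L2D(1,4)[OF L]])
qed

lemma hypergrad_sq_int: "L2 k \<Longrightarrow> sq_int M (\<lambda>\<omega>. hypergrad f g (px S k \<omega>))"
  using sq_int_diff(1)[OF L2D(4) residuals_sq_int(3), of k k] by (simp add: DH_def)

definition "vY k = (\<integral>\<omega>. (norm (DY k \<omega>))\<^sup>2 \<partial>M)"
definition "vZ k = (\<integral>\<omega>. (norm (DZ k \<omega>))\<^sup>2 \<partial>M)"
definition "vE k = (\<integral>\<omega>. (norm (DH k \<omega>))\<^sup>2 \<partial>M)"
definition "vH k = (\<integral>\<omega>. (norm (ph S k \<omega>))\<^sup>2 \<partial>M)"

lemma v_nonneg: "0 \<le> vY k" "0 \<le> vZ k" "0 \<le> vE k" "0 \<le> vH k"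
  by (simp_all add: vY_def vZ_def vE_def vH_def)

lemma integral_sq_affine:
  fixes X :: "'w \<Rightarrow> 'e::euclidean_space" and Y :: "'w \<Rightarrow> 'c::euclidean_space"
  assumes X: "sq_int M X" and Y: "sq_int M Y" and le: "\<And>\<omega>. norm (X \<omega>) \<le> a + c * norm (Y \<omega>)" and "0 \<le> a" "0 \<le> c"
  shows "(\<integral>\<omega>. (norm (X \<omega>))\<^sup>2 \<partial>M) \<le> 2 * a\<^sup>2 + 2 * c\<^sup>2 * (\<integral>\<omega>. (norm (Y \<omega>))\<^sup>2 \<partial>M)"
proof -
  have "(norm (X \<omega>))\<^sup>2 \<le> 2 * a\<^sup>2 + 2 * c\<^sup>2 * (norm (Y \<omega>))\<^sup>2" for \<omega>
  proof -
    have "(norm (X \<omega>))\<^sup>2 \<le> (norm (a + c * norm (Y \<omega>)))\<^sup>2" using le assms(4,5) by (intro power_mono) auto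
    also have "\<dots> \<le> 2 * (norm a)\<^sup>2 + 2 * (norm (c * norm (Y \<omega>)))\<^sup>2" by (rule norm_add_sq)
    finally show ?thesis by (simp add: power_mult_distrib)
  qed
  then have "(\<integral>\<omega>. (norm (X \<omega>))\<^sup>2 \<partial>M) \<le> (\<integral>\<omega>. 2 * a\<^sup>2 + 2 * c\<^sup>2 * (norm (Y \<omega>))\<^sup>2 \<partial>M)"
    using sq_intD(2)[OF X] sq_intD(2)[OF Y] by (intro integral_mono) auto
  then show ?thesis using sq_intD(2)[OF Y] by (simp add: prob_space)
qed

lemma source_moments:
  assumes L: "L2 k"
  shows "(\<integral>\<omega>. (norm (gG k \<omega>))\<^sup>2 \<partial>M) \<le> 2 * Lc\<^sup>2 * vY k"
    "(\<integral>\<omega>. (norm (gF k \<omega>))\<^sup>2 \<partial>M) \<le> 2 * Lc\<^sup>2 + 2 * Lc\<^sup>2 * vY k"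
    "(\<integral>\<omega>. (norm (pZ S k \<omega>))\<^sup>2 \<partial>M) \<le> 2 * Lc\<^sup>2 + 2 * vZ k"
proof -
  note r = residuals_sq_int[OF L] and s = sq_int_grads[OF L]
  show "(\<integral>\<omega>. (norm (gG k \<omega>))\<^sup>2 \<partial>M) \<le> 2 * Lc\<^sup>2 * vY k"
    using integral_sq_affine[OF s(3) r(1), of 0 Lc] grad_y_bound Lc_nonneg by (simp add: DY_def vY_def)
  show "(\<integral>\<omega>. (norm (gF k \<omega>))\<^sup>2 \<partial>M) \<le> 2 * Lc\<^sup>2 + 2 * Lc\<^sup>2 * vY k"
    using integral_sq_affine[OF s(2) r(1), of Lc Lc] grad_y_f_bound Lc_nonneg by (simp add: DY_def vY_def)
  show "(\<integral>\<omega>. (norm (pZ S k \<omega>))\<^sup>2 \<partial>M) \<le> 2 * Lc\<^sup>2 + 2 * vZ k"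
    using integral_sq_affine[OF L2D(3)[OF L] r(2), of Lc 1] Z_bound Lc_nonneg by (simp add: DZ_def vZ_def)
qed

section \<open>Second moments of the update directions\<close>

definition "cV = cP\<^sup>2 * (2 * \<sigma>g1\<^sup>2 + 4 * cP\<^sup>2 * Lc\<^sup>2)"

lemma Vhat_moment:
  assumes L: "L2 k"
  shows "sq_int M (Vhat k)" "(\<integral>\<omega>. (norm (Vhat k \<omega>))\<^sup>2 \<partial>M) \<le> cV * (1 + vY k)"
proof -
  note n = noise_sq_int(6,7)[OF L]
  show "sq_int M (Vhat k)" unfolding Vhat_def[abs_def] by (rule sq_int_lift(1)[OF n(1)])
  have "(\<integral>\<omega>. (norm (Vhat k \<omega>))\<^sup>2 \<partial>M) \<le> cP\<^sup>2 * (\<integral>\<omega>. (norm (pV S (Suc k) \<omega>))\<^sup>2 \<partial>M)"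
    unfolding Vhat_def by (rule sq_int_lift(2)[OF n(1)])
  also have "\<dots> \<le> cP\<^sup>2 * (2 * \<sigma>g1\<^sup>2 + 2 * (cP\<^sup>2 * (2 * Lc\<^sup>2 * vY k)))"
    by (intro mult_left_mono order_trans[OF n(2)] add_left_mono source_moments(1)[OF L]) auto
  also have "\<dots> = cP\<^sup>2 * (2 * \<sigma>g1\<^sup>2 + 4 * cP\<^sup>2 * Lc\<^sup>2 * vY k)" by simp
  also have "\<dots> \<le> cP\<^sup>2 * ((2 * \<sigma>g1\<^sup>2 + 4 * cP\<^sup>2 * Lc\<^sup>2) * (1 + vY k))"
    using v_nonneg[of k] by (intro mult_left_mono) (auto simp: algebra_simps)
  finally show "(\<integral>\<omega>. (norm (Vhat k \<omega>))\<^sup>2 \<partial>M) \<le> cV * (1 + vY k)" by (simp add: cV_def mult.assoc)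
qed

definition "cHa = CHA\<^sup>2 * (real CARD('b) * (real CARD('b) * (2 * \<sigma>g2\<^sup>2 + 2 * CHB\<^sup>2)))"

text \<open>The oracle moments speak of one direction at a time, never of the operator norm, so the
  norm is traded for finitely many columns. The factor \<open>s\<close> stays inside the application
  because it will be random.\<close>

lemma norm_blinfun_le_columns: "norm H * s \<le> (\<Sum>b\<in>UNIV. norm (blinfun_apply H (s *\<^sub>R axis b 1)))" if "0 \<le> s"
  for H :: "(real ^ 'i::finite) \<Rightarrow>\<^sub>L (real ^ 'k::finite)"
proof -
  have "norm H \<le> (\<Sum>b\<in>UNIV. norm (blinfun_apply H (axis b 1)))"
  proof (rule norm_blinfun_bound)
    show "0 \<le> (\<Sum>b\<in>UNIV. norm (blinfun_apply H (axis b 1)))" by (simp add: sum_nonneg)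
    fix v :: "real ^ 'i"
    have "v = (\<Sum>b\<in>UNIV. v $ b *\<^sub>R axis b 1)" using basis_expansion[of v] by (simp add: scalar_mult_eq_scaleR)
    then have "norm (H v) = norm (\<Sum>b\<in>UNIV. v $ b *\<^sub>R H (axis b 1))"
      by (metis (no_types, lifting) blinfun.scaleR_right blinfun.sum_right sum.cong)
    also have "\<dots> \<le> (\<Sum>b\<in>UNIV. norm v * norm (H (axis b 1)))"
      by (rule order_trans[OF norm_sum sum_mono]) (simp add: mult_right_mono component_le_norm_cart)
    finally show "norm (H v) \<le> (\<Sum>b\<in>UNIV. norm (H (axis b 1))) * norm v"
      by (simp add: sum_distrib_left[symmetric] mult.commute)
  qed
  then have "norm H * s \<le> (\<Sum>b\<in>UNIV. norm (blinfun_apply H (axis b 1))) * s" using that by (rule mult_right_mono)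
  then show ?thesis using that by (simp add: blinfun.scaleR_right sum_distrib_left mult.commute)
qed

lemma ha_moment:
  assumes L: "L2 k"
  shows "sq_int M (\<lambda>\<omega>. ha k \<omega> (pH S (Suc k) \<omega>))"
    "(\<integral>\<omega>. (norm (ha k \<omega> (pH S (Suc k) \<omega>)))\<^sup>2 \<partial>M) \<le> cHa * (\<integral>\<omega>. (norm (pZ S k \<omega>))\<^sup>2 \<partial>M)"
proof -
  let ?z = "\<lambda>\<omega>. norm (pZ S k \<omega>)"
  \<comment> \<open>The length of \<open>Z\<close> is put into the direction: these scaled axes are
    measurable before the oracle is drawn and square integrable, so the second-moment relation
    applies to them.\<close>
  define W where "W b \<omega> = ?z \<omega> *\<^sub>R (axis b 1 :: real ^ 'b)" for b \<omega>
  define G where "G b \<omega> = norm (pH S (Suc k) \<omega> (W b \<omega>))" for b \<omega>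
  have nW: "norm (W b \<omega>) = ?z \<omega>" for b \<omega> by (simp add: W_def)
  have mW: "W b \<in> borel_measurable (FilPP D S k)" for b
    unfolding W_def[abs_def] using FilP_FilPP[OF Fil_FilP[OF states_Fil(3)]] by measurable
  have sW: "sq_int M (W b)" for b
    by (rule sq_int_bound(1)[OF FilPP_M[OF mW] L2D(3)[OF L], where C = 1]) (simp add: nW)
  have sG: "sq_int M (G b)" for b unfolding G_def[abs_def] by (rule sq_int_norm[OF H_sq_int(1)[OF sW mW]])
  have eG: "(\<integral>\<omega>. (G b \<omega>)\<^sup>2 \<partial>M) \<le> (2 * \<sigma>g2\<^sup>2 + 2 * CHB\<^sup>2) * (\<integral>\<omega>. (?z \<omega>)\<^sup>2 \<partial>M)" for b
    using H_sq_int(2)[OF sW mW, of b] unfolding G_def nW by simp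
  have sS: "sq_int M (\<lambda>\<omega>. \<Sum>b\<in>UNIV. G b \<omega>)" by (intro sq_int_sum sG)
  have m: "(\<lambda>\<omega>. ha k \<omega> (pH S (Suc k) \<omega>)) \<in> borel_measurable M"
    by (intro borel_hess_action P_measurable borel_blinfun_apply est_measurable probe_measurable sq_intD(1)[OF L2D(3)[OF L]])
  have b: "AE \<omega> in M. norm (ha k \<omega> (pH S (Suc k) \<omega>)) \<le> CHA * norm (\<Sum>b\<in>UNIV. G b \<omega>)"
    using bounded_frames_AE[of k] bounded_probes_AE[of k]
  proof eventually_elim
    case (elim \<omega>)
    have "norm (ha k \<omega> (pH S (Suc k) \<omega>)) \<le> CHA * (norm (pH S (Suc k) \<omega>) * ?z \<omega>)" by (rule CHA(2)[OF elim])
    also have "\<dots> \<le> CHA * (\<Sum>b\<in>UNIV. G b \<omega>)"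
      unfolding G_def W_def by (intro mult_left_mono norm_blinfun_le_columns CHA(1)) simp
    also have "\<dots> \<le> CHA * norm (\<Sum>b\<in>UNIV. G b \<omega>)" by (intro mult_left_mono CHA(1)) simp
    finally show ?case .
  qed
  show "sq_int M (\<lambda>\<omega>. ha k \<omega> (pH S (Suc k) \<omega>))" by (rule sq_int_bound(1)[OF m sS b])
  have "(\<integral>\<omega>. (norm (ha k \<omega> (pH S (Suc k) \<omega>)))\<^sup>2 \<partial>M) \<le> CHA\<^sup>2 * (\<integral>\<omega>. (norm (\<Sum>b\<in>UNIV. G b \<omega>))\<^sup>2 \<partial>M)"
    by (rule sq_int_bound(2)[OF m sS b])
  also have "\<dots> \<le> CHA\<^sup>2 * (real CARD('b) * (\<Sum>b\<in>UNIV. (\<integral>\<omega>. (G b \<omega>)\<^sup>2 \<partial>M)))"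
  proof (rule mult_left_mono)
    have iG: "integrable M (\<lambda>\<omega>. (G b \<omega>)\<^sup>2)" for b using sq_intD(2)[OF sG[of b]] by simp
    have "(\<integral>\<omega>. (norm (\<Sum>b\<in>UNIV. G b \<omega>))\<^sup>2 \<partial>M) \<le> (\<integral>\<omega>. real CARD('b) * (\<Sum>b\<in>UNIV. (G b \<omega>)\<^sup>2) \<partial>M)"
    proof (rule integral_mono)
      show "integrable M (\<lambda>\<omega>. (norm (\<Sum>b\<in>UNIV. G b \<omega>))\<^sup>2)" by (rule sq_intD(2)[OF sS])
      show "integrable M (\<lambda>\<omega>. real CARD('b) * (\<Sum>b\<in>UNIV. (G b \<omega>)\<^sup>2))" using iG by simp
      show "(norm (\<Sum>b\<in>UNIV. G b \<omega>))\<^sup>2 \<le> real CARD('b) * (\<Sum>b\<in>UNIV. (G b \<omega>)\<^sup>2)" for \<omega>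
        using sum_squared_le_sum_of_squares[of "\<lambda>b. G b \<omega>" UNIV] by (simp add: mult.commute)
    qed
    also have "\<dots> = real CARD('b) * (\<Sum>b\<in>UNIV. (\<integral>\<omega>. (G b \<omega>)\<^sup>2 \<partial>M))" using iG by simp
    finally show "(\<integral>\<omega>. (norm (\<Sum>b\<in>UNIV. G b \<omega>))\<^sup>2 \<partial>M) \<le> real CARD('b) * (\<Sum>b\<in>UNIV. (\<integral>\<omega>. (G b \<omega>)\<^sup>2 \<partial>M))" .
  qed simp
  also have "\<dots> \<le> CHA\<^sup>2 * (real CARD('b) * (\<Sum>b\<in>(UNIV :: 'b set). (2 * \<sigma>g2\<^sup>2 + 2 * CHB\<^sup>2) * (\<integral>\<omega>. (?z \<omega>)\<^sup>2 \<partial>M)))"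
    by (intro mult_left_mono sum_mono eG) auto
  finally show "(\<integral>\<omega>. (norm (ha k \<omega> (pH S (Suc k) \<omega>)))\<^sup>2 \<partial>M) \<le> cHa * (\<integral>\<omega>. (norm (pZ S k \<omega>))\<^sup>2 \<partial>M)"
    by (simp add: cHa_def mult.assoc)
qed

definition "cT = 4 * cHa * Lc\<^sup>2 + 4 * cHa + 4 * cP\<^sup>2 * \<sigma>f2\<^sup>2 + 8 * cP\<^sup>2 * cP\<^sup>2 * Lc\<^sup>2"

lemma cHa_nonneg: "0 \<le> cHa"
  unfolding cHa_def by (intro mult_nonneg_nonneg add_nonneg_nonneg) auto

lemma That_moment:
  assumes L: "L2 k"
  shows "sq_int M (That k)" "(\<integral>\<omega>. (norm (That k \<omega>))\<^sup>2 \<partial>M) \<le> cT * (1 + vZ k + vY k)"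
proof -
  note h = ha_moment[OF L] and n = noise_sq_int(4,5)[OF L]
  note u = sq_int_lift[OF n(1), of k]
  show "sq_int M (That k)" unfolding That_def[abs_def] by (rule sq_int_diff(1)[OF h(1) u(1)])
  have "(\<integral>\<omega>. (norm (That k \<omega>))\<^sup>2 \<partial>M) \<le> 2 * (\<integral>\<omega>. (norm (ha k \<omega> (pH S (Suc k) \<omega>)))\<^sup>2 \<partial>M)
      + 2 * (\<integral>\<omega>. (norm (lift D (pP S k \<omega>) (pUY S (Suc k) \<omega>)))\<^sup>2 \<partial>M)"
    unfolding That_def by (rule sq_int_diff(2)[OF h(1) u(1)])
  also have "\<dots> \<le> 2 * (cHa * (2 * Lc\<^sup>2 + 2 * vZ k)) + 2 * (cP\<^sup>2 * (2 * \<sigma>f2\<^sup>2 + 2 * (cP\<^sup>2 * (2 * Lc\<^sup>2 + 2 * Lc\<^sup>2 * vY k))))"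
    by (intro add_mono mult_left_mono order_trans[OF h(2)] order_trans[OF u(2)] order_trans[OF n(2)] add_left_mono
        source_moments(2,3)[OF L] cHa_nonneg) auto
  also have "\<dots> = 4 * cHa * Lc\<^sup>2 + 4 * cHa * vZ k + 4 * cP\<^sup>2 * \<sigma>f2\<^sup>2 + 8 * cP\<^sup>2 * cP\<^sup>2 * Lc\<^sup>2 * (1 + vY k)"
    by (simp add: algebra_simps)
  also have "\<dots> \<le> cT * (1 + vZ k + vY k)"
  proof -
    define c1 c2 c3 c4 where "c1 = 4 * cHa * Lc\<^sup>2" and "c2 = 4 * cHa" and "c3 = 4 * cP\<^sup>2 * \<sigma>f2\<^sup>2" and "c4 = 8 * cP\<^sup>2 * cP\<^sup>2 * Lc\<^sup>2"
    have c: "0 \<le> c1" "0 \<le> c2" "0 \<le> c3" "0 \<le> c4" using cHa_nonneg by (auto simp: c1_def c2_def c3_def c4_def)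
    have "c1 * 1 \<le> c1 * (1 + vZ k + vY k)" "c2 * vZ k \<le> c2 * (1 + vZ k + vY k)" "c3 * 1 \<le> c3 * (1 + vZ k + vY k)"
      "c4 * (1 + vY k) \<le> c4 * (1 + vZ k + vY k)" by (intro mult_left_mono; use c v_nonneg[of k] in simp)+
    then have "c1 + c2 * vZ k + c3 + c4 * (1 + vY k) \<le> (c1 + c2 + c3 + c4) * (1 + vZ k + vY k)"
      unfolding distrib_right[of _ _ "1 + vZ k + vY k"] by linarith
    then show ?thesis unfolding cT_def c1_def c2_def c3_def c4_def .
  qed
  finally show "(\<integral>\<omega>. (norm (That k \<omega>))\<^sup>2 \<partial>M) \<le> cT * (1 + vZ k + vY k)" .
qed

lemma That_eqE:
  assumes L: "L2 k" and A: "A \<in> borel_measurable (Fil D S k)" "sq_int M A"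
  shows "eqE M (\<lambda>\<omega>. inner (A \<omega>) (That k \<omega>)) (\<lambda>\<omega>. inner (A \<omega>) (HY k \<omega> (pZ S k \<omega>) - gF k \<omega>))"
proof -
  have "eqE M (\<lambda>\<omega>. inner (A \<omega>) (ha k \<omega> (pH S (Suc k) \<omega>))) (\<lambda>\<omega>. inner (A \<omega>) (HY k \<omega> (pZ S k \<omega>)))"
    unfolding inner_blocks[OF bijY]
  proof (rule eqE_sum)+
    fix l i j assume "i \<in> {..<m l}" "j \<in> {..<n l}"
    then show "eqE M (\<lambda>\<omega>. blkY (A \<omega>) l (i, j) * blkY (ha k \<omega> (pH S (Suc k) \<omega>)) l (i, j))
      (\<lambda>\<omega>. blkY (A \<omega>) l (i, j) * blkY (HY k \<omega> (pZ S k \<omega>)) l (i, j))"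
      by (intro ha_mean_eqE L borel_block sq_int_block A) auto
  qed
  then show ?thesis unfolding That_def inner_diff_right by (intro eqE_diff UY_eqE L A)
qed

definition "cW = 2 * \<sigma>f1\<^sup>2 + (4 * (\<sigma>g2\<^sup>2 * cP\<^sup>2) + 4 * (Lg1 * (cP * cP + 1))\<^sup>2) * (2 * Lc\<^sup>2 + 2)"

abbreviation "gS k \<omega> \<equiv> gX k \<omega> - JY k \<omega> (pZ S k \<omega>)"

lemma JY_measurable: "W \<in> borel_measurable M \<Longrightarrow> (\<lambda>\<omega>. JY k \<omega> (W \<omega>)) \<in> borel_measurable M"
  by (rule borel_linear_apply[where H = "\<lambda>\<omega>. JY k \<omega>", OF jac_xy_linear borel_grads(5)])
    (use states_measurable[of k] in auto)

lemma JY_sq_int: "sq_int M W \<Longrightarrow> sq_int M (\<lambda>\<omega>. JY k \<omega> (W \<omega>))"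
  by (rule sq_int_bound(1)[where C = Lg1]) (auto intro: JY_measurable sq_intD jac_xy_bound)

lemma gS_sq_int: "L2 k \<Longrightarrow> sq_int M (gS k)"
  by (intro sq_int_diff sq_int_grads JY_sq_int L2D)

lemma J_noise:
  assumes L: "L2 k" and A: "A \<in> borel_measurable (FilPP D S k)" "sq_int M A"
  shows "sq_int M (\<lambda>\<omega>. pJ S (Suc k) \<omega> (compress D (pP S k \<omega>) (pZ S k \<omega>)))"
    "sq_int M (\<lambda>\<omega>. pJ S (Suc k) \<omega> (compress D (pP S k \<omega>) (pZ S k \<omega>)) - JY k \<omega> (lift D (pP S k \<omega>) (compress D (pP S k \<omega>) (pZ S k \<omega>))))"
    "(\<integral>\<omega>. (norm (pJ S (Suc k) \<omega> (compress D (pP S k \<omega>) (pZ S k \<omega>)) - JY k \<omega> (lift D (pP S k \<omega>) (compress D (pP S k \<omega>) (pZ S k \<omega>)))))\<^sup>2 \<partial>M)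
       \<le> \<sigma>g2\<^sup>2 * cP\<^sup>2 * (\<integral>\<omega>. (norm (pZ S k \<omega>))\<^sup>2 \<partial>M)"
    "eqE M (\<lambda>\<omega>. inner (A \<omega>) (pJ S (Suc k) \<omega> (compress D (pP S k \<omega>) (pZ S k \<omega>))))
      (\<lambda>\<omega>. inner (A \<omega>) (JY k \<omega> (lift D (pP S k \<omega>) (compress D (pP S k \<omega>) (pZ S k \<omega>)))))"
proof -
  let ?W = "\<lambda>\<omega>. compress D (pP S k \<omega>) (pZ S k \<omega>)"
  have mW: "?W \<in> borel_measurable (FilPP D S k)"
    by (rule borel_compress[OF FilP_FilPP[OF P_FilP] FilP_FilPP[OF Fil_FilP[OF states_Fil(3)]]])
  note sW = sq_int_compress[OF L2D(3)[OF L], of k]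
  have mJ: "(\<lambda>\<omega>. pJ S (Suc k) \<omega> (?W \<omega>)) \<in> borel_measurable M"
    by (rule borel_linear_apply[where H = "\<lambda>\<omega>. blinfun_apply (pJ S (Suc k) \<omega>)", OF linear_blinfun
        borel_blinfun_apply[OF est_measurable(5)] sq_intD(1)[OF sW(1)]])
  have sJ: "sq_int M (\<lambda>\<omega>. JY k \<omega> (lift D (pP S k \<omega>) (?W \<omega>)))" by (rule JY_sq_int[OF sq_int_lift(1)[OF sW(1)]])
  note d = cond_msd_sq_int[OF subalg(3) estimators_J(2)[OF mW] mJ sq_intD(1)[OF sJ]]
  have d1: "sq_int M (\<lambda>\<omega>. pJ S (Suc k) \<omega> (?W \<omega>) - JY k \<omega> (lift D (pP S k \<omega>) (?W \<omega>)))"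
    by (rule d(1)) (use sW sq_intD(2) in auto)
  have d2: "(\<integral>\<omega>. (norm (pJ S (Suc k) \<omega> (?W \<omega>) - JY k \<omega> (lift D (pP S k \<omega>) (?W \<omega>))))\<^sup>2 \<partial>M) \<le> (\<integral>\<omega>. \<sigma>g2\<^sup>2 * (norm (?W \<omega>))\<^sup>2 \<partial>M)"
    by (rule d(2)) (use sW sq_intD(2) in auto)
  show s: "sq_int M (\<lambda>\<omega>. pJ S (Suc k) \<omega> (?W \<omega>))" using sq_int_add(1)[OF d1 sJ] by simp
  show "sq_int M (\<lambda>\<omega>. pJ S (Suc k) \<omega> (?W \<omega>) - JY k \<omega> (lift D (pP S k \<omega>) (?W \<omega>)))" by (rule d1)
  have "(\<integral>\<omega>. \<sigma>g2\<^sup>2 * (norm (?W \<omega>))\<^sup>2 \<partial>M) = \<sigma>g2\<^sup>2 * (\<integral>\<omega>. (norm (?W \<omega>))\<^sup>2 \<partial>M)" by simp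
  also have "\<dots> \<le> \<sigma>g2\<^sup>2 * (cP\<^sup>2 * (\<integral>\<omega>. (norm (pZ S k \<omega>))\<^sup>2 \<partial>M))" by (intro mult_left_mono sW(2)) auto
  finally show "(\<integral>\<omega>. (norm (pJ S (Suc k) \<omega> (?W \<omega>) - JY k \<omega> (lift D (pP S k \<omega>) (?W \<omega>))))\<^sup>2 \<partial>M)
       \<le> \<sigma>g2\<^sup>2 * cP\<^sup>2 * (\<integral>\<omega>. (norm (pZ S k \<omega>))\<^sup>2 \<partial>M)" using d2 by (simp add: mult.assoc)
  show "eqE M (\<lambda>\<omega>. inner (A \<omega>) (pJ S (Suc k) \<omega> (?W \<omega>))) (\<lambda>\<omega>. inner (A \<omega>) (JY k \<omega> (lift D (pP S k \<omega>) (?W \<omega>))))"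
    by (rule cond_mean_inner_eqE[OF subalg(3) estimators_J(1)[OF mW] s sq_intD(1)[OF sJ] A])
qed

lemma What_moment:
  assumes L: "L2 k"
  shows "sq_int M (What k)" "(\<integral>\<omega>. (norm (What k \<omega> - gS k \<omega>))\<^sup>2 \<partial>M) \<le> cW * (1 + vZ k)"
proof -
  let ?W = "\<lambda>\<omega>. compress D (pP S k \<omega>) (pZ S k \<omega>)"
  let ?ez = "\<integral>\<omega>. (norm (pZ S k \<omega>))\<^sup>2 \<partial>M"
  have z0: "(\<lambda>_. 0 :: real ^ 'd) \<in> borel_measurable (FilPP D S k)" "sq_int M (\<lambda>_. 0 :: real ^ 'd)" by (auto intro: sq_int_const)
  note J = J_noise(1-3)[OF L z0]
  note U = noise_sq_int(1-3)[OF L]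
  show "sq_int M (What k)" unfolding What_def[abs_def] by (rule sq_int_diff(1)[OF U(1) J(1)])
  \<comment> \<open>After the oracle noise is removed, the Jacobian still acts on
    \<open>P P^T Z\<close> instead of \<open>Z\<close>; \<open>E\<close> is this frame error,
    bounded almost surely by a multiple of \<open>norm Z\<close>.\<close>
  define E where "E \<omega> = JY k \<omega> (lift D (pP S k \<omega>) (?W \<omega>)) - JY k \<omega> (pZ S k \<omega>)" for \<omega>
  have mE: "E \<in> borel_measurable M" unfolding E_def[abs_def]
    by (intro borel_measurable_diff JY_measurable sq_intD(1)[OF sq_int_lift(1)[OF sq_int_compress(1)]] L2D L sq_intD)
  have bE: "AE \<omega> in M. norm (E \<omega>) \<le> (Lg1 * (cP * cP + 1)) * norm (pZ S k \<omega>)"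
    using bounded_frames_AE[of k]
  proof eventually_elim
    case (elim \<omega>)
    have "norm (E \<omega>) = norm (JY k \<omega> (lift D (pP S k \<omega>) (?W \<omega>) - pZ S k \<omega>))"
      unfolding E_def by (simp add: linear_diff[OF jac_xy_linear])
    also have "\<dots> \<le> Lg1 * norm (lift D (pP S k \<omega>) (?W \<omega>) - pZ S k \<omega>)" by (rule jac_xy_bound)
    also have "\<dots> \<le> Lg1 * (cP * (cP * norm (pZ S k \<omega>)) + norm (pZ S k \<omega>))"
    proof (rule mult_left_mono)
      have "norm (lift D (pP S k \<omega>) (?W \<omega>)) \<le> cP * norm (?W \<omega>)" by (rule lift_le[OF elim])
      also have "\<dots> \<le> cP * (cP * norm (pZ S k \<omega>))" by (intro mult_left_mono compress_le[OF elim] cP_nonneg)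
      finally show "norm (lift D (pP S k \<omega>) (?W \<omega>) - pZ S k \<omega>) \<le> cP * (cP * norm (pZ S k \<omega>)) + norm (pZ S k \<omega>)"
        by (intro order_trans[OF norm_triangle_ineq4] add_mono) auto
    qed (use pos in simp)
    finally show ?case by (simp add: algebra_simps)
  qed
  note sE = sq_int_bound[OF mE L2D(3)[OF L] bE]
  define R where "R \<omega> = (pJ S (Suc k) \<omega> (?W \<omega>) - JY k \<omega> (lift D (pP S k \<omega>) (?W \<omega>))) + E \<omega>" for \<omega>
  note sR = sq_int_add[OF J(2) sE(1), folded R_def]
  have eq: "What k \<omega> - gS k \<omega> = (pUx S (Suc k) \<omega> - gX k \<omega>) - R \<omega>" for \<omega>
    by (simp add: What_def R_def E_def)
  have "(\<integral>\<omega>. (norm (What k \<omega> - gS k \<omega>))\<^sup>2 \<partial>M) \<le> 2 * (\<integral>\<omega>. (norm (pUx S (Suc k) \<omega> - gX k \<omega>))\<^sup>2 \<partial>M) + 2 * (\<integral>\<omega>. (norm (R \<omega>))\<^sup>2 \<partial>M)"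
    unfolding eq by (rule sq_int_diff(2)[OF U(3) sR(1)])
  also have "\<dots> \<le> 2 * \<sigma>f1\<^sup>2 + 2 * (2 * (\<sigma>g2\<^sup>2 * cP\<^sup>2 * ?ez) + 2 * ((Lg1 * (cP * cP + 1))\<^sup>2 * ?ez))"
  proof (intro add_mono mult_left_mono U(2))
    show "(\<integral>\<omega>. (norm (R \<omega>))\<^sup>2 \<partial>M) \<le> 2 * (\<sigma>g2\<^sup>2 * cP\<^sup>2 * ?ez) + 2 * ((Lg1 * (cP * cP + 1))\<^sup>2 * ?ez)"
      by (rule order_trans[OF sR(2)]) (intro add_mono mult_left_mono J(3) sE(2); simp)
  qed auto
  also have "\<dots> = 2 * \<sigma>f1\<^sup>2 + (4 * (\<sigma>g2\<^sup>2 * cP\<^sup>2) + 4 * (Lg1 * (cP * cP + 1))\<^sup>2) * ?ez"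
    by (simp add: algebra_simps)
  also have "\<dots> \<le> 2 * \<sigma>f1\<^sup>2 + (4 * (\<sigma>g2\<^sup>2 * cP\<^sup>2) + 4 * (Lg1 * (cP * cP + 1))\<^sup>2) * ((2 * Lc\<^sup>2 + 2) * (1 + vZ k))"
  proof (intro add_left_mono mult_left_mono)
    have "?ez \<le> 2 * Lc\<^sup>2 + 2 * vZ k" by (rule source_moments(3)[OF L])
    also have "\<dots> \<le> (2 * Lc\<^sup>2 + 2) * (1 + vZ k)" using v_nonneg[of k] by (simp add: algebra_simps)
    finally show "?ez \<le> (2 * Lc\<^sup>2 + 2) * (1 + vZ k)" .
  qed auto
  also have "\<dots> \<le> cW * (1 + vZ k)"
    unfolding cW_def using v_nonneg[of k] by (simp add: distrib_right mult.assoc mult_left_mono) (simp add: algebra_simps)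
  finally show "(\<integral>\<omega>. (norm (What k \<omega> - gS k \<omega>))\<^sup>2 \<partial>M) \<le> cW * (1 + vZ k)" .
qed

lemma What_eqE:
  assumes L: "L2 k" and A: "A \<in> borel_measurable (Fil D S k)" "sq_int M A"
  shows "eqE M (\<lambda>\<omega>. inner (A \<omega>) (What k \<omega>)) (\<lambda>\<omega>. inner (A \<omega>) (gS k \<omega>))"
proof -
  let ?W = "\<lambda>\<omega>. compress D (pP S k \<omega>) (pZ S k \<omega>)"
  \<comment> \<open>The transposed Jacobian applied to \<open>A\<close>. It depends on the past
    only, so the frame average can be tested against it.\<close>
  define B :: "'w \<Rightarrow> real ^ 'y" where "B \<omega> = (\<chi> c. inner (A \<omega>) (JY k \<omega> (axis c 1)))" for \<omega>
  have B: "inner (A \<omega>) (JY k \<omega> V) = inner (B \<omega>) V" for \<omega> V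
  proof -
    have "V = (\<Sum>c\<in>UNIV. V $ c *\<^sub>R axis c 1)" using basis_expansion[of V] by (simp add: scalar_mult_eq_scaleR)
    then have "JY k \<omega> V = JY k \<omega> (\<Sum>c\<in>UNIV. V $ c *\<^sub>R axis c 1)" by simp
    also have "\<dots> = (\<Sum>c\<in>UNIV. V $ c *\<^sub>R JY k \<omega> (axis c 1))"
      by (simp only: linear_sum[OF jac_xy_linear] linear_scale[OF jac_xy_linear])
    finally show ?thesis by (simp add: B_def inner_vec_def[of "vec_lambda _"] inner_sum_right mult.commute)
  qed
  have mJ: "(\<lambda>\<omega>. JY k \<omega> v) \<in> borel_measurable (Fil D S k)" for v by (intro borel_grads states_Fil)
  have mB: "B \<in> borel_measurable (Fil D S k)"
    by (rule borel_measurable_vec) (simp add: B_def borel_measurable_inner A mJ)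
  have sB: "sq_int M B"
  proof (rule sq_int_vec)
    fix c
    show "sq_int M (\<lambda>\<omega>. B \<omega> $ c)"
    proof (rule sq_int_bound(1)[OF borel_vec_nth[OF Fil_M[OF mB]] A(2), where C = Lg1], rule AE_I2)
      fix \<omega>
      have "norm (B \<omega> $ c) \<le> norm (A \<omega>) * norm (JY k \<omega> (axis c 1))" unfolding B_def by (simp add: Cauchy_Schwarz_ineq2)
      also have "\<dots> \<le> norm (A \<omega>) * (Lg1 * norm (axis c 1 :: real ^ 'y))" by (intro mult_left_mono jac_xy_bound) auto
      finally show "norm (B \<omega> $ c) \<le> Lg1 * norm (A \<omega>)" by (simp add: mult.commute)
    qed
  qed
  have "eqE M (\<lambda>\<omega>. inner (A \<omega>) (pUx S (Suc k) \<omega>)) (\<lambda>\<omega>. inner (A \<omega>) (gX k \<omega>))"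
    by (rule cond_mean_inner_eqE[OF subalg(2) estimators(1)])
      (use noise_sq_int(1)[OF L] sq_intD(1)[OF sq_int_grads(1)[OF L]] A Fil_FilP in auto)
  moreover have "eqE M (\<lambda>\<omega>. inner (A \<omega>) (pJ S (Suc k) \<omega> (?W \<omega>))) (\<lambda>\<omega>. inner (A \<omega>) (JY k \<omega> (pZ S k \<omega>)))"
  proof (rule eqE_trans)
    show "eqE M (\<lambda>\<omega>. inner (A \<omega>) (pJ S (Suc k) \<omega> (?W \<omega>))) (\<lambda>\<omega>. inner (A \<omega>) (JY k \<omega> (lift D (pP S k \<omega>) (?W \<omega>))))"
      by (rule J_noise(4)[OF L FilP_FilPP[OF Fil_FilP[OF A(1)]] A(2)])
    show "eqE M (\<lambda>\<omega>. inner (A \<omega>) (JY k \<omega> (lift D (pP S k \<omega>) (?W \<omega>)))) (\<lambda>\<omega>. inner (A \<omega>) (JY k \<omega> (pZ S k \<omega>)))"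
      unfolding B by (rule frame_mean_eqE[OF mB sB states_Fil(3) L2D(3)[OF L]])
  qed
  ultimately show ?thesis unfolding What_def inner_diff_right by (rule eqE_diff)
qed

lemma sq_int_cong: "(\<And>\<omega>. \<omega> \<in> space M \<Longrightarrow> X \<omega> = X' \<omega>) \<Longrightarrow> sq_int M X' \<Longrightarrow> sq_int M X"
  unfolding sq_int_def using measurable_cong[of M X X' borel]
    Bochner_Integration.integrable_cong[of M M "\<lambda>\<omega>. (norm (X \<omega>))\<^sup>2" "\<lambda>\<omega>. (norm (X' \<omega>))\<^sup>2"] by simp

text \<open>Each update direction is square integrable when the state is, which closes the induction
  for arbitrary stepsizes.\<close>

lemma L2_all: "L2 k"
proof (induction k)
  case 0
  show ?case unfolding L2_def
    using sq_int_cong[OF _ sq_int_const[of x0]] sq_int_cong[OF _ sq_int_const[of Y0]] sq_int_cong[OF _ sq_int_const[of Z0]]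
      sq_int_cong[OF _ sq_int_const[of 0]] init by blast
next
  case (Suc k)
  note L = L2D[OF Suc]
  show ?case unfolding L2_def
  proof (intro conjI)
    show "sq_int M (px S (Suc k))"
      by (rule sq_int_cong[OF step(1)], assumption) (intro sq_int_diff sq_int_scaleR L)
    show "sq_int M (pY S (Suc k))"
      by (rule sq_int_cong[OF step(2)], assumption) (intro sq_int_diff sq_int_scaleR L Vhat_moment Suc)
    show "sq_int M (pZ S (Suc k))"
      by (rule sq_int_cong[OF step(3)], assumption) (intro sq_int_diff sq_int_scaleR L That_moment Suc)
    show "sq_int M (ph S (Suc k))"
      by (rule sq_int_cong[OF step(4)], assumption) (intro sq_int_add sq_int_scaleR L What_moment Suc)
  qed
qed

end

section \<open>Lyapunov function and averaged bound\<close>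

text \<open>Since the coupling of the errors is triangular (the error of \<open>Y\<close> drives that of \<open>Z\<close>, both drive that
  of \<open>h\<close>), the weights below make all cross terms cancel; a large ratio \<open>c\<close> of the stepsizes absorbs
  the drift of the targets, which is proportional to \<open>h\<close>.\<close>

lemma lyapunov:
  fixes p y z e h g :: "nat \<Rightarrow> real"
  assumes pos: "0 < a" "0 < m" "0 \<le> \<kappa>" "0 < c" and b: "b = c * a"
    and nn: "\<And>k. 0 \<le> e k" "\<And>k. 0 \<le> h k"
    and w0: "w0 = 1 / m + \<kappa> / m\<^sup>2 + (\<kappa> / m\<^sup>2 + \<kappa>\<^sup>2 / m ^ 3)"
    and small: "L * a \<le> 1 / 4" "12 * L\<^sup>2 * w0 \<le> m * c\<^sup>2"
    and s: "\<And>k. s k = 2 * C * b\<^sup>2 + 3 / (b * m) * (L\<^sup>2 * (a\<^sup>2 * h k))"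
    and y: "\<And>k. y (Suc k) \<le> (1 - b * m) * y k + s k"
    and z: "\<And>k. z (Suc k) \<le> (1 - b * m) * z k + b * \<kappa> * y k + s k"
    and e: "\<And>k. e (Suc k) \<le> (1 - b * m) * e k + b * \<kappa> * (y k + z k) + s k"
    and p: "\<And>k. p (Suc k) \<le> p k + a / 2 * (e k - g k - h k) + L * a\<^sup>2 * h k"
    and lower: "\<And>k. pinf \<le> p k" and yz: "\<And>k. 0 \<le> y k" "\<And>k. 0 \<le> z k"
  shows "(\<Sum>k<K. g k) \<le> 2 / a * (p 0 + (1 / m * e 0 + \<kappa> / m\<^sup>2 * z 0 + (\<kappa> / m\<^sup>2 + \<kappa>\<^sup>2 / m ^ 3) * y 0) / c - pinf)
     + real K * (4 * C * c * w0 * a)"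
proof -
  \<comment> \<open>The solution of the triangular system \<open>m * we = 1\<close>,
    \<open>m * wz = \<kappa> * we\<close>, \<open>m * wy = \<kappa> * (we + wz)\<close>: each weight
    absorbs the cross terms that its error causes in the later recursions.\<close>
  define we wz wy where "we = 1 / m" and "wz = \<kappa> / m\<^sup>2" and "wy = \<kappa> / m\<^sup>2 + \<kappa>\<^sup>2 / m ^ 3"
  have w: "0 \<le> we" "0 \<le> wz" "0 \<le> wy" "w0 = we + wz + wy" using pos by (auto simp: we_def wz_def wy_def w0)
  have wm: "m * we = 1" "m * wz = \<kappa> * we" "m * wy = \<kappa> * (we + wz)"
    using pos by (auto simp: we_def wz_def wy_def field_simps power2_eq_square power3_eq_cube)
  define R where "R k = we * e k + wz * z k + wy * y k" for k
  have R: "R (Suc k) \<le> R k - b * e k + w0 * s k" for k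
  proof -
    have "R (Suc k) \<le> we * ((1 - b * m) * e k + b * \<kappa> * (y k + z k) + s k)
        + wz * ((1 - b * m) * z k + b * \<kappa> * y k + s k) + wy * ((1 - b * m) * y k + s k)"
      unfolding R_def by (intro add_mono mult_left_mono e z y w)
    also have "\<dots> = R k - b * ((m * we) * e k) - b * ((m * wz) * z k) - b * ((m * wy) * y k)
        + b * (\<kappa> * we) * (y k + z k) + b * (\<kappa> * wz) * y k + w0 * s k"
      unfolding R_def w(4) by (simp add: algebra_simps)
    also have "\<dots> = R k - b * e k + w0 * s k" unfolding wm by (simp add: algebra_simps)
    finally show ?thesis .
  qed
  \<comment> \<open>The target shift, weighted and divided by \<open>c\<close>, costs at most
    \<open>a / 4 * h k\<close>; this is where the lower bound on \<open>c\<close> in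
    \<open>small\<close> is spent.\<close>
  have ws: "w0 * s k / c \<le> 2 * C * c * w0 * a\<^sup>2 + a / 4 * h k" for k
  proof -
    have "w0 * s k / c = 2 * C * c * w0 * a\<^sup>2 + (3 * L\<^sup>2 * w0 / (m * c\<^sup>2)) * (a * h k)"
      unfolding s b using pos by (simp add: field_simps power2_eq_square)
    also have "(3 * L\<^sup>2 * w0 / (m * c\<^sup>2)) * (a * h k) \<le> 1 / 4 * (a * h k)"
    proof (rule mult_right_mono)
      show "3 * L\<^sup>2 * w0 / (m * c\<^sup>2) \<le> 1 / 4" using small(2) pos by (simp add: field_simps)
    qed (use pos nn in simp)
    finally show ?thesis by simp
  qed
  \<comment> \<open>Division by \<open>c\<close> turns the gain \<open>b * e k\<close> of the
    weighted errors into \<open>a * e k\<close>, which exceeds the loss \<open>a / 2 * e k\<close>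
    in the descent of \<open>p\<close>. The two quarters of \<open>a * h k\<close> together use up
    the negative half in that descent.\<close>
  define V where "V k = p k + R k / c" for k
  have V: "V (Suc k) \<le> V k - a / 2 * g k + 2 * C * c * w0 * a\<^sup>2" for k
  proof -
    have "R (Suc k) / c \<le> (R k - b * e k + w0 * s k) / c" using R pos by (intro divide_right_mono) auto
    also have "\<dots> = R k / c - a * e k + w0 * s k / c" unfolding b using pos by (simp add: field_simps)
    finally have 1: "R (Suc k) / c \<le> R k / c - a * e k + (2 * C * c * w0 * a\<^sup>2 + a / 4 * h k)" using ws[of k] by linarith
    have "(L * a) * (a * h k) \<le> 1 / 4 * (a * h k)" using small(1) pos nn by (intro mult_right_mono) auto
    then have 2: "L * a\<^sup>2 * h k \<le> a / 4 * h k" by (simp add: power2_eq_square ac_simps)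
    have 3: "0 \<le> a * e k" using pos nn by simp
    have 4: "a / 2 * (e k - g k - h k) = a * e k / 2 - a / 2 * g k - a / 2 * h k" by (simp add: algebra_simps)
    have 5: "a / 4 * h k + a / 4 * h k = a / 2 * h k" by simp
    show ?thesis unfolding V_def using p[of k] 1 2 3 4 5 by linarith
  qed
  have sum: "V K + a / 2 * (\<Sum>k<K. g k) \<le> V 0 + real K * (2 * C * c * w0 * a\<^sup>2)" for K
  proof (induction K)
    case (Suc K)
    have "V (Suc K) + a / 2 * (\<Sum>k<Suc K. g k) = V (Suc K) + a / 2 * g K + a / 2 * (\<Sum>k<K. g k)"
      by (simp add: algebra_simps)
    also have "\<dots> \<le> V K + a / 2 * (\<Sum>k<K. g k) + 2 * C * c * w0 * a\<^sup>2" using V[of K] by linarith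
    also have "\<dots> \<le> V 0 + real (Suc K) * (2 * C * c * w0 * a\<^sup>2)" using Suc by (simp add: algebra_simps)
    finally show ?case .
  qed simp
  have "0 \<le> R K" unfolding R_def using w nn yz by simp
  then have "pinf \<le> V K" unfolding V_def using lower[of K] pos by (simp add: add_increasing2)
  then have "a / 2 * (\<Sum>k<K. g k) \<le> V 0 - pinf + real K * (2 * C * c * w0 * a\<^sup>2)" using sum[of K] by linarith
  then have "2 / a * (a / 2 * (\<Sum>k<K. g k)) \<le> 2 / a * (V 0 - pinf + real K * (2 * C * c * w0 * a\<^sup>2))"
    using pos by (intro mult_left_mono) auto
  also have "\<dots> = 2 / a * (V 0 - pinf) + real K * (4 * C * c * w0 * a)"
    using pos by (simp add: field_simps power2_eq_square)
  finally show ?thesis using pos by (simp add: V_def R_def we_def wz_def wy_def)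
qed

context bros
begin

text \<open>Common constants for the three recursions. \<open>mT\<close>: the error of
  \<open>Z\<close> keeps half of the strong convexity and that of \<open>h\<close> half of its full
  contraction. \<open>kT\<close>: the price of splitting the cross term for \<open>Z\<close>, plus
  the bias of the direction for \<open>h\<close>. \<open>cS\<close> dominates the second-moment
  constants of all three directions; its last three summands come from \<open>h\<close>.\<close>

definition "mT = min (\<mu>g / 2) (1 / 2)"
definition "kT = Lc\<^sup>2 / (2 * \<mu>g) + Lc\<^sup>2"
definition "cS = cV + cT + 4 + 8 * Lc\<^sup>2 + 2 * cW"

lemma cV_nonneg: "0 \<le> cV" and cT_nonneg: "0 \<le> cT" and cW_nonneg: "0 \<le> cW"
  unfolding cV_def cT_def cW_def using cHa_nonneg by auto

lemma tracking_constants: "0 < mT" "mT \<le> \<mu>g / 2" "mT \<le> 1 / 2" "0 \<le> kT" "0 < cS" "cV \<le> cS" "cT \<le> cS" "Lc\<^sup>2 / (2 * \<mu>g) \<le> kT" "Lc\<^sup>2 \<le> kT"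
proof -
  show "0 < cS" unfolding cS_def using cV_nonneg cT_nonneg cW_nonneg zero_le_power2[of Lc] by linarith
qed (use pos cV_nonneg cT_nonneg cW_nonneg in \<open>auto simp: mT_def kT_def cS_def\<close>)

text \<open>The targets depend on the iteration only through \<open>x\<close>, so in one step they
  move by at most \<open>Lc * a\<close> times the norm of \<open>h\<close>.\<close>

lemma target_drift:
  fixes H :: "real ^ 'd \<Rightarrow> 'c::euclidean_space"
  assumes H: "\<And>x x'. norm (H x - H x') \<le> Lc * norm (x - x')" and s: "\<And>k. sq_int M (\<lambda>\<omega>. H (px S k \<omega>))" and "\<alpha> k = a" "0 \<le> a"
  shows "sq_int M (\<lambda>\<omega>. H (px S k \<omega>) - H (px S (Suc k) \<omega>))"
    "(\<integral>\<omega>. (norm (H (px S k \<omega>) - H (px S (Suc k) \<omega>)))\<^sup>2 \<partial>M) \<le> Lc\<^sup>2 * (a\<^sup>2 * vH k)"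
proof -
  show sN: "sq_int M (\<lambda>\<omega>. H (px S k \<omega>) - H (px S (Suc k) \<omega>))" by (rule sq_int_diff(1)[OF s s])
  have "AE \<omega> in M. norm (H (px S k \<omega>) - H (px S (Suc k) \<omega>)) \<le> (Lc * a) * norm (ph S k \<omega>)"
  proof (rule AE_I2)
    fix \<omega> assume "\<omega> \<in> space M"
    then have "px S k \<omega> - px S (Suc k) \<omega> = a *\<^sub>R ph S k \<omega>" using step(1)[of \<omega> k] assms(3) by simp
    then show "norm (H (px S k \<omega>) - H (px S (Suc k) \<omega>)) \<le> (Lc * a) * norm (ph S k \<omega>)"
      using H[of "px S k \<omega>" "px S (Suc k) \<omega>"] assms(4) by (simp add: mult.assoc)
  qed
  from sq_int_bound(2)[OF sq_intD(1)[OF sN] L2D(4)[OF L2_all] this]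
  show "(\<integral>\<omega>. (norm (H (px S k \<omega>) - H (px S (Suc k) \<omega>)))\<^sup>2 \<partial>M) \<le> Lc\<^sup>2 * (a\<^sup>2 * vH k)"
    by (simp add: vH_def power_mult_distrib mult.assoc)
qed

lemma targets_sq_int: "sq_int M (\<lambda>\<omega>. Ystar g (px S k \<omega>))" "sq_int M (\<lambda>\<omega>. Zstar f g (px S k \<omega>))"
  using sq_int_diff(1)[OF L2D(2)[OF L2_all] residuals_sq_int(1)[OF L2_all], of k k]
    sq_int_diff(1)[OF L2D(3)[OF L2_all] residuals_sq_int(2)[OF L2_all], of k k]
  by (simp_all add: DY_def DZ_def)

lemma eqE_integral: "eqE M F G \<Longrightarrow> (\<integral>\<omega>. F \<omega> \<partial>M) = (\<integral>\<omega>. G \<omega> \<partial>M)"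
  by (simp add: eqE_def)

lemma weighted_sq_bound: "(0::real) < c \<Longrightarrow> u * v \<le> c / 2 * u\<^sup>2 + v\<^sup>2 / (2 * c)"
proof -
  assume c: "0 < c"
  have "0 \<le> (c * u - v)\<^sup>2 / (2 * c)" using c by simp
  also have "\<dots> = c / 2 * u\<^sup>2 + v\<^sup>2 / (2 * c) - u * v" using c by (simp add: power2_eq_square field_simps)
  finally show ?thesis by simp
qed

section \<open>One-step recursions for the three tracking errors\<close>

context
  fixes a b :: real and k :: nat
  assumes stepsizes: "\<alpha> k = a" "\<beta> k = b" "\<gamma> k = b" "\<theta> k = b"
    and ab: "0 < a" "0 < b" "b * mT \<le> 1" "b * cS \<le> mT / 2"
begin

abbreviation "sk \<equiv> 2 * cS * b\<^sup>2 + 3 / (b * mT) * (Lc\<^sup>2 * (a\<^sup>2 * vH k))"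

lemma vY_recursion: "vY (Suc k) \<le> (1 - b * mT) * vY k + sk"
proof -
  note L = L2_all[of k] and tc = tracking_constants
  let ?N = "\<lambda>\<omega>. Ystar g (px S k \<omega>) - Ystar g (px S (Suc k) \<omega>)"
  note r = residuals_sq_int(1)[OF L]
  note d = target_drift[where H = "Ystar g", OF Ystar_lipschitz targets_sq_int(1) stepsizes(1)] 
  have "vY (Suc k) = (\<integral>\<omega>. (norm (DY k \<omega> - b *\<^sub>R Vhat k \<omega> + ?N \<omega>))\<^sup>2 \<partial>M)"
    unfolding vY_def by (intro Bochner_Integration.integral_cong refl) (simp add: DY_def step(2) stepsizes algebra_simps)
  also have "\<dots> \<le> (1 - b * mT) * (\<integral>\<omega>. (norm (DY k \<omega>))\<^sup>2 \<partial>M) + b * (3 * kT + mT) * 0 + 2 * cS * b\<^sup>2 + 3 / (b * mT) * (Lc\<^sup>2 * (a\<^sup>2 * vH k))"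
  proof (rule tracking[OF r Vhat_moment(1)[OF L] d(1) ab(2) tc(1) ab(3,4)])
    have "\<mu>g * vY k = (\<integral>\<omega>. \<mu>g * (norm (DY k \<omega>))\<^sup>2 \<partial>M)" by (simp add: vY_def)
    also have "\<dots> \<le> (\<integral>\<omega>. inner (DY k \<omega>) (gG k \<omega>) \<partial>M)"
      using Y_monotone sq_intD(2)[OF r] by (intro integral_mono sq_int_inner r sq_int_grads L) (auto simp: DY_def)
    also have "\<dots> = (\<integral>\<omega>. inner (DY k \<omega>) (Vhat k \<omega>) \<partial>M)"
      by (rule eqE_integral[OF Vhat_eqE[OF L residuals_Fil(1) r], symmetric])
    finally have "\<mu>g * vY k \<le> (\<integral>\<omega>. inner (DY k \<omega>) (Vhat k \<omega>) \<partial>M)" .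
    moreover have "mT * vY k \<le> \<mu>g * vY k" using tc(2) pos v_nonneg[of k] by (intro mult_right_mono) auto
    ultimately show "mT * (\<integral>\<omega>. (norm (DY k \<omega>))\<^sup>2 \<partial>M) - kT * 0 \<le> (\<integral>\<omega>. inner (DY k \<omega>) (Vhat k \<omega>) \<partial>M)"
      by (simp add: vY_def)
    have "(\<integral>\<omega>. (norm (Vhat k \<omega>))\<^sup>2 \<partial>M) \<le> cV * (1 + vY k)" by (rule Vhat_moment(2)[OF L])
    also have "\<dots> \<le> cS * (1 + vY k)" using tc v_nonneg[of k] by (intro mult_right_mono) auto
    finally show "(\<integral>\<omega>. (norm (Vhat k \<omega>))\<^sup>2 \<partial>M) \<le> cS * (1 + (\<integral>\<omega>. (norm (DY k \<omega>))\<^sup>2 \<partial>M) + 0)" by (simp add: vY_def)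
  qed (use tc d ab in auto)
  finally show ?thesis by (simp add: vY_def)
qed

text \<open>The cross term of \<open>Z_monotone\<close> is split by a weighted square inequality;
  half of the convexity constant pays for it, and the remainder is charged to the error of
  \<open>Y\<close>.\<close>

lemma vZ_recursion: "vZ (Suc k) \<le> (1 - b * mT) * vZ k + b * (3 * kT + mT) * vY k + sk"
proof -
  note L = L2_all[of k] and tc = tracking_constants
  let ?N = "\<lambda>\<omega>. Zstar f g (px S k \<omega>) - Zstar f g (px S (Suc k) \<omega>)"
  note ry = residuals_sq_int(1)[OF L] and r = residuals_sq_int(2)[OF L]
  note d = target_drift[where H = "Zstar f g", OF Zstar_lipschitz targets_sq_int(2) stepsizes(1)]
  have "vZ (Suc k) = (\<integral>\<omega>. (norm (DZ k \<omega> - b *\<^sub>R That k \<omega> + ?N \<omega>))\<^sup>2 \<partial>M)"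
    unfolding vZ_def by (intro Bochner_Integration.integral_cong refl) (simp add: DZ_def step(3) stepsizes algebra_simps)
  also have "\<dots> \<le> (1 - b * mT) * (\<integral>\<omega>. (norm (DZ k \<omega>))\<^sup>2 \<partial>M) + b * (3 * kT + mT) * vY k + 2 * cS * b\<^sup>2 + 3 / (b * mT) * (Lc\<^sup>2 * (a\<^sup>2 * vH k))"
  proof (rule tracking[OF r That_moment(1)[OF L] d(1) ab(2) tc(1) ab(3,4)])
    let ?q = "\<lambda>\<omega>. HY k \<omega> (pZ S k \<omega>) - gF k \<omega>"
    have sq: "sq_int M ?q"
    proof (rule sq_int_diff(1)[OF _ sq_int_grads(2)[OF L]])
      have "(\<lambda>\<omega>. HY k \<omega> (pZ S k \<omega>)) \<in> borel_measurable M"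
        by (rule borel_linear_apply[where H = "\<lambda>\<omega>. HY k \<omega>", OF hess_yy_linear borel_grads(4)]) (use states_measurable[of k] in auto)
      then show "sq_int M (\<lambda>\<omega>. HY k \<omega> (pZ S k \<omega>))"
        by (rule sq_int_bound(1)[OF _ L2D(3)[OF L], where C = Lg1]) (simp add: hess_yy_bound)
    qed
    have pw: "\<mu>g / 2 * (norm (DZ k \<omega>))\<^sup>2 - Lc\<^sup>2 / (2 * \<mu>g) * (norm (DY k \<omega>))\<^sup>2 \<le> inner (DZ k \<omega>) (?q \<omega>)" for \<omega>
    proof -
      have "norm (DZ k \<omega>) * (Lc * norm (DY k \<omega>)) \<le> \<mu>g / 2 * (norm (DZ k \<omega>))\<^sup>2 + (Lc * norm (DY k \<omega>))\<^sup>2 / (2 * \<mu>g)"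
        by (rule weighted_sq_bound[OF pos(1)])
      then have "Lc * norm (DZ k \<omega>) * norm (DY k \<omega>) \<le> \<mu>g / 2 * (norm (DZ k \<omega>))\<^sup>2 + Lc\<^sup>2 / (2 * \<mu>g) * (norm (DY k \<omega>))\<^sup>2"
        by (simp add: power_mult_distrib ac_simps)
      then show ?thesis using Z_monotone[of "pZ S k \<omega>" "px S k \<omega>" "pY S k \<omega>"] unfolding DZ_def DY_def by (simp add: algebra_simps)
    qed
    have "\<mu>g / 2 * vZ k - Lc\<^sup>2 / (2 * \<mu>g) * vY k = (\<integral>\<omega>. \<mu>g / 2 * (norm (DZ k \<omega>))\<^sup>2 - Lc\<^sup>2 / (2 * \<mu>g) * (norm (DY k \<omega>))\<^sup>2 \<partial>M)"
      using sq_intD(2)[OF r] sq_intD(2)[OF ry] by (simp add: vZ_def vY_def)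
    also have "\<dots> \<le> (\<integral>\<omega>. inner (DZ k \<omega>) (?q \<omega>) \<partial>M)"
      using sq_intD(2)[OF r] sq_intD(2)[OF ry] pw by (intro integral_mono sq_int_inner r sq) auto
    also have "\<dots> = (\<integral>\<omega>. inner (DZ k \<omega>) (That k \<omega>) \<partial>M)"
      by (rule eqE_integral[OF That_eqE[OF L residuals_Fil(2) r], symmetric])
    finally have "\<mu>g / 2 * vZ k - Lc\<^sup>2 / (2 * \<mu>g) * vY k \<le> (\<integral>\<omega>. inner (DZ k \<omega>) (That k \<omega>) \<partial>M)" .
    moreover have "mT * vZ k \<le> \<mu>g / 2 * vZ k" "Lc\<^sup>2 / (2 * \<mu>g) * vY k \<le> kT * vY k"
      using tc v_nonneg[of k] by (auto intro!: mult_right_mono simp del: times_divide_eq_left)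
    ultimately show "mT * (\<integral>\<omega>. (norm (DZ k \<omega>))\<^sup>2 \<partial>M) - kT * vY k \<le> (\<integral>\<omega>. inner (DZ k \<omega>) (That k \<omega>) \<partial>M)"
      unfolding vZ_def[symmetric] by linarith
    have "(\<integral>\<omega>. (norm (That k \<omega>))\<^sup>2 \<partial>M) \<le> cT * (1 + vZ k + vY k)" by (rule That_moment(2)[OF L])
    also have "\<dots> \<le> cS * (1 + vZ k + vY k)" using tc v_nonneg[of k] by (intro mult_right_mono) auto
    finally show "(\<integral>\<omega>. (norm (That k \<omega>))\<^sup>2 \<partial>M) \<le> cS * (1 + (\<integral>\<omega>. (norm (DZ k \<omega>))\<^sup>2 \<partial>M) + vY k)" by (simp add: vZ_def)
  qed (use tc d ab v_nonneg in auto)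
  finally show ?thesis by (simp add: vZ_def)
qed

text \<open>The moving average is a step of length \<open>b\<close> along \<open>h\<close> minus its
  estimator, towards the target \<open>hypergrad\<close>. The mean of the estimator differs from the
  target by the errors of \<open>Y\<close> and \<open>Z\<close>, which act as the source
  term.\<close>

lemma vE_recursion: "vE (Suc k) \<le> (1 - b * mT) * vE k + b * (3 * kT + mT) * (vY k + vZ k) + sk"
proof -
  note L = L2_all[of k] and tc = tracking_constants
  let ?G = "\<lambda>\<omega>. hypergrad f g (px S k \<omega>)"
  let ?N = "\<lambda>\<omega>. ?G \<omega> - hypergrad f g (px S (Suc k) \<omega>)"
  let ?T = "\<lambda>\<omega>. ph S k \<omega> - What k \<omega>"
  note ry = residuals_sq_int(1)[OF L] and rz = residuals_sq_int(2)[OF L] and r = residuals_sq_int(3)[OF L]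
  note ir = sq_intD(2)[OF ry] sq_intD(2)[OF rz] sq_intD(2)[OF r]
  note d = target_drift[where H = "hypergrad f g", OF hypergrad_lipschitz hypergrad_sq_int[OF L2_all] stepsizes(1)]
  have bias: "(norm (?G \<omega> - gS k \<omega>))\<^sup>2 \<le> 2 * Lc\<^sup>2 * ((norm (DY k \<omega>))\<^sup>2 + (norm (DZ k \<omega>))\<^sup>2)" for \<omega>
  proof -
    have "(norm (?G \<omega> - gS k \<omega>))\<^sup>2 \<le> (Lc * (norm (DY k \<omega>) + norm (DZ k \<omega>)))\<^sup>2"
      unfolding DY_def DZ_def by (intro power_mono hypergrad_bias) simp
    also have "\<dots> = Lc\<^sup>2 * (norm (norm (DY k \<omega>) + norm (DZ k \<omega>)))\<^sup>2" by (simp add: power_mult_distrib)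
    also have "\<dots> \<le> Lc\<^sup>2 * (2 * (norm (norm (DY k \<omega>)))\<^sup>2 + 2 * (norm (norm (DZ k \<omega>)))\<^sup>2)"
      by (intro mult_left_mono norm_add_sq) simp
    finally show ?thesis by (simp add: algebra_simps)
  qed
  have sT: "sq_int M ?T" by (intro sq_int_diff L2D L What_moment)
  have sgS: "sq_int M (\<lambda>\<omega>. ph S k \<omega> - gS k \<omega>)" by (intro sq_int_diff L2D L gS_sq_int)
  have "vE (Suc k) = (\<integral>\<omega>. (norm (DH k \<omega> - b *\<^sub>R ?T \<omega> + ?N \<omega>))\<^sup>2 \<partial>M)"
    unfolding vE_def by (intro Bochner_Integration.integral_cong refl) (simp add: DH_def step(4) stepsizes algebra_simps)
  also have "\<dots> \<le> (1 - b * mT) * (\<integral>\<omega>. (norm (DH k \<omega>))\<^sup>2 \<partial>M) + b * (3 * kT + mT) * (vY k + vZ k) + 2 * cS * b\<^sup>2 + 3 / (b * mT) * (Lc\<^sup>2 * (a\<^sup>2 * vH k))"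
  proof (rule tracking[OF r sT d(1) ab(2) tc(1) ab(3,4)])
    have pw: "1 / 2 * (norm (DH k \<omega>))\<^sup>2 - Lc\<^sup>2 * ((norm (DY k \<omega>))\<^sup>2 + (norm (DZ k \<omega>))\<^sup>2) \<le> inner (DH k \<omega>) (ph S k \<omega> - gS k \<omega>)" for \<omega>
    proof -
      have "inner (DH k \<omega>) (ph S k \<omega> - gS k \<omega>) = (norm (DH k \<omega>))\<^sup>2 + inner (DH k \<omega>) (?G \<omega> - gS k \<omega>)"
        unfolding power2_norm_eq_inner inner_add_right[symmetric] by (simp add: DH_def algebra_simps)
      moreover have "- inner (DH k \<omega>) (?G \<omega> - gS k \<omega>) \<le> norm (DH k \<omega>) * norm (?G \<omega> - gS k \<omega>)"
        using Cauchy_Schwarz_ineq2[of "DH k \<omega>" "?G \<omega> - gS k \<omega>"] by linarith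
      moreover have "norm (DH k \<omega>) * norm (?G \<omega> - gS k \<omega>) \<le> 1 / 2 * (norm (DH k \<omega>))\<^sup>2 + (norm (?G \<omega> - gS k \<omega>))\<^sup>2 / (2 * 1)"
        by (rule weighted_sq_bound) simp
      ultimately show ?thesis using bias[of \<omega>] by linarith
    qed
    have "1 / 2 * vE k - Lc\<^sup>2 * (vY k + vZ k) = (\<integral>\<omega>. 1 / 2 * (norm (DH k \<omega>))\<^sup>2 - Lc\<^sup>2 * ((norm (DY k \<omega>))\<^sup>2 + (norm (DZ k \<omega>))\<^sup>2) \<partial>M)"
      using ir by (simp add: vE_def vY_def vZ_def)
    also have "\<dots> \<le> (\<integral>\<omega>. inner (DH k \<omega>) (ph S k \<omega> - gS k \<omega>) \<partial>M)"
      using ir pw by (intro integral_mono sq_int_inner r sgS) auto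
    also have "\<dots> = (\<integral>\<omega>. inner (DH k \<omega>) (?T \<omega>) \<partial>M)"
      unfolding inner_diff_right
      by (rule eqE_integral[OF eqE_diff[OF eqE_refl What_eqE[unfolded inner_diff_right]], symmetric])
        (use sq_int_inner[OF r L2D(4)[OF L]] L residuals_Fil r in auto)
    finally have "1 / 2 * vE k - Lc\<^sup>2 * (vY k + vZ k) \<le> (\<integral>\<omega>. inner (DH k \<omega>) (?T \<omega>) \<partial>M)" .
    moreover have "mT * vE k \<le> 1 / 2 * vE k" "Lc\<^sup>2 * (vY k + vZ k) \<le> kT * (vY k + vZ k)"
      by (intro mult_right_mono; use tc v_nonneg[of k] in simp)+
    ultimately show "mT * (\<integral>\<omega>. (norm (DH k \<omega>))\<^sup>2 \<partial>M) - kT * (vY k + vZ k) \<le> (\<integral>\<omega>. inner (DH k \<omega>) (?T \<omega>) \<partial>M)"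
      unfolding vE_def[symmetric] by linarith
    have sW: "sq_int M (\<lambda>\<omega>. What k \<omega> - gS k \<omega>)" by (intro sq_int_diff What_moment gS_sq_int L)
    have "(\<integral>\<omega>. (norm (?T \<omega>))\<^sup>2 \<partial>M) \<le> 2 * (\<integral>\<omega>. (norm (ph S k \<omega> - gS k \<omega>))\<^sup>2 \<partial>M) + 2 * (\<integral>\<omega>. (norm (What k \<omega> - gS k \<omega>))\<^sup>2 \<partial>M)"
      using sq_int_diff(2)[OF sgS sW] by simp
    also have "\<dots> \<le> 2 * (2 * vE k + 4 * Lc\<^sup>2 * (vY k + vZ k)) + 2 * (cW * (1 + vZ k))"
    proof (intro add_mono mult_left_mono What_moment(2)[OF L])
      have "(\<integral>\<omega>. (norm (ph S k \<omega> - gS k \<omega>))\<^sup>2 \<partial>M) \<le> (\<integral>\<omega>. 2 * (norm (DH k \<omega>))\<^sup>2 + 4 * Lc\<^sup>2 * ((norm (DY k \<omega>))\<^sup>2 + (norm (DZ k \<omega>))\<^sup>2) \<partial>M)"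
      proof (rule integral_mono)
        show "(norm (ph S k \<omega> - gS k \<omega>))\<^sup>2 \<le> 2 * (norm (DH k \<omega>))\<^sup>2 + 4 * Lc\<^sup>2 * ((norm (DY k \<omega>))\<^sup>2 + (norm (DZ k \<omega>))\<^sup>2)" for \<omega>
        proof -
          have eq: "ph S k \<omega> - gS k \<omega> = DH k \<omega> + (?G \<omega> - gS k \<omega>)" by (simp add: DH_def algebra_simps)
          show ?thesis unfolding eq using norm_add_sq[of "DH k \<omega>" "?G \<omega> - gS k \<omega>"] bias[of \<omega>] by linarith
        qed
      qed (use sq_intD(2)[OF sgS] ir in auto)
      also have "\<dots> = 2 * vE k + 4 * Lc\<^sup>2 * (vY k + vZ k)" using ir by (simp add: vE_def vY_def vZ_def)
      finally show "(\<integral>\<omega>. (norm (ph S k \<omega> - gS k \<omega>))\<^sup>2 \<partial>M) \<le> 2 * vE k + 4 * Lc\<^sup>2 * (vY k + vZ k)" .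
    qed auto
    also have "\<dots> \<le> cS * (1 + vE k + (vY k + vZ k))"
    proof -
      let ?n = "1 + vE k + (vY k + vZ k)"
      have "4 * vE k \<le> 4 * ?n" "8 * Lc\<^sup>2 * (vY k + vZ k) \<le> 8 * Lc\<^sup>2 * ?n" "2 * cW * (1 + vZ k) \<le> 2 * cW * ?n"
        "0 \<le> (cV + cT) * ?n"
        using v_nonneg[of k] cW_nonneg cV_nonneg cT_nonneg by (auto intro!: mult_left_mono mult_nonneg_nonneg)
      moreover have "cS * ?n = (cV + cT) * ?n + 4 * ?n + 8 * Lc\<^sup>2 * ?n + 2 * cW * ?n" by (simp add: cS_def algebra_simps)
      moreover have "2 * (2 * vE k + 4 * Lc\<^sup>2 * (vY k + vZ k)) + 2 * (cW * (1 + vZ k)) = 4 * vE k + 8 * Lc\<^sup>2 * (vY k + vZ k) + 2 * cW * (1 + vZ k)"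
        by (simp add: algebra_simps)
      ultimately show ?thesis by linarith
    qed
    finally show "(\<integral>\<omega>. (norm (?T \<omega>))\<^sup>2 \<partial>M) \<le> cS * (1 + (\<integral>\<omega>. (norm (DH k \<omega>))\<^sup>2 \<partial>M) + (vY k + vZ k))" by (simp add: vE_def)
  qed (use tc d ab v_nonneg in auto)
  finally show ?thesis by (simp add: vE_def)
qed

end

text \<open>The expansion at the origin bounds \<open>Phi\<close> by a quadratic in
  \<open>x\<close>, and \<open>x\<close> is square integrable.\<close>

lemma Phi_integrable: "integrable M (\<lambda>\<omega>. Phi f g (px S k \<omega>))"
proof (rule Bochner_Integration.integrable_bound)
  note L = L2D(1)[OF L2_all[of k]]
  have cf: "continuous_on UNIV f"
    using GDERIV_f unfolding gderiv_def by (intro continuous_at_imp_continuous_on) (auto intro: has_derivative_continuous)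
  have "(\<lambda>\<omega>. (px S k \<omega>, Ystar g (px S k \<omega>))) \<in> borel_measurable M"
    using sq_intD(1)[OF L] sq_intD(1)[OF targets_sq_int(1)] by (rule borel_measurable_Pair)
  then show "(\<lambda>\<omega>. Phi f g (px S k \<omega>)) \<in> borel_measurable M"
    unfolding Phi_def by (rule measurable_compose[OF _ borel_measurable_continuous_onI[OF cf]])
  show "integrable M (\<lambda>\<omega>. \<bar>Phi f g 0\<bar> + norm (hypergrad f g 0) * norm (px S k \<omega>) + Lc * (norm (px S k \<omega>))\<^sup>2)"
    using sq_intD(2)[OF L] sq_int_integrable[OF sq_int_norm[OF L]] by simp
  show "AE \<omega> in M. norm (Phi f g (px S k \<omega>)) \<le> norm (\<bar>Phi f g 0\<bar> + norm (hypergrad f g 0) * norm (px S k \<omega>) + Lc * (norm (px S k \<omega>))\<^sup>2)"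
  proof (rule AE_I2)
    fix \<omega>
    show "norm (Phi f g (px S k \<omega>)) \<le> norm (\<bar>Phi f g 0\<bar> + norm (hypergrad f g 0) * norm (px S k \<omega>) + Lc * (norm (px S k \<omega>))\<^sup>2)"
      using Phi_expansion[of 0 "px S k \<omega>"] Cauchy_Schwarz_ineq2[of "hypergrad f g 0" "px S k \<omega>"] by simp
  qed
qed

section \<open>Descent of the objective and choice of the constants\<close>

definition "vP k = (\<integral>\<omega>. Phi f g (px S k \<omega>) \<partial>M)"
definition "vG k = (\<integral>\<omega>. (norm (hypergrad f g (px S k \<omega>)))\<^sup>2 \<partial>M)"

lemma vP_recursion:
  assumes a: "\<alpha> k = a" "0 < a"
  shows "vP (Suc k) \<le> vP k + a / 2 * (vE k - vG k - vH k) + Lc * a\<^sup>2 * vH k"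
proof -
  note L = L2_all[of k]
  let ?G = "\<lambda>\<omega>. hypergrad f g (px S k \<omega>)"
  have i: "integrable M (\<lambda>\<omega>. (norm (DH k \<omega>))\<^sup>2)" "integrable M (\<lambda>\<omega>. (norm (?G \<omega>))\<^sup>2)" "integrable M (\<lambda>\<omega>. (norm (ph S k \<omega>))\<^sup>2)"
    using residuals_sq_int(3)[OF L] hypergrad_sq_int[OF L] L2D(4)[OF L] by (auto dest: sq_intD)
  have "vP (Suc k) \<le> (\<integral>\<omega>. Phi f g (px S k \<omega>) + (a / 2 * ((norm (DH k \<omega>))\<^sup>2 - (norm (?G \<omega>))\<^sup>2 - (norm (ph S k \<omega>))\<^sup>2)
      + Lc * a\<^sup>2 * (norm (ph S k \<omega>))\<^sup>2) \<partial>M)"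
    unfolding vP_def
  proof (rule integral_mono)
    fix \<omega> assume "\<omega> \<in> space M"
    then have x: "px S (Suc k) \<omega> = px S k \<omega> + (- a *\<^sub>R ph S k \<omega>)" using step(1) a by simp
    \<comment> \<open>Polarisation: the inner product of the gradient with \<open>h\<close> is
      rewritten through their difference, which produces the negative terms in the squared gradient
      and the squared \<open>h\<close>.\<close>
    have "a / 2 * ((norm (DH k \<omega>))\<^sup>2 - (norm (?G \<omega>))\<^sup>2 - (norm (ph S k \<omega>))\<^sup>2) = inner (?G \<omega>) (- a *\<^sub>R ph S k \<omega>)"
      unfolding DH_def power2_norm_eq_inner by (simp add: inner_diff_left inner_diff_right inner_commute algebra_simps)
    moreover have "Lc * (norm (- a *\<^sub>R ph S k \<omega>))\<^sup>2 = Lc * a\<^sup>2 * (norm (ph S k \<omega>))\<^sup>2" by (simp add: power_mult_distrib)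
    ultimately show "Phi f g (px S (Suc k) \<omega>) \<le> Phi f g (px S k \<omega>) + (a / 2 * ((norm (DH k \<omega>))\<^sup>2 - (norm (?G \<omega>))\<^sup>2 - (norm (ph S k \<omega>))\<^sup>2)
      + Lc * a\<^sup>2 * (norm (ph S k \<omega>))\<^sup>2)"
      using Phi_expansion[of "px S k \<omega>" "- a *\<^sub>R ph S k \<omega>"] unfolding x by linarith
  qed (use i Phi_integrable in auto)
  also have "\<dots> = vP k + (a / 2 * (vE k - vG k - vH k) + Lc * a\<^sup>2 * vH k)"
    using i Phi_integrable by (simp add: vP_def vE_def vG_def vH_def)
  finally show ?thesis by simp
qed

text \<open>\<open>kL\<close> is the source coefficient left by the tracking lemma and
  \<open>wL\<close> the total weight in the Lyapunov function. The ratio \<open>cL\<close> is at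
  least 1, so that \<open>12 * Lc^2 * wL \<le> mT * cL\<close> already implies the condition with
  \<open>cL\<close> squared.\<close>

definition "kL = 3 * kT + mT"
definition "wL = 1 / mT + kL / mT\<^sup>2 + (kL / mT\<^sup>2 + kL\<^sup>2 / mT ^ 3)"
definition "cL = 1 + 12 * Lc\<^sup>2 * wL / mT"
text \<open>The three bounds are the smallness conditions on the stepsize: contraction factor
  nonnegative, second moment absorbed by the drift, and quadratic error in the descent at most a
  quarter.\<close>

definition "aL = Min {1 / (cL * mT), mT / (2 * cL * cS), 1 / (4 * Lc)}"
definition "C1L = 2 * cS * cL * wL"
text \<open>The initial gap of the Lyapunov function above the infimum of \<open>Phi\<close>; the
  added 1 only serves to make the constant strictly positive.\<close>

definition "C0L = 1 + (Phi f g x0 - Inf (range (Phi f g))) + (1 / mT * (norm (hypergrad f g x0))\<^sup>2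
   + kL / mT\<^sup>2 * (norm (Z0 - Zstar f g x0))\<^sup>2 + (kL / mT\<^sup>2 + kL\<^sup>2 / mT ^ 3) * (norm (Y0 - Ystar g x0))\<^sup>2) / cL"

lemma final_constants: "0 \<le> kL" "0 < wL" "1 \<le> cL" "0 < aL" "0 < C1L" "bdd_below (range (Phi f g)) \<Longrightarrow> 0 < C0L"
proof -
  note tc = tracking_constants
  have Lc1: "0 < Lc" using Lc_ge(1) by simp
  show k: "0 \<le> kL" using tc by (simp add: kL_def)
  have "0 \<le> kL / mT\<^sup>2" "0 \<le> kL\<^sup>2 / mT ^ 3" "0 < 1 / mT" using k tc by auto
  then show w: "0 < wL" unfolding wL_def by linarith
  have "0 \<le> 12 * Lc\<^sup>2 * wL / mT" using w tc by simp
  then show c: "1 \<le> cL" by (simp add: cL_def)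
  show "0 < aL" unfolding aL_def using c tc Lc1 by simp
  show "0 < C1L" unfolding C1L_def using c w tc by simp
  assume bdd: "bdd_below (range (Phi f g))"
  have "0 \<le> Phi f g x0 - Inf (range (Phi f g))" using cInf_lower[OF _ bdd, of "Phi f g x0"] by simp
  moreover have "0 \<le> (1 / mT * (norm (hypergrad f g x0))\<^sup>2
   + kL / mT\<^sup>2 * (norm (Z0 - Zstar f g x0))\<^sup>2 + (kL / mT\<^sup>2 + kL\<^sup>2 / mT ^ 3) * (norm (Y0 - Ystar g x0))\<^sup>2) / cL"
    using c k tc by (intro divide_nonneg_pos add_nonneg_nonneg mult_nonneg_nonneg) auto
  ultimately show "0 < C0L" unfolding C0L_def by linarith
qed

theorem average_bound:
  assumes bdd: "bdd_below (range (Phi f g))" and a: "0 < a" "a \<le> aL"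
    and st: "\<And>k. \<alpha> k = a" "\<And>k. \<beta> k = cL * a" "\<And>k. \<gamma> k = cL * a" "\<And>k. \<theta> k = cL * a" and K: "1 \<le> K"
  shows "1 / real K * (\<Sum>k<K. vG k) \<le> 2 * (C0L / (real K * a) + C1L * a)"
proof -
  note tc = tracking_constants and fc = final_constants
  have Lc1: "0 < Lc" using Lc_ge(1) by simp
  let ?b = "cL * a"
  have aL: "a \<le> 1 / (cL * mT)" "a \<le> mT / (2 * cL * cS)" "a \<le> 1 / (4 * Lc)" using a(2) unfolding aL_def by auto
  have b: "0 < ?b" using fc(3) a by simp
  have b1: "?b * mT \<le> 1" using aL(1) fc(3) tc(1) by (simp add: field_simps)
  have b2: "?b * cS \<le> mT / 2" using aL(2) fc(3) tc(5) by (simp add: field_simps)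
  have b3: "Lc * a \<le> 1 / 4" using aL(3) Lc1 by (simp add: field_simps)
  have c2: "12 * Lc\<^sup>2 * wL \<le> mT * cL\<^sup>2"
  proof -
    have "12 * Lc\<^sup>2 * wL \<le> mT * cL" using tc(1) by (simp add: cL_def field_simps)
    also have "\<dots> \<le> mT * cL\<^sup>2" using fc(3) tc(1) by (intro mult_left_mono) (auto simp: power2_eq_square)
    finally show ?thesis .
  qed
  have inf: "Inf (range (Phi f g)) \<le> vP k" for k
  proof -
    have "Inf (range (Phi f g)) = (\<integral>\<omega>. Inf (range (Phi f g)) \<partial>M)" by (simp add: prob_space)
    also have "\<dots> \<le> vP k" unfolding vP_def
      using cInf_lower[OF _ bdd] Phi_integrable by (intro integral_mono) auto
    finally show ?thesis .
  qed
  have "(\<Sum>k<K. vG k) \<le> 2 / a * (vP 0 + (1 / mT * vE 0 + kL / mT\<^sup>2 * vZ 0 + (kL / mT\<^sup>2 + kL\<^sup>2 / mT ^ 3) * vY 0) / cL - Inf (range (Phi f g)))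
     + real K * (4 * cS * cL * wL * a)"
    by (rule lyapunov[where b = ?b and L = Lc and h = vH and C = cS and g = vG and s = "\<lambda>k. 2 * cS * ?b\<^sup>2 + 3 / (?b * mT) * (Lc\<^sup>2 * (a\<^sup>2 * vH k))"])
      (use a tc fc b3 c2 v_nonneg inf wL_def
        vY_recursion[OF st a(1) b b1 b2] vZ_recursion[OF st a(1) b b1 b2, folded kL_def]
        vE_recursion[OF st a(1) b b1 b2, folded kL_def] vP_recursion[OF st(1) a(1)] in auto)
  \<comment> \<open>The initial state is deterministic, so the moments at time 0 are the explicit
    terms of \<open>C0L\<close>.\<close>
  also have "vP 0 + (1 / mT * vE 0 + kL / mT\<^sup>2 * vZ 0 + (kL / mT\<^sup>2 + kL\<^sup>2 / mT ^ 3) * vY 0) / cL - Inf (range (Phi f g)) = C0L - 1"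
  proof -
    have "vP 0 = (\<integral>\<omega>. Phi f g x0 \<partial>M)" "vE 0 = (\<integral>\<omega>. (norm (hypergrad f g x0))\<^sup>2 \<partial>M)"
      "vZ 0 = (\<integral>\<omega>. (norm (Z0 - Zstar f g x0))\<^sup>2 \<partial>M)" "vY 0 = (\<integral>\<omega>. (norm (Y0 - Ystar g x0))\<^sup>2 \<partial>M)"
      unfolding vP_def vE_def vZ_def vY_def DH_def DZ_def DY_def
      by (rule Bochner_Integration.integral_cong; simp add: init)+
    then show ?thesis by (simp add: C0L_def prob_space)
  qed
  also have "2 / a * (C0L - 1) + real K * (4 * cS * cL * wL * a) \<le> 2 / a * C0L + real K * (2 * C1L * a)"
    using a by (simp add: C1L_def divide_right_mono)
  finally have "1 / real K * (\<Sum>k<K. vG k) \<le> 1 / real K * (2 / a * C0L + real K * (2 * C1L * a))"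
    by (intro mult_left_mono) auto
  also have "\<dots> = 2 * (C0L / (real K * a) + C1L * a)" using K a by (simp add: field_simps)
  finally show ?thesis .
qed

end

section \<open>Rates\<close>

context bros
begin

lemma sq_grad_eq: "sq_grad_at f g S R \<omega> = (norm (hypergrad f g (px S (R \<omega>) \<omega>)))\<^sup>2"
  by (simp add: sq_grad_at_def grad_Phi)

lemma sq_grad_integrable: "integrable M (sq_grad_at f g S (\<lambda>_. k))"
  using sq_intD(2)[OF hypergrad_sq_int[OF L2_all[of k]]] by (simp add: sq_grad_eq[abs_def])

lemma avg_sq_grad_eq: "avg_sq_grad f g S K = 1 / real K * (\<Sum>k<K. vG k)"
  by (simp add: avg_sq_grad_def sq_grad_eq[abs_def] vG_def)

text \<open>The event that \<open>R\<close> equals \<open>k\<close> is independent of everything the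
  algorithm generates and has probability \<open>1 / real K\<close>; summing over these events turns
  the expectation at the random index into the average.\<close>

lemma uniform_index_mean:
  assumes R: "uniform_index D S K R" and K: "1 \<le> K"
  shows "integrable M (sq_grad_at f g S R)" "(\<integral>\<omega>. sq_grad_at f g S R \<omega> \<partial>M) = avg_sq_grad f g S K"
proof -
  have mR: "R \<in> M \<rightarrow>\<^sub>M count_space UNIV" and dR: "distr M (count_space UNIV) R = measure_pmf (pmf_of_set {..<K})"
    and ind: "indep_set (gen M R (count_space UNIV)) (sets (FilAll D S))"
    using R by (auto simp: uniform_index_def)
  have K0: "{..<K} \<noteq> {}" using K by (auto simp: lessThan_empty_iff)
  let ?G = "\<lambda>k \<omega>. (norm (hypergrad f g (px S k \<omega>)))\<^sup>2"
  define B where "B k = R -` {k} \<inter> space M" for k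
  have BM: "B k \<in> events" for k unfolding B_def by (rule measurable_sets[OF mR]) simp
  have pB: "prob (B k) = 1 / real K" if "k < K" for k
  proof -
    have "prob (B k) = measure (distr M (count_space UNIV) R) {k}" unfolding B_def by (rule measure_distr[OF mR, symmetric]) simp
    also have "\<dots> = pmf (pmf_of_set {..<K}) k" unfolding dR by (simp add: measure_pmf_single)
    also have "\<dots> = 1 / real K" using that K0 by (simp add: pmf_of_set)
    finally show ?thesis .
  qed
  have AK: "AE \<omega> in M. R \<omega> < K"
  proof -
    have "AE k in distr M (count_space UNIV) R. k < K" unfolding dR using K0 by (auto simp: AE_measure_pmf_iff set_pmf_of_set)
    then show ?thesis by (rule AE_distrD[OF mR])
  qed
  define A1 where "A1 = vimage_algebra (space M) R (count_space UNIV)"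
  have FA: "space (FilAll D S) = space M" "sets (FilAll D S) = sigma_sets (space M)
      (\<Union>k. gen_states S k \<union> gen_P D S k \<union> gen_probes D S (Suc k) \<union> \<Union> (set (est_algebras S (Suc k))))"
  proof -
    have "(\<Union>k. gen_states S k \<union> gen_P D S k \<union> gen_probes D S (Suc k) \<union> \<Union> (set (est_algebras S (Suc k)))) \<subseteq> Pow (space M)"
    proof (intro UN_least Un_least Union_least)
      show "gen_states S k \<subseteq> Pow (space M)" "gen_P D S k \<subseteq> Pow (space M)" "gen_probes D S (Suc k) \<subseteq> Pow (space M)" for k
        unfolding gen_states_def gen_P_def gen_probes_def by (intro Un_least UN_least gen_Pow)+
      show "X \<subseteq> Pow (space M)" if "X \<in> set (est_algebras S (Suc k))" for X k
        using that unfolding est_algebras_def by (auto dest: subsetD[OF gen_Pow])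
    qed
    then show "space (FilAll D S) = space M" "sets (FilAll D S) = sigma_sets (space M)
      (\<Union>k. gen_states S k \<union> gen_P D S k \<union> gen_probes D S (Suc k) \<union> \<Union> (set (est_algebras S (Suc k))))"
      unfolding FilAll_def by (simp_all add: space_measure_of sets_measure_of)
  qed
  have mx: "px S k \<in> borel_measurable (FilAll D S)" for k
  proof (rule gen_measurable[where M = M])
    show "gen M (px S k) borel \<subseteq> sets (FilAll D S)"
      unfolding FA gen_states_def by (blast intro: sigma_sets.Basic)
  qed (auto simp: FA)
  have "continuous_on UNIV (hypergrad f g)"
    by (rule lipschitz_on_continuous_on[where L = Lc]) (rule lipschitz_onI, auto simp: dist_norm hypergrad_lipschitz Lc_nonneg)
  then have mG: "?G k \<in> borel_measurable (FilAll D S)" for k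
    using measurable_compose[OF mx borel_measurable_continuous_onI] by measurable
  have iG: "integrable M (?G k)" for k by (rule sq_intD(2)[OF hypergrad_sq_int[OF L2_all]])
  have part: "eqE M (\<lambda>\<omega>. indicator (B k) \<omega> * ?G k \<omega>) (\<lambda>\<omega>. indicator (B k) \<omega> * vG k)" for k
    unfolding vG_def
  proof (rule indep_set_eqE[OF ind])
    have "B k \<in> sets A1" unfolding A1_def B_def by (rule in_vimage_algebra) simp
    then show "indicator (B k) \<in> borel_measurable A1" by simp
    show "sets A1 \<subseteq> gen M R (count_space UNIV)" "space A1 = space M" by (simp_all add: A1_def gen_def)
    show "integrable M (indicator (B k) :: _ \<Rightarrow> real)" using BM by (simp add: integrable_indicator_iff less_top[symmetric])
    show "?G k \<in> borel_measurable (FilAll D S)" "integrable M (?G k)" by (rule mG iG)+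
  qed (simp_all add: FA)
  have s: "eqE M (\<lambda>\<omega>. \<Sum>k<K. indicator (B k) \<omega> * ?G k \<omega>) (\<lambda>\<omega>. \<Sum>k<K. indicator (B k) \<omega> * vG k)"
    by (rule eqE_sum) (rule part)
  have AE: "AE \<omega> in M. sq_grad_at f g S R \<omega> = (\<Sum>k<K. indicator (B k) \<omega> * ?G k \<omega>)"
    using AK AE_space
  proof eventually_elim
    case (elim \<omega>)
    have "(\<Sum>k<K. indicator (B k) \<omega> * ?G k \<omega>) = (\<Sum>k<K. if k = R \<omega> then ?G k \<omega> else 0)"
      using elim by (intro sum.cong) (auto simp: B_def indicator_def)
    then show ?case using elim by (simp add: sq_grad_eq)
  qed
  have m1: "sq_grad_at f g S R \<in> borel_measurable M"
  proof -
    have "(\<lambda>\<omega>. ?G (R \<omega>) \<omega>) \<in> borel_measurable M"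
      by (rule measurable_compose_countable[OF _ mR]) (use iG in auto)
    then show ?thesis by (simp add: sq_grad_eq[abs_def])
  qed
  have m2: "(\<lambda>\<omega>. \<Sum>k<K. indicator (B k) \<omega> * ?G k \<omega>) \<in> borel_measurable M" using s by (auto simp: eqE_def)
  show "integrable M (sq_grad_at f g S R)" using integrable_cong_AE[OF m1 m2 AE] s by (simp add: eqE_def)
  have "(\<integral>\<omega>. sq_grad_at f g S R \<omega> \<partial>M) = (\<integral>\<omega>. (\<Sum>k<K. indicator (B k) \<omega> * vG k) \<partial>M)"
    using integral_cong_AE[OF m1 m2 AE] s by (simp add: eqE_def)
  also have "\<dots> = (\<Sum>k<K. prob (B k) * vG k)"
    using BM by (subst Bochner_Integration.integral_sum) (auto simp: integrable_indicator_iff less_top[symmetric])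
  also have "\<dots> = avg_sq_grad f g S K"
    unfolding avg_sq_grad_eq sum_distrib_left using pB by (intro sum.cong) auto
  finally show "(\<integral>\<omega>. sq_grad_at f g S R \<omega> \<partial>M) = avg_sq_grad f g S K" .
qed

end

text \<open>The constants have to be named before the run, but the locale defining them can be
  entered only with a run at hand. They do not mention the run or its stepsizes, so those taken from
  one arbitrary run serve for all others.\<close>

lemma uniform_constants:
  fixes D :: "('l::finite, 'y::finite, 'b::finite) layout"
    and f g :: "(real ^ 'd::finite) \<times> (real ^ 'y) \<Rightarrow> real"
  assumes layout: "valid_layout D"
    and smooth: "smooth_bilevel f g \<mu>g Lf0 Lf1 Lg1 Lg2"
    and lower: "bdd_below (range (Phi f g))"
  shows "\<exists>c C0 C1 abar :: real. 0 < c \<and> 0 < C0 \<and> 0 < C1 \<and> 0 < abar \<and>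
    (\<forall>a (S :: ('w, 'd, 'l, 'y, 'b) process). 0 < a \<longrightarrow> a \<le> abar \<longrightarrow>
      bros_run D f g \<sigma>f1 \<sigma>f2 \<sigma>g1 \<sigma>g2 x0 Y0 Z0 (\<lambda>_. a) (\<lambda>_. c * a) (\<lambda>_. c * a) (\<lambda>_. c * a) S \<longrightarrow>
      (\<forall>k. integrable (pM S) (sq_grad_at f g S (\<lambda>_. k))) \<and>
      (\<forall>K\<ge>1. avg_sq_grad f g S K \<le> 2 * (C0 / (real K * a) + C1 * a)) \<and>
      (\<forall>K\<ge>1. \<forall>R. uniform_index D S K R \<longrightarrow> integrable (pM S) (sq_grad_at f g S R) \<and>
        (\<integral>\<omega>. sq_grad_at f g S R \<omega> \<partial>pM S) = avg_sq_grad f g S K))"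
\<comment> \<open>If these data admit no run for any stepsizes, every choice of positive constants
  works; otherwise some run gives access to the locale.\<close>
proof (cases "\<exists>\<alpha> \<beta> \<gamma> \<theta> (S :: ('w, 'd, 'l, 'y, 'b) process). bros_run D f g \<sigma>f1 \<sigma>f2 \<sigma>g1 \<sigma>g2 x0 Y0 Z0 \<alpha> \<beta> \<gamma> \<theta> S")
  case False
  then show ?thesis by (intro exI[of _ 1]) auto
next
  case True
  then obtain \<alpha> \<beta> \<gamma> \<theta> and S1 :: "('w, 'd, 'l, 'y, 'b) process"
    where "bros_run D f g \<sigma>f1 \<sigma>f2 \<sigma>g1 \<sigma>g2 x0 Y0 Z0 \<alpha> \<beta> \<gamma> \<theta> S1" by blast
  then interpret B: bros D f g \<mu>g Lf0 Lf1 Lg1 Lg2 \<sigma>f1 \<sigma>f2 \<sigma>g1 \<sigma>g2 x0 Y0 Z0 \<alpha> \<beta> \<gamma> \<theta> S1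
    using layout smooth by unfold_locales
  show ?thesis
  proof (intro exI conjI allI impI)
    show "0 < B.cL" "0 < B.C0L" "0 < B.C1L" "0 < B.aL" using B.final_constants lower by auto
    fix a and S :: "('w, 'd, 'l, 'y, 'b) process"
    assume a: "0 < a" "a \<le> B.aL"
      and "bros_run D f g \<sigma>f1 \<sigma>f2 \<sigma>g1 \<sigma>g2 x0 Y0 Z0 (\<lambda>_. a) (\<lambda>_. B.cL * a) (\<lambda>_. B.cL * a) (\<lambda>_. B.cL * a) S"
    then interpret S: bros D f g \<mu>g Lf0 Lf1 Lg1 Lg2 \<sigma>f1 \<sigma>f2 \<sigma>g1 \<sigma>g2 x0 Y0 Z0 "\<lambda>_. a" "\<lambda>_. B.cL * a" "\<lambda>_. B.cL * a" "\<lambda>_. B.cL * a" S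
      using layout smooth by unfold_locales
    show "integrable (pM S) (sq_grad_at f g S (\<lambda>_. k))" for k by (rule S.sq_grad_integrable)
    show "avg_sq_grad f g S K \<le> 2 * (B.C0L / (real K * a) + B.C1L * a)" if "1 \<le> K" for K
      unfolding S.avg_sq_grad_eq by (rule S.average_bound[OF lower a]) (use that in auto)
    show "integrable (pM S) (sq_grad_at f g S R)" "(\<integral>\<omega>. sq_grad_at f g S R \<omega> \<partial>pM S) = avg_sq_grad f g S K"
      if "1 \<le> K" "uniform_index D S K R" for K R
      by (rule S.uniform_index_mean[OF that(2,1)])+
  qed
qed

text \<open>The lower half of the order relation controls the term with \<open>\<alpha> K\<close> in
  the denominator and the upper half the term linear in \<open>\<alpha> K\<close>; at this scale
  both are of the same order because \<open>real K * q * q = 1\<close>.\<close>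

lemma balanced_stepsize_rate:
  fixes \<alpha> :: "nat \<Rightarrow> real"
  assumes \<alpha>: "\<alpha> \<in> \<Theta>(\<lambda>K. real K powr (- 1 / 2))" and pos: "\<And>K. 1 \<le> K \<Longrightarrow> 0 < \<alpha> K" and C: "0 < C0" "0 < C1"
  obtains B N where "0 < B" "1 \<le> N" "\<And>K. N \<le> K \<Longrightarrow> 2 * (C0 / (real K * \<alpha> K) + C1 * \<alpha> K) \<le> B * real K powr (- 1 / 2)"
proof -
  obtain u where u: "0 < u" "eventually (\<lambda>K. norm (\<alpha> K) \<le> u * norm (real K powr (- 1 / 2))) at_top"
    using landau_o.bigE[OF bigthetaD1[OF \<alpha>]] by blast
  obtain v where v: "0 < v" "eventually (\<lambda>K. norm (\<alpha> K) \<ge> v * norm (real K powr (- 1 / 2))) at_top"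
    using landau_omega.bigE[OF bigthetaD2[OF \<alpha>]] by blast
  obtain N0 where N0: "\<And>K. N0 \<le> K \<Longrightarrow> norm (\<alpha> K) \<le> u * norm (real K powr (- 1 / 2)) \<and> norm (\<alpha> K) \<ge> v * norm (real K powr (- 1 / 2))"
    using eventually_conj[OF u(2) v(2)] unfolding eventually_at_top_linorder by blast
  show thesis
  proof (rule that[of "2 * (C0 / v + C1 * u)" "max 1 N0"])
    show "0 < 2 * (C0 / v + C1 * u)" using C u v by (simp add: add_pos_pos)
    fix K assume K: "max 1 N0 \<le> K"
    define q where "q = real K powr (- 1 / 2)"
    have q: "0 < q" "real K * q * q = 1"
    proof -
      show "0 < q" using K by (simp add: q_def)
      have "q * q = real K powr (- 1)" unfolding q_def by (simp add: powr_add[symmetric])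
      then show "real K * q * q = 1" using K by (simp add: powr_minus mult.assoc)
    qed
    have a: "\<alpha> K \<le> u * q" "v * q \<le> \<alpha> K" "0 < \<alpha> K" using N0[of K] pos[of K] K q by (auto simp: q_def)
    have "C0 / (real K * \<alpha> K) \<le> C0 / (real K * (v * q))"
      using a q v C K by (intro divide_left_mono mult_left_mono mult_pos_pos) auto
    also have "\<dots> = C0 * (real K * q * q) / (real K * (v * q))" by (simp add: q)
    also have "\<dots> = C0 / v * q" using q K v by (simp add: field_simps)
    finally have "C0 / (real K * \<alpha> K) \<le> C0 / v * q" .
    then have "C0 / (real K * \<alpha> K) + C1 * \<alpha> K \<le> C0 / v * q + C1 * (u * q)"
      using a C by (intro add_mono mult_left_mono) auto
    also have "\<dots> = (C0 / v + C1 * u) * q" by (simp add: distrib_right)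
    finally have "2 * (C0 / (real K * \<alpha> K) + C1 * \<alpha> K) \<le> 2 * ((C0 / v + C1 * u) * q)" by (rule mult_left_mono) simp
    then show "2 * (C0 / (real K * \<alpha> K) + C1 * \<alpha> K) \<le> 2 * (C0 / v + C1 * u) * real K powr (- 1 / 2)"
      by (simp only: q_def mult.assoc)
  qed auto
qed

lemma iterations_for_accuracy:
  assumes "0 < (B::real)"
  shows "\<exists>\<kappa> :: real \<Rightarrow> nat. (\<lambda>\<epsilon>. real (\<kappa> \<epsilon>)) \<in> O[at_right 0](\<lambda>\<epsilon>. \<epsilon> powr (- 2)) \<and>
    (\<forall>\<epsilon>>0. N \<le> \<kappa> \<epsilon> \<and> 1 \<le> \<kappa> \<epsilon> \<and> (\<forall>K\<ge>\<kappa> \<epsilon>. B * real K powr (- 1 / 2) \<le> \<epsilon>))"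
proof (intro exI conjI allI impI)
  \<comment> \<open>The summand \<open>N\<close> passes the threshold of the rate bound, 1 keeps the
    count positive, and the ceiling is the number of iterations at which \<open>B\<close> over the
    square root of \<open>K\<close> drops to \<open>\<epsilon>\<close>.\<close>
  let ?\<kappa> = "\<lambda>\<epsilon>::real. N + 1 + nat \<lceil>(B / \<epsilon>)\<^sup>2\<rceil>"
  show "(\<lambda>\<epsilon>. real (?\<kappa> \<epsilon>)) \<in> O[at_right 0](\<lambda>\<epsilon>. \<epsilon> powr (- 2))"
  proof (rule bigoI[of _ "real N + 2 + B\<^sup>2"], rule eventually_at_rightI[of 0 1])
    fix \<epsilon> :: real assume e: "\<epsilon> \<in> {0<..<1}"
    have p: "\<epsilon> powr (- 2) = 1 / \<epsilon>\<^sup>2" using e by (simp add: powr_minus powr_numeral divide_inverse)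
    have "\<epsilon>\<^sup>2 \<le> 1" using e by (simp add: power_le_one)
    then have one: "1 \<le> 1 / \<epsilon>\<^sup>2" using e by (simp add: le_divide_eq)
    have le: "real N + 1 + y \<le> (real N + 2) * 1 + z" if "y \<le> z + 1" for y z :: real using that by simp
    have "real (nat \<lceil>(B / \<epsilon>)\<^sup>2\<rceil>) \<le> (B / \<epsilon>)\<^sup>2 + 1"
      by (rule order_trans[OF eq_refl[OF of_nat_nat] of_int_ceiling_le_add_one]) (simp add: le_ceiling_iff order.strict_trans2[of "- 1 :: real" 0])
    then have "real (?\<kappa> \<epsilon>) \<le> (real N + 2) * 1 + (B / \<epsilon>)\<^sup>2" 
      by (simp only: of_nat_add of_nat_1) (rule le)
    also have "\<dots> = (real N + 2) * 1 + B\<^sup>2 * (1 / \<epsilon>\<^sup>2)" by (simp add: power_divide)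
    also have "\<dots> \<le> (real N + 2) * (1 / \<epsilon>\<^sup>2) + B\<^sup>2 * (1 / \<epsilon>\<^sup>2)" using one by (intro add_right_mono mult_left_mono) auto
    finally show "norm (real (?\<kappa> \<epsilon>)) \<le> (real N + 2 + B\<^sup>2) * norm (\<epsilon> powr (- 2))"
      unfolding p real_norm_def abs_of_nat using e by (simp add: add_divide_distrib)
  qed simp
  fix \<epsilon> :: real and K assume e: "0 < \<epsilon>" and K: "?\<kappa> \<epsilon> \<le> K"
  have "(B / \<epsilon>)\<^sup>2 \<le> real (nat \<lceil>(B / \<epsilon>)\<^sup>2\<rceil>)" by (rule real_nat_ceiling_ge)
  also have "\<dots> \<le> real K" using K by simp
  finally have "B \<le> \<epsilon> * sqrt (real K)" using e by (simp add: real_le_rsqrt pos_divide_le_eq[symmetric] mult.commute[of \<epsilon>])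
  moreover have "0 < real K" using K by simp
  moreover have "real K powr (- 1 / 2) = 1 / sqrt (real K)"
    by (simp only: minus_divide_left[symmetric] powr_minus_divide powr_half_sqrt of_nat_0_le_iff)
  ultimately show "B * real K powr (- 1 / 2) \<le> \<epsilon>" by (simp add: pos_divide_le_eq)
qed auto

lemma bigo_constant_weight:
  assumes "f \<in> O[F](g)" "1 \<le> (c::real)"
  shows "f \<in> O[F](\<lambda>x. c * g x)"
  using assms by (subst landau_o.big.cmult) auto

theorem theorem1:
  fixes D :: "('l::finite, 'y::finite, 'b::finite) layout"
    and f g :: "(real ^ 'd::finite) \<times> (real ^ 'y) \<Rightarrow> real"
    and \<mu>g Lf0 Lf1 Lg1 Lg2 \<sigma>f1 \<sigma>f2 \<sigma>g1 \<sigma>g2 :: real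
    and x0 :: "real ^ 'd" and Y0 Z0 :: "real ^ 'y"
  assumes layout: "valid_layout D"
    and smooth: "smooth_bilevel f g \<mu>g Lf0 Lf1 Lg1 Lg2"
    and noise: "0 \<le> \<sigma>f1" "0 \<le> \<sigma>f2" "0 \<le> \<sigma>g1" "0 \<le> \<sigma>g2"
    and lower: "bdd_below (range (Phi f g))"
  defines "run \<equiv> (\<lambda>c1 c2 c3 a (S :: ('w, 'd, 'l, 'y, 'b) process).
      bros_run D f g \<sigma>f1 \<sigma>f2 \<sigma>g1 \<sigma>g2 x0 Y0 Z0
        (\<lambda>_. a) (\<lambda>_. c1 * a) (\<lambda>_. c2 * a) (\<lambda>_. c3 * a) S)"
    and "w \<equiv> omegaP D"
  shows "\<exists>c1 c2 c3 C0 C1 abar :: real.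
    0 < c1 \<and> 0 < c2 \<and> 0 < c3 \<and> 0 < C0 \<and> 0 < C1 \<and> 0 < abar \<and>
    (\<forall>a S. 0 < a \<and> a \<le> abar / (1 + w ^ 3) \<and> run c1 c2 c3 a S \<longrightarrow>
       (\<forall>k. integrable (pM S) (sq_grad_at f g S (\<lambda>_. k))) \<and>
       (\<forall>K\<ge>1. avg_sq_grad f g S K
          \<le> 2 * (C0 * (1 + w ^ 2) / (real K * a) + C1 * (1 + w ^ 4) * a))) \<and>
    (\<forall>\<alpha> :: nat \<Rightarrow> real.
       \<alpha> \<in> \<Theta>(\<lambda>K. real K powr (- 1 / 2)) \<and> (\<forall>K\<ge>1. 0 < \<alpha> K \<and> \<alpha> K \<le> abar / (1 + w ^ 3)) \<longrightarrow>
       (\<forall>S. (\<forall>K\<ge>1. run c1 c2 c3 (\<alpha> K) (S K)) \<longrightarrow>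
          (\<lambda>K. avg_sq_grad f g (S K) K) \<in> O(\<lambda>K. (1 + w ^ 4) * real K powr (- 1 / 2))) \<and>
       (\<forall>S R. (\<forall>K\<ge>1. run c1 c2 c3 (\<alpha> K) (S K) \<and> uniform_index D (S K) K (R K)) \<longrightarrow>
          (\<forall>K\<ge>1. integrable (pM (S K)) (sq_grad_at f g (S K) (R K))) \<and>
          (\<lambda>K. \<integral>\<omega>. sq_grad_at f g (S K) (R K) \<omega> \<partial>pM (S K))
            \<in> O(\<lambda>K. (1 + w ^ 4) * real K powr (- 1 / 2))) \<and>
       (\<exists>\<kappa> :: real \<Rightarrow> nat.
          (\<lambda>\<epsilon>. real (\<kappa> \<epsilon>)) \<in> O[at_right 0](\<lambda>\<epsilon>. (1 + w ^ 4) ^ 2 * \<epsilon> powr (- 2)) \<and>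
          (\<lambda>\<epsilon>. real (\<kappa> \<epsilon>)) \<in> O[at_right 0](\<lambda>\<epsilon>. \<epsilon> powr (- 2)) \<and>
          (\<forall>\<epsilon>>0. 1 \<le> \<kappa> \<epsilon> \<and>
             (\<forall>K\<ge>\<kappa> \<epsilon>. \<forall>S R. run c1 c2 c3 (\<alpha> K) S \<and> uniform_index D S K R \<longrightarrow>
                integrable (pM S) (sq_grad_at f g S R) \<and>
                (\<integral>\<omega>. sq_grad_at f g S R \<omega> \<partial>pM S) \<le> \<epsilon>))))"
proof -
  have run: "run c c c a S \<longleftrightarrow> bros_run D f g \<sigma>f1 \<sigma>f2 \<sigma>g1 \<sigma>g2 x0 Y0 Z0 (\<lambda>_. a) (\<lambda>_. c * a) (\<lambda>_. c * a) (\<lambda>_. c * a) S" for c a S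
    by (simp add: run_def)
  obtain c C0 C1 abar where pos: "0 < c" "0 < C0" "0 < C1" "0 < abar"
    and ex: "\<forall>a (S :: ('w, 'd, 'l, 'y, 'b) process). 0 < a \<longrightarrow> a \<le> abar \<longrightarrow> run c c c a S \<longrightarrow>
      (\<forall>k. integrable (pM S) (sq_grad_at f g S (\<lambda>_. k))) \<and>
      (\<forall>K\<ge>1. avg_sq_grad f g S K \<le> 2 * (C0 / (real K * a) + C1 * a)) \<and>
      (\<forall>K\<ge>1. \<forall>R. uniform_index D S K R \<longrightarrow> integrable (pM S) (sq_grad_at f g S R) \<and>
        (\<integral>\<omega>. sq_grad_at f g S R \<omega> \<partial>pM S) = avg_sq_grad f g S K)"
    using uniform_constants[OF layout smooth lower, of \<sigma>f1 \<sigma>f2 \<sigma>g1 \<sigma>g2 x0 Y0 Z0, where 'w = 'w] unfolding run[symmetric]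
    by (elim exE conjE) (rule that)
  note main = ex[THEN spec, THEN spec, THEN mp, THEN mp, THEN mp]
  have w0: "0 \<le> w"
  proof -
    fix l :: 'l
    have "0 \<le> real (nrow D l) / real (nred D l)" by simp
    also have "\<dots> \<le> w" unfolding w_def omegaP_def by (intro Max_ge) auto
    finally show ?thesis .
  qed
  \<comment> \<open>The constants obtained above already absorb the dimensions, and with them the
    ratios in \<open>w\<close>. Each weight is at least 1, so inserting it on the right only
    enlarges the bound, and dividing the stepsize cap by it only restricts the stepsizes.\<close>
  have w1: "1 \<le> 1 + w ^ n" for n using w0 by simp
  have step: "a \<le> abar" if "a \<le> abar / (1 + w ^ 3)" for a
  proof -
    have "abar / (1 + w ^ 3) \<le> abar / 1" using pos w1[of 3] by (intro divide_left_mono) (linarith | simp add: add_pos_nonneg w0)+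
    then show ?thesis using that by simp
  qed
  have nn: "0 \<le> avg_sq_grad f g S K" for S :: "('w, 'd, 'l, 'y, 'b) process" and K
    unfolding avg_sq_grad_def sq_grad_at_def by (intro mult_nonneg_nonneg sum_nonneg integral_nonneg_AE) auto
  show ?thesis
  proof (rule exI[of _ c], rule exI[of _ c], rule exI[of _ c], rule exI[of _ C0], rule exI[of _ C1], rule exI[of _ abar],
      intro conjI allI impI)
    show "0 < c" "0 < c" "0 < c" "0 < C0" "0 < C1" "0 < abar" by (rule pos)+
  next
    fix a and S :: "('w, 'd, 'l, 'y, 'b) process" and k
    assume a: "0 < a \<and> a \<le> abar / (1 + w ^ 3) \<and> run c c c a S"
    then show "integrable (pM S) (sq_grad_at f g S (\<lambda>_. k))" using main[of a S] step by blast
  next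
    fix a and S :: "('w, 'd, 'l, 'y, 'b) process" and K :: nat
    assume a: "0 < a \<and> a \<le> abar / (1 + w ^ 3) \<and> run c c c a S" and K: "1 \<le> K"
    then have "avg_sq_grad f g S K \<le> 2 * (C0 / (real K * a) + C1 * a)" using main[of a S] step by blast
    also have "\<dots> \<le> 2 * (C0 * (1 + w ^ 2) / (real K * a) + C1 * (1 + w ^ 4) * a)"
    proof (intro mult_left_mono add_mono divide_right_mono mult_right_mono)
      show "C0 \<le> C0 * (1 + w ^ 2)" "C1 \<le> C1 * (1 + w ^ 4)"
        using pos mult_left_mono[OF w1[of 2], of C0] mult_left_mono[OF w1[of 4], of C1] by auto
    qed (use a K in auto)
    finally show "avg_sq_grad f g S K \<le> 2 * (C0 * (1 + w ^ 2) / (real K * a) + C1 * (1 + w ^ 4) * a)" .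
  next
    fix \<alpha> :: "nat \<Rightarrow> real" and S :: "nat \<Rightarrow> ('w, 'd, 'l, 'y, 'b) process"
    assume \<alpha>: "\<alpha> \<in> \<Theta>(\<lambda>K. real K powr (- 1 / 2)) \<and> (\<forall>K\<ge>1. 0 < \<alpha> K \<and> \<alpha> K \<le> abar / (1 + w ^ 3))"
      and S: "\<forall>K\<ge>1. run c c c (\<alpha> K) (S K)"
    obtain B N where B: "0 < B" "1 \<le> N" "\<And>K. N \<le> K \<Longrightarrow> 2 * (C0 / (real K * \<alpha> K) + C1 * \<alpha> K) \<le> B * real K powr (- 1 / 2)"
      using balanced_stepsize_rate[of \<alpha> C0 C1] \<alpha> pos by metis
    have "(\<lambda>K. avg_sq_grad f g (S K) K) \<in> O(\<lambda>K. real K powr (- 1 / 2))"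
    proof (rule bigoI[of _ B], rule eventually_at_top_linorderI[of N])
      fix K assume K: "N \<le> K"
      then have "avg_sq_grad f g (S K) K \<le> 2 * (C0 / (real K * \<alpha> K) + C1 * \<alpha> K)"
        using main[of "\<alpha> K" "S K"] \<alpha> S B(2) step[of "\<alpha> K"] by (meson order_trans)
      then show "norm (avg_sq_grad f g (S K) K) \<le> B * norm (real K powr (- 1 / 2))" using B(3)[OF K] nn[of "S K" K] by simp
    qed
    then show "(\<lambda>K. avg_sq_grad f g (S K) K) \<in> O(\<lambda>K. (1 + w ^ 4) * real K powr (- 1 / 2))"
      using w1 by (rule bigo_constant_weight)
  next
    fix \<alpha> :: "nat \<Rightarrow> real" and S :: "nat \<Rightarrow> ('w, 'd, 'l, 'y, 'b) process" and R and K :: nat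
    assume \<alpha>: "\<alpha> \<in> \<Theta>(\<lambda>K. real K powr (- 1 / 2)) \<and> (\<forall>K\<ge>1. 0 < \<alpha> K \<and> \<alpha> K \<le> abar / (1 + w ^ 3))"
      and S: "\<forall>K\<ge>1. run c c c (\<alpha> K) (S K) \<and> uniform_index D (S K) K (R K)" and K: "1 \<le> K"
    show "integrable (pM (S K)) (sq_grad_at f g (S K) (R K))"
      using main[of "\<alpha> K" "S K"] \<alpha> S K step[of "\<alpha> K"] by blast
  next
    fix \<alpha> :: "nat \<Rightarrow> real" and S :: "nat \<Rightarrow> ('w, 'd, 'l, 'y, 'b) process" and R
    assume \<alpha>: "\<alpha> \<in> \<Theta>(\<lambda>K. real K powr (- 1 / 2)) \<and> (\<forall>K\<ge>1. 0 < \<alpha> K \<and> \<alpha> K \<le> abar / (1 + w ^ 3))"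
      and S: "\<forall>K\<ge>1. run c c c (\<alpha> K) (S K) \<and> uniform_index D (S K) K (R K)"
    obtain B N where B: "0 < B" "1 \<le> N" "\<And>K. N \<le> K \<Longrightarrow> 2 * (C0 / (real K * \<alpha> K) + C1 * \<alpha> K) \<le> B * real K powr (- 1 / 2)"
      using balanced_stepsize_rate[of \<alpha> C0 C1] \<alpha> pos by metis
    have "(\<lambda>K. \<integral>\<omega>. sq_grad_at f g (S K) (R K) \<omega> \<partial>pM (S K)) \<in> O(\<lambda>K. real K powr (- 1 / 2))"
    proof (rule bigoI[of _ B], rule eventually_at_top_linorderI[of N])
      fix K assume K: "N \<le> K"
      then have K1: "1 \<le> K" using B(2) by simp
      have "avg_sq_grad f g (S K) K \<le> 2 * (C0 / (real K * \<alpha> K) + C1 * \<alpha> K)"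
        and "(\<integral>\<omega>. sq_grad_at f g (S K) (R K) \<omega> \<partial>pM (S K)) = avg_sq_grad f g (S K) K"
        using main[of "\<alpha> K" "S K"] \<alpha> S K1 step[of "\<alpha> K"] by blast+
      then show "norm (\<integral>\<omega>. sq_grad_at f g (S K) (R K) \<omega> \<partial>pM (S K)) \<le> B * norm (real K powr (- 1 / 2))"
        using B(3)[OF K] nn[of "S K" K] by simp
    qed
    then show "(\<lambda>K. \<integral>\<omega>. sq_grad_at f g (S K) (R K) \<omega> \<partial>pM (S K)) \<in> O(\<lambda>K. (1 + w ^ 4) * real K powr (- 1 / 2))"
      using w1 by (rule bigo_constant_weight)
  next
    fix \<alpha> :: "nat \<Rightarrow> real"
    assume \<alpha>: "\<alpha> \<in> \<Theta>(\<lambda>K. real K powr (- 1 / 2)) \<and> (\<forall>K\<ge>1. 0 < \<alpha> K \<and> \<alpha> K \<le> abar / (1 + w ^ 3))"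
    obtain B N where B: "0 < B" "1 \<le> N" "\<And>K. N \<le> K \<Longrightarrow> 2 * (C0 / (real K * \<alpha> K) + C1 * \<alpha> K) \<le> B * real K powr (- 1 / 2)"
      using balanced_stepsize_rate[of \<alpha> C0 C1] \<alpha> pos by metis
    obtain \<kappa> :: "real \<Rightarrow> nat" where \<kappa>: "(\<lambda>\<epsilon>. real (\<kappa> \<epsilon>)) \<in> O[at_right 0](\<lambda>\<epsilon>. \<epsilon> powr (- 2))"
      "\<And>\<epsilon>. 0 < \<epsilon> \<Longrightarrow> N \<le> \<kappa> \<epsilon> \<and> 1 \<le> \<kappa> \<epsilon> \<and> (\<forall>K\<ge>\<kappa> \<epsilon>. B * real K powr (- 1 / 2) \<le> \<epsilon>)"
      using iterations_for_accuracy[OF B(1), of N] by blast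
    show "\<exists>\<kappa> :: real \<Rightarrow> nat.
          (\<lambda>\<epsilon>. real (\<kappa> \<epsilon>)) \<in> O[at_right 0](\<lambda>\<epsilon>. (1 + w ^ 4) ^ 2 * \<epsilon> powr (- 2)) \<and>
          (\<lambda>\<epsilon>. real (\<kappa> \<epsilon>)) \<in> O[at_right 0](\<lambda>\<epsilon>. \<epsilon> powr (- 2)) \<and>
          (\<forall>\<epsilon>>0. 1 \<le> \<kappa> \<epsilon> \<and>
             (\<forall>K\<ge>\<kappa> \<epsilon>. \<forall>S R. run c c c (\<alpha> K) S \<and> uniform_index D S K R \<longrightarrow>
                integrable (pM S) (sq_grad_at f g S R) \<and>
                (\<integral>\<omega>. sq_grad_at f g S R \<omega> \<partial>pM S) \<le> \<epsilon>))"
    proof (intro exI[of _ \<kappa>] conjI allI impI \<kappa>(1))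
      have "1 \<le> (1 + w ^ 4) ^ 2" using w1[of 4] by (rule one_le_power)
      then show "(\<lambda>\<epsilon>. real (\<kappa> \<epsilon>)) \<in> O[at_right 0](\<lambda>\<epsilon>. (1 + w ^ 4) ^ 2 * \<epsilon> powr (- 2))"
        by (rule bigo_constant_weight[OF \<kappa>(1)])
      show "1 \<le> \<kappa> \<epsilon>" if "0 < \<epsilon>" for \<epsilon> using \<kappa>(2)[OF that] by simp
      fix \<epsilon> :: real and K and S :: "('w, 'd, 'l, 'y, 'b) process" and R
      assume e: "0 < \<epsilon>" and K: "\<kappa> \<epsilon> \<le> K" and S: "run c c c (\<alpha> K) S \<and> uniform_index D S K R"
      have K1: "1 \<le> K" "N \<le> K" and le: "B * real K powr (- 1 / 2) \<le> \<epsilon>" using \<kappa>(2)[OF e] K by auto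
      have m: "integrable (pM S) (sq_grad_at f g S R)" "(\<integral>\<omega>. sq_grad_at f g S R \<omega> \<partial>pM S) = avg_sq_grad f g S K"
        "avg_sq_grad f g S K \<le> 2 * (C0 / (real K * \<alpha> K) + C1 * \<alpha> K)"
        using main[of "\<alpha> K" S] \<alpha> S K1 step[of "\<alpha> K"] by blast+
      show "integrable (pM S) (sq_grad_at f g S R)" by (rule m)
      show "(\<integral>\<omega>. sq_grad_at f g S R \<omega> \<partial>pM S) \<le> \<epsilon>" using m(2,3) B(3)[OF K1(2)] le by linarith
    qed
  qed
qed

end
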